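(* Let $p\in(1,\infty)$, $k\in\mathbb{N}_0$, $\mathsf{bc}\in\{\mathrm{Dir},\mathrm{Neu}\}$, $\gamma\in(-1,(k+2-k_{\mathsf{bc}})p-1)\setminus\{jp-1:j\in\mathbb{N}_1\}$, $\omega\in(0,\pi)$ and let $X$ be a $\mathrm{UMD}$ Banach space. Then for all $f\in W^{k,p}_{\Delta,\mathsf{bc}}(\mathbb{R}_+,w_\gamma;X)$ and $\lambda\in\Sigma_{\pi-\omega}$ there exists a unique $u\in W^{k+2,p}_{\Delta,\mathsf{bc}}(\mathbb{R}_+,w_\gamma;X)$ such that $\lambda u-\Delta_{\mathsf{bc}}u=f$. Moreover, this solution satisfies $$\sum_{j=0}^2|\lambda|^{1-\frac j2}\|\partial_x^ju\|_{W^{k,p}(\mathbb{R}_+,w_\gamma;X)}\le C\,(1+|\lambda|^{1-\alpha_{\mathsf{bc},\gamma}})\,\|f\|_{W^{k,p}(\mathbb{R}_+,w_\gamma;X)},$$ where $$\alpha_{\mathsf{bc},\gamma}:=\max\Big\{1,\frac{\gamma+k_{\mathsf{bc}}p+1}{2p}\Big\}$$ and the constant $C>0$ only depends on $p,k,\gamma,\omega,\mathsf{bc}$ and $X$.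
   Context: $\mathbb{N}_0$, $\mathbb{N}_1$ denote the natural numbers starting at $0$, $1$; $\mathbb{R}_+=(0,\infty)$; $\Sigma_\theta=\{z\in\mathbb{C}\setminus\{0\}:|\arg z|<\theta\}$ for $\theta\in(0,\pi)$; $k_{\mathrm{Dir}}:=0$ and $k_{\mathrm{Neu}}:=1$. For $\gamma>-1$, $w_\gamma(x)=|x|^\gamma$ on $\mathbb{R}_+$; $L^p(\mathbb{R}_+,w_\gamma;X)$ is the space of strongly measurable $f:\mathbb{R}_+\to X$ with $\int_0^\infty\|f(x)\|_X^px^\gamma\,dx<\infty$, and $W^{k,p}(\mathbb{R}_+,w_\gamma;X)$ is the space of $X$-valued distributions on $\mathbb{R}_+$ all of whose derivatives of order $\le k$ lie in $L^p(\mathbb{R}_+,w_\gamma;X)$, with its canonical norm. The trace $\mathrm{Tr}\,\partial_x^mf=(\partial_x^mf)(0)$ is well defined on $W^{k,p}(\mathbb{R}_+,w_\gamma;X)$ if $m<k-\frac{\gamma+1}{p}$. Define $$W^{k,p}_{\Delta,\mathsf{bc}}(\mathbb{R}_+,w_\gamma;X):=\{f\in W^{k,p}(\mathbb{R}_+,w_\gamma;X):\mathrm{Tr}\,\partial_x^{k_{\mathsf{bc}}+2j}f=0\ \ \forall j\in\mathbb{N}_0\text{ with }k_{\mathsf{bc}}+2j<k-\tfrac{\gamma+1}{p}\}.$$ $\Delta_{\mathsf{bc}}u=\partial_x^2u$ for $u\in W^{k+2,p}_{\Delta,\mathsf{bc}}(\mathbb{R}_+,w_\gamma;X)$. *)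

theory Defs
  imports "HOL-Probability.Probability"
begin

section \<open>Complex Banach spaces\<close>

class complex_banach = banach +
  fixes scaleC :: "complex \<Rightarrow> 'a \<Rightarrow> 'a"  (infixr \<open>*\<^sub>C\<close> 75)
  assumes scaleC_add_right: "c *\<^sub>C (x + y) = c *\<^sub>C x + c *\<^sub>C y"
    and scaleC_add_left: "(c + d) *\<^sub>C x = c *\<^sub>C x + d *\<^sub>C x"
    and scaleC_scaleC: "c *\<^sub>C d *\<^sub>C x = (c * d) *\<^sub>C x"
    and scaleR_scaleC: "r *\<^sub>R x = complex_of_real r *\<^sub>C x"
    and norm_scaleC: "norm (c *\<^sub>C x) = cmod c * norm x"

instantiation complex :: complex_banach
begin
definition scaleC_complex :: "complex \<Rightarrow> complex \<Rightarrow> complex"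
  where "scaleC_complex c x = c * x"
instance
  by standard (simp_all add: scaleC_complex_def algebra_simps scaleR_conv_of_real norm_mult)
end


section \<open>Strong measurability and the Bochner integral\<close>

text \<open>
  The library's Bochner integral is restricted to second countable (that is, separable) ranges.
  Here the range is an arbitrary normed space, so Borel measurability is replaced by strong
  measurability; apart from that, the integral below is defined as
  \<^const>\<open>has_bochner_integral\<close> is.
\<close>

definition strongly_measurable :: "'b measure \<Rightarrow> ('b \<Rightarrow> 'a::real_normed_vector) \<Rightarrow> bool" where
  "strongly_measurable M f \<longleftrightarrow>
     (\<exists>s. (\<forall>i. Bochner_Integration.simple_bochner_integrable M (s i)) \<and>
          (AE x in M. (\<lambda>i::nat. s i x) \<longlonglongrightarrow> f x))"

definition has_strong_integral ::
    "'b measure \<Rightarrow> ('b \<Rightarrow> 'a::real_normed_vector) \<Rightarrow> 'a \<Rightarrow> bool" where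
  "has_strong_integral M f I \<longleftrightarrow>
     strongly_measurable M f \<and>
     (\<exists>s. (\<forall>i::nat. Bochner_Integration.simple_bochner_integrable M (s i)) \<and>
          (\<lambda>i. \<integral>\<^sup>+x. ennreal (norm (f x - s i x)) \<partial>M) \<longlonglongrightarrow> 0 \<and>
          (\<lambda>i. Bochner_Integration.simple_bochner_integral M (s i)) \<longlonglongrightarrow> I)"

definition Lp :: "'b measure \<Rightarrow> real \<Rightarrow> ('b \<Rightarrow> 'a::real_normed_vector) set" where
  "Lp M p = {f. strongly_measurable M f \<and> (\<integral>\<^sup>+x. ennreal (norm (f x) powr p) \<partial>M) < \<infinity>}"

definition Lp_norm :: "'b measure \<Rightarrow> real \<Rightarrow> ('b \<Rightarrow> 'a::real_normed_vector) \<Rightarrow> real" where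
  "Lp_norm M p f = enn2real (\<integral>\<^sup>+x. ennreal (norm (f x) powr p) \<partial>M) powr (1 / p)"


section \<open>UMD spaces\<close>

definition Lp_martingale ::
    "'b measure \<Rightarrow> (nat \<Rightarrow> 'b measure) \<Rightarrow> real \<Rightarrow> (nat \<Rightarrow> 'b \<Rightarrow> 'a::real_normed_vector) \<Rightarrow> bool"
  where
  "Lp_martingale M F p f \<longleftrightarrow>
     filtration (space M) F \<and> (\<forall>n. subalgebra M (F n)) \<and>
     (\<forall>n. strongly_measurable (restr_to_subalg M (F n)) (f n) \<and> f n \<in> Lp M p) \<and>
     (\<forall>m n. m \<le> n \<longrightarrow> (\<forall>A\<in>sets (F m). \<exists>I.
        has_strong_integral M (\<lambda>x. indicat_real A x *\<^sub>R f n x) I \<and>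
        has_strong_integral M (\<lambda>x. indicat_real A x *\<^sub>R f m x) I))"

text \<open>
  A definition cannot quantify over all types of sample points, so the probability spaces are
  those carried by the real line, with arbitrary sigma-algebras. This is no restriction: they
  include the unit interval with Lebesgue measure, and hence (copies of) all Paley-Walsh
  martingales, which already determine the UMD property.
\<close>

definition UMD :: "'a::real_normed_vector itself \<Rightarrow> bool" where
  "UMD (X :: 'a itself) \<longleftrightarrow>
     (\<forall>q>1. \<exists>\<beta>::real.
       \<forall>(M :: real measure) F (f :: nat \<Rightarrow> real \<Rightarrow> 'a) (\<epsilon> :: nat \<Rightarrow> real) N.
         prob_space M \<and> Lp_martingale M F q f \<and> (\<forall>n. \<epsilon> n \<in> {-1, 1}) \<longrightarrow>
           Lp_norm M q (\<lambda>x. \<Sum>n\<le>N. \<epsilon> n *\<^sub>R (if n = 0 then f 0 x else f n x - f (n - 1) x))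
             \<le> \<beta> * Lp_norm M q (f N))"


section \<open>Weighted Sobolev spaces on the half-line\<close>

text \<open>
  Functions on \<open>(0, \<infinity>)\<close> are total functions whose values outside \<open>(0, \<infinity>)\<close> are irrelevant;
  no quotient by almost everywhere equality is taken.
\<close>

abbreviation halfline :: "real measure" where
  "halfline \<equiv> restrict_space lborel {0<..}"

definition weighted :: "real \<Rightarrow> real measure" where
  "weighted \<gamma> = density halfline (\<lambda>x. ennreal (\<bar>x\<bar> powr \<gamma>))"

definition test_fun :: "(real \<Rightarrow> real) \<Rightarrow> bool" where
  "test_fun \<phi> \<longleftrightarrow>
     (\<forall>n x. (deriv ^^ n) \<phi> field_differentiable at x) \<and>
     (\<exists>a b. 0 < a \<and> (\<forall>x. x \<notin> {a..b} \<longrightarrow> \<phi> x = 0))"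

text \<open>
  \<open>g\<close> is the \<open>j\<close>-th derivative of \<open>f\<close> in the sense of distributions on \<open>(0, \<infinity>)\<close>. Real-valued test
  functions suffice, as both sides are linear in the test function.
\<close>

definition weak_deriv ::
    "nat \<Rightarrow> (real \<Rightarrow> 'a::real_normed_vector) \<Rightarrow> (real \<Rightarrow> 'a) \<Rightarrow> bool" where
  "weak_deriv j f g \<longleftrightarrow>
     (\<forall>\<phi>. test_fun \<phi> \<longrightarrow> (\<exists>I.
        has_strong_integral halfline (\<lambda>x. (deriv ^^ j) \<phi> x *\<^sub>R f x) I \<and>
        has_strong_integral halfline (\<lambda>x. \<phi> x *\<^sub>R g x) ((-1) ^ j *\<^sub>R I)))"

text \<open>A representative of the \<open>j\<close>-th distributional derivative, unique up to null sets.\<close>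

definition wderiv :: "nat \<Rightarrow> (real \<Rightarrow> 'a::real_normed_vector) \<Rightarrow> real \<Rightarrow> 'a" where
  "wderiv j f = (SOME g. weak_deriv j f g)"

definition Sobolev ::
    "nat \<Rightarrow> real \<Rightarrow> real \<Rightarrow> (real \<Rightarrow> 'a::real_normed_vector) set" where
  "Sobolev k p \<gamma> = {f. \<forall>j\<le>k. \<exists>g \<in> Lp (weighted \<gamma>) p. weak_deriv j f g}"

definition Sobolev_norm ::
    "nat \<Rightarrow> real \<Rightarrow> real \<Rightarrow> (real \<Rightarrow> 'a::real_normed_vector) \<Rightarrow> real" where
  "Sobolev_norm k p \<gamma> f = (\<Sum>j\<le>k. Lp_norm (weighted \<gamma>) p (wderiv j f))"

text \<open>The trace at \<open>0\<close> is the value at \<open>0\<close> of the representative that is continuous up to \<open>0\<close>.\<close>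

definition has_trace :: "(real \<Rightarrow> 'a::real_normed_vector) \<Rightarrow> 'a \<Rightarrow> bool" where
  "has_trace f y \<longleftrightarrow>
     (\<exists>g. continuous_on {0..} g \<and> (AE x in halfline. f x = g x) \<and> g 0 = y)"


section \<open>Dirichlet and Neumann Laplacian\<close>

datatype bc = Dir | Neu

fun k_bc :: "bc \<Rightarrow> nat" where
  "k_bc Dir = 0"
| "k_bc Neu = 1"

definition Sobolev_bc ::
    "bc \<Rightarrow> nat \<Rightarrow> real \<Rightarrow> real \<Rightarrow> (real \<Rightarrow> 'a::real_normed_vector) set" where
  "Sobolev_bc b k p \<gamma> =
     {f \<in> Sobolev k p \<gamma>. \<forall>j::nat.
        real (k_bc b + 2 * j) < real k - (\<gamma> + 1) / p \<longrightarrow> has_trace (wderiv (k_bc b + 2 * j) f) 0}"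

definition laplacian :: "(real \<Rightarrow> 'a::real_normed_vector) \<Rightarrow> real \<Rightarrow> 'a" where
  "laplacian u = wderiv 2 u"

definition solves_resolvent ::
    "complex \<Rightarrow> (real \<Rightarrow> 'a::complex_banach) \<Rightarrow> (real \<Rightarrow> 'a) \<Rightarrow> bool" where
  "solves_resolvent \<mu> f u \<longleftrightarrow> (AE x in halfline. \<mu> *\<^sub>C u x - laplacian u x = f x)"

definition sector :: "real \<Rightarrow> complex set" where
  "sector \<theta> = {z. z \<noteq> 0 \<and> \<bar>Arg z\<bar> < \<theta>}"

definition alpha_bc :: "bc \<Rightarrow> real \<Rightarrow> real \<Rightarrow> real" where
  "alpha_bc b p \<gamma> = max 1 ((\<gamma> + real (k_bc b) * p + 1) / (2 * p))"

end

theory Submission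
  imports Defs
begin

text \<open>
  Write \<open>\<mu> = s\<^sup>2\<close> with \<open>Re s > 0\<close>. Since the spectral parameter stays in a sector, \<open>Re s\<close> and
  \<open>cmod s\<close> are comparable. The equation \<open>s\<^sup>2 u - u'' = f\<close> factorises: \<open>W = u' + s u\<close> satisfies
  \<open>W' = s W - f\<close>, whose only solution that does not grow exponentially is the integral of
  \<open>exp (- s (t - x)) f t\<close> over \<open>t > x\<close>; and then \<open>u' = W - s u\<close> is solved forward from the origin,
  with one free constant that the boundary condition determines. Everything is an estimate of two
  explicit exponential kernels, whose constants depend on \<open>s\<close> only through a lower bound of
  \<open>Re s / cmod s\<close>.

  The weighted estimates rest on Schur's test. Put \<open>a = Re s\<close>. On the scale \<open>1 / a\<close> the weight
  \<open>t powr \<gamma>\<close> varies slowly away from the origin, whatever \<open>\<gamma>\<close> is, so that the exponential kernels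
  act boundedly there; looking forward from near the origin is harmless for \<open>\<gamma> > -1\<close>. Looking
  backward into the interval below \<open>1 / a\<close> is not, and this part is replaced by the point value of
  \<open>u\<close> at \<open>1 / a\<close>. This gives \<open>second_order_bound\<close>: the norms of \<open>a\<^sup>2 u\<close> and \<open>a u'\<close> are bounded by
  the norm of \<open>f\<close> and by \<open>a powr (2 - (\<gamma> + 1) / p) * norm (u (1 / a))\<close>.

  It remains to bound the point values of the derivatives of \<open>u\<close> at \<open>1 / a\<close>. The boundary
  condition expresses \<open>u (1 / a)\<close> by the integral of \<open>f\<close> against a kernel of size \<open>t\<close> (Dirichlet)
  or \<open>1 / a\<close> (Neumann) for \<open>t < 1 / a\<close>. A heavy weight is small near the origin and lets \<open>f\<close> be
  singular there, but the derivatives of \<open>f\<close> limit the singularity: if \<open>m p - 1 < \<gamma>\<close> with \<open>m \<ge> 1\<close>,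
  the Hardy type bound \<open>Sobolev_pointwise\<close> says that \<open>f\<close> grows at most like
  \<open>t powr (m - (\<gamma> + 1) / p)\<close>. The exclusion of the values \<open>j p - 1\<close> ensures that some \<open>m \<le> k\<close> fits
  (\<open>level_exists\<close>). For large \<open>s\<close>, higher derivatives are treated by differentiating the equation,
  which exchanges the two boundary conditions, for as long as \<open>f\<close> has a trace
  (\<open>point_values_large\<close>); beyond that the equation itself expresses \<open>u''\<close> by \<open>u\<close> and \<open>f\<close>. For
  small \<open>s\<close> the integral over \<open>1 < t < 1 / a\<close> is the only obstruction. If the weight makes
  \<open>t powr e\<close> integrable against \<open>f\<close> at infinity, with \<open>e = 1\<close> for Dirichlet and \<open>e = 0\<close> for
  Neumann, this integral is bounded independently of \<open>a\<close>, which costs a negative power of \<open>a\<close> and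
  is the origin of the factor \<open>1 + cmod \<mu> powr (1 - \<alpha>)\<close> (\<open>point_value_small\<close>).

  To speak about point values, a function in the Sobolev space is represented by a chain of
  functions, each the indefinite Bochner integral of the next (\<open>Sobolev_chain_exists\<close>). This needs
  the strong integral for functions with values in a possibly nonseparable Banach space, a product
  rule for indefinite integrals, and the fundamental lemma of the calculus of variations.
  Uniqueness holds because for \<open>f = 0\<close> the function \<open>W\<close> vanishes, hence \<open>u\<close> is a multiple of
  \<open>exp (- s x)\<close>, and the boundary condition leaves only zero.
\<close>

abbreviation nn_norm :: "'b measure \<Rightarrow> ('b \<Rightarrow> 'a::real_normed_vector) \<Rightarrow> ennreal" where
  "nn_norm M f \<equiv> (\<integral>\<^sup>+x. ennreal (norm (f x)) \<partial>M)"

abbreviation nnint :: "real set \<Rightarrow> (real \<Rightarrow> real) \<Rightarrow> ennreal" where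
  "nnint A h \<equiv> (\<integral>\<^sup>+t\<in>A. ennreal (h t) \<partial>lborel)"

section \<open>The strong integral in a Banach space\<close>

lemma simple_function_simple_bochner_integrable:
  "Bochner_Integration.simple_bochner_integrable M s \<Longrightarrow> simple_function M s"
  by (auto elim: simple_bochner_integrable.cases)

lemma simple_bochner_integral_zero:
  "Bochner_Integration.simple_bochner_integral M (\<lambda>x. 0) = (0::'a::real_normed_vector)"
  by (auto simp: simple_bochner_integral_def intro!: sum.neutral)

text \<open>
  The source of all closure properties. The condition \<open>P 0 0 = 0\<close> keeps the supports of the
  approximating simple functions of finite measure.
\<close>

lemma strongly_measurable_compose2:
  fixes f :: "'b \<Rightarrow> 'a::real_normed_vector" and g :: "'b \<Rightarrow> 'c::real_normed_vector"
    and P :: "'a \<Rightarrow> 'c \<Rightarrow> 'd::real_normed_vector"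
  assumes "strongly_measurable M f" "strongly_measurable M g" and P0: "P 0 0 = 0"
    and lim: "\<And>X Y x y. X \<longlonglongrightarrow> x \<Longrightarrow> Y \<longlonglongrightarrow> y \<Longrightarrow> (\<lambda>i::nat. P (X i) (Y i)) \<longlonglongrightarrow> P x y"
  shows "strongly_measurable M (\<lambda>x. P (f x) (g x))"
proof -
  obtain s t where s: "\<And>i. Bochner_Integration.simple_bochner_integrable M (s i)"
      "AE x in M. (\<lambda>i::nat. s i x) \<longlonglongrightarrow> f x"
    and t: "\<And>i. Bochner_Integration.simple_bochner_integrable M (t i)"
      "AE x in M. (\<lambda>i::nat. t i x) \<longlonglongrightarrow> g x"
    using assms(1,2) unfolding strongly_measurable_def by blast
  have "\<And>i. Bochner_Integration.simple_bochner_integrable M (\<lambda>x. P (s i x) (t i x))"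
    by (rule simple_bochner_integrable_compose2[where p=P, OF P0 s(1) t(1)])
  moreover have "AE x in M. (\<lambda>i. P (s i x) (t i x)) \<longlonglongrightarrow> P (f x) (g x)"
    using s(2) t(2) by eventually_elim (rule lim)
  ultimately show ?thesis unfolding strongly_measurable_def
    by (intro exI[of _ "\<lambda>i x. P (s i x) (t i x)"]) auto
qed

lemma strongly_measurable_cong_AE:
  assumes "strongly_measurable M f" "AE x in M. f x = g x"
  shows "strongly_measurable M g"
proof -
  obtain s where s: "\<And>i. Bochner_Integration.simple_bochner_integrable M (s i)"
      "AE x in M. (\<lambda>i::nat. s i x) \<longlonglongrightarrow> f x"
    using assms(1) unfolding strongly_measurable_def by blast
  have "AE x in M. (\<lambda>i. s i x) \<longlonglongrightarrow> g x"
    using s(2) assms(2) by eventually_elim simp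
  with s(1) show ?thesis unfolding strongly_measurable_def by blast
qed

lemma strongly_measurable_zero [simp]: "strongly_measurable M (\<lambda>x. 0)"
  unfolding strongly_measurable_def
  by (intro exI[of _ "\<lambda>i x. 0"]) (auto simp: simple_bochner_integrable.simps)

lemma strongly_measurable_add:
  "strongly_measurable M f \<Longrightarrow> strongly_measurable M g \<Longrightarrow> strongly_measurable M (\<lambda>x. f x + g x)"
  by (rule strongly_measurable_compose2[where P="(+)"]) (auto intro: tendsto_add)

lemma strongly_measurable_diff:
  "strongly_measurable M f \<Longrightarrow> strongly_measurable M g \<Longrightarrow> strongly_measurable M (\<lambda>x. f x - g x)"
  by (rule strongly_measurable_compose2[where P="(-)"]) (auto intro: tendsto_diff)

lemma strongly_measurable_bounded_linear:
  assumes "bounded_linear T" "strongly_measurable M f"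
  shows "strongly_measurable M (\<lambda>x. T (f x))"
  using strongly_measurable_compose2[where P="\<lambda>x y. T x", OF assms(2,2)] assms(1)
  by (simp add: bounded_linear.tendsto linear_simps)

lemma strongly_measurable_bounded_bilinear:
  assumes "bounded_bilinear T" "strongly_measurable M f" "strongly_measurable M g"
  shows "strongly_measurable M (\<lambda>x. T (f x) (g x))"
  by (rule strongly_measurable_compose2[OF assms(2,3)])
     (auto simp: bounded_bilinear.zero_left[OF assms(1)] intro: bounded_bilinear.tendsto[OF assms(1)])

lemma strongly_measurable_scaleR:
  "strongly_measurable M f \<Longrightarrow> strongly_measurable M g \<Longrightarrow> strongly_measurable M (\<lambda>x. f x *\<^sub>R g x)"
  by (rule strongly_measurable_bounded_bilinear[OF bounded_bilinear_scaleR])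

text \<open>
  Cutting off along an exhaustion by sets of finite measure: on a sigma-finite space the finite
  supports required of the approximating simple functions come for free.
\<close>

lemma strongly_measurableI_sigma_finite:
  fixes f :: "'b \<Rightarrow> 'a::real_normed_vector"
  assumes "sigma_finite_measure M" and s: "\<And>i. simple_function M (s i)"
    and lim: "AE x in M. (\<lambda>i::nat. s i x) \<longlonglongrightarrow> f x"
  shows "strongly_measurable M f"
proof -
  interpret sigma_finite_measure M by fact
  obtain A :: "nat \<Rightarrow> 'b set" where A: "range A \<subseteq> sets M" "(\<Union>i. A i) = space M"
      "\<And>i. emeasure M (A i) \<noteq> \<infinity>" "incseq A"
    using sigma_finite_incseq by blast
  define t where "t i x = (if x \<in> A i then s i x else 0)" for i x
  have "Bochner_Integration.simple_bochner_integrable M (t i)" for i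
  proof
    show "simple_function M (t i)"
      unfolding t_def by (rule simple_function_If_set) (use s A in auto)
    have "emeasure M {y \<in> space M. t i y \<noteq> 0} \<le> emeasure M (A i)"
      by (rule emeasure_mono) (use A in \<open>auto simp: t_def split: if_splits\<close>)
    then show "emeasure M {y \<in> space M. t i y \<noteq> 0} \<noteq> \<infinity>"
      using A(3)[of i] by (auto simp: top_unique)
  qed
  moreover have "AE x in M. (\<lambda>i. t i x) \<longlonglongrightarrow> f x"
    using lim AE_space
  proof eventually_elim
    fix x assume x: "(\<lambda>i. s i x) \<longlonglongrightarrow> f x" "x \<in> space M"
    then obtain n where n: "x \<in> A n" using A(2) by auto
    have "eventually (\<lambda>i. t i x = s i x) sequentially"
      using eventually_ge_at_top[of n]
      by eventually_elim (use n A(4) in \<open>auto simp: t_def incseq_def\<close>)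
    then show "(\<lambda>i. t i x) \<longlonglongrightarrow> f x" using x(1) by (simp add: tendsto_cong)
  qed
  ultimately show ?thesis unfolding strongly_measurable_def by blast
qed

lemma strongly_measurable_borel:
  fixes f :: "'b \<Rightarrow> 'a::{real_normed_vector, second_countable_topology}"
  assumes "sigma_finite_measure M" "f \<in> borel_measurable M"
  shows "strongly_measurable M f"
proof -
  obtain F where "\<And>i. simple_function M (F i)" "\<And>x. x \<in> space M \<Longrightarrow> (\<lambda>i. F i x) \<longlonglongrightarrow> f x"
    using borel_measurable_implies_sequence_metric[OF assms(2)] by blast
  then show ?thesis by (intro strongly_measurableI_sigma_finite[OF assms(1), of F]) auto
qed

text \<open>
  A strongly measurable function need not be Borel measurable, as the measure need not be complete;
  its norm agrees almost everywhere with a Borel function, which is what the monotone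
  integral needs.
\<close>

lemma strongly_measurable_norm:
  assumes "strongly_measurable M f"
  shows "\<exists>h::_ \<Rightarrow> real. h \<in> borel_measurable M \<and> (\<forall>x. 0 \<le> h x) \<and> (AE x in M. norm (f x) = h x)"
proof -
  obtain s where s: "\<And>i. Bochner_Integration.simple_bochner_integrable M (s i)"
      "AE x in M. (\<lambda>i::nat. s i x) \<longlonglongrightarrow> f x"
    using assms(1) unfolding strongly_measurable_def by blast
  have [measurable]: "(\<lambda>x. norm (s i x)) \<in> borel_measurable M" for i
    by (rule borel_measurable_simple_function[OF simple_function_compose1[OF
            simple_function_simple_bochner_integrable[OF s(1)], of norm]])
  show ?thesis
  proof (intro exI[of _ "\<lambda>x. max 0 (lim (\<lambda>i. norm (s i x)))"] conjI allI)
    show "(\<lambda>x. max 0 (lim (\<lambda>i. norm (s i x)))) \<in> borel_measurable M" by measurable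
    show "AE x in M. norm (f x) = max 0 (lim (\<lambda>i. norm (s i x)))"
      using s(2)
    proof eventually_elim
      fix x assume "(\<lambda>i. s i x) \<longlonglongrightarrow> f x"
      then have "lim (\<lambda>i. norm (s i x)) = norm (f x)" by (intro limI tendsto_norm)
      then show "norm (f x) = max 0 (lim (\<lambda>i. norm (s i x)))" by simp
    qed
  qed simp
qed

lemma nn_integral_norm_cong:
  assumes "AE x in M. norm (f x) = h x"
  shows "nn_norm M f = (\<integral>\<^sup>+x. ennreal (h x) \<partial>M)"
proof (rule nn_integral_cong_AE)
  show "AE x in M. ennreal (norm (f x)) = ennreal (h x)" using assms by eventually_elim simp
qed

text \<open>
  The norms themselves need not be measurable, so additivity is obtained from Borel functions that
  agree with them almost everywhere.
\<close>

lemma nn_integral_norm_add: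
  assumes "strongly_measurable M f" "strongly_measurable M g"
  shows "(\<integral>\<^sup>+x. ennreal (norm (f x)) + ennreal (norm (g x)) \<partial>M)
    = nn_norm M f + nn_norm M g"
proof -
  obtain h k where h: "h \<in> borel_measurable M" "AE x in M. norm (f x) = h x"
    and k: "k \<in> borel_measurable M" "AE x in M. norm (g x) = k x"
    using strongly_measurable_norm[OF assms(1)] strongly_measurable_norm[OF assms(2)] by blast
  have "(\<integral>\<^sup>+x. ennreal (norm (f x)) + ennreal (norm (g x)) \<partial>M)
    = (\<integral>\<^sup>+x. ennreal (h x) + ennreal (k x) \<partial>M)"
  proof (rule nn_integral_cong_AE)
    show "AE x in M. ennreal (norm (f x)) + ennreal (norm (g x)) = ennreal (h x) + ennreal (k x)"
      using h(2) k(2) by eventually_elim simp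
  qed
  also have "\<dots> = (\<integral>\<^sup>+x. ennreal (h x) \<partial>M) + (\<integral>\<^sup>+x. ennreal (k x) \<partial>M)"
    using h(1) k(1) by (intro nn_integral_add) auto
  also have "(\<integral>\<^sup>+x. ennreal (h x) \<partial>M) = nn_norm M f"
    by (rule nn_integral_norm_cong[OF h(2), symmetric])
  also have "(\<integral>\<^sup>+x. ennreal (k x) \<partial>M) = nn_norm M g"
    by (rule nn_integral_norm_cong[OF k(2), symmetric])
  finally show ?thesis .
qed

lemma nn_integral_norm_triangle:
  assumes "strongly_measurable M f" "strongly_measurable M g"
    and "\<And>x. norm (e x) \<le> norm (f x) + norm (g x)"
  shows "nn_norm M e
    \<le> nn_norm M f + nn_norm M g"
  unfolding nn_integral_norm_add[OF assms(1,2), symmetric]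
  by (intro nn_integral_mono) (simp add: assms(3) flip: ennreal_plus)

lemma strongly_measurable_simple:
  "Bochner_Integration.simple_bochner_integrable M s \<Longrightarrow> strongly_measurable M s"
  unfolding strongly_measurable_def by (intro exI[of _ "\<lambda>i. s"]) auto

text \<open>
  Simple functions that are close to \<open>f\<close> in mean have close integrals. Both the norm bound, hence
  uniqueness, and the Cauchy property behind existence come from this.
\<close>

lemma simple_integral_diff_le:
  fixes f :: "'b \<Rightarrow> 'a::real_normed_vector"
  assumes f: "strongly_measurable M f"
    and s: "Bochner_Integration.simple_bochner_integrable M s"
    and t: "Bochner_Integration.simple_bochner_integrable M t"
  shows "ennreal (norm (Bochner_Integration.simple_bochner_integral M s - Bochner_Integration.simple_bochner_integral M t))
    \<le> nn_norm M (\<lambda>x. f x - s x) + nn_norm M (\<lambda>x. f x - t x)"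
    (is "ennreal (norm (?s - ?t)) \<le> _")
proof -
  have "ennreal (norm (?s - ?t)) = norm (Bochner_Integration.simple_bochner_integral M (\<lambda>x. s x - t x))"
    using s t by (subst simple_bochner_integral_diff) auto
  also have "\<dots> \<le> Bochner_Integration.simple_bochner_integral M (\<lambda>x. norm (s x - t x))"
    using simple_bochner_integrable_compose2[of "(-)" M "s" "t"] s t
    by (auto intro!: simple_bochner_integral_norm_bound)
  also have "\<dots> = (\<integral>\<^sup>+x. norm (s x - t x) \<partial>M)"
    using simple_bochner_integrable_compose2[of "\<lambda>x y. norm (x - y)" M "s" "t"] s t
    by (auto intro!: simple_bochner_integral_eq_nn_integral)
  also have "\<dots> \<le> nn_norm M (\<lambda>x. f x - s x) + nn_norm M (\<lambda>x. f x - t x)"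
  proof (rule nn_integral_norm_triangle)
    show "strongly_measurable M (\<lambda>x. f x - s x)" "strongly_measurable M (\<lambda>x. f x - t x)"
      by (intro strongly_measurable_diff f strongly_measurable_simple s t)+
    show "norm (s x - t x) \<le> norm (f x - s x) + norm (f x - t x)" for x
      using norm_triangle_ineq4[of "f x - t x" "f x - s x"] by simp
  qed
  finally show ?thesis .
qed

lemma has_strong_integral_imp:
  fixes f :: "'b \<Rightarrow> 'a::real_normed_vector"
  assumes "has_strong_integral M f I"
  shows "strongly_measurable M f" "nn_norm M f < \<infinity>"
    "ennreal (norm I) \<le> nn_norm M f"
proof -
  show f: "strongly_measurable M f" using assms unfolding has_strong_integral_def by blast
  obtain s where s: "\<And>i. Bochner_Integration.simple_bochner_integrable M (s i)"
    and l: "(\<lambda>i. nn_norm M (\<lambda>x. f x - s i x)) \<longlonglongrightarrow> 0"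
    and I: "(\<lambda>i. Bochner_Integration.simple_bochner_integral M (s i)) \<longlonglongrightarrow> I"
    using assms unfolding has_strong_integral_def by blast
  have sn: "nn_norm M (\<lambda>x. s i x)
    = ennreal (Bochner_Integration.simple_bochner_integral M (\<lambda>x. norm (s i x)))" for i
    using s[of i] simple_bochner_integrable_compose2[of "\<lambda>x y. norm x" M "s i" "s i"]
    by (subst simple_bochner_integral_eq_nn_integral) auto
  have "eventually (\<lambda>i. (nn_norm M (\<lambda>x. f x - s i x)) < 1) sequentially"
    using order_tendstoD(2)[OF l, of 1] by simp
  then obtain i where i: "nn_norm M (\<lambda>x. f x - s i x) < 1"
    by (auto simp: eventually_sequentially)
  have "nn_norm M f
    \<le> nn_norm M (\<lambda>x. f x - s i x) + nn_norm M (\<lambda>x. s i x)"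
  proof (rule nn_integral_norm_triangle)
    show "norm (f x) \<le> norm (f x - s i x) + norm (s i x)" for x
      using norm_triangle_sub[of "f x" "s i x"] by simp
  qed (intro strongly_measurable_diff f strongly_measurable_simple s)+
  also have "\<dots> < \<infinity>" using order.strict_trans[OF i ennreal_one_less_top] unfolding sn by simp
  finally show "nn_norm M f < \<infinity>" .
  have "ennreal (norm (Bochner_Integration.simple_bochner_integral M (s i)))
     \<le> nn_norm M (\<lambda>x. f x - s i x) + nn_norm M f" for i
    using simple_integral_diff_le[OF f s[of i], of "\<lambda>x. 0"]
    by (simp add: simple_bochner_integrable.simps simple_bochner_integral_zero)
  moreover have "(\<lambda>i. ennreal (norm (Bochner_Integration.simple_bochner_integral M (s i)))) \<longlonglongrightarrow> ennreal (norm I)"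
    by (intro tendsto_ennrealI tendsto_norm I)
  moreover have "(\<lambda>i. (nn_norm M (\<lambda>x. f x - s i x)) + nn_norm M f)
     \<longlonglongrightarrow> 0 + nn_norm M f"
    by (intro tendsto_add l tendsto_const)
  ultimately have "ennreal (norm I) \<le> 0 + nn_norm M f"
    using LIMSEQ_le by blast
  then show "ennreal (norm I) \<le> nn_norm M f" by simp
qed

lemma has_strong_integral_cong_AE:
  assumes "has_strong_integral M f I" "AE x in M. f x = g x"
  shows "has_strong_integral M g I"
proof -
  obtain s where s: "\<And>i. Bochner_Integration.simple_bochner_integrable M (s i)"
    and l: "(\<lambda>i. nn_norm M (\<lambda>x. f x - s i x)) \<longlonglongrightarrow> 0"
    and I: "(\<lambda>i. Bochner_Integration.simple_bochner_integral M (s i)) \<longlonglongrightarrow> I"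
    using assms unfolding has_strong_integral_def by blast
  have "nn_norm M (\<lambda>x. f x - s i x) = nn_norm M (\<lambda>x. g x - s i x)" for i
  proof (rule nn_integral_cong_AE)
    show "AE x in M. ennreal (norm (f x - s i x)) = ennreal (norm (g x - s i x))"
      using assms(2) by eventually_elim simp
  qed
  with l s I strongly_measurable_cong_AE[OF has_strong_integral_imp(1)[OF assms(1)] assms(2)]
  show ?thesis unfolding has_strong_integral_def by auto
qed

lemma has_strong_integral_add:
  fixes f :: "'b \<Rightarrow> 'a::real_normed_vector"
  assumes "has_strong_integral M f I" "has_strong_integral M g J"
  shows "has_strong_integral M (\<lambda>x. f x + g x) (I + J)"
proof -
  obtain s where s: "\<And>i. Bochner_Integration.simple_bochner_integrable M (s i)"
    and ls: "(\<lambda>i. nn_norm M (\<lambda>x. f x - s i x)) \<longlonglongrightarrow> 0"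
    and I: "(\<lambda>i. Bochner_Integration.simple_bochner_integral M (s i)) \<longlonglongrightarrow> I"
    and f: "strongly_measurable M f"
    using assms(1) unfolding has_strong_integral_def by blast
  obtain t where t: "\<And>i. Bochner_Integration.simple_bochner_integrable M (t i)"
    and lt: "(\<lambda>i. nn_norm M (\<lambda>x. g x - t i x)) \<longlonglongrightarrow> 0"
    and J: "(\<lambda>i. Bochner_Integration.simple_bochner_integral M (t i)) \<longlonglongrightarrow> J"
    and g: "strongly_measurable M g"
    using assms(2) unfolding has_strong_integral_def by blast
  let ?st = "\<lambda>i x. s i x + t i x"
  have "Bochner_Integration.simple_bochner_integrable M (?st i)" for i
    by (rule simple_bochner_integrable_compose2[where p="(+)"]) (use s t in auto)
  moreover have "(\<lambda>i. Bochner_Integration.simple_bochner_integral M (?st i)) \<longlonglongrightarrow> I + J"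
    using s t I J by (simp add: simple_bochner_integral_add tendsto_add)
  moreover have "(\<lambda>i. nn_norm M (\<lambda>x. f x + g x - ?st i x)) \<longlonglongrightarrow> 0"
  proof (rule tendsto_sandwich[OF _ _ tendsto_const])
    show "\<forall>\<^sub>F i in sequentially. (nn_norm M (\<lambda>x. f x + g x - ?st i x))
       \<le> nn_norm M (\<lambda>x. f x - s i x) + nn_norm M (\<lambda>x. g x - t i x)"
    proof (intro always_eventually allI nn_integral_norm_triangle)
      fix i x
      have "f x + g x - ?st i x = (f x - s i x) + (g x - t i x)" by simp
      then show "norm (f x + g x - ?st i x) \<le> norm (f x - s i x) + norm (g x - t i x)"
        by (metis norm_triangle_ineq)
    qed (intro strongly_measurable_diff f g strongly_measurable_simple s t)+
    show "(\<lambda>i. (nn_norm M (\<lambda>x. f x - s i x)) + nn_norm M (\<lambda>x. g x - t i x)) \<longlonglongrightarrow> 0"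
      using tendsto_add[OF ls lt] by simp
  qed simp
  ultimately show ?thesis unfolding has_strong_integral_def
    using strongly_measurable_add[OF f g] by (intro conjI exI[of _ ?st]) auto
qed

lemma has_strong_integral_bounded_linear:
  fixes f :: "'b \<Rightarrow> 'a::real_normed_vector"
  assumes T: "bounded_linear T" and "has_strong_integral M f I"
  shows "has_strong_integral M (\<lambda>x. T (f x)) (T I)"
proof -
  obtain s where s: "\<And>i. Bochner_Integration.simple_bochner_integrable M (s i)"
    and ls: "(\<lambda>i. nn_norm M (\<lambda>x. f x - s i x)) \<longlonglongrightarrow> 0"
    and I: "(\<lambda>i. Bochner_Integration.simple_bochner_integral M (s i)) \<longlonglongrightarrow> I"
    and f: "strongly_measurable M f"
    using assms(2) unfolding has_strong_integral_def by blast
  interpret bounded_linear T by fact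
  obtain K where K: "K > 0" "\<And>x. norm (T x) \<le> norm x * K" using pos_bounded by blast
  have "Bochner_Integration.simple_bochner_integrable M (\<lambda>x. T (s i x))" for i
    using simple_bochner_integrable_compose2[where p="\<lambda>x y. T x", OF _ s s] by (simp add: zero)
  moreover have "(\<lambda>i. Bochner_Integration.simple_bochner_integral M (\<lambda>x. T (s i x))) \<longlonglongrightarrow> T I"
    using tendsto[OF I] s by (simp add: simple_bochner_integral_linear linear_axioms)
  moreover have "(\<lambda>i. nn_norm M (\<lambda>x. T (f x) - T (s i x))) \<longlonglongrightarrow> 0"
  proof (rule tendsto_sandwich[OF _ _ tendsto_const])
    show "\<forall>\<^sub>F i in sequentially. (nn_norm M (\<lambda>x. T (f x) - T (s i x)))
       \<le> ennreal K * nn_norm M (\<lambda>x. f x - s i x)"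
    proof (intro always_eventually allI)
      fix i
      obtain h where h: "h \<in> borel_measurable M" "AE x in M. norm (f x - s i x) = h x"
        using strongly_measurable_norm[OF strongly_measurable_diff[OF f strongly_measurable_simple[OF s[of i]]]]
        by blast
      have "nn_norm M (\<lambda>x. T (f x) - T (s i x)) \<le> (\<integral>\<^sup>+x. ennreal K * ennreal (h x) \<partial>M)"
        using h(2) by (intro nn_integral_mono_AE, eventually_elim)
          (metis K diff ennreal_leI ennreal_mult' less_imp_le mult.commute)
      also have "\<dots> = ennreal K * (\<integral>\<^sup>+x. ennreal (h x) \<partial>M)"
        using h(1) by (intro nn_integral_cmult) auto
      also have "(\<integral>\<^sup>+x. ennreal (h x) \<partial>M) = nn_norm M (\<lambda>x. f x - s i x)"
        by (rule nn_integral_norm_cong[OF h(2), symmetric])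
      finally show "nn_norm M (\<lambda>x. T (f x) - T (s i x))
        \<le> ennreal K * nn_norm M (\<lambda>x. f x - s i x)" .
    qed
    show "(\<lambda>i. ennreal K * nn_norm M (\<lambda>x. f x - s i x)) \<longlonglongrightarrow> 0"
      using ennreal_tendsto_cmult[OF _ ls, of "ennreal K"] by simp
  qed simp
  ultimately show ?thesis unfolding has_strong_integral_def
    using strongly_measurable_bounded_linear[OF T f] by (intro conjI exI[of _ "\<lambda>i x. T (s i x)"]) auto
qed

lemma has_strong_integral_diff:
  fixes f :: "'b \<Rightarrow> 'a::real_normed_vector"
  assumes "has_strong_integral M f I" "has_strong_integral M g J"
  shows "has_strong_integral M (\<lambda>x. f x - g x) (I - J)"
  using has_strong_integral_add[OF assms(1)
      has_strong_integral_bounded_linear[OF bounded_linear_minus[OF bounded_linear_ident] assms(2)]]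
  by simp

lemma has_strong_integral_unique:
  fixes f :: "'b \<Rightarrow> 'a::real_normed_vector"
  assumes "has_strong_integral M f I" "has_strong_integral M f J"
  shows "I = J"
  using has_strong_integral_imp(3)[OF has_strong_integral_diff[OF assms]] by simp

lemma has_strong_integral_zero: "has_strong_integral M (\<lambda>x. 0) (0::'a::real_normed_vector)"
  unfolding has_strong_integral_def
  by (auto intro!: exI[of _ "\<lambda>i x. 0"] simp: simple_bochner_integrable.simps simple_bochner_integral_zero)

text \<open>
  Bochner's criterion. The approximants are truncated where they exceed twice the limit, so that
  dominated convergence turns almost everywhere convergence into convergence in mean.
\<close>

lemma has_strong_integral_exists:
  fixes f :: "'b \<Rightarrow> 'a::banach"
  assumes f: "strongly_measurable M f" and fin: "nn_norm M f < \<infinity>"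
  shows "\<exists>I. has_strong_integral M f I"
proof -
  obtain s where s: "\<And>i. Bochner_Integration.simple_bochner_integrable M (s i)"
      "AE x in M. (\<lambda>i::nat. s i x) \<longlonglongrightarrow> f x"
    using f unfolding strongly_measurable_def by blast
  obtain h where h[measurable]: "h \<in> borel_measurable M" and h0: "\<And>x. 0 \<le> h x"
    and hf: "AE x in M. norm (f x) = h x"
    using strongly_measurable_norm[OF f] by blast
  have [measurable]: "(\<lambda>x. norm (s i x)) \<in> borel_measurable M" for i
    by (rule borel_measurable_simple_function[OF simple_function_compose1[OF
            simple_function_simple_bochner_integrable[OF s(1)], of norm]])
  define t where "t i x = (if norm (s i x) \<le> 2 * h x then s i x else 0)" for i x
  have t: "Bochner_Integration.simple_bochner_integrable M (t i)" for i
  proof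
    have sf: "simple_function M (s i)" and fs: "emeasure M {y \<in> space M. s i y \<noteq> 0} \<noteq> \<infinity>"
      using s(1)[of i] by (auto elim: simple_bochner_integrable.cases)
    show "simple_function M (t i)"
      unfolding t_def by (rule simple_function_If) (use sf in auto)
    have [measurable]: "s i \<in> measurable M (count_space UNIV)" using sf by (rule measurable_simple_function)
    have "emeasure M {y \<in> space M. t i y \<noteq> 0} \<le> emeasure M {y \<in> space M. s i y \<noteq> 0}"
      by (rule emeasure_mono) (auto simp: t_def split: if_splits)
    then show "emeasure M {y \<in> space M. t i y \<noteq> 0} \<noteq> \<infinity>" using fs by (auto simp: top_unique)
  qed
  have tl: "AE x in M. (\<lambda>i. t i x) \<longlonglongrightarrow> f x"
    using s(2) hf
  proof eventually_elim
    fix x assume x: "(\<lambda>i. s i x) \<longlonglongrightarrow> f x" "norm (f x) = h x"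
    show "(\<lambda>i. t i x) \<longlonglongrightarrow> f x"
    proof (cases "f x = 0")
      case True
      then have "t i x = 0" for i using x(2) by (auto simp: t_def)
      then show ?thesis using True by simp
    next
      case False
      then have "norm (f x) < 2 * h x" unfolding x(2)[symmetric] by simp
      then have "eventually (\<lambda>i. norm (s i x) < 2 * h x) sequentially"
        using order_tendstoD(2)[OF tendsto_norm[OF x(1)]] by blast
      then have "eventually (\<lambda>i. t i x = s i x) sequentially"
        by eventually_elim (simp add: t_def)
      then show ?thesis using x(1) by (simp add: tendsto_cong)
    qed
  qed
  have l: "(\<lambda>i. nn_norm M (\<lambda>x. f x - t i x)) \<longlonglongrightarrow> 0"
  proof -
    have "\<exists>k. k \<in> borel_measurable M \<and> (AE x in M. norm (f x - t i x) = k x)" for i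
      using strongly_measurable_norm[OF strongly_measurable_diff[OF f strongly_measurable_simple[OF t[of i]]]]
      by blast
    then obtain k where k[measurable]: "\<And>i. k i \<in> borel_measurable M"
      and kf: "\<And>i. AE x in M. norm (f x - t i x) = k i x" by metis
    have "(\<lambda>i. \<integral>\<^sup>+x. ennreal (k i x) \<partial>M) \<longlonglongrightarrow> (\<integral>\<^sup>+x. 0 \<partial>M)"
    proof (rule nn_integral_dominated_convergence[where w="\<lambda>x. ennreal (3 * h x)"])
      show "AE x in M. ennreal (k i x) \<le> ennreal (3 * h x)" for i
        using kf[of i] hf
      proof eventually_elim
        fix x assume "norm (f x - t i x) = k i x" "norm (f x) = h x"
        moreover have "norm (t i x) \<le> 2 * h x" using h0[of x] by (simp add: t_def)
        ultimately show "ennreal (k i x) \<le> ennreal (3 * h x)"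
          using norm_triangle_ineq4[of "f x" "t i x"] by (intro ennreal_leI) simp
      qed
      have "(\<integral>\<^sup>+x. ennreal (3 * h x) \<partial>M) = ennreal 3 * (\<integral>\<^sup>+x. ennreal (h x) \<partial>M)"
        by (subst nn_integral_cmult[symmetric]) (auto simp: ennreal_mult')
      also have "(\<integral>\<^sup>+x. ennreal (h x) \<partial>M) = nn_norm M f"
        by (rule nn_integral_norm_cong[OF hf, symmetric])
      finally show "(\<integral>\<^sup>+x. ennreal (3 * h x) \<partial>M) < \<infinity>"
        using fin by (simp add: ennreal_mult_less_top)
      have "AE x in M. \<forall>i. norm (f x - t i x) = k i x" using kf by (simp add: AE_all_countable)
      then show "AE x in M. (\<lambda>i. ennreal (k i x)) \<longlonglongrightarrow> 0"
        using tl
      proof eventually_elim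
        fix x assume x: "\<forall>i. norm (f x - t i x) = k i x" "(\<lambda>i. t i x) \<longlonglongrightarrow> f x"
        have "(\<lambda>i. norm (f x - t i x)) \<longlonglongrightarrow> norm (f x - f x)"
          by (intro tendsto_norm tendsto_diff tendsto_const x(2))
        then have "(\<lambda>i. k i x) \<longlonglongrightarrow> 0" using x(1) by simp
        then show "(\<lambda>i. ennreal (k i x)) \<longlonglongrightarrow> 0"
          by (metis tendsto_ennrealI ennreal_0)
      qed
    qed auto
    moreover have "(\<integral>\<^sup>+x. ennreal (k i x) \<partial>M) = nn_norm M (\<lambda>x. f x - t i x)" for i
      by (rule nn_integral_norm_cong[OF kf, symmetric])
    ultimately show ?thesis by simp
  qed
  have "Cauchy (\<lambda>i. Bochner_Integration.simple_bochner_integral M (t i))"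
  proof (rule metric_CauchyI)
    fix e :: real assume e: "0 < e"
    have "eventually (\<lambda>i. (nn_norm M (\<lambda>x. f x - t i x)) < ennreal (e/2)) sequentially"
      using order_tendstoD(2)[OF l, of "ennreal (e/2)"] e by simp
    then obtain N where N: "\<And>i. i \<ge> N \<Longrightarrow> (nn_norm M (\<lambda>x. f x - t i x)) < ennreal (e/2)"
      by (auto simp: eventually_sequentially)
    show "\<exists>N. \<forall>m\<ge>N. \<forall>n\<ge>N. dist (Bochner_Integration.simple_bochner_integral M (t m))
        (Bochner_Integration.simple_bochner_integral M (t n)) < e"
    proof (intro exI[of _ N] allI impI)
      fix m n assume mn: "m \<ge> N" "n \<ge> N"
      have "ennreal (norm (Bochner_Integration.simple_bochner_integral M (t m) - Bochner_Integration.simple_bochner_integral M (t n)))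
        \<le> nn_norm M (\<lambda>x. f x - t m x) + nn_norm M (\<lambda>x. f x - t n x)"
        by (rule simple_integral_diff_le[OF f t t])
      also have "\<dots> < ennreal (e/2) + ennreal (e/2)" by (intro add_strict_mono N mn)
      also have "\<dots> = ennreal e" using e by (simp flip: ennreal_plus)
      finally show "dist (Bochner_Integration.simple_bochner_integral M (t m))
        (Bochner_Integration.simple_bochner_integral M (t n)) < e"
        by (simp add: dist_norm ennreal_less_iff)
    qed
  qed
  then obtain I where "(\<lambda>i. Bochner_Integration.simple_bochner_integral M (t i)) \<longlonglongrightarrow> I"
    by (auto simp: Cauchy_convergent_iff convergent_def)
  then show ?thesis using f t l unfolding has_strong_integral_def by blast
qed

section \<open>Integrals over sets and indefinite integrals\<close>

lemma bounded_bilinear_scaleC: "bounded_bilinear (scaleC :: complex \<Rightarrow> 'a \<Rightarrow> 'a::complex_banach)"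
proof (rule bounded_bilinear.intro)
  show "scaleC (r *\<^sub>R a) b = r *\<^sub>R scaleC a b" for r a and b :: 'a
    by (simp add: scaleR_scaleC scaleC_scaleC scaleC_complex_def)
  show "scaleC a (r *\<^sub>R b) = r *\<^sub>R scaleC a b" for r a and b :: 'a
    by (simp add: scaleR_scaleC scaleC_scaleC mult.commute)
  show "\<exists>K. \<forall>a (b::'a). norm (scaleC a b) \<le> norm a * norm b * K"
    by (intro exI[of _ 1]) (simp add: norm_scaleC)
qed (simp_all add: scaleC_add_left scaleC_add_right)

interpretation scaleC: bounded_bilinear "scaleC :: complex \<Rightarrow> 'a \<Rightarrow> 'a::complex_banach"
  by (rule bounded_bilinear_scaleC)

lemma scaleC_one [simp]: "1 *\<^sub>C (x::'a::complex_banach) = x"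
  using scaleR_scaleC[of 1 x] by simp

lemma scaleR_eq_scaleC: "r *\<^sub>R (x::'a::complex_banach) = complex_of_real r *\<^sub>C x"
  by (rule scaleR_scaleC)

lemma scaleC_scaleR_commute: "c *\<^sub>C r *\<^sub>R (x::'a::complex_banach) = r *\<^sub>R c *\<^sub>C x"
  by (rule scaleC.scaleR_right)

abbreviation has_set_integral :: "real set \<Rightarrow> (real \<Rightarrow> 'a::real_normed_vector) \<Rightarrow> 'a \<Rightarrow> bool" where
  "has_set_integral A f I \<equiv> has_strong_integral lborel (\<lambda>t. indicat_real A t *\<^sub>R f t) I"

definition set_integrable_on :: "real set \<Rightarrow> (real \<Rightarrow> 'a::real_normed_vector) \<Rightarrow> bool" where
  "set_integrable_on A f \<longleftrightarrow> (\<exists>I. has_set_integral A f I)"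

lemma norm_indicator_scaleR:
  "ennreal (norm (indicat_real A t *\<^sub>R f t)) = ennreal (norm (f t)) * indicator A t"
  by (simp split: split_indicator)

lemma sigma_finite_lborel: "sigma_finite_measure (lborel :: real measure)"
  by (rule lborel.sigma_finite_measure_axioms)

lemma strongly_measurable_indicator:
  fixes A :: "real set"
  shows "A \<in> sets borel \<Longrightarrow> strongly_measurable lborel (indicat_real A)"
  by (rule strongly_measurable_borel[OF sigma_finite_lborel]) simp

lemma set_integrable_on_iff:
  fixes f :: "real \<Rightarrow> 'a::banach"
  shows "set_integrable_on A f \<longleftrightarrow> strongly_measurable lborel (\<lambda>t. indicat_real A t *\<^sub>R f t) \<and>
    (nnint A (\<lambda>t. norm (f t))) < \<infinity>"
proof
  assume "set_integrable_on A f"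
  then obtain I where I: "has_set_integral A f I" unfolding set_integrable_on_def by blast
  show "strongly_measurable lborel (\<lambda>t. indicat_real A t *\<^sub>R f t) \<and>
    (nnint A (\<lambda>t. norm (f t))) < \<infinity>"
    using has_strong_integral_imp(1,2)[OF I] by (simp only: norm_indicator_scaleR simp_thms)
next
  assume *: "strongly_measurable lborel (\<lambda>t. indicat_real A t *\<^sub>R f t) \<and>
    (nnint A (\<lambda>t. norm (f t))) < \<infinity>"
  have "\<exists>I. has_set_integral A f I"
    by (rule has_strong_integral_exists) (use * in \<open>simp_all only: norm_indicator_scaleR simp_thms\<close>)
  then show "set_integrable_on A f" unfolding set_integrable_on_def .
qed

lemma set_integrable_on_norm:
  fixes f :: "real \<Rightarrow> 'a::banach"
  assumes "set_integrable_on A f"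
  shows "\<exists>h::real \<Rightarrow> real. h \<in> borel_measurable lborel \<and> (\<forall>t. 0 \<le> h t) \<and>
    (AE t in lborel. norm (indicat_real A t *\<^sub>R f t) = h t)"
  using assms strongly_measurable_norm unfolding set_integrable_on_iff by blast

lemma strongly_measurable_indicator_subset:
  fixes A B :: "real set"
  assumes "strongly_measurable lborel (\<lambda>t. indicat_real A t *\<^sub>R f t)" "B \<in> sets borel" "B \<subseteq> A"
  shows "strongly_measurable lborel (\<lambda>t. indicat_real B t *\<^sub>R f t)"
proof -
  have "(\<lambda>t. indicat_real B t *\<^sub>R indicat_real A t *\<^sub>R f t) = (\<lambda>t. indicat_real B t *\<^sub>R f t)"
    using assms(3) by (auto simp: fun_eq_iff split: split_indicator)
  then show ?thesis
    using strongly_measurable_scaleR[OF strongly_measurable_indicator[OF assms(2)] assms(1)] by simp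
qed

lemma set_integrable_on_subset:
  fixes f :: "real \<Rightarrow> 'a::banach"
  assumes "set_integrable_on A f" "B \<in> sets borel" "B \<subseteq> A"
  shows "set_integrable_on B f"
proof -
  have "nnint B (\<lambda>t. norm (f t)) \<le> nnint A (\<lambda>t. norm (f t))"
    using assms(3) by (intro nn_integral_mono) (auto split: split_indicator)
  with assms strongly_measurable_indicator_subset[OF _ assms(2,3), of f] show ?thesis
    unfolding set_integrable_on_iff by (auto intro: le_less_trans)
qed

lemma has_set_integral_norm_le:
  assumes "has_set_integral A f I"
  shows "ennreal (norm I) \<le> nnint A (\<lambda>t. norm (f t))"
  using has_strong_integral_imp(3)[OF assms] by (simp only: norm_indicator_scaleR)

lemma has_set_integral_Un:
  assumes "has_set_integral A f I" "has_set_integral B f J" "A \<inter> B = {}"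
  shows "has_set_integral (A \<union> B) f (I + J)"
proof -
  have "(\<lambda>t. indicat_real A t *\<^sub>R f t + indicat_real B t *\<^sub>R f t) = (\<lambda>t. indicat_real (A \<union> B) t *\<^sub>R f t)"
    using assms(3) by (auto simp: fun_eq_iff split: split_indicator)
  then show ?thesis using has_strong_integral_add[OF assms(1,2)] by simp
qed

lemma has_set_integral_add:
  assumes "has_set_integral A f I" "has_set_integral A g J"
  shows "has_set_integral A (\<lambda>t. f t + g t) (I + J)"
  using has_strong_integral_add[OF assms] by (simp add: scaleR_add_right)

lemma has_set_integral_diff:
  assumes "has_set_integral A f I" "has_set_integral A g J"
  shows "has_set_integral A (\<lambda>t. f t - g t) (I - J)"
  using has_strong_integral_diff[OF assms] by (simp add: scaleR_diff_right)

lemma has_set_integral_linear: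
  assumes T: "bounded_linear T" and "has_set_integral A f I"
  shows "has_set_integral A (\<lambda>t. T (f t)) (T I)"
proof -
  interpret bounded_linear T by fact
  show ?thesis using has_strong_integral_bounded_linear[OF assms] by (simp add: scaleR)
qed

lemma has_set_integral_cong:
  assumes "has_set_integral A f I" "\<And>t. t \<in> A \<Longrightarrow> f t = g t"
  shows "has_set_integral A g I"
proof -
  have "(\<lambda>t. indicat_real A t *\<^sub>R f t) = (\<lambda>t. indicat_real A t *\<^sub>R g t)"
    using assms(2) by (auto simp: fun_eq_iff split: split_indicator)
  then show ?thesis using assms(1) by simp
qed

lemma has_set_integral_cong_AE:
  assumes "has_set_integral A f I" "AE t in lborel. t \<in> A \<longrightarrow> f t = g t"
  shows "has_set_integral A g I"
proof (rule has_strong_integral_cong_AE[OF assms(1)])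
  show "AE t in lborel. indicat_real A t *\<^sub>R f t = indicat_real A t *\<^sub>R g t"
    using assms(2) by eventually_elim (auto split: split_indicator)
qed

lemma set_integrable_on_cong:
  "set_integrable_on A f \<Longrightarrow> (\<And>t. t \<in> A \<Longrightarrow> f t = g t) \<Longrightarrow> set_integrable_on A g"
  unfolding set_integrable_on_def using has_set_integral_cong by blast

lemma set_integrable_on_add:
  "set_integrable_on A f \<Longrightarrow> set_integrable_on A g \<Longrightarrow> set_integrable_on A (\<lambda>t. f t + g t)"
  unfolding set_integrable_on_def using has_set_integral_add by blast

lemma set_integrable_on_diff:
  "set_integrable_on A f \<Longrightarrow> set_integrable_on A g \<Longrightarrow> set_integrable_on A (\<lambda>t. f t - g t)"
  unfolding set_integrable_on_def using has_set_integral_diff by blast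

lemma set_integrable_on_bilinear:
  fixes m :: "real \<Rightarrow> 'c::{real_normed_vector, second_countable_topology}"
    and f :: "real \<Rightarrow> 'b::banach" and T :: "'c \<Rightarrow> 'b \<Rightarrow> 'a::banach"
  assumes f: "set_integrable_on A f" and A: "A \<in> sets borel"
    and m: "(\<lambda>t. indicat_real A t *\<^sub>R m t) \<in> borel_measurable borel" and K: "\<And>t. t \<in> A \<Longrightarrow> norm (m t) \<le> K"
    and T: "bounded_bilinear T"
  shows "set_integrable_on A (\<lambda>t. T (m t) (f t))"
proof -
  interpret T: bounded_bilinear T by fact
  obtain L where L: "L > 0" "\<And>a b. norm (T a b) \<le> norm a * norm b * L" using T.pos_bounded by blast
  have fm: "strongly_measurable lborel (\<lambda>t. indicat_real A t *\<^sub>R f t)"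
    and fin: "nnint A (\<lambda>t. norm (f t)) < \<infinity>"
    using f unfolding set_integrable_on_iff by auto
  have mm: "strongly_measurable lborel (\<lambda>t. indicat_real A t *\<^sub>R m t)"
    by (rule strongly_measurable_borel[OF sigma_finite_lborel]) (use m in simp)
  have "(\<lambda>t. T (indicat_real A t *\<^sub>R m t) (indicat_real A t *\<^sub>R f t)) = (\<lambda>t. indicat_real A t *\<^sub>R T (m t) (f t))"
    by (auto simp: fun_eq_iff T.scaleR_left T.scaleR_right split: split_indicator)
  then have "strongly_measurable lborel (\<lambda>t. indicat_real A t *\<^sub>R T (m t) (f t))"
    using strongly_measurable_bounded_bilinear[OF T mm fm] by simp
  moreover have "nnint A (\<lambda>t. norm (T (m t) (f t))) < \<infinity>"
  proof -
    obtain h where h: "h \<in> borel_measurable lborel" "AE t in lborel. norm (indicat_real A t *\<^sub>R f t) = h t"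
      using strongly_measurable_norm[OF fm] by blast
    have "nnint A (\<lambda>t. norm (T (m t) (f t))) \<le> (\<integral>\<^sup>+t. ennreal (K * L) * ennreal (h t) \<partial>lborel)"
    proof (rule nn_integral_mono_AE)
      show "AE t in lborel. ennreal (norm (T (m t) (f t))) * indicator A t \<le> ennreal (K * L) * ennreal (h t)"
        using h(2)
      proof eventually_elim
        fix t assume ht: "norm (indicat_real A t *\<^sub>R f t) = h t"
        show "ennreal (norm (T (m t) (f t))) * indicator A t \<le> ennreal (K * L) * ennreal (h t)"
        proof (cases "t \<in> A")
          case True
          have "norm (T (m t) (f t)) \<le> norm (m t) * norm (f t) * L" by (rule L)
          also have "\<dots> \<le> K * norm (f t) * L"
            using K[OF True] L by (intro mult_right_mono) auto
          finally have "norm (T (m t) (f t)) \<le> K * L * h t" using ht True by (simp add: algebra_simps)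
          moreover have "0 \<le> K" using K[OF True] norm_ge_zero[of "m t"] by linarith
          ultimately show ?thesis using True L
            by (simp add: ht[symmetric] ennreal_leI flip: ennreal_mult)
        qed simp
      qed
    qed
    also have "\<dots> = ennreal (K * L) * (\<integral>\<^sup>+t. ennreal (h t) \<partial>lborel)"
      using h(1) by (intro nn_integral_cmult) auto
    also have "(\<integral>\<^sup>+t. ennreal (h t) \<partial>lborel) = nnint A (\<lambda>t. norm (f t))"
      using nn_integral_norm_cong[OF h(2)] by (simp only: norm_indicator_scaleR)
    also have "ennreal (K * L) * \<dots> < \<infinity>" using fin by (simp add: ennreal_mult_less_top)
    finally show ?thesis .
  qed
  ultimately show ?thesis unfolding set_integrable_on_iff by blast
qed

text \<open>
  On separable ranges the library's Bochner integral is a strong integral, which makes the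
  fundamental theorem of calculus available for scalar functions.
\<close>

lemma has_set_integral_bochner:
  fixes f :: "real \<Rightarrow> 'a::{banach, second_countable_topology}"
  assumes "has_bochner_integral lborel f I"
  shows "has_strong_integral lborel f I"
  using assms
proof cases
  case (1 s)
  then show ?thesis unfolding has_strong_integral_def
    using strongly_measurable_borel[OF sigma_finite_lborel, of f] by auto
qed

text \<open>Dominated convergence, applied to a Borel function in place of the norm.\<close>

lemma nn_integral_shrinking:
  fixes f :: "real \<Rightarrow> 'a::banach"
  assumes f: "set_integrable_on A f" and An: "\<And>n::nat. B n \<in> sets borel" "\<And>n. B n \<subseteq> A"
    and lim: "AE t in lborel. eventually (\<lambda>n. t \<notin> B n) sequentially"
  shows "(\<lambda>n. \<integral>\<^sup>+t\<in>B n. ennreal (norm (f t)) \<partial>lborel) \<longlonglongrightarrow> 0"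
proof -
  have fm: "strongly_measurable lborel (\<lambda>t. indicat_real A t *\<^sub>R f t)"
    and fin: "nnint A (\<lambda>t. norm (f t)) < \<infinity>"
    using f unfolding set_integrable_on_iff by auto
  obtain h where h: "h \<in> borel_measurable lborel" "AE t in lborel. norm (indicat_real A t *\<^sub>R f t) = h t"
    using strongly_measurable_norm[OF fm] by blast
  have "(\<lambda>n. \<integral>\<^sup>+t. ennreal (h t) * indicator (B n) t \<partial>lborel) \<longlonglongrightarrow> nn_integral lborel (\<lambda>t::real. 0)"
  proof (rule nn_integral_dominated_convergence[where w="\<lambda>t. ennreal (h t)"])
    show "AE t in lborel. ennreal (h t) * indicator (B n) t \<le> ennreal (h t)" for n
      by (auto split: split_indicator)
    show "(\<integral>\<^sup>+t. ennreal (h t) \<partial>lborel) < \<infinity>"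
      using fin nn_integral_norm_cong[OF h(2)] by (simp only: norm_indicator_scaleR)
    show "AE t in lborel. (\<lambda>n. ennreal (h t) * indicator (B n) t) \<longlonglongrightarrow> 0"
      using lim
    proof eventually_elim
      fix t assume "eventually (\<lambda>n. t \<notin> B n) sequentially"
      then have "eventually (\<lambda>n. ennreal (h t) * indicator (B n) t = 0) sequentially"
        by eventually_elim simp
      then show "(\<lambda>n. ennreal (h t) * indicator (B n) t) \<longlonglongrightarrow> 0" by (rule tendsto_eventually)
    qed
  qed (use h(1) An(1) in auto)
  moreover have "(\<integral>\<^sup>+t. ennreal (h t) * indicator (B n) t \<partial>lborel) = nnint (B n) (\<lambda>t. norm (f t))" for n
  proof (rule nn_integral_cong_AE)
    show "AE t in lborel. ennreal (h t) * indicator (B n) t = ennreal (norm (f t)) * indicator (B n) t"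
      using h(2)
    proof eventually_elim
      fix t assume "norm (indicat_real A t *\<^sub>R f t) = h t"
      then show "ennreal (h t) * indicator (B n) t = ennreal (norm (f t)) * indicator (B n) t"
        using An(2)[of n] by (auto split: split_indicator)
    qed
  qed
  ultimately show ?thesis by simp
qed

lemma tendsto_zero_ennreal_norm:
  fixes f :: "nat \<Rightarrow> 'a::real_normed_vector"
  assumes "\<And>n. ennreal (norm (f n)) \<le> e n" "e \<longlonglongrightarrow> 0"
  shows "f \<longlonglongrightarrow> 0"
proof -
  have "(\<lambda>n. ennreal (norm (f n))) \<longlonglongrightarrow> 0"
    by (rule tendsto_sandwich[OF _ _ tendsto_const assms(2)]) (use assms(1) in auto)
  then have "(\<lambda>n. enn2real (ennreal (norm (f n)))) \<longlonglongrightarrow> 0"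
    using tendsto_enn2real[where l=0 and u="\<lambda>n. ennreal (norm (f n))" and F=sequentially] by simp
  then show ?thesis by (simp add: tendsto_norm_zero_iff)
qed

text \<open>
  \<open>v\<close> is an indefinite integral of \<open>g\<close> on the open half-line: the vector-valued substitute for
  local absolute continuity, where differentiability almost everywhere is not available in general.
\<close>

definition indef_integral :: "(real \<Rightarrow> 'a::real_normed_vector) \<Rightarrow> (real \<Rightarrow> 'a) \<Rightarrow> bool" where
  "indef_integral v g \<longleftrightarrow> (\<forall>x y. 0 < x \<longrightarrow> x \<le> y \<longrightarrow> has_set_integral {x<..y} g (v y - v x))"

definition loc_integrable :: "(real \<Rightarrow> 'a::real_normed_vector) \<Rightarrow> bool" where
  "loc_integrable g \<longleftrightarrow> (\<forall>x y. 0 < x \<longrightarrow> x \<le> y \<longrightarrow> set_integrable_on {x<..y} g)"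

lemma indef_integral_imp_loc_integrable: "indef_integral v g \<Longrightarrow> loc_integrable g"
  unfolding indef_integral_def loc_integrable_def set_integrable_on_def by blast

lemma indef_integral_cong_AE:
  assumes "indef_integral v f" "AE t in lborel. 0 < t \<longrightarrow> f t = g t"
  shows "indef_integral v g"
  unfolding indef_integral_def
proof (intro allI impI)
  fix x y :: real assume xy: "0 < x" "x \<le> y"
  show "has_set_integral {x<..y} g (v y - v x)"
    by (rule has_set_integral_cong_AE[of _ f])
       (use assms xy in \<open>auto simp: indef_integral_def elim!: eventually_mono\<close>)
qed

lemma indef_integral_cong:
  assumes "indef_integral v f" "\<And>t. 0 < t \<Longrightarrow> v t = w t" "\<And>t. 0 < t \<Longrightarrow> f t = g t"
  shows "indef_integral w g"
proof -
  have "indef_integral v g" by (rule indef_integral_cong_AE[OF assms(1)]) (use assms(3) in auto)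
  then show ?thesis using assms(2) unfolding indef_integral_def by auto
qed

lemma indef_integral_add:
  assumes "indef_integral v f" "indef_integral w g"
  shows "indef_integral (\<lambda>t. v t + w t) (\<lambda>t. f t + g t)"
  unfolding indef_integral_def
proof (intro allI impI)
  fix x y :: real assume xy: "0 < x" "x \<le> y"
  have "has_set_integral {x<..y} (\<lambda>t. f t + g t) ((v y - v x) + (w y - w x))"
    by (rule has_set_integral_add) (use assms xy in \<open>auto simp: indef_integral_def\<close>)
  then show "has_set_integral {x<..y} (\<lambda>t. f t + g t) (v y + w y - (v x + w x))"
    by (simp add: algebra_simps)
qed

lemma indef_integral_linear:
  assumes "bounded_linear T" "indef_integral v f"
  shows "indef_integral (\<lambda>t. T (v t)) (\<lambda>t. T (f t))"
  using assms(2) has_set_integral_linear[OF assms(1)]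
  unfolding indef_integral_def by (simp add: bounded_linear.linear[OF assms(1)] linear_diff[symmetric])

lemma indef_integral_diff:
  "indef_integral v f \<Longrightarrow> indef_integral w g \<Longrightarrow> indef_integral (\<lambda>t. v t - w t) (\<lambda>t. f t - g t)"
  using indef_integral_add[of v f "\<lambda>t. - w t" "\<lambda>t. - g t"]
    indef_integral_linear[OF bounded_linear_minus[OF bounded_linear_ident], of w g] by simp

lemma indef_integral_scaleC:
  "indef_integral v (f :: real \<Rightarrow> 'a::complex_banach) \<Longrightarrow> indef_integral (\<lambda>t. c *\<^sub>C v t) (\<lambda>t. c *\<^sub>C f t)"
  by (rule indef_integral_linear[OF scaleC.bounded_linear_right])

lemma indef_integral_const: "indef_integral (\<lambda>t. c) (\<lambda>t. 0)"
  unfolding indef_integral_def by (simp add: has_strong_integral_zero)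

lemma indef_integral_shift:
  "indef_integral v g \<Longrightarrow> indef_integral (\<lambda>t. v t + c) g"
  using indef_integral_add[OF _ indef_integral_const, of v g c] by simp

lemma indef_integral_norm_le:
  assumes "indef_integral v g" "0 < x" "x \<le> y"
  shows "ennreal (norm (v y - v x)) \<le> nnint {x<..y} (\<lambda>t. norm (g t))"
  using assms by (intro has_set_integral_norm_le) (auto simp: indef_integral_def)

lemma indef_integral_exists:
  fixes g :: "real \<Rightarrow> 'a::banach"
  assumes "loc_integrable g"
  shows "\<exists>v. indef_integral v g"
proof -
  have "\<exists>I. has_set_integral {x<..y} g I" if "0 < x" "x \<le> y" for x y
    using assms that unfolding loc_integrable_def set_integrable_on_def by blast
  then obtain I where I: "\<And>x y. 0 < x \<Longrightarrow> x \<le> y \<Longrightarrow> has_set_integral {x<..y} g (I x y)" by metis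
  have chasles: "I x y + I y z = I x z" if "0 < x" "x \<le> y" "y \<le> z" for x y z
  proof -
    have "{x<..y} \<union> {y<..z} = {x<..z}" "{x<..y} \<inter> {y<..z} = {}" using that by auto
    then have "has_set_integral {x<..z} g (I x y + I y z)"
      using has_set_integral_Un[OF I[of x y] I[of y z]] that by simp
    then show ?thesis using I[of x z] that by (intro has_strong_integral_unique) auto
  qed
  define v where "v x = (if 1 \<le> x then I 1 x else - I x 1)" for x
  have "v y - v x = I x y" if "0 < x" "x \<le> y" for x y
  proof -
    consider "1 \<le> x" | "x < 1" "1 \<le> y" | "y < 1" using that by linarith
    then show ?thesis
      using chasles[of 1 x y] chasles[of x 1 y] chasles[of x y 1] that
      by cases (auto simp: v_def algebra_simps)
  qed
  then show ?thesis using I unfolding indef_integral_def by metis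
qed

text \<open>The increments are integrals over intervals shrinking to a point.\<close>

lemma indef_integral_continuous_on:
  fixes g :: "real \<Rightarrow> 'a::banach"
  assumes v: "indef_integral v g"
  shows "continuous_on {0<..} v"
  unfolding continuous_on_sequentially
proof (intro ballI allI impI, elim conjE)
  fix x and X :: "nat \<Rightarrow> real" assume x: "x \<in> {0<..}" and X: "\<forall>n. X n \<in> {0<..}" and l: "X \<longlonglongrightarrow> x"
  obtain c where c: "0 < c" "\<And>n. c < X n" "c < x"
  proof -
    have "eventually (\<lambda>n. x / 2 < X n) sequentially"
      using order_tendstoD(1)[OF l, of "x/2"] x by simp
    then obtain N where N: "\<And>n. n \<ge> N \<Longrightarrow> x/2 < X n" by (auto simp: eventually_sequentially)
    define \<mu> where "\<mu> = Min (insert (x/2) (X ` {..<N}))"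
    have pos: "\<mu> > 0" using x X unfolding \<mu>_def by (subst Min_gr_iff) auto
    have le: "\<mu> \<le> x/2" unfolding \<mu>_def by (intro Min_le) auto
    have leX: "\<mu> \<le> X n" for n
    proof (cases "n < N")
      case True then show ?thesis unfolding \<mu>_def by (intro Min_le) auto
    next
      case False
      then show ?thesis using N[of n] le by simp
    qed
    have "\<mu> / 2 < X n" for n using leX[of n] pos by simp
    moreover have "\<mu> / 2 < x" using le pos x by simp
    ultimately show ?thesis using that[of "\<mu> / 2"] pos by simp
  qed
  obtain d where d: "\<And>n. X n \<le> d" "x \<le> d"
    using convergent_imp_Bseq[OF convergentI[OF l]] unfolding Bseq_def
    by (metis abs_le_D1 dual_order.trans max.cobounded1 max.cobounded2 real_norm_def)
  have cd: "set_integrable_on {c<..d} g"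
    using indef_integral_imp_loc_integrable[OF v] c d unfolding loc_integrable_def
    by (meson less_imp_le less_le_trans)
  define B where "B n = {min x (X n)<..max x (X n)}" for n
  have "(\<lambda>n. \<integral>\<^sup>+t\<in>B n. ennreal (norm (g t)) \<partial>lborel) \<longlonglongrightarrow> 0"
  proof (rule nn_integral_shrinking[OF cd])
    show "B n \<subseteq> {c<..d}" for n using c(2)[of n] c(3) d(1)[of n] d(2) by (auto simp: B_def)
    have "eventually (\<lambda>n. t \<notin> B n) sequentially" if "t \<noteq> x" for t
    proof (cases "t < x")
      case True
      show ?thesis using order_tendstoD(1)[OF l True]
        by eventually_elim (use True in \<open>auto simp: B_def\<close>)
    next
      case False
      then have "x < t" using that by simp
      show ?thesis using order_tendstoD(2)[OF l \<open>x < t\<close>]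
        by eventually_elim (use \<open>x < t\<close> in \<open>auto simp: B_def\<close>)
    qed
    moreover have "AE t in lborel. t \<noteq> x" by (rule AE_lborel_singleton)
    ultimately show "AE t in lborel. eventually (\<lambda>n. t \<notin> B n) sequentially" by (auto elim: eventually_mono)
  qed (simp add: B_def)
  then have "(\<lambda>n. v (X n) - v x) \<longlonglongrightarrow> 0"
  proof (rule tendsto_zero_ennreal_norm[rotated])
    fix n
    show "ennreal (norm (v (X n) - v x)) \<le> nnint (B n) (\<lambda>t. norm (g t))"
      using indef_integral_norm_le[OF v, of x "X n"] indef_integral_norm_le[OF v, of "X n" x] x X
      by (cases "x \<le> X n") (auto simp: B_def norm_minus_commute min_def max_def)
  qed
  then show "(v \<circ> X) \<longlonglongrightarrow> v x" by (simp add: LIM_zero_iff comp_def)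
qed

text \<open>A continuous function is the pointwise limit of its samples on dyadic grids.\<close>

lemma strongly_measurable_continuous:
  fixes v :: "real \<Rightarrow> 'a::real_normed_vector"
  assumes v: "continuous_on {0<..} v"
  shows "strongly_measurable lborel (\<lambda>t. indicat_real {0<..} t *\<^sub>R v t)"
proof (rule strongly_measurableI_sigma_finite[OF sigma_finite_lborel])
  define q where "q n t = (if t \<in> {0<..real n} then real_of_int \<lfloor>2 ^ n * t\<rfloor> else -1)" for n and t :: real
  define \<phi> where "\<phi> n z = (if z < 0 then 0 else v ((z + 1) / 2 ^ n))" for n :: nat and z :: real
  show "simple_function lborel (\<lambda>t. \<phi> n (q n t))" for n
  proof -
    have "q n ` UNIV \<subseteq> insert (-1) (real_of_int ` {0..\<lfloor>2 ^ n * real n\<rfloor>})"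
      by (auto simp: q_def intro!: imageI floor_mono)
    then have "finite (q n ` UNIV)" by (rule finite_subset) auto
    then have "simple_function lborel (q n)"
      by (intro simple_function_borel_measurable) (auto simp: q_def[abs_def])
    then show ?thesis by (rule simple_function_compose1)
  qed
  show "AE t in lborel. (\<lambda>n. \<phi> n (q n t)) \<longlonglongrightarrow> indicat_real {0<..} t *\<^sub>R v t"
  proof (intro AE_I2)
    fix t :: real
    show "(\<lambda>n. \<phi> n (q n t)) \<longlonglongrightarrow> indicat_real {0<..} t *\<^sub>R v t"
    proof (cases "0 < t")
      case False
      then show ?thesis by (simp add: q_def \<phi>_def)
    next
      case True
      define d where "d n = (real_of_int \<lfloor>2 ^ n * t\<rfloor> + 1) / 2 ^ n" for n :: nat
      have d1: "t \<le> d n" and d2: "d n \<le> t + (1/2) ^ n" for n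
      proof -
        have "2 ^ n * t \<le> real_of_int \<lfloor>2 ^ n * t\<rfloor> + 1" by linarith
        then show "t \<le> d n" by (simp add: d_def field_simps)
        have "real_of_int \<lfloor>2 ^ n * t\<rfloor> + 1 \<le> 2 ^ n * t + 1" by simp
        then show "d n \<le> t + (1/2) ^ n" by (simp add: d_def field_simps power_divide)
      qed
      have "(\<lambda>n. t + (1/2::real) ^ n) \<longlonglongrightarrow> t + 0"
        by (intro tendsto_add tendsto_const LIMSEQ_realpow_zero) auto
      then have "d \<longlonglongrightarrow> t"
        by (intro tendsto_sandwich[of "\<lambda>n. t" d sequentially "\<lambda>n. t + (1/2) ^ n" t])
           (auto simp: d1 d2)
      then have "(\<lambda>n. v (d n)) \<longlonglongrightarrow> v t"
        by (intro continuous_on_tendsto_compose[OF v]) (use True d1 in \<open>auto intro!: always_eventually less_le_trans[OF True]\<close>)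
      moreover have "eventually (\<lambda>n. \<phi> n (q n t) = v (d n)) sequentially"
        using eventually_ge_at_top[of "nat \<lceil>t\<rceil>"]
      proof eventually_elim
        fix n assume "nat \<lceil>t\<rceil> \<le> n"
        then have "t \<le> real n" by linarith
        moreover have "\<not> 2 ^ n * t < 0" using True by (simp add: not_less)
        ultimately show "\<phi> n (q n t) = v (d n)" using True by (auto simp: q_def \<phi>_def d_def mult_less_0_iff)
      qed
      ultimately show ?thesis using True by (simp add: tendsto_cong)
    qed
  qed
qed

lemma set_integrable_on_continuous:
  fixes v :: "real \<Rightarrow> 'a::banach"
  assumes v: "continuous_on {0<..} v" and x: "0 < x"
  shows "set_integrable_on {x<..y} v"
  unfolding set_integrable_on_iff
proof
  show "strongly_measurable lborel (\<lambda>t. indicat_real {x<..y} t *\<^sub>R v t)"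
    by (rule strongly_measurable_indicator_subset[OF strongly_measurable_continuous[OF v]])
       (use x in auto)
  have "compact (v ` {x..y})"
    by (intro compact_continuous_image continuous_on_subset[OF v]) (use x in auto)
  then obtain K where K: "\<And>t. t \<in> {x..y} \<Longrightarrow> norm (v t) \<le> K"
    by (meson bounded_iff compact_imp_bounded imageI)
  have "nnint {x<..y} (\<lambda>t. norm (v t)) \<le> (\<integral>\<^sup>+t. ennreal K * indicator {x<..y} t \<partial>lborel)"
    by (intro nn_integral_mono) (auto split: split_indicator intro!: ennreal_leI K)
  also have "\<dots> = ennreal K * emeasure lborel {x<..y}" by (intro nn_integral_cmult_indicator) simp
  also have "\<dots> < \<infinity>" by (cases "x \<le> y") (auto simp: ennreal_mult_less_top)
  finally show "nnint {x<..y} (\<lambda>t. norm (v t)) < \<infinity>" .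
qed

text \<open>
  Each bisection of the interval halves the bound, because the increments of \<open>E\<close> add up.
\<close>

lemma additive_small_imp_zero:
  fixes R :: "real \<Rightarrow> real \<Rightarrow> 'a::real_normed_vector"
  assumes add: "\<And>x y z. a \<le> x \<Longrightarrow> x \<le> y \<Longrightarrow> y \<le> z \<Longrightarrow> z \<le> b \<Longrightarrow> R x z = R x y + R y z"
    and small: "\<And>x y. a \<le> x \<Longrightarrow> x \<le> y \<Longrightarrow> y \<le> b \<Longrightarrow> norm (R x y) \<le> (y - x) * (E y - E x)"
    and xy: "a \<le> x" "x \<le> y" "y \<le> b"
  shows "R x y = 0"
proof -
  have *: "norm (R x y) \<le> (y - x) / 2 ^ n * (E y - E x)" if "a \<le> x" "x \<le> y" "y \<le> b" for n x y
    using that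
  proof (induction n arbitrary: x y)
    case 0
    then show ?case using small by simp
  next
    case (Suc n)
    define m where "m = (x + y) / 2"
    have m: "x \<le> m" "m \<le> y" "m - x = (y - x) / 2" "y - m = (y - x) / 2"
      using Suc.prems by (auto simp: m_def field_simps)
    have "norm (R x y) \<le> norm (R x m) + norm (R m y)"
      using add[of x m y] Suc.prems m by (metis norm_triangle_ineq)
    also have "\<dots> \<le> (m - x) / 2 ^ n * (E m - E x) + (y - m) / 2 ^ n * (E y - E m)"
      using Suc m by (intro add_mono Suc.IH) auto
    also have "\<dots> = (y - x) / 2 ^ Suc n * (E y - E x)"
      unfolding m(3,4) by (simp add: field_simps)
    finally show ?case .
  qed
  have "(\<lambda>n. (y - x) * (E y - E x) * (1/2) ^ n) \<longlonglongrightarrow> (y - x) * (E y - E x) * 0"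
    by (intro tendsto_mult tendsto_const LIMSEQ_realpow_zero) auto
  then have "norm (R x y) \<le> 0"
    by (intro LIMSEQ_le_const[of "\<lambda>n. (y - x) * (E y - E x) * (1/2) ^ n"])
       (use *[OF xy] in \<open>auto simp: power_divide field_simps\<close>)
  then show ?thesis by simp
qed

text \<open>
  Product rule. The defect of the claimed identity is additive in the interval and, on a short
  interval, bounded by its length times the integral of the norm of \<open>g\<close>; bisecting shows
  that it vanishes. This avoids Fubini's theorem for vector-valued functions.
\<close>

lemma indef_integral_mult:
  fixes g :: "real \<Rightarrow> 'a::complex_banach" and m m' :: "real \<Rightarrow> complex"
  assumes v: "indef_integral v g"
    and m: "\<And>t. 0 < t \<Longrightarrow> (m has_vector_derivative m' t) (at t)" and m': "continuous_on {0<..} m'"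
  shows "indef_integral (\<lambda>t. m t *\<^sub>C v t) (\<lambda>t. m' t *\<^sub>C v t + m t *\<^sub>C g t)"
  unfolding indef_integral_def
proof (intro allI impI)
  fix a b :: real assume ab: "0 < a" "a \<le> b"
  have mc: "continuous_on {0<..} m"
    by (intro continuous_at_imp_continuous_on ballI)
       (use m in \<open>auto dest: has_vector_derivative_continuous\<close>)
  have vc: "continuous_on {0<..} v" by (rule indef_integral_continuous_on[OF v])
  let ?G = "\<lambda>t. m' t *\<^sub>C v t + m t *\<^sub>C g t"
  have cont_bdd: "\<exists>K. \<forall>t\<in>{x..y}. norm (c t) \<le> K" if "continuous_on {0<..} c" "0 < x"
    for x y and c :: "real \<Rightarrow> complex"
  proof -
    have "compact (c ` {x..y})"
      by (intro compact_continuous_image continuous_on_subset[OF that(1)]) (use that in auto)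
    then show ?thesis by (meson bounded_iff compact_imp_bounded imageI)
  qed
  have meas: "(\<lambda>t. indicat_real {x<..y} t *\<^sub>R c t) \<in> borel_measurable borel"
    if "continuous_on {0<..} c" "0 < x" for x y and c :: "real \<Rightarrow> complex"
    by (rule borel_measurable_continuous_on_indicator[OF _ continuous_on_subset[OF that(1)]])
       (use that in auto)
  have int_mult: "set_integrable_on {x<..y} (\<lambda>t. c t *\<^sub>C f t)"
    if c: "continuous_on {0<..} c" and x: "0 < x" and f: "set_integrable_on {x<..y} f"
    for x y c and f :: "real \<Rightarrow> 'a"
  proof -
    obtain K where "\<forall>t\<in>{x..y}. norm (c t) \<le> K" using cont_bdd[OF c x] by blast
    then show ?thesis
      by (intro set_integrable_on_bilinear[OF f _ meas _ bounded_bilinear_scaleC, where K=K] c x) auto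
  qed
  have g_int: "set_integrable_on {x<..y} g" if "0 < x" "x \<le> y" for x y
    using indef_integral_imp_loc_integrable[OF v] that unfolding loc_integrable_def by blast
  have "set_integrable_on {x<..y} ?G" if "0 < x" "x \<le> y" for x y
    by (intro set_integrable_on_add int_mult mc m' that g_int set_integrable_on_continuous vc)
  then obtain J where J: "\<And>x y. 0 < x \<Longrightarrow> x \<le> y \<Longrightarrow> has_set_integral {x<..y} ?G (J x y)"
    unfolding set_integrable_on_def by metis
  define R where "R x y = m y *\<^sub>C v y - m x *\<^sub>C v x - J x y" for x y
  obtain K where K: "\<And>t. t \<in> {a..b} \<Longrightarrow> norm (m' t) \<le> K" using cont_bdd[OF m' ab(1)] by blast
  have K0: "0 \<le> K" using order_trans[OF norm_ge_zero K[of a]] ab by simp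
  define N where "N x y = nnint {x<..y} (\<lambda>t. norm (g t))" for x y
  have Nfin: "N x y < \<infinity>" if "0 < x" "x \<le> y" for x y
    using g_int[OF that] unfolding set_integrable_on_iff N_def by blast
  define E where "E y = enn2real (N a y)" for y
  have Nsplit: "N x z = N x y + N y z" if "0 < x" "x \<le> y" "y \<le> z" for x y z
  proof -
    obtain h where h: "h \<in> borel_measurable lborel" "AE t in lborel. norm (indicat_real {x<..z} t *\<^sub>R g t) = h t"
      using set_integrable_on_norm[OF g_int[of x z]] \<open>0 < x\<close> \<open>x \<le> y\<close> \<open>y \<le> z\<close> by auto
    have *: "nnint B (\<lambda>t. norm (g t)) = nnint B h"
      if "B \<subseteq> {x<..z}" for B
    proof (rule nn_integral_cong_AE)
      show "AE t in lborel. ennreal (norm (g t)) * indicator B t = ennreal (h t) * indicator B t"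
        using h(2) by eventually_elim (use that in \<open>auto split: split_indicator split_indicator_asm\<close>)
    qed
    have "N x z = nnint {x<..z} h" unfolding N_def by (rule *) simp
    also have "\<dots> = (\<integral>\<^sup>+t. ennreal (h t) * indicator {x<..y} t + ennreal (h t) * indicator {y<..z} t \<partial>lborel)"
      using that by (intro nn_integral_cong) (auto split: split_indicator)
    also have "\<dots> = nnint {x<..y} h + nnint {y<..z} h"
      using h(1) by (intro nn_integral_add) auto
    also have "\<dots> = N x y + N y z" unfolding N_def using that by (subst (1 2) *) auto
    finally show ?thesis .
  qed
  have NE: "N x y = ennreal (E y - E x)" and Emono: "E x \<le> E y" if "a \<le> x" "x \<le> y" for x y
  proof -
    have s: "N a y = N a x + N x y" using Nsplit[of a x y] ab that by auto
    have f: "N a x < top" "N x y < top" using Nfin[of a x] Nfin[of x y] ab that by auto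
    have "enn2real (N a y) = enn2real (N a x) + enn2real (N x y)"
      unfolding s using f by (simp add: enn2real_plus)
    then have "E y - E x = enn2real (N x y)" by (simp add: E_def)
    then show "N x y = ennreal (E y - E x)" "E x \<le> E y"
      using f(2) enn2real_nonneg[of "N x y"] by (simp, linarith)
  qed
  have "R a b = 0"
  proof (rule additive_small_imp_zero[where a=a and b=b and E="\<lambda>t. 2 * K * E t"])
    fix x y z assume xyz: "a \<le> x" "x \<le> y" "y \<le> z" "z \<le> b"
    have "{x<..y} \<union> {y<..z} = {x<..z}" "{x<..y} \<inter> {y<..z} = {}" using xyz by auto
    then have "has_set_integral {x<..z} ?G (J x y + J y z)"
      using has_set_integral_Un[OF J[of x y] J[of y z]] xyz ab by simp
    then have "J x z = J x y + J y z"
      using J[of x z] xyz ab by (intro has_strong_integral_unique) auto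
    then show "R x z = R x y + R y z" by (simp add: R_def)
  next
    fix x y assume xy: "a \<le> x" "x \<le> y" "y \<le> b"
    have x0: "0 < x" using xy ab by simp
    have vint: "has_set_integral {x<..y} g (v y - v x)"
      using v x0 xy unfolding indef_integral_def by blast
    have "has_bochner_integral lborel (\<lambda>t. indicat_real {x..y} t *\<^sub>R m' t) (m y - m x)"
    proof (rule has_bochner_integral_FTC_Icc[OF xy(2)])
      show "(m has_vector_derivative m' t) (at t within {x..y})" if "x \<le> t" "t \<le> y" for t
        using m[of t] that x0 by (auto intro: has_vector_derivative_at_within)
      show "continuous_on {x..y} m'" by (rule continuous_on_subset[OF m']) (use x0 in auto)
    qed
    then have "has_set_integral {x..y} m' (m y - m x)" by (rule has_set_integral_bochner)
    then have mint: "has_set_integral {x<..y} m' (m y - m x)"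
    proof (rule has_strong_integral_cong_AE)
      show "AE t in lborel. indicat_real {x..y} t *\<^sub>R m' t = indicat_real {x<..y} t *\<^sub>R m' t"
        using AE_lborel_singleton[of x] by eventually_elim (auto split: split_indicator)
    qed
    have Rint: "has_set_integral {x<..y} (\<lambda>t. m y *\<^sub>C g t + m' t *\<^sub>C v x - ?G t)
        (m y *\<^sub>C (v y - v x) + (m y - m x) *\<^sub>C v x - J x y)"
      by (intro has_set_integral_diff has_set_integral_add has_set_integral_linear[OF _ vint]
          has_set_integral_linear[OF scaleC.bounded_linear_left mint] J x0 xy scaleC.bounded_linear_right)
    have Req: "m y *\<^sub>C (v y - v x) + (m y - m x) *\<^sub>C v x - J x y = R x y"
      by (simp add: R_def scaleC.diff_left scaleC.diff_right)
    have "ennreal (norm (R x y))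
       \<le> nnint {x<..y} (\<lambda>t. norm (m y *\<^sub>C g t + m' t *\<^sub>C v x - ?G t))"
      by (rule has_set_integral_norm_le[OF Rint[unfolded Req]])
    also have "\<dots> \<le> (\<integral>\<^sup>+t. ennreal (K * (y - x)) * (ennreal (norm (g t)) * indicator {x<..y} t)
        + ennreal (K * (E y - E x)) * indicator {x<..y} t \<partial>lborel)"
    proof (rule nn_integral_mono)
      fix t :: real
      show "ennreal (norm (m y *\<^sub>C g t + m' t *\<^sub>C v x - ?G t)) * indicator {x<..y} t
        \<le> ennreal (K * (y - x)) * (ennreal (norm (g t)) * indicator {x<..y} t)
        + ennreal (K * (E y - E x)) * indicator {x<..y} t"
      proof (cases "t \<in> {x<..y}")
        case True
        have "m y *\<^sub>C g t + m' t *\<^sub>C v x - ?G t = (m y - m t) *\<^sub>C g t + m' t *\<^sub>C (v x - v t)"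
          by (simp add: scaleC.diff_left scaleC.diff_right)
        then have "norm (m y *\<^sub>C g t + m' t *\<^sub>C v x - ?G t)
          \<le> norm (m y - m t) * norm (g t) + norm (m' t) * norm (v x - v t)"
          by (metis norm_triangle_ineq norm_scaleC)
        also have "norm (m y - m t) \<le> K * (y - x)"
        proof -
          have "norm (m y - m t) \<le> K * norm (y - t)"
          proof (rule differentiable_bound[where S="{t..y}" and f'="\<lambda>r h. h *\<^sub>R m' r"])
            show "(m has_derivative (\<lambda>h. h *\<^sub>R m' r)) (at r within {t..y})" if "r \<in> {t..y}" for r
              using m[of r] that x0 True
              by (auto intro: has_vector_derivative_at_within simp flip: has_vector_derivative_def)
            show "onorm (\<lambda>h. h *\<^sub>R m' r) \<le> K" if "r \<in> {t..y}" for r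
              using K[of r] K0 that True xy
              by (intro onorm_bound) (auto simp: mult.commute[of "\<bar>_\<bar>"] intro!: mult_right_mono)
          qed (use True in auto)
          also have "\<dots> \<le> K * (y - x)" using True K0 by (intro mult_left_mono) auto
          finally show ?thesis .
        qed
        also have "norm (m' t) * norm (v x - v t) \<le> K * (E y - E x)"
        proof (intro mult_mono)
          show "norm (m' t) \<le> K" using K[of t] True xy by auto
          have "ennreal (norm (v t - v x)) \<le> N x t"
            using indef_integral_norm_le[OF v x0, of t] True unfolding N_def by auto
          also have "\<dots> = ennreal (E t - E x)" using NE[of x t] xy True by auto
          finally have "norm (v t - v x) \<le> E t - E x"
            using Emono[of x t] xy True by (subst (asm) ennreal_le_iff) auto
          then show "norm (v x - v t) \<le> E y - E x"
            using Emono[of t y] xy True by (simp add: norm_minus_commute)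
        qed (use K0 in auto)
        finally have *: "norm (m y *\<^sub>C g t + m' t *\<^sub>C v x - ?G t) \<le> K * (y - x) * norm (g t) + K * (E y - E x)"
          by (simp add: mult_right_mono)
        show ?thesis using True K0 xy Emono[of x y]
          by (simp flip: ennreal_mult ennreal_plus add: ennreal_leI *)
      qed simp
    qed
    also have "\<dots> = ennreal (K * (y - x)) * N x y + ennreal (K * (E y - E x)) * ennreal (y - x)"
    proof -
      obtain h where h: "h \<in> borel_measurable lborel" "AE t in lborel. norm (indicat_real {x<..y} t *\<^sub>R g t) = h t"
        using set_integrable_on_norm[OF g_int[of x y]] x0 xy by auto
      have AEh: "AE t in lborel. ennreal (norm (g t)) * indicator {x<..y} t = ennreal (h t)"
        using h(2) by eventually_elim (auto split: split_indicator split_indicator_asm)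
      have "(\<integral>\<^sup>+t. ennreal (K * (y - x)) * (ennreal (norm (g t)) * indicator {x<..y} t)
        + ennreal (K * (E y - E x)) * indicator {x<..y} t \<partial>lborel)
        = (\<integral>\<^sup>+t. ennreal (K * (y - x)) * ennreal (h t) + ennreal (K * (E y - E x)) * indicator {x<..y} t \<partial>lborel)"
      proof (rule nn_integral_cong_AE)
        show "AE t in lborel. ennreal (K * (y - x)) * (ennreal (norm (g t)) * indicator {x<..y} t)
          + ennreal (K * (E y - E x)) * indicator {x<..y} t
          = ennreal (K * (y - x)) * ennreal (h t) + ennreal (K * (E y - E x)) * indicator {x<..y} t"
          using AEh by eventually_elim simp
      qed
      also have "\<dots> = ennreal (K * (y - x)) * (\<integral>\<^sup>+t. ennreal (h t) \<partial>lborel)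
          + ennreal (K * (E y - E x)) * emeasure lborel {x<..y}"
        using h(1) by (subst nn_integral_add) (auto simp: nn_integral_cmult)
      also have "(\<integral>\<^sup>+t. ennreal (h t) \<partial>lborel) = N x y"
        unfolding N_def by (rule nn_integral_cong_AE) (use AEh in \<open>auto elim: eventually_mono\<close>)
      finally show ?thesis using xy by simp
    qed
    also have "\<dots> = ennreal ((y - x) * (2 * K * E y - 2 * K * E x))"
    proof -
      have e: "0 \<le> E y - E x" "0 \<le> y - x" using Emono[of x y] xy by auto
      have "ennreal (K * (y - x)) * N x y + ennreal (K * (E y - E x)) * ennreal (y - x)
         = ennreal (K * (y - x) * (E y - E x) + K * (E y - E x) * (y - x))"
        unfolding NE[OF xy(1,2)] using e K0 by (simp flip: ennreal_mult ennreal_plus)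
      then show ?thesis by (simp add: algebra_simps)
    qed
    finally have "norm (R x y) \<le> (y - x) * (2 * K * E y - 2 * K * E x)"
      using xy K0 Emono[of x y] by (subst (asm) ennreal_le_iff) (auto intro!: mult_nonneg_nonneg mult_left_mono)
    then show "norm (R x y) \<le> (y - x) * (2 * K * E y - 2 * K * E x)" .
  qed (use ab in auto)
  then have "J a b = m b *\<^sub>C v b - m a *\<^sub>C v a" by (simp add: R_def)
  then show "has_set_integral {a<..b} ?G (m b *\<^sub>C v b - m a *\<^sub>C v a)" using J[OF ab] by simp
qed

section \<open>The measures on the half-line\<close>

lemma sigma_finite_halfline: "sigma_finite_measure halfline"
  by (rule sigma_finite_measure_restrict_space[OF sigma_finite_lborel]) simp

lemma AE_halfline: "(AE x in halfline. P x) \<longleftrightarrow> (AE x in lborel. 0 < x \<longrightarrow> P x)"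
  by (subst AE_restrict_space_iff) auto

lemma indicator_scaleR_if:
  fixes f :: "'b \<Rightarrow> 'a::real_vector"
  shows "(\<lambda>t. indicat_real A t *\<^sub>R f t) = (\<lambda>t. if t \<in> A then f t else 0)"
  by (auto simp: fun_eq_iff)

lemma strongly_measurable_halfline:
  fixes f :: "real \<Rightarrow> 'a::real_normed_vector"
  shows "strongly_measurable halfline f \<longleftrightarrow> strongly_measurable lborel (\<lambda>t. indicat_real {0<..} t *\<^sub>R f t)"
proof
  assume "strongly_measurable halfline f"
  then obtain s where s: "\<And>i. Bochner_Integration.simple_bochner_integrable halfline (s i)"
      "AE x in halfline. (\<lambda>i::nat. s i x) \<longlonglongrightarrow> f x"
    unfolding strongly_measurable_def by blast
  have "Bochner_Integration.simple_bochner_integrable lborel (\<lambda>t. indicat_real {0<..} t *\<^sub>R s i t)" for i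
    using s(1)[of i] by (subst (asm) simple_bochner_integrable_restrict_space) auto
  moreover have "AE x in lborel. (\<lambda>i. indicat_real {0<..} x *\<^sub>R s i x) \<longlonglongrightarrow> indicat_real {0<..} x *\<^sub>R f x"
    using s(2) unfolding AE_halfline by eventually_elim (auto split: split_indicator)
  ultimately show "strongly_measurable lborel (\<lambda>t. indicat_real {0<..} t *\<^sub>R f t)"
    unfolding strongly_measurable_def by (intro exI[of _ "\<lambda>i t. indicat_real {0<..} t *\<^sub>R s i t"]) auto
next
  assume "strongly_measurable lborel (\<lambda>t. indicat_real {0<..} t *\<^sub>R f t)"
  then obtain s where s: "\<And>i. Bochner_Integration.simple_bochner_integrable lborel (s i)"
      "AE x in lborel. (\<lambda>i::nat. s i x) \<longlonglongrightarrow> indicat_real {0<..} x *\<^sub>R f x"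
    unfolding strongly_measurable_def by blast
  show "strongly_measurable halfline f"
  proof (rule strongly_measurableI_sigma_finite[OF sigma_finite_halfline])
    show "simple_function halfline (s i)" for i
    proof -
      have "simple_function lborel (\<lambda>t. indicat_real {0<..} t *\<^sub>R s i t)"
        unfolding indicator_scaleR_if
        by (rule simple_function_If_set[OF simple_function_simple_bochner_integrable[OF s(1)]]) auto
      then show ?thesis by (subst simple_function_restrict_space) auto
    qed
    show "AE x in halfline. (\<lambda>i. s i x) \<longlonglongrightarrow> f x"
      unfolding AE_halfline using s(2) by eventually_elim auto
  qed
qed

lemma has_strong_integral_halfline:
  fixes f :: "real \<Rightarrow> 'a::banach"
  shows "has_strong_integral halfline f I \<longleftrightarrow> has_set_integral {0<..} f I"
proof -
  have nn: "nn_norm halfline F = nn_norm lborel (\<lambda>x. indicat_real {0<..} x *\<^sub>R F x)"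
    for F :: "real \<Rightarrow> 'a"
    unfolding norm_indicator_scaleR by (subst nn_integral_restrict_space) auto
  have *: "has_set_integral {0<..} f I" if f: "has_strong_integral halfline f I" for I
  proof -
    obtain s where s: "\<And>i::nat. Bochner_Integration.simple_bochner_integrable halfline (s i)"
      and l: "(\<lambda>i. nn_norm halfline (\<lambda>x. f x - s i x)) \<longlonglongrightarrow> 0"
      and I: "(\<lambda>i. Bochner_Integration.simple_bochner_integral halfline (s i)) \<longlonglongrightarrow> I"
      and f: "strongly_measurable halfline f"
      using f unfolding has_strong_integral_def by blast
    let ?s = "\<lambda>i t. indicat_real {0<..} t *\<^sub>R s i t"
    have "Bochner_Integration.simple_bochner_integrable lborel (?s i)" for i
      using s[of i] by (subst (asm) simple_bochner_integrable_restrict_space) auto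
    moreover have "(\<lambda>i. nn_norm lborel (\<lambda>x. indicat_real {0<..} x *\<^sub>R f x - ?s i x)) \<longlonglongrightarrow> 0"
      using l unfolding nn by (simp add: scaleR_diff_right)
    moreover have "(\<lambda>i. Bochner_Integration.simple_bochner_integral lborel (?s i)) \<longlonglongrightarrow> I"
      using I s by (subst (asm) simple_bochner_integral_restrict_space) auto
    ultimately show ?thesis
      unfolding has_strong_integral_def using f[unfolded strongly_measurable_halfline]
      by (intro conjI exI[of _ ?s]) auto
  qed
  show ?thesis
  proof
    assume I: "has_set_integral {0<..} f I"
    have "strongly_measurable halfline f" "nn_norm halfline f < \<infinity>"
      using has_strong_integral_imp(1,2)[OF I] unfolding strongly_measurable_halfline nn by auto
    then obtain J where J: "has_strong_integral halfline f J" using has_strong_integral_exists by blast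
    have "J = I" by (rule has_strong_integral_unique[OF *[OF J] I])
    then show "has_strong_integral halfline f I" using J by simp
  qed (rule *)
qed

lemma weight_measurable [measurable]: "(\<lambda>x. ennreal (\<bar>x\<bar> powr \<gamma>)) \<in> borel_measurable halfline"
  by (rule measurable_restrict_space1) measurable

lemma AE_weighted: "(AE x in weighted \<gamma>. P x) \<longleftrightarrow> (AE x in lborel. 0 < x \<longrightarrow> P x)"
  unfolding weighted_def AE_density[OF weight_measurable] AE_halfline
  by (intro AE_cong) auto

text \<open>
  The weight is positive, so both measures have the same null sets; only the finiteness of the
  supports of the approximants has to be adjusted.
\<close>

lemma strongly_measurable_weighted:
  "strongly_measurable (weighted \<gamma>) f \<longleftrightarrow> strongly_measurable lborel (\<lambda>t. indicat_real {0<..} t *\<^sub>R f t)"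
proof -
  have sf: "simple_function (weighted \<gamma>) s \<longleftrightarrow> simple_function halfline s" for s :: "real \<Rightarrow> 'a"
    by (simp add: simple_function_def weighted_def)
  have sig: "sigma_finite_measure (weighted \<gamma>)"
  proof -
    interpret sigma_finite_measure halfline by (rule sigma_finite_halfline)
    show ?thesis unfolding weighted_def by (subst sigma_finite_iff_density_finite) (rule weight_measurable, auto)
  qed
  have "strongly_measurable (weighted \<gamma>) f \<longleftrightarrow> strongly_measurable halfline f"
  proof
    assume "strongly_measurable (weighted \<gamma>) f"
    then obtain s where "\<And>i. Bochner_Integration.simple_bochner_integrable (weighted \<gamma>) (s i)"
        "AE x in weighted \<gamma>. (\<lambda>i::nat. s i x) \<longlonglongrightarrow> f x"
      unfolding strongly_measurable_def by blast
    then show "strongly_measurable halfline f"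
      by (intro strongly_measurableI_sigma_finite[OF sigma_finite_halfline, of s])
         (auto simp: AE_weighted AE_halfline sf[symmetric] simple_function_simple_bochner_integrable)
  next
    assume "strongly_measurable halfline f"
    then obtain s where "\<And>i. Bochner_Integration.simple_bochner_integrable halfline (s i)"
        "AE x in halfline. (\<lambda>i::nat. s i x) \<longlonglongrightarrow> f x"
      unfolding strongly_measurable_def by blast
    then show "strongly_measurable (weighted \<gamma>) f"
      by (intro strongly_measurableI_sigma_finite[OF sig, of s])
         (auto simp: AE_weighted AE_halfline sf simple_function_simple_bochner_integrable)
  qed
  then show ?thesis by (simp add: strongly_measurable_halfline)
qed

definition weighted_power :: "real \<Rightarrow> real \<Rightarrow> (real \<Rightarrow> 'a::real_normed_vector) \<Rightarrow> ennreal" where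
  "weighted_power p \<gamma> f = nnint {0<..} (\<lambda>t. norm (f t) powr p * t powr \<gamma>)"

lemma nn_integral_weighted:
  fixes f :: "real \<Rightarrow> 'a::real_normed_vector"
  assumes f: "strongly_measurable lborel (\<lambda>t. indicat_real {0<..} t *\<^sub>R f t)"
  shows "(\<integral>\<^sup>+x. ennreal (norm (f x) powr p) \<partial>weighted \<gamma>) = weighted_power p \<gamma> f"
proof -
  obtain h :: "real \<Rightarrow> real" where h[measurable]: "h \<in> borel_measurable borel"
    and hf: "AE t in lborel. norm (indicat_real {0<..} t *\<^sub>R f t) = h t"
    using strongly_measurable_norm[OF f] by auto
  have hr[measurable]: "h \<in> borel_measurable halfline"
    by (rule measurable_restrict_space1) measurable
  have "(\<integral>\<^sup>+x. ennreal (norm (f x) powr p) \<partial>weighted \<gamma>) = (\<integral>\<^sup>+x. ennreal (h x powr p) \<partial>weighted \<gamma>)"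
  proof (rule nn_integral_cong_AE)
    show "AE x in weighted \<gamma>. ennreal (norm (f x) powr p) = ennreal (h x powr p)"
      unfolding AE_weighted using hf by eventually_elim auto
  qed
  also have "\<dots> = (\<integral>\<^sup>+x. ennreal (\<bar>x\<bar> powr \<gamma>) * ennreal (h x powr p) \<partial>halfline)"
    unfolding weighted_def by (rule nn_integral_density) measurable
  also have "\<dots> = (\<integral>\<^sup>+x\<in>{0<..}. (ennreal (\<bar>x\<bar> powr \<gamma>) * ennreal (h x powr p)) \<partial>lborel)"
    by (subst nn_integral_restrict_space) auto
  also have "\<dots> = weighted_power p \<gamma> f"
    unfolding weighted_power_def
  proof (rule nn_integral_cong_AE)
    show "AE x in lborel. ennreal (\<bar>x\<bar> powr \<gamma>) * ennreal (h x powr p) * indicator {0<..} x =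
        ennreal (norm (f x) powr p * x powr \<gamma>) * indicator {0<..} x"
      using hf by eventually_elim (auto split: split_indicator simp: mult.commute simp flip: ennreal_mult)
  qed
  finally show ?thesis .
qed

lemma Lp_weighted_iff:
  "f \<in> Lp (weighted \<gamma>) p \<longleftrightarrow>
    strongly_measurable lborel (\<lambda>t. indicat_real {0<..} t *\<^sub>R f t) \<and> weighted_power p \<gamma> f < \<infinity>"
  unfolding Lp_def mem_Collect_eq strongly_measurable_weighted using nn_integral_weighted[where f=f and p=p and \<gamma>=\<gamma>] by auto

lemma Lp_norm_weighted:
  assumes "f \<in> Lp (weighted \<gamma>) p"
  shows "Lp_norm (weighted \<gamma>) p f = enn2real (weighted_power p \<gamma> f) powr (1 / p)"
  using assms nn_integral_weighted[where f=f and p=p and \<gamma>=\<gamma>] unfolding Lp_weighted_iff Lp_norm_def by simp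

lemma weighted_power_cong_AE:
  assumes "AE t in lborel. 0 < t \<longrightarrow> f t = g t"
  shows "weighted_power p \<gamma> f = weighted_power p \<gamma> g"
  unfolding weighted_power_def
proof (rule nn_integral_cong_AE)
  show "AE t in lborel. ennreal (norm (f t) powr p * t powr \<gamma>) * indicator {0<..} t
      = ennreal (norm (g t) powr p * t powr \<gamma>) * indicator {0<..} t"
    using assms by eventually_elim (auto split: split_indicator)
qed

lemma Lp_weighted_cong_AE:
  assumes "f \<in> Lp (weighted \<gamma>) p" "AE t in lborel. 0 < t \<longrightarrow> f t = g t"
  shows "g \<in> Lp (weighted \<gamma>) p"
proof -
  have "strongly_measurable lborel (\<lambda>t. indicat_real {0<..} t *\<^sub>R g t)"
  proof (rule strongly_measurable_cong_AE)
    show "strongly_measurable lborel (\<lambda>t. indicat_real {0<..} t *\<^sub>R f t)"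
      using assms(1) by (simp add: Lp_weighted_iff)
    show "AE t in lborel. indicat_real {0<..} t *\<^sub>R f t = indicat_real {0<..} t *\<^sub>R g t"
      using assms(2) by eventually_elim (auto split: split_indicator)
  qed
  then show ?thesis using assms(1) weighted_power_cong_AE[OF assms(2), of p \<gamma>] by (simp add: Lp_weighted_iff)
qed

text \<open>
  On a compact interval away from the origin the weight is bounded below, and \<open>h \<le> 1 + h powr p\<close>.
\<close>

lemma Lp_weighted_loc_integrable:
  fixes f :: "real \<Rightarrow> 'a::banach"
  assumes p: "1 \<le> p" and f: "f \<in> Lp (weighted \<gamma>) p"
  shows "loc_integrable f"
  unfolding loc_integrable_def
proof (intro allI impI)
  fix x y :: real assume xy: "0 < x" "x \<le> y"
  have fm: "strongly_measurable lborel (\<lambda>t. indicat_real {0<..} t *\<^sub>R f t)" and fin: "weighted_power p \<gamma> f < \<infinity>"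
    using f by (auto simp: Lp_weighted_iff)
  obtain h :: "real \<Rightarrow> real" where h[measurable]: "h \<in> borel_measurable borel"
    and hf: "AE t in lborel. norm (indicat_real {0<..} t *\<^sub>R f t) = h t"
    using strongly_measurable_norm[OF fm] by auto
  have sub: "{x<..y} \<subseteq> {0<..}" using xy by auto
  define \<kappa> where "\<kappa> = min (x powr \<gamma>) (y powr \<gamma>)"
  have \<kappa>: "0 < \<kappa>" using xy by (simp add: \<kappa>_def)
  have \<kappa>_le: "\<kappa> \<le> t powr \<gamma>" if "x \<le> t" "t \<le> y" for t
  proof (cases "0 \<le> \<gamma>")
    case True
    then have "x powr \<gamma> \<le> t powr \<gamma>" using that xy by (intro powr_mono2) auto
    then show ?thesis by (simp add: \<kappa>_def min.coboundedI1)
  next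
    case False
    then have "y powr \<gamma> \<le> t powr \<gamma>" using that xy by (intro powr_mono2') auto
    then show ?thesis by (simp add: \<kappa>_def min.coboundedI2)
  qed
  have "nnint {x<..y} (\<lambda>t. norm (f t))
    \<le> (\<integral>\<^sup>+t. indicator {x<..y} t + ennreal (1/\<kappa>) * (ennreal (h t powr p * t powr \<gamma>) * indicator {0<..} t) \<partial>lborel)"
  proof (rule nn_integral_mono_AE)
    show "AE t in lborel. ennreal (norm (f t)) * indicator {x<..y} t
      \<le> indicator {x<..y} t + ennreal (1/\<kappa>) * (ennreal (h t powr p * t powr \<gamma>) * indicator {0<..} t)"
      using hf
    proof eventually_elim
      fix t assume ht: "norm (indicat_real {0<..} t *\<^sub>R f t) = h t"
      show "ennreal (norm (f t)) * indicator {x<..y} t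
        \<le> indicator {x<..y} t + ennreal (1/\<kappa>) * (ennreal (h t powr p * t powr \<gamma>) * indicator {0<..} t)"
      proof (cases "t \<in> {x<..y}")
        case True
        then have ht': "norm (f t) = h t" and h0: "0 \<le> h t" using ht xy by (auto simp flip: ht)
        have "h t \<le> 1 + h t powr p"
        proof (cases "h t \<le> 1")
          case False
          then have "h t powr 1 \<le> h t powr p" using p by (intro powr_mono) auto
          then show ?thesis using False by simp
        qed (use powr_ge_zero[of "h t" p] in linarith)
        also have "h t powr p \<le> 1 / \<kappa> * (h t powr p * t powr \<gamma>)"
          using \<kappa> mult_left_mono[OF \<kappa>_le[of t] powr_ge_zero[of "h t" p]] True
          by (simp add: field_simps)
        finally have "ennreal (h t) \<le> ennreal (1 + 1 / \<kappa> * (h t powr p * t powr \<gamma>))"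
          by (intro ennreal_leI) simp
        also have "\<dots> = 1 + ennreal (1/\<kappa>) * ennreal (h t powr p * t powr \<gamma>)"
          using \<kappa> by (subst ennreal_plus) (auto simp: ennreal_mult'[symmetric])
        finally show ?thesis using True xy ht' by simp
      qed simp
    qed
  qed
  also have "\<dots> = emeasure lborel {x<..y} + ennreal (1/\<kappa>) * nnint {0<..} (\<lambda>t. h t powr p * t powr \<gamma>)"
    by (subst nn_integral_add) (auto simp: nn_integral_cmult)
  also have "nnint {0<..} (\<lambda>t. h t powr p * t powr \<gamma>) = weighted_power p \<gamma> f"
    unfolding weighted_power_def
  proof (rule nn_integral_cong_AE)
    show "AE t in lborel. ennreal (h t powr p * t powr \<gamma>) * indicator {0<..} t
      = ennreal (norm (f t) powr p * t powr \<gamma>) * indicator {0<..} t"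
      using hf by eventually_elim (auto split: split_indicator split_indicator_asm)
  qed
  also have "emeasure lborel {x<..y} + ennreal (1/\<kappa>) * weighted_power p \<gamma> f < \<infinity>"
    using fin xy by (auto simp: ennreal_mult_less_top)
  finally show "set_integrable_on {x<..y} f"
    unfolding set_integrable_on_iff
    using strongly_measurable_indicator_subset[OF fm, of "{x<..y}"] sub by auto
qed

section \<open>Test functions\<close>

lemma test_fun_derivative: "test_fun \<phi> \<Longrightarrow> (\<phi> has_real_derivative deriv \<phi> x) (at x)"
  unfolding test_fun_def DERIV_deriv_iff_field_differentiable by (metis funpow_0)

lemma test_fun_support:
  assumes "test_fun \<phi>"
  obtains a b where "0 < a" "a < b" "\<And>x. x \<notin> {a..b} \<Longrightarrow> \<phi> x = 0"
proof -
  obtain a b where ab: "0 < a" "\<And>x. x \<notin> {a..b} \<Longrightarrow> \<phi> x = 0"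
    using assms unfolding test_fun_def by blast
  have "\<phi> x = 0" if "x \<notin> {a..max b (a + 1)}" for x
    by (rule ab(2)) (use that in \<open>auto simp: max_def split: if_splits\<close>)
  then show thesis using ab(1) by (intro that[of a "max b (a + 1)"]) auto
qed

lemma deriv_zero_outside:
  assumes "\<And>x. x \<notin> {a..b} \<Longrightarrow> \<phi> x = (0::real)" "x \<notin> {a..b}"
  shows "deriv \<phi> x = 0"
proof -
  have "(\<phi> has_real_derivative 0) (at x)"
    by (rule has_field_derivative_transform_within_open[of "\<lambda>x. 0" _ _ "- {a..b}"])
       (use assms in auto)
  then show ?thesis by (rule DERIV_imp_deriv)
qed

lemma test_fun_deriv:
  assumes "test_fun \<phi>"
  shows "test_fun (deriv \<phi>)"
proof -
  obtain a b where "0 < a" "\<And>x. x \<notin> {a..b} \<Longrightarrow> \<phi> x = 0"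
    using test_fun_support[OF assms] by metis
  then have "\<exists>a b. 0 < a \<and> (\<forall>x. x \<notin> {a..b} \<longrightarrow> deriv \<phi> x = 0)"
    using deriv_zero_outside by blast
  moreover have "(deriv ^^ n) (deriv \<phi>) field_differentiable at x" for n x
    using assms unfolding test_fun_def by (metis funpow_Suc_right comp_apply)
  ultimately show ?thesis unfolding test_fun_def by blast
qed

lemma test_fun_continuous: "test_fun \<phi> \<Longrightarrow> continuous_on S \<phi>"
  by (intro continuous_at_imp_continuous_on ballI DERIV_isCont[OF test_fun_derivative])

lemma test_fun_diff_scaled:
  assumes "test_fun \<phi>" "test_fun \<psi>"
  shows "test_fun (\<lambda>x. \<phi> x - c * \<psi> x)"
proof -
  have fd: "(deriv ^^ n) \<phi> field_differentiable at x" "(deriv ^^ n) \<psi> field_differentiable at x" for n x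
    using assms unfolding test_fun_def by auto
  have eq: "(deriv ^^ n) (\<lambda>x. \<phi> x - c * \<psi> x) = (\<lambda>x. (deriv ^^ n) \<phi> x - c * (deriv ^^ n) \<psi> x)" for n
  proof (induction n)
    case (Suc n)
    have "deriv (\<lambda>x. (deriv ^^ n) \<phi> x - c * (deriv ^^ n) \<psi> x) x
        = deriv ((deriv ^^ n) \<phi>) x - c * deriv ((deriv ^^ n) \<psi>) x" for x
      using fd[of n x] by (intro DERIV_imp_deriv DERIV_diff DERIV_cmult)
        (auto simp: DERIV_deriv_iff_field_differentiable)
    then show ?case using Suc by simp
  qed simp
  have "(deriv ^^ n) (\<lambda>x. \<phi> x - c * \<psi> x) field_differentiable at x" for n x
    unfolding eq by (intro field_differentiable_diff field_differentiable_mult fd field_differentiable_const)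
  moreover have "\<exists>a b. 0 < a \<and> (\<forall>x. x \<notin> {a..b} \<longrightarrow> \<phi> x - c * \<psi> x = 0)"
  proof -
    obtain a b where 1: "0 < a" "\<And>x. x \<notin> {a..b} \<Longrightarrow> \<phi> x = 0" using test_fun_support[OF assms(1)] by metis
    obtain a' b' where 2: "0 < a'" "\<And>x. x \<notin> {a'..b'} \<Longrightarrow> \<psi> x = 0" using test_fun_support[OF assms(2)] by metis
    have "\<phi> x - c * \<psi> x = 0" if "x \<notin> {min a a'..max b b'}" for x
    proof -
      have "\<phi> x = 0" by (rule 1) (use that in auto)
      moreover have "\<psi> x = 0" by (rule 2) (use that in auto)
      ultimately show ?thesis by simp
    qed
    then show ?thesis using 1(1) 2(1) by (intro exI[of _ "min a a'"] exI[of _ "max b b'"]) auto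
  qed
  ultimately show ?thesis unfolding test_fun_def by blast
qed

lemma test_fun_primitive:
  assumes \<rho>: "test_fun \<rho>" and D: "\<And>x. (\<psi> has_real_derivative \<rho> x) (at x)"
    and supp: "0 < a" "\<And>x. x \<notin> {a..b} \<Longrightarrow> \<psi> x = 0"
  shows "test_fun \<psi>" "deriv \<psi> = \<rho>"
proof -
  show d: "deriv \<psi> = \<rho>" using D by (auto intro!: DERIV_imp_deriv ext)
  have "(deriv ^^ n) \<psi> field_differentiable at x" for n x
  proof (cases n)
    case 0
    then show ?thesis using D[of x] by (auto simp: field_differentiable_def)
  next
    case (Suc m)
    then have "(deriv ^^ n) \<psi> = (deriv ^^ m) \<rho>" by (simp only: Suc funpow_Suc_right comp_apply d)
    then show ?thesis using \<rho> unfolding test_fun_def by simp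
  qed
  then show "test_fun \<psi>" unfolding test_fun_def using supp by blast
qed

lemma DERIV_zero_quadratic:
  fixes F :: "real \<Rightarrow> real"
  assumes "\<And>y. \<bar>F y - F x\<bar> \<le> C * (y - x)\<^sup>2"
  shows "(F has_real_derivative 0) (at x)"
  unfolding has_field_derivative_iff
proof (rule Lim_null_comparison[where g="\<lambda>y. \<bar>C\<bar> * \<bar>y - x\<bar>"])
  show "\<forall>\<^sub>F y in at x. norm ((F y - F x) / (y - x)) \<le> \<bar>C\<bar> * \<bar>y - x\<bar>"
  proof (intro eventually_at_filter[THEN iffD2] always_eventually allI impI)
    fix y assume "y \<noteq> x"
    have "\<bar>F y - F x\<bar> \<le> \<bar>C\<bar> * (y - x)\<^sup>2"
      using assms[of y] mult_right_mono[OF abs_ge_self[of C] zero_le_power2[of "y - x"]] by linarith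
    also have "\<dots> = \<bar>C\<bar> * \<bar>y - x\<bar> * \<bar>y - x\<bar>" by (simp add: power2_eq_square)
    finally show "norm ((F y - F x) / (y - x)) \<le> \<bar>C\<bar> * \<bar>y - x\<bar>"
      using \<open>y \<noteq> x\<close> by (simp add: abs_divide divide_le_eq)
  qed
  have "((\<lambda>y. \<bar>C\<bar> * \<bar>y - x\<bar>) \<longlongrightarrow> \<bar>C\<bar> * \<bar>x - x\<bar>) (at x)"
    by (intro tendsto_intros)
  then show "((\<lambda>y. \<bar>C\<bar> * \<bar>y - x\<bar>) \<longlongrightarrow> 0) (at x)" by simp
qed

lemma power_le_exp:
  fixes z :: real
  assumes "0 \<le> z" "0 < N"
  shows "z ^ N \<le> real N ^ N * exp z"
proof -
  have "z / N \<le> exp (z / N)" using exp_ge_add_one_self[of "z / N"] by linarith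
  then have "(z / N) ^ N \<le> exp (z / N) ^ N" using assms by (intro power_mono) auto
  also have "exp (z / N) ^ N = exp z" using assms by (simp flip: exp_of_nat_mult)
  finally show ?thesis using assms by (simp add: power_divide field_simps)
qed

text \<open>
  The derivatives of \<open>exp (- c / q x)\<close>, with \<open>q x = (x - a) * (b - x)\<close>, extended by zero outside
  the interval between the zeros of \<open>q\<close>, stay in the following family, whose members vanish to
  second order at the end points.
\<close>

definition bump_family :: "real \<Rightarrow> real \<Rightarrow> real \<Rightarrow> real poly \<Rightarrow> nat \<Rightarrow> real \<Rightarrow> real" where
  "bump_family a b c P m x =
    (if a < x \<and> x < b then poly P x / ((x - a) * (b - x)) ^ m * exp (- c / ((x - a) * (b - x))) else 0)"

lemma bump_family_quadratic:
  assumes c: "0 < c" and x: "\<not> (a < x \<and> x < b)"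
  shows "\<exists>C. \<forall>y. \<bar>bump_family a b c P m y\<bar> \<le> C * (y - x)\<^sup>2"
proof -
  have "compact (poly P ` {a..b})" by (intro compact_continuous_image continuous_intros) auto
  then obtain K where K: "\<And>y. y \<in> {a..b} \<Longrightarrow> \<bar>poly P y\<bar> \<le> K"
    by (metis bounded_iff compact_imp_bounded imageI real_norm_def)
  define N where "N = m + 2"
  define C where "C = \<bar>K\<bar> * (real N ^ N / c ^ N) * (b - a)\<^sup>2"
  have "\<bar>bump_family a b c P m y\<bar> \<le> C * (y - x)\<^sup>2" for y
  proof (cases "a < y \<and> y < b")
    case False
    then show ?thesis using c by (auto simp: bump_family_def C_def)
  next
    case True
    define q where "q = (y - a) * (b - y)"
    have q: "0 < q" using True by (simp add: q_def)
    have "(c / q) ^ N \<le> real N ^ N * exp (c / q)"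
      using c q by (intro power_le_exp) (auto simp: N_def)
    then have "exp (- (c / q)) \<le> real N ^ N / c ^ N * q ^ N"
      using c q by (simp add: exp_minus power_divide field_simps)
    then have e: "exp (- c / q) / q ^ m \<le> real N ^ N / c ^ N * q\<^sup>2"
    proof -
      assume e: "exp (- (c / q)) \<le> real N ^ N / c ^ N * q ^ N"
      have "exp (- c / q) / q ^ m \<le> real N ^ N / c ^ N * q ^ N / q ^ m"
        using e q by (intro divide_right_mono) auto
      also have "q ^ N = q\<^sup>2 * q ^ m" by (simp add: N_def power_add power2_eq_square)
      finally show ?thesis using q by simp
    qed
    have "q \<le> (b - a) * \<bar>y - x\<bar>"
    proof (cases "x \<le> a")
      case True': True
      have "(y - a) * (b - y) \<le> \<bar>y - x\<bar> * (b - a)" using True True' by (intro mult_mono) auto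
      then show ?thesis by (simp add: q_def mult.commute)
    next
      case False
      then have "b \<le> x" using x by auto
      then show ?thesis unfolding q_def using True by (intro mult_mono) auto
    qed
    then have q2: "q\<^sup>2 \<le> (b - a)\<^sup>2 * (y - x)\<^sup>2"
      using q power_mono[of q "(b - a) * \<bar>y - x\<bar>" 2] by (simp add: power_mult_distrib)
    have "\<bar>bump_family a b c P m y\<bar> = \<bar>poly P y\<bar> * (exp (- c / q) / q ^ m)"
      using True q by (simp add: bump_family_def flip: q_def) (simp add: abs_mult)
    also have "\<dots> \<le> \<bar>K\<bar> * (real N ^ N / c ^ N * q\<^sup>2)"
      using K[of y] True q by (intro mult_mono e) auto
    also have "\<dots> \<le> \<bar>K\<bar> * (real N ^ N / c ^ N * ((b - a)\<^sup>2 * (y - x)\<^sup>2))"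
      using c by (intro mult_left_mono q2) auto
    also have "\<dots> = C * (y - x)\<^sup>2" by (simp add: C_def)
    finally show ?thesis .
  qed
  then show ?thesis by blast
qed

lemma bump_family_derivative:
  assumes c: "0 < c"
  shows "\<exists>Q. \<forall>x. (bump_family a b c P m has_real_derivative bump_family a b c Q (m + 2) x) (at x)"
proof -
  define q where "q = [:-a, 1:] * [:b, -1:]"
  define Q where "Q = pderiv P * q\<^sup>2 - smult (real m) (P * pderiv q * q) + smult c (P * pderiv q)"
  have q: "poly q x = (x - a) * (b - x)" for x by (simp add: q_def algebra_simps)
  have "(bump_family a b c P m has_real_derivative bump_family a b c Q (m + 2) x) (at x)" for x
  proof (cases "a < x \<and> x < b")
    case False
    then have 0: "bump_family a b c R n x = 0" for R n unfolding bump_family_def by (rule if_not_P)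
    obtain C where C: "\<And>y. \<bar>bump_family a b c P m y\<bar> \<le> C * (y - x)\<^sup>2"
      using bump_family_quadratic[OF c False] by blast
    have "(bump_family a b c P m has_real_derivative 0) (at x)"
      by (rule DERIV_zero_quadratic[where C=C]) (simp only: 0 diff_zero C)
    then show ?thesis by (simp add: 0)
  next
    case True
    then have qx: "poly q x > 0" by (simp add: q)
    have "((\<lambda>x. poly P x / poly q x ^ m * exp (- c / poly q x)) has_real_derivative
        poly Q x / poly q x ^ (m + 2) * exp (- c / poly q x)) (at x)"
      apply (rule derivative_eq_intros poly_DERIV refl | use qx in force)+
      using qx apply (cases m)
       apply (simp_all add: Q_def field_simps power2_eq_square)
      done
    then have "((\<lambda>x. poly P x / ((x - a) * (b - x)) ^ m * exp (- c / ((x - a) * (b - x)))) has_real_derivative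
        bump_family a b c Q (m + 2) x) (at x)"
      unfolding q using True by (simp add: bump_family_def)
    then show ?thesis
      by (rule has_field_derivative_transform_within_open[where S="{a<..<b}"])
         (use True in \<open>auto simp: bump_family_def\<close>)
  qed
  then show ?thesis by blast
qed

lemma test_fun_bump:
  assumes c: "0 < c" and a: "0 < a"
  shows "test_fun (bump_family a b c P m)"
proof -
  have "\<exists>Q k. (deriv ^^ n) (bump_family a b c P m) = bump_family a b c Q k" for n
  proof (induction n)
    case 0
    then show ?case by auto
  next
    case (Suc n)
    then obtain Q k where Q: "(deriv ^^ n) (bump_family a b c P m) = bump_family a b c Q k" by blast
    obtain R where "\<And>x. (bump_family a b c Q k has_real_derivative bump_family a b c R (k + 2) x) (at x)"
      using bump_family_derivative[OF c] by blast
    then have "deriv (bump_family a b c Q k) = bump_family a b c R (k + 2)"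
      by (auto intro!: DERIV_imp_deriv ext)
    then show ?case using Q by auto
  qed
  moreover have "bump_family a b c Q k field_differentiable at x" for Q k x
    using bump_family_derivative[OF c, of a b Q k] by (auto simp: field_differentiable_def)
  ultimately have "(deriv ^^ n) (bump_family a b c P m) field_differentiable at x" for n x
    by metis
  moreover have "x \<notin> {a..b} \<Longrightarrow> bump_family a b c P m x = 0" for x by (auto simp: bump_family_def)
  ultimately show ?thesis unfolding test_fun_def using a by blast
qed

abbreviation bump :: "real \<Rightarrow> real \<Rightarrow> nat \<Rightarrow> real \<Rightarrow> real" where
  "bump a b n \<equiv> bump_family a b (1 / real (Suc n)) 1 0"

lemma bump_range: "0 \<le> bump a b n x" "bump a b n x \<le> 1"
  by (auto simp: bump_family_def)

lemma bump_pos: "a < x \<Longrightarrow> x < b \<Longrightarrow> 0 < bump a b n x"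
  by (simp add: bump_family_def)

lemma bump_tendsto:
  assumes "a < x" "x < b"
  shows "(\<lambda>n. bump a b n x) \<longlonglongrightarrow> 1"
proof -
  have "(\<lambda>n. exp (- (1 / real (Suc n)) / ((x - a) * (b - x)))) \<longlonglongrightarrow> exp (- 0 / ((x - a) * (b - x)))"
    using assms by (intro tendsto_exp tendsto_divide tendsto_minus lim_inverse_n'[THEN LIMSEQ_Suc] tendsto_const) auto
  then show ?thesis using assms by (simp add: bump_family_def)
qed

section \<open>The fundamental lemma and weak derivatives\<close>

lemma set_integrable_on_Icc_Ioc:
  fixes f :: "real \<Rightarrow> 'a::banach"
  shows "set_integrable_on {a<..b} f \<Longrightarrow> set_integrable_on {a<..<b} f"
  by (rule set_integrable_on_subset) auto

lemma has_set_integral_extend: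
  assumes "has_set_integral A f I" "A \<subseteq> B" "\<And>t. t \<in> B \<Longrightarrow> t \<notin> A \<Longrightarrow> f t = 0"
  shows "has_set_integral B f I"
proof -
  have "(\<lambda>t. indicat_real A t *\<^sub>R f t) = (\<lambda>t. indicat_real B t *\<^sub>R f t)"
    using assms(2,3) by (auto simp: fun_eq_iff split: split_indicator)
  then show ?thesis using assms(1) by simp
qed

lemma set_integrable_on_extend:
  assumes "set_integrable_on A f" "A \<subseteq> B" "\<And>t. t \<in> B \<Longrightarrow> t \<notin> A \<Longrightarrow> f t = 0"
  shows "set_integrable_on B f"
  using assms has_set_integral_extend[of A f _ B] unfolding set_integrable_on_def by blast

lemma set_integrable_on_scaleR:
  fixes f :: "real \<Rightarrow> 'a::banach" and m :: "real \<Rightarrow> real"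
  assumes "set_integrable_on A f" "A \<in> sets borel" "m \<in> borel_measurable borel" "\<And>t. t \<in> A \<Longrightarrow> \<bar>m t\<bar> \<le> K"
  shows "set_integrable_on A (\<lambda>t. m t *\<^sub>R f t)"
  by (rule set_integrable_on_bilinear[OF assms(1,2) _ _ bounded_bilinear_scaleR, where K=K]) (use assms in auto)

lemma continuous_on_bounded_Icc:
  fixes m :: "real \<Rightarrow> real"
  assumes "continuous_on {a..b} m"
  obtains K where "\<And>t. t \<in> {a..b} \<Longrightarrow> \<bar>m t\<bar> \<le> K"
proof -
  have "compact (m ` {a..b})" by (intro compact_continuous_image assms) auto
  then show thesis using that by (metis bounded_iff compact_imp_bounded imageI real_norm_def)
qed

lemma test_fun_measurable: "test_fun \<phi> \<Longrightarrow> \<phi> \<in> borel_measurable borel"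
  by (intro borel_measurable_continuous_onI test_fun_continuous)

lemma test_fun_integrable:
  fixes f :: "real \<Rightarrow> 'a::banach"
  assumes f: "loc_integrable f" and \<phi>: "test_fun \<phi>"
  shows "set_integrable_on {0<..} (\<lambda>t. \<phi> t *\<^sub>R f t)"
proof -
  obtain a b where ab: "0 < a" "a < b" "\<And>x. x \<notin> {a..b} \<Longrightarrow> \<phi> x = 0" using test_fun_support[OF \<phi>] by blast
  obtain K where K: "\<And>t. t \<in> {a/2..b} \<Longrightarrow> \<bar>\<phi> t\<bar> \<le> K"
    using continuous_on_bounded_Icc[OF test_fun_continuous[OF \<phi>]] by blast
  have "set_integrable_on {a/2<..b} (\<lambda>t. \<phi> t *\<^sub>R f t)"
    by (rule set_integrable_on_scaleR[where K=K])
       (use f ab K test_fun_measurable[OF \<phi>] in \<open>auto simp: loc_integrable_def\<close>)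
  then show ?thesis by (rule set_integrable_on_extend) (use ab in auto)
qed

text \<open>Divide by a bump that is positive on the interval.\<close>

lemma loc_integrableI_test_fun:
  fixes f :: "real \<Rightarrow> 'a::banach"
  assumes "\<And>\<phi>. test_fun \<phi> \<Longrightarrow> set_integrable_on {0<..} (\<lambda>t. \<phi> t *\<^sub>R f t)"
  shows "loc_integrable f"
  unfolding loc_integrable_def
proof (intro allI impI)
  fix x y :: real assume xy: "0 < x" "x \<le> y"
  define \<phi> where "\<phi> = bump (x/2) (y + 1) 0"
  have \<phi>: "test_fun \<phi>" unfolding \<phi>_def by (rule test_fun_bump) (use xy in auto)
  have pos: "0 < \<phi> t" if "t \<in> {x..y}" for t unfolding \<phi>_def by (rule bump_pos) (use that xy in auto)
  have inv_cont: "continuous_on {x..y} (\<lambda>t. 1 / \<phi> t)"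
    by (intro continuous_intros test_fun_continuous[OF \<phi>]) (use pos in force)
  obtain K where K: "\<And>t. t \<in> {x..y} \<Longrightarrow> \<bar>1 / \<phi> t\<bar> \<le> K" using continuous_on_bounded_Icc[OF inv_cont] by blast
  have "set_integrable_on {x<..y} (\<lambda>t. \<phi> t *\<^sub>R f t)"
    by (rule set_integrable_on_subset[OF assms[OF \<phi>]]) (use xy in auto)
  then have "set_integrable_on {x<..y} (\<lambda>t. (1 / \<phi> t) *\<^sub>R \<phi> t *\<^sub>R f t)"
    by (rule set_integrable_on_scaleR[where K=K]) (use K test_fun_measurable[OF \<phi>] in auto)
  then show "set_integrable_on {x<..y} f"
  proof (rule set_integrable_on_cong)
    fix t assume "t \<in> {x<..y}"
    then have "\<phi> t \<noteq> 0" using pos[of t] by auto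
    then show "(1 / \<phi> t) *\<^sub>R \<phi> t *\<^sub>R f t = f t" by simp
  qed
qed

lemma has_set_integral_const:
  fixes y :: "'a::real_normed_vector" and A :: "real set"
  assumes "A \<in> sets borel" "emeasure lborel A < \<infinity>"
  shows "has_set_integral A (\<lambda>t. y) (measure lborel A *\<^sub>R y)"
proof -
  have "has_bochner_integral lborel (indicat_real A) (measure lborel A)"
    by (rule has_bochner_integral_real_indicator) (use assms in auto)
  from has_strong_integral_bounded_linear[OF bounded_linear_scaleR_left has_set_integral_bochner[OF this]]
  show ?thesis .
qed

text \<open>
  Bumps increase to the indicator of an interval, so \<open>d\<close> integrates to zero over intervals and,
  by the pi-lambda theorem, over all bounded Borel sets away from zero.
\<close>

lemma set_integral_zero_if_test_fun:
  fixes d :: "real \<Rightarrow> 'a::banach"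
  assumes d: "loc_integrable d"
    and zero: "\<And>\<phi>. test_fun \<phi> \<Longrightarrow> has_set_integral {0<..} (\<lambda>t. \<phi> t *\<^sub>R d t) 0"
    and ab: "0 < a" and A: "A \<in> sets borel"
  shows "has_set_integral (A \<inter> {a<..<b}) d 0"
proof -
  have Ioo: "has_set_integral {x<..<y} d 0" if x: "0 < x" for x y
  proof (cases "x \<le> y")
    case False
    then show ?thesis by (simp add: has_strong_integral_zero)
  next
    case True
    have di: "set_integrable_on {x<..<y} d"
      using d x True unfolding loc_integrable_def by (auto intro: set_integrable_on_Icc_Ioc)
    then obtain I where I: "has_set_integral {x<..<y} d I" unfolding set_integrable_on_def by blast
    obtain h where h[measurable]: "h \<in> borel_measurable borel" and h0: "\<And>t. 0 \<le> h t"
      and hd: "AE t in lborel. norm (indicat_real {x<..<y} t *\<^sub>R d t) = h t"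
      using set_integrable_on_norm[OF di] by auto
    have tf: "test_fun (bump x y n)" for n by (rule test_fun_bump) (use x in auto)
    have [measurable]: "bump x y n \<in> borel_measurable borel" for n by (rule test_fun_measurable[OF tf])
    let ?D = "\<lambda>n t. indicat_real {x<..<y} t *\<^sub>R d t - indicat_real {0<..} t *\<^sub>R (bump x y n t *\<^sub>R d t)"
    have D: "has_strong_integral lborel (?D n) (I - 0)" for n
      by (rule has_strong_integral_diff[OF I zero[OF tf]])
    have nD: "AE t in lborel. norm (?D n t) = (1 - bump x y n t) * h t" for n
      using hd
    proof eventually_elim
      fix t assume ht: "norm (indicat_real {x<..<y} t *\<^sub>R d t) = h t"
      show "norm (?D n t) = (1 - bump x y n t) * h t"
      proof (cases "x < t \<and> t < y")
        case True
        then have "?D n t = (1 - bump x y n t) *\<^sub>R d t" using x by (simp add: scaleR_diff_left)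
        then show ?thesis using ht True bump_range[of x y n t] by simp
      next
        case False
        then have "bump x y n t = 0" unfolding bump_family_def by (rule if_not_P)
        then show ?thesis using ht False by auto
      qed
    qed
    have "(\<lambda>n. \<integral>\<^sup>+t. ennreal ((1 - bump x y n t) * h t) \<partial>lborel) \<longlonglongrightarrow> nn_integral lborel (\<lambda>t::real. 0)"
    proof (rule nn_integral_dominated_convergence[where w="\<lambda>t. ennreal (h t)"])
      show "AE t in lborel. ennreal ((1 - bump x y n t) * h t) \<le> ennreal (h t)" for n
        using bump_range[of x y n] h0 by (intro AE_I2 ennreal_leI mult_left_le_one_le) auto
      show "(\<integral>\<^sup>+t. ennreal (h t) \<partial>lborel) < \<infinity>"
        using has_strong_integral_imp(2)[OF I] nn_integral_norm_cong[OF hd] by simp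
      show "AE t in lborel. (\<lambda>n. ennreal ((1 - bump x y n t) * h t)) \<longlonglongrightarrow> 0"
        using hd
      proof eventually_elim
        fix t assume ht: "norm (indicat_real {x<..<y} t *\<^sub>R d t) = h t"
        show "(\<lambda>n. ennreal ((1 - bump x y n t) * h t)) \<longlonglongrightarrow> 0"
        proof (cases "x < t \<and> t < y")
          case True
          have "(\<lambda>n. (1 - bump x y n t) * h t) \<longlonglongrightarrow> (1 - 1) * h t"
            using True by (intro tendsto_intros bump_tendsto) auto
          then have "(\<lambda>n. ennreal ((1 - bump x y n t) * h t)) \<longlonglongrightarrow> ennreal ((1 - 1) * h t)"
            by (rule tendsto_ennrealI)
          then show ?thesis by simp
        next
          case False
          then have "h t = 0" using ht by auto
          then show ?thesis by simp
        qed
      qed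
      have aux: "(\<lambda>t. ennreal ((1 - m t) * h t)) \<in> borel_measurable lborel"
        if [measurable]: "m \<in> borel_measurable borel" for m :: "real \<Rightarrow> real" by measurable
      show "(\<lambda>t. ennreal ((1 - bump x y n t) * h t)) \<in> borel_measurable lborel" for n
        by (rule aux[OF test_fun_measurable[OF tf]])
      show "(\<lambda>t. ennreal (h t)) \<in> borel_measurable lborel" by measurable
    qed simp
    then have "(\<lambda>n::nat. I) \<longlonglongrightarrow> 0"
    proof (intro tendsto_zero_ennreal_norm[where e="\<lambda>n. \<integral>\<^sup>+t. ennreal ((1 - bump x y n t) * h t) \<partial>lborel"])
      show "ennreal (norm I) \<le> (\<integral>\<^sup>+t. ennreal ((1 - bump x y n t) * h t) \<partial>lborel)" for n
        using has_strong_integral_imp(3)[OF D[of n]] nn_integral_norm_cong[OF nD[of n]] by simp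
    qed simp
    then have "I = 0" by (simp add: LIMSEQ_const_iff)
    then show ?thesis using I by simp
  qed
  let ?K = "{a<..<b}"
  have Kint: "set_integrable_on ?K d" unfolding set_integrable_on_def using Ioo[OF ab] by blast
  have gen: "sets borel = sigma_sets UNIV (range (greaterThan :: real \<Rightarrow> real set))"
    by (subst borel_Ioi) simp
  have "Int_stable (range (greaterThan :: real \<Rightarrow> real set))"
  proof (rule Int_stableI)
    fix s t :: "real set" assume "s \<in> range greaterThan" "t \<in> range greaterThan"
    then obtain u v where "s = {u<..}" "t = {v<..}" by auto
    then have "s \<inter> t = {max u v<..}" by auto
    then show "s \<inter> t \<in> range greaterThan" by auto
  qed
  moreover have "range (greaterThan :: real \<Rightarrow> real set) \<subseteq> Pow UNIV" by simp
  moreover have "A \<in> sigma_sets UNIV (range (greaterThan :: real \<Rightarrow> real set))" using A gen by simp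
  ultimately show ?thesis
  proof (induction rule: sigma_sets_induct_disjoint)
    case (basic s)
    then obtain u where "s = {u<..}" by auto
    then have "s \<inter> ?K = {max u a<..<b}" by auto
    then show ?case using Ioo[of "max u a" b] ab by simp
  next
    case empty
    then show ?case by (simp add: has_strong_integral_zero)
  next
    case (compl s)
    have eq: "(\<lambda>t. indicat_real ?K t *\<^sub>R d t - indicat_real (s \<inter> ?K) t *\<^sub>R d t)
        = (\<lambda>t. indicat_real ((UNIV - s) \<inter> ?K) t *\<^sub>R d t)"
      by (auto simp: fun_eq_iff split: split_indicator)
    show ?case using has_strong_integral_diff[OF Ioo[OF ab, of b] compl(2)] by (simp only: eq diff_self)
  next
    case (union s)
    have sb: "s i \<in> sets borel" for i unfolding gen by (rule range_subsetD[OF union(2)])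
    have "has_set_integral ((\<Union>i<n. s i) \<inter> ?K) d 0" for n
    proof (induction n)
      case 0
      then show ?case by (simp add: has_strong_integral_zero)
    next
      case (Suc n)
      have "((\<Union>i<n. s i) \<inter> ?K) \<inter> (s n \<inter> ?K) = {}"
      proof -
        have "s i \<inter> s n = {}" if "i < n" for i
          using disjoint_family_onD[OF union(1), of i n] that by simp
        then show ?thesis by blast
      qed
      moreover have "((\<Union>i<n. s i) \<inter> ?K) \<union> (s n \<inter> ?K) = (\<Union>i<Suc n. s i) \<inter> ?K"
        by (auto simp: less_Suc_eq)
      ultimately show ?case using has_set_integral_Un[OF Suc union(3)[of n]] by simp
    qed
    note fin = this
    obtain I where I: "has_set_integral ((\<Union>i. s i) \<inter> ?K) d I"
      using set_integrable_on_subset[OF Kint, of "(\<Union>i. s i) \<inter> ?K"] sb unfolding set_integrable_on_def by auto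
    define B where "B n = ((\<Union>i. s i) - (\<Union>i<n. s i)) \<inter> ?K" for n
    have "has_set_integral (B n) d I" for n
    proof -
      have "(\<lambda>t. indicat_real ((\<Union>i. s i) \<inter> ?K) t *\<^sub>R d t - indicat_real ((\<Union>i<n. s i) \<inter> ?K) t *\<^sub>R d t)
        = (\<lambda>t. indicat_real (B n) t *\<^sub>R d t)"
        by (auto simp: fun_eq_iff B_def split: split_indicator)
      then show ?thesis using has_strong_integral_diff[OF I fin[of n]] by simp
    qed
    then have le: "ennreal (norm I) \<le> nnint (B n) (\<lambda>t. norm (d t))" for n
      by (rule has_set_integral_norm_le)
    have "(\<lambda>n. \<integral>\<^sup>+t\<in>B n. ennreal (norm (d t)) \<partial>lborel) \<longlonglongrightarrow> 0"
    proof (rule nn_integral_shrinking[OF Kint])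
      show "B n \<in> sets borel" for n unfolding B_def using sb by auto
      show "B n \<subseteq> ?K" for n by (auto simp: B_def)
      have "eventually (\<lambda>n. t \<notin> B n) sequentially" for t
      proof (cases "t \<in> (\<Union>i. s i)")
        case True
        then obtain i where "t \<in> s i" by auto
        show ?thesis
          using eventually_gt_at_top[of i] by eventually_elim (use \<open>t \<in> s i\<close> in \<open>auto simp: B_def\<close>)
      qed (simp add: B_def)
      then show "AE t in lborel. eventually (\<lambda>n. t \<notin> B n) sequentially" by simp
    qed
    then have "(\<lambda>n::nat. I) \<longlonglongrightarrow> 0" by (rule tendsto_zero_ennreal_norm[OF le])
    then have "I = 0" by (simp add: LIMSEQ_const_iff)
    then show ?case using I by simp
  qed
qed

text \<open>
  If \<open>d\<close> stayed within half of the norm of \<open>y\<close> from \<open>y\<close> on a set of positive measure, its integral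
  over that set could not vanish. Strong measurability allows \<open>y\<close> to run through a countable set.
\<close>

lemma fundamental_lemma:
  fixes d :: "real \<Rightarrow> 'a::banach"
  assumes d: "loc_integrable d"
    and zero: "\<And>\<phi>. test_fun \<phi> \<Longrightarrow> has_set_integral {0<..} (\<lambda>t. \<phi> t *\<^sub>R d t) 0"
  shows "AE t in lborel. 0 < t \<longrightarrow> d t = 0"
proof -
  have *: "AE t in lborel. t \<in> {a<..<b} \<longrightarrow> d t = 0" if a: "0 < a" "a \<le> b" for a b
  proof -
    let ?K = "{a<..<b}"
    have Kint: "set_integrable_on ?K d"
      using d a unfolding loc_integrable_def by (auto intro: set_integrable_on_Icc_Ioc)
    then have dm: "strongly_measurable lborel (\<lambda>t. indicat_real ?K t *\<^sub>R d t)"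
      unfolding set_integrable_on_iff by blast
    then obtain s where s: "\<And>i. Bochner_Integration.simple_bochner_integrable lborel (s i)"
      and lim: "AE t in lborel. (\<lambda>i::nat. s i t) \<longlonglongrightarrow> indicat_real ?K t *\<^sub>R d t"
      unfolding strongly_measurable_def by blast
    define Y where "Y = (\<Union>i. range (s i)) - {0}"
    have Y: "countable Y"
    proof -
      have "countable (range (s i))" for i
        using simple_functionD(1)[OF simple_function_simple_bochner_integrable[OF s[of i]]]
        by (simp add: countable_finite)
      then show ?thesis unfolding Y_def by (intro countable_Diff countable_UN) auto
    qed
    have "AE t in lborel. t \<in> ?K \<longrightarrow> norm y / 2 < norm (d t - y)" if "y \<in> Y" for y
    proof -
      have y: "0 < norm y" using that by (simp add: Y_def)
      have ym: "strongly_measurable lborel (\<lambda>t::real. y)"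
        by (rule strongly_measurableI_sigma_finite[OF sigma_finite_lborel, of "\<lambda>i t. y"]) auto
      obtain h :: "real \<Rightarrow> real" where h[measurable]: "h \<in> borel_measurable borel"
        and hd: "AE t in lborel. norm (indicat_real ?K t *\<^sub>R d t - y) = h t"
        using strongly_measurable_norm[OF strongly_measurable_diff[OF dm ym]] by auto
      define A where "A = {t. h t \<le> norm y / 2}"
      have A[measurable]: "A \<in> sets borel" unfolding A_def by measurable
      have fin: "emeasure lborel (A \<inter> ?K) < \<infinity>"
        using emeasure_mono[of "A \<inter> ?K" ?K lborel] a by (auto intro: le_less_trans)
      have "has_set_integral (A \<inter> ?K) (\<lambda>t. d t - y) (0 - measure lborel (A \<inter> ?K) *\<^sub>R y)"
        by (intro has_set_integral_diff has_set_integral_const fin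
            set_integral_zero_if_test_fun[OF d zero a(1)]) (use A in auto)
      then have "ennreal (norm (0 - measure lborel (A \<inter> ?K) *\<^sub>R y))
          \<le> nnint (A \<inter> ?K) (\<lambda>t. norm (d t - y))"
        by (rule has_set_integral_norm_le)
      also have "\<dots> \<le> (\<integral>\<^sup>+t. ennreal (norm y / 2) * indicator (A \<inter> ?K) t \<partial>lborel)"
      proof (rule nn_integral_mono_AE)
        show "AE t in lborel. ennreal (norm (d t - y)) * indicator (A \<inter> ?K) t
          \<le> ennreal (norm y / 2) * indicator (A \<inter> ?K) t"
          using hd by eventually_elim (auto simp: A_def split: split_indicator intro!: ennreal_leI)
      qed
      also have "\<dots> = ennreal (norm y / 2) * emeasure lborel (A \<inter> ?K)"
        by (intro nn_integral_cmult_indicator) auto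
      also have "\<dots> = ennreal (norm y / 2) * ennreal (measure lborel (A \<inter> ?K))"
        using fin by (subst emeasure_eq_ennreal_measure) auto
      also have "\<dots> = ennreal (norm y / 2 * measure lborel (A \<inter> ?K))"
        by (rule ennreal_mult[symmetric]) auto
      finally have "measure lborel (A \<inter> ?K) * norm y \<le> norm y / 2 * measure lborel (A \<inter> ?K)"
        by (subst (asm) ennreal_le_iff) auto
      then have "norm y * measure lborel (A \<inter> ?K) \<le> 0" by (simp add: mult.commute)
      then have "measure lborel (A \<inter> ?K) \<le> 0" using y by (simp add: mult_le_0_iff)
      then have "measure lborel (A \<inter> ?K) = 0" using measure_nonneg antisym by blast
      then have "emeasure lborel (A \<inter> ?K) = 0"
        using fin by (simp add: emeasure_eq_ennreal_measure)
      then have "AE t in lborel. t \<notin> A \<inter> ?K" by (intro AE_not_in null_setsI) auto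
      then show ?thesis using hd by eventually_elim (auto simp: A_def)
    qed
    then have "AE t in lborel. \<forall>y\<in>Y. t \<in> ?K \<longrightarrow> norm y / 2 < norm (d t - y)"
      by (rule AE_ball_countable'[OF _ Y])
    then show ?thesis using lim
    proof eventually_elim
      fix t assume far: "\<forall>y\<in>Y. t \<in> ?K \<longrightarrow> norm y / 2 < norm (d t - y)"
        and l: "(\<lambda>i. s i t) \<longlonglongrightarrow> indicat_real ?K t *\<^sub>R d t"
      show "t \<in> ?K \<longrightarrow> d t = 0"
      proof (rule impI, rule ccontr)
        assume t: "t \<in> ?K" and nz: "d t \<noteq> 0"
        have "eventually (\<lambda>i. dist (s i t) (d t) < norm (d t) / 3) sequentially"
          using tendstoD[OF l, of "norm (d t) / 3"] t nz by simp
        then obtain i where i: "norm (d t - s i t) < norm (d t) / 3"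
          by (auto simp: eventually_sequentially dist_norm norm_minus_commute)
        have "norm (d t) \<le> norm (d t - s i t) + norm (s i t)" using norm_triangle_sub[of "d t" "s i t"] by simp
        then have n: "2 / 3 * norm (d t) < norm (s i t)" using i by simp
        then have "s i t \<in> Y" using nz by (auto simp: Y_def)
        then have "norm (s i t) / 2 < norm (d t - s i t)" using far t by blast
        then show False using n i by simp
      qed
    qed
  qed
  have "AE t in lborel. \<forall>n. t \<in> {1 / real (Suc n)<..<real (Suc n)} \<longrightarrow> d t = 0"
    unfolding AE_all_countable
  proof
    fix n
    have "1 * 1 \<le> real (Suc n) * real (Suc n)" by (intro mult_mono) auto
    then have "1 / real (Suc n) \<le> real (Suc n)" by (simp add: divide_le_eq)
    then show "AE t in lborel. t \<in> {1 / real (Suc n)<..<real (Suc n)} \<longrightarrow> d t = 0"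
      by (intro *) simp_all
  qed
  then show ?thesis
  proof eventually_elim
    fix t :: real assume all: "\<forall>n. t \<in> {1 / real (Suc n)<..<real (Suc n)} \<longrightarrow> d t = 0"
    show "0 < t \<longrightarrow> d t = 0"
    proof
      assume "0 < t"
      obtain n where n: "1 / t < real n" "t < real n"
        using reals_Archimedean2[of "max (1/t) t"] by auto
      then have "1 / t < real (Suc n)" "t < real (Suc n)" by auto
      then have "t \<in> {1 / real (Suc n)<..<real (Suc n)}"
        using \<open>0 < t\<close> by (auto simp: field_simps)
      then show "d t = 0" using all by blast
    qed
  qed
qed

lemma weak_deriv_iff:
  fixes f g :: "real \<Rightarrow> 'a::banach"
  shows "weak_deriv j f g \<longleftrightarrow> (\<forall>\<phi>. test_fun \<phi> \<longrightarrow> (\<exists>I.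
        has_set_integral {0<..} (\<lambda>x. (deriv ^^ j) \<phi> x *\<^sub>R f x) I \<and>
        has_set_integral {0<..} (\<lambda>x. \<phi> x *\<^sub>R g x) ((-1) ^ j *\<^sub>R I)))"
  unfolding weak_deriv_def has_strong_integral_halfline ..

lemma weak_deriv_loc_integrable:
  fixes f g :: "real \<Rightarrow> 'a::banach"
  shows "weak_deriv j f g \<Longrightarrow> loc_integrable g"
  unfolding weak_deriv_iff by (rule loc_integrableI_test_fun) (auto simp: set_integrable_on_def)

lemma weak_deriv_unique:
  fixes f g :: "real \<Rightarrow> 'a::banach"
  assumes "weak_deriv j f g" "weak_deriv j f h"
  shows "AE t in lborel. 0 < t \<longrightarrow> g t = h t"
proof -
  have "AE t in lborel. 0 < t \<longrightarrow> g t - h t = 0"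
  proof (rule fundamental_lemma)
    show "loc_integrable (\<lambda>t. g t - h t)"
      using weak_deriv_loc_integrable[OF assms(1)] weak_deriv_loc_integrable[OF assms(2)]
      unfolding loc_integrable_def by (auto intro: set_integrable_on_diff)
    fix \<phi> assume \<phi>: "test_fun \<phi>"
    obtain I where I: "has_set_integral {0<..} (\<lambda>x. (deriv ^^ j) \<phi> x *\<^sub>R f x) I"
      "has_set_integral {0<..} (\<lambda>x. \<phi> x *\<^sub>R g x) ((-1) ^ j *\<^sub>R I)"
      using assms(1) \<phi> unfolding weak_deriv_iff by blast
    obtain J where J: "has_set_integral {0<..} (\<lambda>x. (deriv ^^ j) \<phi> x *\<^sub>R f x) J"
      "has_set_integral {0<..} (\<lambda>x. \<phi> x *\<^sub>R h x) ((-1) ^ j *\<^sub>R J)"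
      using assms(2) \<phi> unfolding weak_deriv_iff by blast
    have "I = J" by (rule has_strong_integral_unique[OF I(1) J(1)])
    then show "has_set_integral {0<..} (\<lambda>t. \<phi> t *\<^sub>R (g t - h t)) 0"
      using has_set_integral_diff[OF I(2) J(2)] by (simp add: scaleR_diff_right)
  qed
  then show ?thesis by eventually_elim simp
qed

lemma weak_deriv_cong_AE:
  fixes f g :: "real \<Rightarrow> 'a::banach"
  assumes "weak_deriv j f g" "AE t in lborel. 0 < t \<longrightarrow> f t = f' t" "AE t in lborel. 0 < t \<longrightarrow> g t = g' t"
  shows "weak_deriv j f' g'"
  unfolding weak_deriv_iff
proof (intro allI impI)
  fix \<phi> assume "test_fun \<phi>"
  then obtain I where I: "has_set_integral {0<..} (\<lambda>x. (deriv ^^ j) \<phi> x *\<^sub>R f x) I"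
      "has_set_integral {0<..} (\<lambda>x. \<phi> x *\<^sub>R g x) ((-1) ^ j *\<^sub>R I)"
    using assms(1) unfolding weak_deriv_iff by blast
  have "has_set_integral {0<..} (\<lambda>x. (deriv ^^ j) \<phi> x *\<^sub>R f' x) I"
    by (rule has_set_integral_cong_AE[OF I(1)]) (use assms(2) in \<open>auto elim!: eventually_mono\<close>)
  moreover have "has_set_integral {0<..} (\<lambda>x. \<phi> x *\<^sub>R g' x) ((-1) ^ j *\<^sub>R I)"
    by (rule has_set_integral_cong_AE[OF I(2)]) (use assms(3) in \<open>auto elim!: eventually_mono\<close>)
  ultimately show "\<exists>I. has_set_integral {0<..} (\<lambda>x. (deriv ^^ j) \<phi> x *\<^sub>R f' x) I \<and>
      has_set_integral {0<..} (\<lambda>x. \<phi> x *\<^sub>R g' x) ((-1) ^ j *\<^sub>R I)" by blast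
qed

lemma wderiv_eq_AE:
  fixes f g :: "real \<Rightarrow> 'a::banach"
  assumes "weak_deriv j f g"
  shows "AE t in lborel. 0 < t \<longrightarrow> wderiv j f t = g t"
  using weak_deriv_unique[OF someI[of "weak_deriv j f" g, OF assms] assms] unfolding wderiv_def .

lemma weak_deriv_0:
  fixes f :: "real \<Rightarrow> 'a::banach"
  assumes "loc_integrable f"
  shows "weak_deriv 0 f f"
  unfolding weak_deriv_iff using test_fun_integrable[OF assms] by (auto simp: set_integrable_on_def)

lemma weak_deriv_0_AE:
  fixes f g :: "real \<Rightarrow> 'a::banach"
  assumes "weak_deriv 0 f g"
  shows "AE t in lborel. 0 < t \<longrightarrow> f t = g t"
proof -
  have "loc_integrable f"
    using assms unfolding weak_deriv_iff by (intro loc_integrableI_test_fun) (auto simp: set_integrable_on_def)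
  from weak_deriv_unique[OF weak_deriv_0[OF this] assms] show ?thesis .
qed

lemma weak_deriv_trans:
  fixes f g h :: "real \<Rightarrow> 'a::banach"
  assumes "weak_deriv i f g" "weak_deriv j g h"
  shows "weak_deriv (i + j) f h"
  unfolding weak_deriv_iff
proof (intro allI impI)
  fix \<phi> assume \<phi>: "test_fun \<phi>"
  then obtain I where I: "has_set_integral {0<..} (\<lambda>x. (deriv ^^ j) \<phi> x *\<^sub>R g x) I"
      "has_set_integral {0<..} (\<lambda>x. \<phi> x *\<^sub>R h x) ((-1) ^ j *\<^sub>R I)"
    using assms(2) unfolding weak_deriv_iff by blast
  have "test_fun ((deriv ^^ j) \<phi>)" using \<phi> by (induction j) (auto intro: test_fun_deriv)
  then obtain J where J: "has_set_integral {0<..} (\<lambda>x. (deriv ^^ i) ((deriv ^^ j) \<phi>) x *\<^sub>R f x) J"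
      "has_set_integral {0<..} (\<lambda>x. (deriv ^^ j) \<phi> x *\<^sub>R g x) ((-1) ^ i *\<^sub>R J)"
    using assms(1) unfolding weak_deriv_iff by blast
  have "I = (-1) ^ i *\<^sub>R J" by (rule has_strong_integral_unique[OF I(1) J(2)])
  then have "(-1) ^ j *\<^sub>R I = (-1) ^ (i + j) *\<^sub>R J" by (simp add: power_add mult.commute)
  then show "\<exists>I. has_set_integral {0<..} (\<lambda>x. (deriv ^^ (i + j)) \<phi> x *\<^sub>R f x) I \<and>
      has_set_integral {0<..} (\<lambda>x. \<phi> x *\<^sub>R h x) ((-1) ^ (i + j) *\<^sub>R I)"
    using I(2) J(1) by (auto simp: funpow_add)
qed

lemma weak_deriv_Suc_imp:
  fixes f g h :: "real \<Rightarrow> 'a::banach"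
  assumes "weak_deriv j f g" "weak_deriv (Suc j) f h"
  shows "weak_deriv 1 g h"
  unfolding weak_deriv_iff
proof (intro allI impI)
  fix \<phi> assume \<phi>: "test_fun \<phi>"
  then obtain I where I: "has_set_integral {0<..} (\<lambda>x. (deriv ^^ Suc j) \<phi> x *\<^sub>R f x) I"
      "has_set_integral {0<..} (\<lambda>x. \<phi> x *\<^sub>R h x) ((-1) ^ Suc j *\<^sub>R I)"
    using assms(2) unfolding weak_deriv_iff by blast
  obtain J where J: "has_set_integral {0<..} (\<lambda>x. (deriv ^^ j) (deriv \<phi>) x *\<^sub>R f x) J"
      "has_set_integral {0<..} (\<lambda>x. deriv \<phi> x *\<^sub>R g x) ((-1) ^ j *\<^sub>R J)"
    using assms(1) test_fun_deriv[OF \<phi>] unfolding weak_deriv_iff by blast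
  have "I = J"
    by (rule has_strong_integral_unique[OF I(1)]) (use J(1) in \<open>simp add: funpow_swap1\<close>)
  then show "\<exists>I. has_set_integral {0<..} (\<lambda>x. (deriv ^^ 1) \<phi> x *\<^sub>R g x) I \<and>
      has_set_integral {0<..} (\<lambda>x. \<phi> x *\<^sub>R h x) ((-1) ^ 1 *\<^sub>R I)"
    using I(2) J(2) by (intro exI[of _ "(-1) ^ j *\<^sub>R J"]) auto
qed

lemma indef_integral_loc_integrable:
  fixes v :: "real \<Rightarrow> 'a::banach"
  assumes "indef_integral v g"
  shows "loc_integrable v"
  using set_integrable_on_continuous[OF indef_integral_continuous_on[OF assms]]
  unfolding loc_integrable_def by blast

text \<open>
  The product rule for the test function times \<open>v\<close>, on an interval containing the support.
\<close>

lemma indef_integral_weak_deriv: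
  fixes v :: "real \<Rightarrow> 'a::complex_banach"
  assumes v: "indef_integral v g"
  shows "weak_deriv 1 v g"
  unfolding weak_deriv_iff
proof (intro allI impI)
  fix \<phi> assume \<phi>: "test_fun \<phi>"
  obtain a b where ab: "0 < a" "a < b" "\<And>x. x \<notin> {a..b} \<Longrightarrow> \<phi> x = 0" using test_fun_support[OF \<phi>] by blast
  have zero: "deriv \<phi> x = 0" if "x \<notin> {a..b}" for x using deriv_zero_outside[of a b \<phi> x] ab that by blast
  obtain I where I: "has_set_integral {0<..} (\<lambda>x. deriv \<phi> x *\<^sub>R v x) I"
    using test_fun_integrable[OF indef_integral_loc_integrable[OF v] test_fun_deriv[OF \<phi>]]
    unfolding set_integrable_on_def by blast
  obtain J where J: "has_set_integral {0<..} (\<lambda>x. \<phi> x *\<^sub>R g x) J"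
    using test_fun_integrable[OF indef_integral_imp_loc_integrable[OF v] \<phi>]
    unfolding set_integrable_on_def by blast
  have step: "indef_integral (\<lambda>t. complex_of_real (\<phi> t) *\<^sub>C v t)
      (\<lambda>t. complex_of_real (deriv \<phi> t) *\<^sub>C v t + complex_of_real (\<phi> t) *\<^sub>C g t)"
  proof (rule indef_integral_mult[OF v])
    show "((\<lambda>t. complex_of_real (\<phi> t)) has_vector_derivative complex_of_real (deriv \<phi> t)) (at t)" for t
      using test_fun_derivative[OF \<phi>, of t]
      by (auto intro: has_vector_derivative_of_real simp flip: has_real_derivative_iff_has_vector_derivative)
    show "continuous_on {0<..} (\<lambda>t. complex_of_real (deriv \<phi> t))"
      by (intro continuous_intros test_fun_continuous[OF test_fun_deriv[OF \<phi>]])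
  qed
  have "has_set_integral {a/2<..b+1}
      (\<lambda>t. complex_of_real (deriv \<phi> t) *\<^sub>C v t + complex_of_real (\<phi> t) *\<^sub>C g t)
      (complex_of_real (\<phi> (b+1)) *\<^sub>C v (b+1) - complex_of_real (\<phi> (a/2)) *\<^sub>C v (a/2))"
    using step[unfolded indef_integral_def, rule_format, of "a/2" "b+1"] ab(1,2) by simp
  then have "has_set_integral {a/2<..b+1} (\<lambda>t. deriv \<phi> t *\<^sub>R v t + \<phi> t *\<^sub>R g t)
      (\<phi> (b+1) *\<^sub>R v (b+1) - \<phi> (a/2) *\<^sub>R v (a/2))"
    by (simp only: scaleR_eq_scaleC[where 'a='a, symmetric])
  moreover have "\<phi> (b + 1) = 0" "\<phi> (a / 2) = 0" using ab(1,2) by (auto intro!: ab(3))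
  ultimately have "has_set_integral {a/2<..b+1} (\<lambda>t. deriv \<phi> t *\<^sub>R v t + \<phi> t *\<^sub>R g t) 0"
    by simp
  then have "has_set_integral {0<..} (\<lambda>t. deriv \<phi> t *\<^sub>R v t + \<phi> t *\<^sub>R g t) 0"
    by (rule has_set_integral_extend) (use ab zero in auto)
  then have "I + J = 0"
    by (intro has_strong_integral_unique[OF has_set_integral_add[OF I J]])
  then have "J = - I" by (simp add: eq_neg_iff_add_eq_0 add.commute)
  then show "\<exists>I. has_set_integral {0<..} (\<lambda>x. (deriv ^^ 1) \<phi> x *\<^sub>R v x) I \<and>
      has_set_integral {0<..} (\<lambda>x. \<phi> x *\<^sub>R g x) ((-1) ^ 1 *\<^sub>R I)"
    using I J by (intro exI[of _ I]) auto
qed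

lemma test_fun_total_integral:
  assumes \<phi>: "test_fun \<phi>"
  shows "\<exists>\<Phi> T a b. 0 < a \<and> a < b \<and> (\<forall>x. (\<Phi> has_real_derivative \<phi> x) (at x)) \<and>
    (\<forall>x<a. \<Phi> x = 0) \<and> (\<forall>x>b. \<Phi> x = T) \<and> has_set_integral {0<..} \<phi> T"
proof -
  obtain a b where ab: "0 < a" "a < b" "\<And>x. x \<notin> {a..b} \<Longrightarrow> \<phi> x = 0" using test_fun_support[OF \<phi>] by blast
  have c: "continuous_on S \<phi>" for S by (rule test_fun_continuous[OF \<phi>])
  define \<Phi> where "\<Phi> x = integral {0..x} \<phi>" for x
  have low: "\<Phi> x = 0" if "x < a" for x
  proof -
    have "\<Phi> x = integral {0..x} (\<lambda>x. 0)"
      unfolding \<Phi>_def by (rule integral_cong) (use that in \<open>auto intro!: ab(3)\<close>)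
    then show ?thesis by simp
  qed
  have der: "(\<Phi> has_real_derivative \<phi> x) (at x)" for x
  proof (cases "x < a")
    case True
    have "(\<Phi> has_real_derivative 0) (at x)"
      by (rule has_field_derivative_transform_within_open[of "\<lambda>x. 0" _ _ "{..<a}"]) (use True low in auto)
    then show ?thesis using ab(3)[of x] True by simp
  next
    case False
    then have x: "0 < x" using ab by simp
    have "(\<Phi> has_real_derivative \<phi> x) (at x within {0..x+1})"
      unfolding \<Phi>_def by (rule integral_has_real_derivative[OF c]) (use x in auto)
    then show ?thesis using x at_within_Icc_at[of 0 x "x + 1"] by simp
  qed
  have high: "\<Phi> x = \<Phi> (b + 1)" if "b < x" for x
  proof -
    have "\<exists>c. \<forall>x\<in>{b<..}. \<Phi> x = c"
    proof (rule has_field_derivative_zero_constant)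
      show "(\<Phi> has_real_derivative 0) (at y within {b<..})" if "y \<in> {b<..}" for y
        using DERIV_subset[OF der[of y]] ab(3)[of y] that by auto
    qed simp
    then show ?thesis using that by (metis greaterThan_iff less_add_one)
  qed
  have "has_bochner_integral lborel (\<lambda>x. indicat_real {0..b+1} x *\<^sub>R \<phi> x) (\<Phi> (b+1) - \<Phi> 0)"
  proof (rule has_bochner_integral_FTC_Icc)
    show "(\<Phi> has_vector_derivative \<phi> x) (at x within {0..b + 1})" for x
      using der[of x] by (auto simp: has_real_derivative_iff_has_vector_derivative
          intro: has_vector_derivative_at_within)
  qed (use ab c in auto)
  from has_set_integral_bochner[OF this] have "has_set_integral {0..b+1} \<phi> (\<Phi> (b+1))"
    using low[of 0] ab by simp
  moreover have "(\<lambda>t. indicat_real {0..b+1} t *\<^sub>R \<phi> t) = (\<lambda>t. indicat_real {0<..} t *\<^sub>R \<phi> t)"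
    using ab by (auto simp: fun_eq_iff split: split_indicator)
  ultimately have "has_set_integral {0<..} \<phi> (\<Phi> (b+1))" by simp
  then show ?thesis using ab(1,2) der low high by blast
qed

lemma test_fun_has_integral: "test_fun \<phi> \<Longrightarrow> \<exists>T. has_set_integral {0<..} \<phi> T"
  using test_fun_total_integral by blast

lemma test_fun_unit_mass: "\<exists>\<psi>. test_fun \<psi> \<and> has_set_integral {0<..} \<psi> (1::real)"
proof -
  have tb: "test_fun (bump 1 2 0)" by (rule test_fun_bump) auto
  obtain T where T: "has_set_integral {0<..} (bump 1 2 0) T"
    using test_fun_has_integral[OF tb] by blast
  have "T \<noteq> 0"
  proof
    assume "T = 0"
    have "AE t in lborel. 0 < t \<longrightarrow> bump 1 2 0 t = 0"
    proof -
      have fin: "nnint {0<..} (\<lambda>t. norm (bump 1 2 0 t)) < \<infinity>"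
      proof -
        have "set_integrable_on {0<..} (bump 1 2 0)" using T unfolding set_integrable_on_def by blast
        then show ?thesis unfolding set_integrable_on_iff by blast
      qed
      have bi: "has_bochner_integral lborel (\<lambda>t. indicat_real {0<..} t *\<^sub>R bump 1 2 0 t)
          (enn2real (\<integral>\<^sup>+t. ennreal (indicat_real {0<..} t *\<^sub>R bump 1 2 0 t) \<partial>lborel))"
      proof (rule has_bochner_integral_nn_integral)
        show "(\<lambda>t. indicat_real {0<..} t *\<^sub>R bump 1 2 0 t) \<in> borel_measurable lborel"
          using test_fun_measurable[OF tb] by auto
        have "ennreal (norm (bump 1 2 0 t)) * indicator {0<..} t = ennreal (indicat_real {0<..} t *\<^sub>R bump 1 2 0 t)" for t :: real
          using bump_range(1)[of 1 2 0 t] by (auto split: split_indicator)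
        then show "(\<integral>\<^sup>+t. ennreal (indicat_real {0<..} t *\<^sub>R bump 1 2 0 t) \<partial>lborel)
          = ennreal (enn2real (\<integral>\<^sup>+t. ennreal (indicat_real {0<..} t *\<^sub>R bump 1 2 0 t) \<partial>lborel))"
          using fin by simp
      qed (use bump_range(1)[of 1 2 0] in \<open>auto intro!: AE_I2 mult_nonneg_nonneg\<close>)
      have "enn2real (\<integral>\<^sup>+t. ennreal (indicat_real {0<..} t *\<^sub>R bump 1 2 0 t) \<partial>lborel) = 0"
        using has_strong_integral_unique[OF has_set_integral_bochner[OF bi] T] \<open>T = 0\<close> by simp
      then have "integral\<^sup>L lborel (\<lambda>t. indicat_real {0<..} t *\<^sub>R bump 1 2 0 t) = 0"
        using has_bochner_integral_integral_eq[OF bi] by simp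
      then have "AE t in lborel. indicat_real {0<..} t *\<^sub>R bump 1 2 0 t = 0"
        using integrable.intros[OF bi] bump_range(1)[of 1 2 0]
        by (subst (asm) integral_nonneg_eq_0_iff_AE) (auto intro!: AE_I2 mult_nonneg_nonneg)
      then show ?thesis by eventually_elim auto
    qed
    then have "AE t in lborel. t \<notin> {1<..<2::real}"
      by eventually_elim (use bump_pos[of 1 _ 2 0] in force)
    then have "emeasure lborel {1<..<2::real} = 0"
      using AE_iff_null_sets[of "{1<..<2::real}" lborel] by auto
    then show False by simp
  qed
  have "test_fun (\<lambda>x. bump 1 2 0 x - (1 - 1/T) * bump 1 2 0 x)" by (rule test_fun_diff_scaled[OF tb tb])
  then have "test_fun (\<lambda>x. (1/T) * bump 1 2 0 x)" by (simp add: algebra_simps)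
  moreover have "has_set_integral {0<..} (\<lambda>x. (1/T) * bump 1 2 0 x) ((1/T) * T)"
    by (rule has_set_integral_linear[OF bounded_linear_mult_right T])
  ultimately show ?thesis using \<open>T \<noteq> 0\<close> by auto
qed

text \<open>
  A test function minus a multiple of a fixed one of mass one is the derivative of a test function,
  so a function with vanishing weak derivative pairs with test functions like a constant.
\<close>

lemma weak_deriv_imp_indef_integral:
  fixes h g :: "real \<Rightarrow> 'a::complex_banach"
  assumes w: "weak_deriv 1 h g" and h: "loc_integrable h"
  shows "\<exists>v. indef_integral v g \<and> (AE t in lborel. 0 < t \<longrightarrow> h t = v t)"
proof -
  obtain v where v: "indef_integral v g"
    using indef_integral_exists[OF weak_deriv_loc_integrable[OF w]] by blast
  define d where "d t = h t - v t" for t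
  have d: "loc_integrable d"
    using h indef_integral_loc_integrable[OF v] unfolding loc_integrable_def d_def
    by (auto intro: set_integrable_on_diff)
  have d0: "has_set_integral {0<..} (\<lambda>t. deriv \<psi> t *\<^sub>R d t) 0" if \<psi>: "test_fun \<psi>" for \<psi>
  proof -
    obtain I where I: "has_set_integral {0<..} (\<lambda>x. deriv \<psi> x *\<^sub>R h x) I"
      "has_set_integral {0<..} (\<lambda>x. \<psi> x *\<^sub>R g x) (- I)"
      using w \<psi> unfolding weak_deriv_iff by fastforce
    obtain J where J: "has_set_integral {0<..} (\<lambda>x. deriv \<psi> x *\<^sub>R v x) J"
      "has_set_integral {0<..} (\<lambda>x. \<psi> x *\<^sub>R g x) (- J)"
      using indef_integral_weak_deriv[OF v] \<psi> unfolding weak_deriv_iff by fastforce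
    have "- I = - J" by (rule has_strong_integral_unique[OF I(2) J(2)])
    then show ?thesis using has_set_integral_diff[OF I(1) J(1)] by (simp add: d_def scaleR_diff_right)
  qed
  obtain \<psi>0 where \<psi>0: "test_fun \<psi>0" "has_set_integral {0<..} \<psi>0 (1::real)" using test_fun_unit_mass by blast
  obtain c where c: "has_set_integral {0<..} (\<lambda>t. \<psi>0 t *\<^sub>R d t) c"
    using test_fun_integrable[OF d \<psi>0(1)] unfolding set_integrable_on_def by blast
  have "AE t in lborel. 0 < t \<longrightarrow> d t - c = 0"
  proof (rule fundamental_lemma)
    have "loc_integrable (\<lambda>t. c)"
      unfolding loc_integrable_def by (intro allI impI set_integrable_on_continuous) auto
    then show "loc_integrable (\<lambda>t. d t - c)"
      using d unfolding loc_integrable_def by (auto intro: set_integrable_on_diff)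
    fix \<phi> assume \<phi>: "test_fun \<phi>"
    obtain T where T: "has_set_integral {0<..} \<phi> T"
      using test_fun_has_integral[OF \<phi>] by blast
    define \<rho> where "\<rho> x = \<phi> x - T * \<psi>0 x" for x
    have \<rho>: "test_fun \<rho>" unfolding \<rho>_def by (rule test_fun_diff_scaled[OF \<phi> \<psi>0(1)])
    obtain \<Psi> S a b where \<Psi>: "0 < a" "a < b" "\<And>x. (\<Psi> has_real_derivative \<rho> x) (at x)"
      "\<And>x. x < a \<Longrightarrow> \<Psi> x = 0" "\<And>x. b < x \<Longrightarrow> \<Psi> x = S" "has_set_integral {0<..} \<rho> S"
      using test_fun_total_integral[OF \<rho>] by blast
    have "has_set_integral {0<..} \<rho> (T - T * 1)"
      unfolding \<rho>_def
      by (intro has_set_integral_diff T has_set_integral_linear[OF bounded_linear_mult_right \<psi>0(2)])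
    then have "S = 0" using has_strong_integral_unique[OF \<Psi>(6)] by fastforce
    then have supp: "\<And>x. x \<notin> {a..b} \<Longrightarrow> \<Psi> x = 0" using \<Psi>(4,5) by force
    have "has_set_integral {0<..} (\<lambda>t. \<rho> t *\<^sub>R d t) 0"
      using d0[OF test_fun_primitive(1)[OF \<rho> \<Psi>(3) \<Psi>(1) supp]]
        test_fun_primitive(2)[OF \<rho> \<Psi>(3) \<Psi>(1) supp] by simp
    from has_set_integral_add[OF this has_set_integral_linear[OF bounded_linear_scaleR_right c, of T]]
    have 1: "has_set_integral {0<..} (\<lambda>t. \<phi> t *\<^sub>R d t) (T *\<^sub>R c)"
      by (simp add: \<rho>_def algebra_simps)
    have 2: "has_set_integral {0<..} (\<lambda>t. \<phi> t *\<^sub>R c) (T *\<^sub>R c)"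
      by (rule has_set_integral_linear[OF bounded_linear_scaleR_left T])
    show "has_set_integral {0<..} (\<lambda>t. \<phi> t *\<^sub>R (d t - c)) 0"
      using has_set_integral_diff[OF 1 2] by (simp add: scaleR_diff_right)
  qed
  then have "AE t in lborel. 0 < t \<longrightarrow> h t = v t + c"
    by eventually_elim (simp add: d_def algebra_simps)
  then show ?thesis using indef_integral_shift[OF v, of c] by blast
qed

text \<open>
  The continuous representatives of a Sobolev function and its derivatives: each is the
  indefinite integral of the next.
\<close>

definition Sobolev_chain :: "nat \<Rightarrow> real \<Rightarrow> real \<Rightarrow> (nat \<Rightarrow> real \<Rightarrow> 'a::real_normed_vector) \<Rightarrow> bool" where
  "Sobolev_chain k p \<gamma> F \<longleftrightarrow> (\<forall>i<k. indef_integral (F i) (F (Suc i))) \<and> (\<forall>i\<le>k. F i \<in> Lp (weighted \<gamma>) p)"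

lemma Sobolev_chain_weak_deriv:
  fixes F :: "nat \<Rightarrow> real \<Rightarrow> 'a::complex_banach"
  assumes p: "1 \<le> p" and F: "Sobolev_chain k p \<gamma> F" and "i + j \<le> k"
  shows "weak_deriv j (F i) (F (i + j))"
  using assms(3)
proof (induction j)
  case 0
  then show ?case
    using Lp_weighted_loc_integrable[OF p, of "F i" \<gamma>] F by (auto simp: Sobolev_chain_def intro!: weak_deriv_0)
next
  case (Suc j)
  have "weak_deriv 1 (F (i + j)) (F (Suc (i + j)))"
    using F Suc.prems by (intro indef_integral_weak_deriv) (auto simp: Sobolev_chain_def)
  then show ?case using weak_deriv_trans[OF Suc.IH, of 1] Suc.prems by simp
qed

lemma Sobolev_chain_exists:
  fixes f :: "real \<Rightarrow> 'a::complex_banach"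
  assumes p: "1 \<le> p" and f: "f \<in> Sobolev k p \<gamma>"
  shows "\<exists>F. Sobolev_chain k p \<gamma> F \<and> (AE t in lborel. 0 < t \<longrightarrow> f t = F 0 t) \<and>
    (\<forall>i\<le>k. weak_deriv i f (F i))"
proof -
  obtain g where g: "\<And>j. j \<le> k \<Longrightarrow> g j \<in> Lp (weighted \<gamma>) p" "\<And>j. j \<le> k \<Longrightarrow> weak_deriv j f (g j)"
    using f unfolding Sobolev_def by (simp, metis)
  have "\<exists>v. indef_integral v (g (Suc i)) \<and> (AE t in lborel. 0 < t \<longrightarrow> g i t = v t)" if "i < k" for i
    by (intro weak_deriv_imp_indef_integral weak_deriv_Suc_imp[of i f]
        Lp_weighted_loc_integrable[OF p, where \<gamma>=\<gamma>] g) (use that in auto)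
  then obtain v where v: "\<And>i. i < k \<Longrightarrow> indef_integral (v i) (g (Suc i))"
    "\<And>i. i < k \<Longrightarrow> AE t in lborel. 0 < t \<longrightarrow> g i t = v i t" by metis
  define F where "F i = (if i < k then v i else g i)" for i
  have gF: "AE t in lborel. 0 < t \<longrightarrow> g i t = F i t" for i using v(2)[of i] by (auto simp: F_def)
  have "indef_integral (F i) (F (Suc i))" if "i < k" for i
    using indef_integral_cong_AE[OF v(1)[OF that] gF] that by (simp add: F_def)
  moreover have "F i \<in> Lp (weighted \<gamma>) p" if "i \<le> k" for i
    by (rule Lp_weighted_cong_AE[OF g(1)[OF that] gF])
  moreover have wd: "weak_deriv i f (F i)" if "i \<le> k" for i
    by (rule weak_deriv_cong_AE[OF g(2)[OF that] _ gF]) simp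
  moreover have "AE t in lborel. 0 < t \<longrightarrow> f t = F 0 t" by (rule weak_deriv_0_AE[OF wd]) simp
  ultimately show ?thesis unfolding Sobolev_chain_def by blast
qed

lemma Sobolev_chain_imp_Sobolev:
  fixes F :: "nat \<Rightarrow> real \<Rightarrow> 'a::complex_banach"
  assumes "1 \<le> p" "Sobolev_chain k p \<gamma> F"
  shows "F 0 \<in> Sobolev k p \<gamma>"
  using Sobolev_chain_weak_deriv[OF assms, of 0] assms(2) unfolding Sobolev_def Sobolev_chain_def by auto

lemma Lp_norm_cong_AE:
  assumes "AE t in lborel. 0 < t \<longrightarrow> f t = g t"
  shows "Lp_norm (weighted \<gamma>) p f = Lp_norm (weighted \<gamma>) p g"
proof -
  have "(\<integral>\<^sup>+x. ennreal (norm (f x) powr p) \<partial>weighted \<gamma>) = (\<integral>\<^sup>+x. ennreal (norm (g x) powr p) \<partial>weighted \<gamma>)"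
  proof (rule nn_integral_cong_AE)
    show "AE x in weighted \<gamma>. ennreal (norm (f x) powr p) = ennreal (norm (g x) powr p)"
      unfolding AE_weighted using assms by eventually_elim auto
  qed
  then show ?thesis by (simp add: Lp_norm_def)
qed

lemma Sobolev_norm_eq:
  fixes f :: "real \<Rightarrow> 'a::complex_banach"
  assumes "\<And>i. i \<le> k \<Longrightarrow> weak_deriv i f (F i)"
  shows "Sobolev_norm k p \<gamma> f = (\<Sum>i\<le>k. Lp_norm (weighted \<gamma>) p (F i))"
  unfolding Sobolev_norm_def by (intro sum.cong refl Lp_norm_cong_AE wderiv_eq_AE assms) simp

lemma continuous_AE_eq:
  fixes f g :: "real \<Rightarrow> 'a::real_normed_vector"
  assumes f: "continuous_on {0<..} f" and g: "continuous_on {0<..} g"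
    and ae: "AE t in lborel. 0 < t \<longrightarrow> f t = g t" and x: "0 < x"
  shows "f x = g x"
proof (rule ccontr)
  assume ne: "f x \<noteq> g x"
  have "continuous (at x) (\<lambda>t. norm (f t - g t))"
    using f g x by (intro continuous_intros) (auto simp: continuous_on_eq_continuous_at)
  then have "eventually (\<lambda>t. 0 < norm (f t - g t)) (at x)"
    using order_tendstoD(1)[of "\<lambda>t. norm (f t - g t)" _ "at x" 0] ne by (simp add: continuous_at)
  then obtain e where e: "0 < e" "\<And>t. t \<noteq> x \<Longrightarrow> dist t x < e \<Longrightarrow> f t \<noteq> g t"
    by (auto simp: eventually_at)
  have "AE t in lborel. t \<notin> {x<..<x + e}"
    using ae by eventually_elim (use e(2) x in \<open>force simp: dist_real_def\<close>)
  then have "emeasure lborel {x<..<x + e} = 0"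
    using AE_iff_null_sets[of "{x<..<x + e}" lborel] by auto
  then show False using e(1) by simp
qed

text \<open>
  The representative that is continuous up to the origin must agree with \<open>F\<close> on the open
  half-line.
\<close>

lemma has_trace_zero_iff:
  fixes f F :: "real \<Rightarrow> 'a::real_normed_vector"
  assumes F: "continuous_on {0<..} F" and ae: "AE t in lborel. 0 < t \<longrightarrow> f t = F t"
  shows "has_trace f 0 \<longleftrightarrow> (F \<longlongrightarrow> 0) (at_right 0)"
proof
  assume "has_trace f 0"
  then obtain g where g: "continuous_on {0..} g" "AE x in lborel. 0 < x \<longrightarrow> f x = g x" "g 0 = 0"
    unfolding has_trace_def AE_halfline by blast
  have Fg: "AE x in lborel. 0 < x \<longrightarrow> F x = g x" using g(2) ae by eventually_elim simp
  have eq: "F x = g x" if "0 < x" for x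
    by (rule continuous_AE_eq[OF F continuous_on_subset[OF g(1)] Fg that]) auto
  have "(g \<longlongrightarrow> g 0) (at 0 within {0..})" using g(1) by (auto simp: continuous_on_def)
  then have "(g \<longlongrightarrow> 0) (at_right 0)"
    unfolding g(3) by (rule tendsto_within_subset) auto
  then show "(F \<longlongrightarrow> 0) (at_right 0)"
    by (rule Lim_transform_eventually) (auto simp: eq eventually_at_filter)
next
  assume l: "(F \<longlongrightarrow> 0) (at_right 0)"
  define g where "g x = (if 0 < x then F x else 0)" for x :: real
  have "continuous_on {0..} g"
    unfolding continuous_on_def
  proof
    fix x :: real assume "x \<in> {0..}"
    show "(g \<longlongrightarrow> g x) (at x within {0..})"
    proof (cases "x = 0")
      case True
      have "(g \<longlongrightarrow> 0) (at_right 0)"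
        by (rule Lim_transform_eventually[OF l]) (auto simp: g_def eventually_at_filter)
      moreover have "at 0 within {0..} = at_right (0::real)"
        unfolding at_within_def by (rule arg_cong2[where f=inf]) auto
      ultimately show ?thesis using True by (simp add: g_def)
    next
      case False
      then have x: "0 < x" using \<open>x \<in> {0..}\<close> by simp
      have "(F \<longlongrightarrow> F x) (at x)" using F x by (auto simp: continuous_on_eq_continuous_at isCont_def)
      then have "(g \<longlongrightarrow> F x) (at x)"
        by (rule Lim_transform_within_open[where s="{0<..}"]) (use x in \<open>auto simp: g_def\<close>)
      then show ?thesis using x by (auto simp: g_def intro: tendsto_within_subset)
    qed
  qed
  moreover have "AE x in halfline. f x = g x"
    unfolding AE_halfline using ae by eventually_elim (simp add: g_def)
  ultimately show "has_trace f 0" unfolding has_trace_def by (intro exI[of _ g]) (auto simp: g_def)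
qed

section \<open>Weighted estimates for exponential kernels\<close>

lemma ennreal_le_smallI:
  fixes X :: ennreal
  assumes "\<And>e. 0 < e \<Longrightarrow> X \<le> ennreal (e * K)" "0 \<le> K"
  shows "X = 0"
proof -
  have small: "X \<le> 0 + ennreal e" if "0 < e" for e
  proof -
    have "X \<le> ennreal (e / (K + 1) * K)" using assms that by (intro assms(1)) auto
    also have "\<dots> \<le> ennreal e"
      using assms(2) that by (intro ennreal_leI) (simp add: field_simps)
    finally show ?thesis by simp
  qed
  have "X \<le> 0" by (rule ennreal_le_epsilon, rule small, simp)
  then show ?thesis by simp
qed

text \<open>
  Hoelder's inequality up to a factor 2, by splitting at the level \<open>(B / K) powr (1 / p)\<close>
  of \<open>h\<close>: below it \<open>h\<close> is bounded, above it \<open>h\<close> is dominated by its power.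
\<close>

lemma weighted_holder:
  fixes k h :: "'b \<Rightarrow> real"
  assumes p: "1 < p" and [measurable]: "k \<in> borel_measurable M" "h \<in> borel_measurable M"
    and k0: "\<And>x. 0 \<le> k x" and h0: "\<And>x. 0 \<le> h x"
    and K: "(\<integral>\<^sup>+x. ennreal (k x) \<partial>M) \<le> ennreal K" "0 < K"
    and B: "(\<integral>\<^sup>+x. ennreal (k x * h x powr p) \<partial>M) \<le> ennreal B" "0 \<le> B"
  shows "(\<integral>\<^sup>+x. ennreal (k x * h x) \<partial>M) \<le> ennreal (2 * K powr (1 - 1/p) * B powr (1/p))"
proof -
  have level: "(\<integral>\<^sup>+x. ennreal (k x * h x) \<partial>M) \<le> ennreal (A * K + A powr (1 - p) * B)" if A: "0 < A" for A
  proof -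
    have pt: "h x \<le> A + A powr (1 - p) * h x powr p" for x
    proof (cases "h x \<le> A")
      case True
      then show ?thesis by (simp add: add_increasing2)
    next
      case False
      then have hx: "0 < h x" using A by simp
      have "h x powr (1 - p) \<le> A powr (1 - p)" using False A p by (intro powr_mono2') auto
      then have "h x powr (1 - p) * h x powr p \<le> A powr (1 - p) * h x powr p" by (intro mult_right_mono) auto
      moreover have "h x powr (1 - p) * h x powr p = h x" using hx by (simp flip: powr_add)
      ultimately show ?thesis using A by linarith
    qed
    have "(\<integral>\<^sup>+x. ennreal (k x * h x) \<partial>M)
      \<le> (\<integral>\<^sup>+x. ennreal A * ennreal (k x) + ennreal (A powr (1 - p)) * ennreal (k x * h x powr p) \<partial>M)"
    proof (rule nn_integral_mono)
      fix x
      have "k x * h x \<le> k x * (A + A powr (1 - p) * h x powr p)" by (intro mult_left_mono pt k0)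
      then have "ennreal (k x * h x) \<le> ennreal (A * k x + A powr (1 - p) * (k x * h x powr p))"
        by (intro ennreal_leI) (simp add: algebra_simps)
      also have "\<dots> = ennreal A * ennreal (k x) + ennreal (A powr (1 - p)) * ennreal (k x * h x powr p)"
        using A k0[of x] by (simp add: ennreal_mult' ennreal_plus)
      finally show "ennreal (k x * h x) \<le> ennreal A * ennreal (k x) + ennreal (A powr (1 - p)) * ennreal (k x * h x powr p)" .
    qed
    also have "\<dots> = ennreal A * (\<integral>\<^sup>+x. ennreal (k x) \<partial>M)
        + ennreal (A powr (1 - p)) * (\<integral>\<^sup>+x. ennreal (k x * h x powr p) \<partial>M)"
      by (subst nn_integral_add) (auto simp: nn_integral_cmult)
    also have "\<dots> \<le> ennreal A * ennreal K + ennreal (A powr (1 - p)) * ennreal B"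
      by (intro add_mono mult_left_mono K(1) B(1)) auto
    also have "\<dots> = ennreal (A * K + A powr (1 - p) * B)"
      using A K B by (simp add: ennreal_mult' ennreal_plus)
    finally show ?thesis .
  qed
  show ?thesis
  proof (cases "B = 0")
    case True
    have "(\<integral>\<^sup>+x. ennreal (k x * h x) \<partial>M) = 0"
      by (rule ennreal_le_smallI[where K=K]) (use level K True in auto)
    then show ?thesis by simp
  next
    case False
    then have B0: "0 < B" using B by simp
    define A where "A = (B / K) powr (1/p)"
    have A: "0 < A" using B0 K by (simp add: A_def)
    have "A * K = K powr (1 - 1/p) * B powr (1/p)"
      using B0 K by (simp add: A_def powr_divide powr_diff)
    moreover have "A powr (1 - p) * B = K powr (1 - 1/p) * B powr (1/p)"
    proof -
      have e: "1 / p * (1 - p) = 1/p - 1" using p by (simp add: field_simps)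
      have "A powr (1 - p) = (B / K) powr (1/p - 1)" unfolding A_def by (simp only: powr_powr e)
      also have "\<dots> = B powr (1/p) / B / (K powr (1/p) / K)"
        using B0 K by (simp add: powr_divide powr_diff)
      finally show ?thesis using B0 K by (simp add: powr_diff)
    qed
    ultimately have "A * K + A powr (1 - p) * B = 2 * K powr (1 - 1/p) * B powr (1/p)" by simp
    then show ?thesis using level[OF A] by (simp only:)
  qed
qed

text \<open>Hoelder's inequality in the form used for the rows of a kernel in Schur's test.\<close>

lemma weighted_jensen:
  fixes k h :: "'b \<Rightarrow> real"
  assumes p: "1 < p" and [measurable]: "k \<in> borel_measurable M" "h \<in> borel_measurable M"
    and k0: "\<And>x. 0 \<le> k x" and h0: "\<And>x. 0 \<le> h x"
    and K: "(\<integral>\<^sup>+x. ennreal (k x) \<partial>M) \<le> ennreal K" "0 < K"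
    and w: "0 \<le> w" "ennreal w \<le> (\<integral>\<^sup>+x. ennreal (k x * h x) \<partial>M)"
  shows "ennreal (w powr p) \<le> ennreal (2 powr p * K powr (p - 1)) * (\<integral>\<^sup>+x. ennreal (k x * h x powr p) \<partial>M)"
proof (cases "\<integral>\<^sup>+x. ennreal (k x * h x powr p) \<partial>M" rule: ennreal_cases)
  case (real B)
  have "(\<integral>\<^sup>+x. ennreal (k x * h x) \<partial>M) \<le> ennreal (2 * K powr (1 - 1/p) * B powr (1/p))"
    by (rule weighted_holder[OF assms(1-7)]) (use real in auto)
  with w(2) have "ennreal w \<le> ennreal (2 * K powr (1 - 1/p) * B powr (1/p))" by (rule order_trans)
  then have "w \<le> 2 * K powr (1 - 1/p) * B powr (1/p)" by (subst (asm) ennreal_le_iff) auto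
  then have "w powr p \<le> (2 * K powr (1 - 1/p) * B powr (1/p)) powr p"
    using p w(1) by (intro powr_mono2) auto
  also have "\<dots> = 2 powr p * K powr (p - 1) * B"
  proof -
    have "(1 - 1/p) * p = p - 1" using p by (simp add: field_simps)
    then show ?thesis using p real by (simp add: powr_mult powr_powr)
  qed
  finally show ?thesis using real by (simp flip: ennreal_mult add: ennreal_leI)
next
  case top
  then show ?thesis using K(2) by (simp add: ennreal_mult_top)
qed

text \<open>
  Schur's test: row sums of the kernel, together with column sums against the weight,
  bound the operator on the weighted space. The function \<open>z\<close> absorbs boundary terms.
\<close>

lemma schur_test:
  fixes k :: "real \<Rightarrow> real \<Rightarrow> real" and h z v :: "real \<Rightarrow> real"
  assumes p: "1 < p" and km[measurable]: "(\<lambda>(x, y). k x y) \<in> borel_measurable (borel \<Otimes>\<^sub>M borel)"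
    and k0: "\<And>x y. 0 \<le> k x y"
    and h[measurable]: "h \<in> borel_measurable borel" and h0: "\<And>y. 0 \<le> h y"
    and z[measurable]: "z \<in> borel_measurable borel" and z0: "\<And>x. 0 \<le> z x" and v0: "\<And>x. 0 \<le> v x"
    and row: "\<And>x. 0 < x \<Longrightarrow> (\<integral>\<^sup>+y. ennreal (k x y) \<partial>lborel) \<le> ennreal K1" and K1: "0 < K1" and K2: "0 \<le> K2"
    and col: "\<And>y. (nnint {0<..} (\<lambda>x. k x y * x powr \<gamma>)) \<le> ennreal (K2 * y powr \<gamma>) * indicator {0<..} y"
    and bound: "\<And>x. 0 < x \<Longrightarrow> ennreal (v x) \<le> ennreal (z x) + (\<integral>\<^sup>+y. ennreal (k x y * h y) \<partial>lborel)"
  shows "weighted_power p \<gamma> v \<le> ennreal (2 powr p) * weighted_power p \<gamma> z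
    + ennreal (4 powr p * K1 powr (p - 1) * K2) * weighted_power p \<gamma> h"
proof -
  let ?I = "\<lambda>x. \<integral>\<^sup>+y. ennreal (k x y * h y powr p) \<partial>lborel"
  have [measurable]: "(\<lambda>(x, y). ennreal (k x y * h y powr p)) \<in> borel_measurable (lborel \<Otimes>\<^sub>M lborel)"
    using km by (simp add: split_beta')
  have Im[measurable]: "?I \<in> borel_measurable lborel"
    by (intro lborel.borel_measurable_nn_integral) (simp add: split_beta')
  let ?c = "2 powr p * K1 powr (p - 1)"
  have pt: "ennreal (v x powr p * x powr \<gamma>) * indicator {0<..} x
     \<le> ennreal (2 powr p) * (ennreal (z x powr p * x powr \<gamma>) * indicator {0<..} x)
       + ennreal (2 powr p * ?c) * (ennreal (x powr \<gamma>) * indicator {0<..} x * ?I x)" for x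
  proof (cases "0 < x")
    case True
    define w where "w = max 0 (v x - z x)"
    have "ennreal w \<le> (\<integral>\<^sup>+y. ennreal (k x y * h y) \<partial>lborel)"
    proof (cases "v x \<le> z x")
      case False
      then have "ennreal (z x) + ennreal w = ennreal (v x)"
        using z0[of x] by (simp add: w_def flip: ennreal_plus)
      then have "ennreal (z x) + ennreal w \<le> ennreal (z x) + (\<integral>\<^sup>+y. ennreal (k x y * h y) \<partial>lborel)"
        using bound[OF True] by simp
      then show ?thesis unfolding ennreal_add_left_cancel_le by simp
    qed (simp add: w_def)
    then have w: "ennreal (w powr p) \<le> ennreal ?c * ?I x"
    proof (intro weighted_jensen[OF p])
      show "(\<lambda>y. k x y) \<in> borel_measurable lborel"
        using measurable_compose[OF measurable_Pair1'[of x borel borel] km] by simp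
    qed (use k0 h0 row[OF True] K1 in \<open>auto simp: w_def\<close>)
    have "v x \<le> z x + w" by (simp add: w_def)
    then have "v x powr p \<le> (z x + w) powr p" using v0 p by (intro powr_mono2) auto
    also have "\<dots> \<le> (2 * max (z x) w) powr p" using z0[of x] p by (intro powr_mono2) (auto simp: w_def max_def)
    also have "\<dots> = 2 powr p * max (z x) w powr p" using z0[of x] by (simp add: powr_mult)
    also have "max (z x) w powr p \<le> z x powr p + w powr p" by (simp add: max_def)
    finally have "v x powr p \<le> 2 powr p * z x powr p + 2 powr p * w powr p" by (simp add: distrib_left)
    then have "ennreal (v x powr p) \<le> ennreal (2 powr p * z x powr p + 2 powr p * w powr p)" by (rule ennreal_leI)
    also have "\<dots> = ennreal (2 powr p) * ennreal (z x powr p) + ennreal (2 powr p) * ennreal (w powr p)"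
      by (simp add: ennreal_plus ennreal_mult')
    also have "\<dots> \<le> ennreal (2 powr p) * ennreal (z x powr p) + ennreal (2 powr p) * (ennreal ?c * ?I x)"
      by (intro add_left_mono mult_left_mono w) auto
    finally have "ennreal (v x powr p) * ennreal (x powr \<gamma>)
       \<le> (ennreal (2 powr p) * ennreal (z x powr p) + ennreal (2 powr p) * (ennreal ?c * ?I x)) * ennreal (x powr \<gamma>)"
      by (intro mult_right_mono) auto
    then show ?thesis using True by (simp add: ennreal_mult distrib_right distrib_left mult_ac)
  qed simp
  have "weighted_power p \<gamma> v \<le> (\<integral>\<^sup>+x. ennreal (2 powr p) * (ennreal (z x powr p * x powr \<gamma>) * indicator {0<..} x)
       + ennreal (2 powr p * ?c) * (ennreal (x powr \<gamma>) * indicator {0<..} x * ?I x) \<partial>lborel)"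
    unfolding weighted_power_def using v0 by (intro nn_integral_mono) (use pt in simp)
  also have "\<dots> = ennreal (2 powr p) * weighted_power p \<gamma> z
       + ennreal (2 powr p * ?c) * (\<integral>\<^sup>+x. ennreal (x powr \<gamma>) * indicator {0<..} x * ?I x \<partial>lborel)"
    using z0 by (subst nn_integral_add) (auto simp: nn_integral_cmult weighted_power_def)
  also have "(\<integral>\<^sup>+x. ennreal (x powr \<gamma>) * indicator {0<..} x * ?I x \<partial>lborel)
      = (\<integral>\<^sup>+x. \<integral>\<^sup>+y. ennreal (x powr \<gamma>) * indicator {0<..} x * ennreal (k x y * h y powr p) \<partial>lborel \<partial>lborel)"
  proof (rule nn_integral_cong)
    fix x
    have "(\<lambda>y. ennreal (k x y * h y powr p)) \<in> borel_measurable lborel"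
      using measurable_compose[OF _ km[unfolded split_beta'], of "\<lambda>y. (x, y)" borel] by simp
    then show "ennreal (x powr \<gamma>) * indicator {0<..} x * ?I x
       = (\<integral>\<^sup>+y. ennreal (x powr \<gamma>) * indicator {0<..} x * ennreal (k x y * h y powr p) \<partial>lborel)"
      by (rule nn_integral_cmult[symmetric])
  qed
  also have "\<dots> = (\<integral>\<^sup>+y. \<integral>\<^sup>+x. ennreal (x powr \<gamma>) * indicator {0<..} x * ennreal (k x y * h y powr p) \<partial>lborel \<partial>lborel)"
    by (rule lborel_pair.Fubini') measurable
  also have "\<dots> \<le> (\<integral>\<^sup>+y. ennreal K2 * (ennreal (h y powr p * y powr \<gamma>) * indicator {0<..} y) \<partial>lborel)"
  proof (rule nn_integral_mono)
    fix y
    have m: "(\<lambda>x. ennreal (k x y * x powr \<gamma>) * indicator {0<..} x) \<in> borel_measurable lborel"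
      using measurable_compose[OF _ km[unfolded split_beta'], of "\<lambda>x. (x, y)" borel] by simp
    have "(\<integral>\<^sup>+x. ennreal (x powr \<gamma>) * indicator {0<..} x * ennreal (k x y * h y powr p) \<partial>lborel)
       = (\<integral>\<^sup>+x. ennreal (h y powr p) * (ennreal (k x y * x powr \<gamma>) * indicator {0<..} x) \<partial>lborel)"
      by (intro nn_integral_cong) (auto simp: k0 mult_ac split: split_indicator simp flip: ennreal_mult)
    also have "\<dots> = ennreal (h y powr p) * nnint {0<..} (\<lambda>x. k x y * x powr \<gamma>)"
      by (rule nn_integral_cmult[OF m])
    also have "\<dots> \<le> ennreal (h y powr p) * (ennreal (K2 * y powr \<gamma>) * indicator {0<..} y)"
      by (intro mult_left_mono col) auto
    also have "\<dots> = ennreal K2 * (ennreal (h y powr p * y powr \<gamma>) * indicator {0<..} y)"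
      using K2 by (simp add: ennreal_mult mult_ac)
    finally show "(\<integral>\<^sup>+x. ennreal (x powr \<gamma>) * indicator {0<..} x * ennreal (k x y * h y powr p) \<partial>lborel)
      \<le> ennreal K2 * (ennreal (h y powr p * y powr \<gamma>) * indicator {0<..} y)" .
  qed
  also have "\<dots> = ennreal K2 * weighted_power p \<gamma> h"
    using h0 by (simp add: nn_integral_cmult weighted_power_def)
  also have "ennreal (2 powr p * ?c) * (ennreal K2 * weighted_power p \<gamma> h)
      = ennreal (4 powr p * K1 powr (p - 1) * K2) * weighted_power p \<gamma> h"
  proof -
    have "(4::real) powr p = 2 powr p * 2 powr p" by (simp flip: powr_mult)
    then have eq: "4 powr p * K1 powr (p - 1) * K2 = 2 powr p * ?c * K2" by simp
    show ?thesis unfolding eq using K2 by (simp add: ennreal_mult mult.assoc)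
  qed
  finally show ?thesis by (simp add: mult_left_mono add_left_mono)
qed

text \<open>
  Powers grow slower than exponentials: \<open>y / x \<le> (1 + 1 / (a * x)) * (1 + a * (y - x))\<close>, and the
  exponential absorbs any power of the second factor.
\<close>

lemma powr_growth:
  fixes \<gamma> :: real
  shows "\<exists>D\<ge>1. \<forall>a x y. 0 < a \<longrightarrow> 0 < x \<longrightarrow> x \<le> y \<longrightarrow>
    y powr \<gamma> \<le> D * (1 + 1 / (a * x)) powr \<bar>\<gamma>\<bar> * x powr \<gamma> * exp (a * (y - x) / 2)"
proof -
  define N where "N = nat \<lceil>\<bar>\<gamma>\<bar>\<rceil> + 1"
  define D where "D = (2 * real N) ^ N * exp (1/2)"
  have D1: "1 \<le> D"
  proof -
    have "1 \<le> (2 * real N) ^ N" by (intro one_le_power) (simp add: N_def)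
    moreover have "1 \<le> exp (1/2::real)" by simp
    ultimately show ?thesis unfolding D_def using mult_mono[of 1 _ 1] by fastforce
  qed
  have key: "(1 + \<tau>) powr \<bar>\<gamma>\<bar> \<le> D * exp (\<tau> / 2)" if "0 \<le> \<tau>" for \<tau> :: real
  proof -
    have "(1 + \<tau>) powr \<bar>\<gamma>\<bar> \<le> (1 + \<tau>) powr real N"
      using that by (intro powr_mono) (auto simp: N_def, linarith)
    also have "\<dots> = 2 ^ N * ((1 + \<tau>) / 2) ^ N"
      using that by (simp add: powr_realpow power_divide)
    also have "\<dots> \<le> 2 ^ N * (real N ^ N * exp ((1 + \<tau>) / 2))"
      using that by (intro mult_left_mono power_le_exp) (auto simp: N_def)
    also have "\<dots> = D * exp (\<tau> / 2)"
      by (simp add: D_def power_mult_distrib add_divide_distrib exp_add)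
    finally show ?thesis .
  qed
  have "y powr \<gamma> \<le> D * (1 + 1 / (a * x)) powr \<bar>\<gamma>\<bar> * x powr \<gamma> * exp (a * (y - x) / 2)"
    if a: "0 < a" and x: "0 < x" "x \<le> y" for a x y
  proof -
    define \<tau> where "\<tau> = a * (y - x)"
    have \<tau>: "0 \<le> \<tau>" using a x by (simp add: \<tau>_def)
    have "y / x = 1 + \<tau> / (a * x)" using a x by (simp add: \<tau>_def field_simps)
    also have "\<dots> \<le> (1 + 1 / (a * x)) * (1 + \<tau>)" using \<tau> a x by (simp add: field_simps)
    finally have yx: "y / x \<le> (1 + 1 / (a * x)) * (1 + \<tau>)" .
    have "(y / x) powr \<gamma> \<le> (y / x) powr \<bar>\<gamma>\<bar>" using x by (intro powr_mono) auto
    also have "\<dots> \<le> ((1 + 1 / (a * x)) * (1 + \<tau>)) powr \<bar>\<gamma>\<bar>"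
      using x by (intro powr_mono2 yx) auto
    also have "\<dots> = (1 + 1 / (a * x)) powr \<bar>\<gamma>\<bar> * (1 + \<tau>) powr \<bar>\<gamma>\<bar>"
      using a x \<tau> by (simp add: powr_mult)
    also have "\<dots> \<le> (1 + 1 / (a * x)) powr \<bar>\<gamma>\<bar> * (D * exp (\<tau> / 2))"
      using key[OF \<tau>] by (intro mult_left_mono) auto
    finally have "(y / x) powr \<gamma> * x powr \<gamma> \<le> (1 + 1 / (a * x)) powr \<bar>\<gamma>\<bar> * (D * exp (\<tau> / 2)) * x powr \<gamma>"
      by (intro mult_right_mono) auto
    moreover have "(y / x) powr \<gamma> * x powr \<gamma> = y powr \<gamma>" using x by (simp add: powr_divide)
    ultimately show ?thesis by (simp add: \<tau>_def mult_ac)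
  qed
  then show ?thesis using D1 by blast
qed

lemma nn_integral_exp_tail:
  assumes "0 < (a::real)"
  shows "nnint {x<..} (\<lambda>y. exp (- a * (y - x))) \<le> ennreal (1 / a)"
proof -
  have "nnint {x<..} (\<lambda>y. exp (- a * (y - x)))
    \<le> nnint {x..} (\<lambda>y. exp (- a * y) * exp (a * x))"
    by (intro nn_integral_mono) (auto split: split_indicator intro!: ennreal_leI simp: algebra_simps simp flip: exp_add)
  also have "\<dots> = ennreal (exp (- a * x) / a * exp (a * x))"
    by (rule nn_integral_has_integral_lebesgue'[OF _ has_integral_mult_left[OF has_integral_exp_minus_to_infinity[OF assms]]]) auto
  also have "exp (- a * x) / a * exp (a * x) = 1 / a" by (simp flip: exp_add)
  finally show ?thesis .
qed

lemma nn_integral_exp_head: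
  assumes "0 < (a::real)"
  shows "nnint {c<..<x} (\<lambda>y. exp (- a * (x - y))) \<le> ennreal (1 / a)"
proof (cases "c \<le> x")
  case True
  have "nnint {c<..<x} (\<lambda>y. exp (- a * (x - y)))
    \<le> nnint {c..x} (\<lambda>y. exp (- a * (x - y)))"
    by (intro nn_integral_mono) (auto split: split_indicator)
  also have "\<dots> = ennreal (exp (- a * (x - x)) / a - exp (- a * (x - c)) / a)"
  proof (rule nn_integral_has_integral_lebesgue')
    show "((\<lambda>y. exp (- a * (x - y))) has_integral exp (- a * (x - x)) / a - exp (- a * (x - c)) / a) {c..x}"
      by (rule fundamental_theorem_of_calculus[OF True])
         (use assms in \<open>auto intro!: derivative_eq_intros simp flip: has_real_derivative_iff_has_vector_derivative\<close>)
  qed simp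
  also have "\<dots> \<le> ennreal (1 / a)" using assms by (intro ennreal_leI) simp
  finally show ?thesis .
next
  case False
  then show ?thesis by simp
qed

lemma nn_integral_powr_head:
  assumes "-1 < \<sigma>" "0 \<le> d"
  shows "nnint {0<..d} (\<lambda>t. t powr \<sigma>) \<le> ennreal (d powr (\<sigma> + 1) / (\<sigma> + 1))"
proof -
  have "nnint {0<..d} (\<lambda>t. t powr \<sigma>) \<le> nnint {0..d} (\<lambda>t. t powr \<sigma>)"
    by (intro nn_integral_mono) (auto split: split_indicator)
  also have "\<dots> = ennreal (d powr (\<sigma> + 1) / (\<sigma> + 1))"
    by (rule nn_integral_has_integral_lebesgue'[OF _ has_integral_powr_from_0]) (use assms in auto)
  finally show ?thesis .
qed

lemma nn_integral_powr_tail: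
  assumes "\<sigma> < -1" "0 < d"
  shows "nnint {d<..} (\<lambda>t. t powr \<sigma>) \<le> ennreal (d powr (\<sigma> + 1) / (- (\<sigma> + 1)))"
proof -
  have "nnint {d<..} (\<lambda>t. t powr \<sigma>) \<le> nnint {d..} (\<lambda>t. t powr \<sigma>)"
    by (intro nn_integral_mono) (auto split: split_indicator)
  also have "\<dots> = ennreal (- (d powr (\<sigma> + 1)) / (\<sigma> + 1))"
    by (rule nn_integral_has_integral_lebesgue'[OF _ has_integral_powr_to_inf]) (use assms in auto)
  finally show ?thesis by (simp add: minus_divide_left[symmetric] minus_divide_right)
qed

text \<open>
  The kernel looks forward from everywhere and backward only as far as \<open>1 / a\<close>. The factor
  \<open>exp 2\<close> leaves room for the growing exponential \<open>exp (a * (y - x))\<close> as long as \<open>y \<le> 1 / a\<close>.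
  Away from the origin at scale \<open>1 / a\<close> the weight varies slowly, whatever its exponent, and
  near the origin looking forward is harmless as long as the weight is integrable there.
\<close>

definition exp_kernel :: "real \<Rightarrow> real \<Rightarrow> real \<Rightarrow> real" where
  "exp_kernel a x y = exp 2 * exp (- a * (y - x)) * indicat_real {0<..} x * indicat_real {x<..} y
    + exp (- a * (x - y)) * indicat_real {1/a<..} y * indicat_real {y<..} x"

lemma exp_kernel_nonneg: "0 \<le> exp_kernel a x y"
  by (simp add: exp_kernel_def)

lemma exp_kernel_measurable: "(\<lambda>(x, y). exp_kernel a x y) \<in> borel_measurable (borel \<Otimes>\<^sub>M borel)"
proof -
  have "(\<lambda>(x::real, y::real). exp 2 * exp (- a * (y - x)) * (if 0 < x \<and> x < y then 1 else 0)
    + exp (- a * (x - y)) * (if 1/a < y \<and> y < x then 1 else 0)) \<in> borel_measurable (borel \<Otimes>\<^sub>M borel)"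
    by measurable
  also have "(\<lambda>(x::real, y::real). exp 2 * exp (- a * (y - x)) * (if 0 < x \<and> x < y then 1 else 0)
    + exp (- a * (x - y)) * (if 1/a < y \<and> y < x then 1 else 0)) = (\<lambda>(x, y). exp_kernel a x y)"
    by (auto simp: fun_eq_iff exp_kernel_def)
  finally show ?thesis .
qed

lemma exp_kernel_row:
  assumes a: "0 < a"
  shows "(\<integral>\<^sup>+y. ennreal (exp_kernel a x y) \<partial>lborel) \<le> ennreal ((exp 2 + 1) / a)"
proof -
  have "(\<integral>\<^sup>+y. ennreal (exp_kernel a x y) \<partial>lborel)
    \<le> (\<integral>\<^sup>+y. ennreal (exp 2) * (ennreal (exp (- a * (y - x))) * indicator {x<..} y)
        + ennreal (exp (- a * (x - y))) * indicator {1/a<..<x} y \<partial>lborel)"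
    by (intro nn_integral_mono)
       (auto simp: exp_kernel_def ennreal_mult' ennreal_plus split: split_indicator)
  also have "\<dots> = ennreal (exp 2) * nnint {x<..} (\<lambda>y. exp (- a * (y - x)))
      + nnint {1/a<..<x} (\<lambda>y. exp (- a * (x - y)))"
    by (subst nn_integral_add) (auto simp: nn_integral_cmult)
  also have "\<dots> \<le> ennreal (exp 2) * ennreal (1/a) + ennreal (1/a)"
    by (intro add_mono mult_left_mono nn_integral_exp_tail nn_integral_exp_head a) auto
  also have "\<dots> = ennreal ((exp 2 + 1) / a)"
    using a by (simp add: add_divide_distrib flip: ennreal_mult ennreal_plus)
  finally show ?thesis .
qed

text \<open>
  The column is split at \<open>y / 2\<close> and at \<open>y\<close>. Below \<open>y / 2\<close> the kernel is exponentially small and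
  the weight is integrable at the origin; between \<open>y / 2\<close> and \<open>y\<close> the weights are comparable;
  above \<open>y\<close> only the case \<open>1 / a < y\<close> occurs, where the weight grows slowly on the scale \<open>1 / a\<close>.
\<close>

lemma exp_kernel_column:
  assumes g: "-1 < \<gamma>"
  shows "\<exists>K>0. \<forall>a>0. \<forall>y. (nnint {0<..} (\<lambda>x. exp_kernel a x y * x powr \<gamma>))
    \<le> ennreal (K / a * y powr \<gamma>) * indicator {0<..} y"
proof -
  obtain D where D: "1 \<le> D" "\<And>a x y. 0 < a \<Longrightarrow> 0 < x \<Longrightarrow> x \<le> y \<Longrightarrow>
    y powr \<gamma> \<le> D * (1 + 1 / (a * x)) powr \<bar>\<gamma>\<bar> * x powr \<gamma> * exp (a * (y - x) / 2)"
    using powr_growth[of \<gamma>] by blast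
  define E where "E = D * 2 powr \<bar>\<gamma>\<bar>"
  have E: "0 < E" using D(1) by (simp add: E_def)
  have g1: "0 < \<gamma> + 1" using g by simp
  define K where "K = exp 2 * (2 powr \<bar>\<gamma>\<bar> + 2 / (\<gamma> + 1)) + 2 * E"
  have "nnint {0<..} (\<lambda>x. exp_kernel a x y * x powr \<gamma>)
    \<le> ennreal (K / a * y powr \<gamma>) * indicator {0<..} y" if a: "0 < a" for a y
  proof (cases "0 < y")
    case False
    have "1/a > 0" using a by simp
    then have "\<not> 1/a < y" using False by linarith
    then have "ennreal (exp_kernel a x y * x powr \<gamma>) * indicator {0<..} x = 0" for x
      using False by (auto simp: exp_kernel_def split: split_indicator)
    then have "nnint {0<..} (\<lambda>x. exp_kernel a x y * x powr \<gamma>) = nn_integral lborel (\<lambda>x::real. 0)"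
      by (intro nn_integral_cong)
    then show ?thesis by simp
  next
    case True
    let ?f1 = "\<lambda>x. ennreal (2 powr \<bar>\<gamma>\<bar> * y powr \<gamma>) * (ennreal (exp (- a * (y - x))) * indicator {0<..<y} x)"
    let ?f2 = "\<lambda>x. ennreal (exp (- a * y / 2)) * (ennreal (x powr \<gamma>) * indicator {0<..y/2} x)"
    let ?f3 = "\<lambda>x. ennreal (E * y powr \<gamma>) * (ennreal (exp (- (a/2) * (x - y))) * indicator {y<..} x)"
    have pt: "ennreal (exp_kernel a x y * x powr \<gamma>) * indicator {0<..} x
       \<le> ennreal (exp 2) * (?f1 x + ?f2 x) + ?f3 x" for x
    proof -
      consider "x \<le> 0" | "0 < x" "x \<le> y/2" | "0 < x" "y/2 < x" "x < y" | "x = y" | "y < x" by linarith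
      then show ?thesis
      proof cases
        case 1 then show ?thesis by simp
      next
        case 2
        then have xy: "x < y" using True by simp
        have "exp (- a * (y - x)) \<le> exp (- a * y / 2)" using 2 a by (simp add: field_simps)
        then have "ennreal (exp_kernel a x y * x powr \<gamma>) \<le> ennreal (exp 2 * (exp (- a * y / 2) * x powr \<gamma>))"
          using 2 xy by (intro ennreal_leI) (simp add: exp_kernel_def mult_right_mono)
        also have "\<dots> = ennreal (exp 2) * ?f2 x" using 2 by (simp add: ennreal_mult)
        also have "\<dots> \<le> ennreal (exp 2) * (?f1 x + ?f2 x) + ?f3 x"
          by (rule add_increasing2[OF _ mult_left_mono[OF add_increasing[OF _ order_refl]]]) auto
        finally show ?thesis using 2 by simp
      next
        case 3
        have "x powr \<gamma> \<le> 2 powr \<bar>\<gamma>\<bar> * y powr \<gamma>"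
        proof (cases "0 \<le> \<gamma>")
          case True
          have "x powr \<gamma> \<le> y powr \<gamma>" using 3 True by (intro powr_mono2) auto
          also have "\<dots> \<le> 2 powr \<bar>\<gamma>\<bar> * y powr \<gamma>" by (simp add: mult_le_cancel_right1 ge_one_powr_ge_zero)
          finally show ?thesis .
        next
          case False
          have "x powr \<gamma> \<le> (y/2) powr \<gamma>" using 3 False True by (intro powr_mono2') auto
          also have "\<dots> = 2 powr \<bar>\<gamma>\<bar> * y powr \<gamma>"
            using False True by (simp add: powr_divide powr_minus_divide)
          finally show ?thesis .
        qed
        then have "ennreal (exp_kernel a x y * x powr \<gamma>)
            \<le> ennreal (exp 2 * (2 powr \<bar>\<gamma>\<bar> * y powr \<gamma> * exp (- a * (y - x))))"
          using 3 by (intro ennreal_leI) (simp add: exp_kernel_def mult_ac)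
        also have "\<dots> = ennreal (exp 2) * ?f1 x" using 3 by (simp add: ennreal_mult)
        also have "\<dots> \<le> ennreal (exp 2) * (?f1 x + ?f2 x) + ?f3 x"
          by (intro add_increasing2 mult_left_mono) auto
        finally show ?thesis using 3 by simp
      next
        case 4 then show ?thesis by (simp add: exp_kernel_def)
      next
        case 5
        show ?thesis
        proof (cases "1/a < y")
          case False
          then show ?thesis using 5 by (simp add: exp_kernel_def)
        next
          case ay: True
          have "1 / (a * y) \<le> 1" using ay a True by (simp add: field_simps)
          then have "(1 + 1 / (a * y)) powr \<bar>\<gamma>\<bar> \<le> 2 powr \<bar>\<gamma>\<bar>"
            using a True by (intro powr_mono2) auto
          then have "D * (1 + 1 / (a * y)) powr \<bar>\<gamma>\<bar> * y powr \<gamma> * exp (a * (x - y) / 2)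
              \<le> E * y powr \<gamma> * exp (a * (x - y) / 2)"
            unfolding E_def using D(1) by (intro mult_right_mono mult_left_mono) auto
          with D(2)[OF a True, of x] 5 have "x powr \<gamma> \<le> E * y powr \<gamma> * exp (a * (x - y) / 2)"
            by linarith
          then have "exp (- a * (x - y)) * x powr \<gamma> \<le> exp (- a * (x - y)) * (E * y powr \<gamma> * exp (a * (x - y) / 2))"
            by (rule mult_left_mono) simp
          also have "\<dots> = E * y powr \<gamma> * (exp (- a * (x - y)) * exp (a * (x - y) / 2))" by simp
          also have "exp (- a * (x - y)) * exp (a * (x - y) / 2) = exp (- (a/2) * (x - y))"
            by (simp flip: exp_add add: field_simps)
          finally have "ennreal (exp_kernel a x y * x powr \<gamma>) \<le> ennreal (E * y powr \<gamma> * exp (- (a/2) * (x - y)))"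
            using 5 ay by (intro ennreal_leI) (simp add: exp_kernel_def)
          also have "\<dots> = ?f3 x" using 5 E by (simp add: ennreal_mult)
          also have "\<dots> \<le> ennreal (exp 2) * (?f1 x + ?f2 x) + ?f3 x" by (rule add_increasing) auto
          finally show ?thesis using 5 True by simp
        qed
      qed
    qed
    have i1: "(\<integral>\<^sup>+x. ?f1 x \<partial>lborel) \<le> ennreal (2 powr \<bar>\<gamma>\<bar> / a * y powr \<gamma>)"
    proof -
      have "(\<integral>\<^sup>+x. ?f1 x \<partial>lborel)
        = ennreal (2 powr \<bar>\<gamma>\<bar> * y powr \<gamma>) * nnint {0<..<y} (\<lambda>x. exp (- a * (y - x)))"
        by (rule nn_integral_cmult) measurable
      also have "\<dots> \<le> ennreal (2 powr \<bar>\<gamma>\<bar> * y powr \<gamma>) * ennreal (1/a)"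
        by (rule mult_left_mono[OF nn_integral_exp_head[OF a]]) simp
      also have "\<dots> = ennreal (2 powr \<bar>\<gamma>\<bar> / a * y powr \<gamma>)" using a by (simp flip: ennreal_mult)
      finally show ?thesis .
    qed
    have i2: "(\<integral>\<^sup>+x. ?f2 x \<partial>lborel) \<le> ennreal (2 / (\<gamma> + 1) / a * y powr \<gamma>)"
    proof -
      have "(\<integral>\<^sup>+x. ?f2 x \<partial>lborel) \<le> ennreal (exp (- a * y / 2)) * ennreal ((y/2) powr (\<gamma> + 1) / (\<gamma> + 1))"
        using True by (subst nn_integral_cmult) (auto intro!: mult_left_mono nn_integral_powr_head g)
      also have "\<dots> = ennreal (exp (- a * y / 2) * ((y/2) powr (\<gamma> + 1) / (\<gamma> + 1)))"
        using g1 by (simp flip: ennreal_mult)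
      also have "\<dots> \<le> ennreal (2 / (\<gamma> + 1) / a * y powr \<gamma>)"
      proof (rule ennreal_leI)
        have "a * y / 2 \<le> exp (a * y / 2)" using exp_ge_add_one_self[of "a * y / 2"] by linarith
        then have e: "y * exp (- a * y / 2) \<le> 2 / a" using a by (simp add: exp_minus field_simps)
        have "(y/2) powr (\<gamma> + 1) \<le> y powr (\<gamma> + 1)" using True g1 by (intro powr_mono2) auto
        also have "\<dots> = y powr \<gamma> * y" using True by (simp add: powr_add)
        finally have "exp (- a * y / 2) * ((y/2) powr (\<gamma> + 1) / (\<gamma> + 1)) \<le> exp (- a * y / 2) * (y powr \<gamma> * y / (\<gamma> + 1))"
          using g1 by (intro mult_left_mono divide_right_mono) auto
        also have "\<dots> = y * exp (- a * y / 2) * (y powr \<gamma> / (\<gamma> + 1))" by simp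
        also have "\<dots> \<le> 2 / a * (y powr \<gamma> / (\<gamma> + 1))" using g1 by (intro mult_right_mono e) auto
        finally show "exp (- a * y / 2) * ((y/2) powr (\<gamma> + 1) / (\<gamma> + 1)) \<le> 2 / (\<gamma> + 1) / a * y powr \<gamma>"
          by (simp add: field_simps)
      qed
      finally show ?thesis .
    qed
    have i3: "(\<integral>\<^sup>+x. ?f3 x \<partial>lborel) \<le> ennreal (2 * E / a * y powr \<gamma>)"
    proof -
      have "(\<integral>\<^sup>+x. ?f3 x \<partial>lborel) \<le> ennreal (E * y powr \<gamma>) * ennreal (1 / (a/2))"
        using a by (subst nn_integral_cmult) (auto intro!: mult_left_mono nn_integral_exp_tail[of "a/2", simplified])
      also have "\<dots> = ennreal (2 * E / a * y powr \<gamma>)" using a E by (simp flip: ennreal_mult add: mult_ac)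
      finally show ?thesis .
    qed
    have "nnint {0<..} (\<lambda>x. exp_kernel a x y * x powr \<gamma>)
       \<le> (\<integral>\<^sup>+x. ennreal (exp 2) * (?f1 x + ?f2 x) + ?f3 x \<partial>lborel)"
      by (intro nn_integral_mono pt)
    also have "\<dots> = ennreal (exp 2) * ((\<integral>\<^sup>+x. ?f1 x \<partial>lborel) + (\<integral>\<^sup>+x. ?f2 x \<partial>lborel)) + (\<integral>\<^sup>+x. ?f3 x \<partial>lborel)"
      by (simp add: nn_integral_add nn_integral_cmult)
    also have "\<dots> \<le> ennreal (exp 2) * (ennreal (2 powr \<bar>\<gamma>\<bar> / a * y powr \<gamma>) + ennreal (2 / (\<gamma> + 1) / a * y powr \<gamma>))
        + ennreal (2 * E / a * y powr \<gamma>)"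
      by (intro add_mono mult_left_mono i1 i2 i3) auto
    also have "\<dots> = ennreal (exp 2 * (2 powr \<bar>\<gamma>\<bar> / a * y powr \<gamma> + 2 / (\<gamma> + 1) / a * y powr \<gamma>) + 2 * E / a * y powr \<gamma>)"
      using a g1 E by (simp flip: ennreal_mult ennreal_plus)
    also have "exp 2 * (2 powr \<bar>\<gamma>\<bar> / a * y powr \<gamma> + 2 / (\<gamma> + 1) / a * y powr \<gamma>) + 2 * E / a * y powr \<gamma>
        = K / a * y powr \<gamma>"
      by (simp add: K_def add_divide_distrib distrib_left distrib_right)
    finally show ?thesis using True by simp
  qed
  moreover have "0 < K" unfolding K_def using E g1 by (intro add_pos_pos mult_pos_pos) auto
  ultimately show ?thesis by blast
qed

lemma weighted_power_exp:
  assumes g: "-1 < \<gamma>" and p: "1 < p"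
  shows "\<exists>K>0. \<forall>a>0. \<forall>V\<ge>0. weighted_power p \<gamma> (\<lambda>x. V * exp (- a * x)) \<le> ennreal (K * V powr p * a powr (- \<gamma> - 1))"
proof -
  obtain D where D: "1 \<le> D" "\<And>a x y. 0 < a \<Longrightarrow> 0 < x \<Longrightarrow> x \<le> y \<Longrightarrow>
    y powr \<gamma> \<le> D * (1 + 1 / (a * x)) powr \<bar>\<gamma>\<bar> * x powr \<gamma> * exp (a * (y - x) / 2)"
    using powr_growth[of \<gamma>] by blast
  define E where "E = D * 2 powr \<bar>\<gamma>\<bar>"
  have E: "0 < E" using D(1) by (simp add: E_def)
  have g1: "0 < \<gamma> + 1" using g by simp
  define K where "K = 1 / (\<gamma> + 1) + 2 * E"
  have "weighted_power p \<gamma> (\<lambda>x. V * exp (- a * x)) \<le> ennreal (K * V powr p * a powr (- \<gamma> - 1))"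
    if a: "0 < a" and V: "0 \<le> V" for a V
  proof -
    let ?f1 = "\<lambda>x. ennreal (x powr \<gamma>) * indicator {0<..1/a} x"
    let ?f2 = "\<lambda>x. ennreal (E * a powr (- \<gamma>)) * (ennreal (exp (- (a/2) * (x - 1/a))) * indicator {1/a<..} x)"
    have pt: "ennreal (norm (V * exp (- a * x)) powr p * x powr \<gamma>) * indicator {0<..} x
      \<le> ennreal (V powr p) * (?f1 x + ?f2 x)" for x
    proof (cases "0 < x")
      case x: True
      have "exp (- a * x) powr p \<le> exp (- a * x) powr 1"
        using p a x by (intro powr_mono') auto
      then have e: "norm (V * exp (- a * x)) powr p \<le> V powr p * exp (- a * x)"
        using V by (simp add: powr_mult abs_mult mult_left_mono)
      show ?thesis
      proof (cases "x \<le> 1/a")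
        case True
        have "V powr p * exp (- a * x) \<le> V powr p * 1" using a x by (intro mult_left_mono) auto
        with e have "norm (V * exp (- a * x)) powr p \<le> V powr p" by simp
        then have "norm (V * exp (- a * x)) powr p * x powr \<gamma> \<le> V powr p * x powr \<gamma>" by (intro mult_right_mono) auto
        then show ?thesis using x True by (simp flip: ennreal_mult add: ennreal_leI)
      next
        case False
        then have "x powr \<gamma> \<le> D * (1 + 1 / (a * (1/a))) powr \<bar>\<gamma>\<bar> * (1/a) powr \<gamma> * exp (a * (x - 1/a) / 2)"
          using a by (intro D(2)) auto
        moreover have "1 + 1 / (a * (1/a)) = 2" "(1/a) powr \<gamma> = a powr (- \<gamma>)"
          using a by (simp_all add: powr_divide powr_minus_divide)
        ultimately have xg: "x powr \<gamma> \<le> E * a powr (- \<gamma>) * exp (a * (x - 1/a) / 2)"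
          by (simp only: E_def)
        have ee: "exp (- a * x) * exp (a * (x - 1/a) / 2) \<le> exp (- (a/2) * (x - 1/a))"
        proof -
          have "- a * x + a * (x - 1/a) / 2 \<le> - (a/2) * (x - 1/a)" using a by (simp add: field_simps)
          then show ?thesis by (simp only: exp_add[symmetric] exp_le_cancel_iff)
        qed
        have "norm (V * exp (- a * x)) powr p * x powr \<gamma>
           \<le> (V powr p * exp (- a * x)) * (E * a powr (- \<gamma>) * exp (a * (x - 1/a) / 2))"
          using e xg by (intro mult_mono) auto
        also have "\<dots> = V powr p * (E * a powr (- \<gamma>)) * (exp (- a * x) * exp (a * (x - 1/a) / 2))" by simp
        also have "\<dots> \<le> V powr p * (E * a powr (- \<gamma>)) * exp (- (a/2) * (x - 1/a))"
          using E by (intro mult_left_mono ee) auto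
        finally have "norm (V * exp (- a * x)) powr p * x powr \<gamma> \<le> V powr p * ((E * a powr (- \<gamma>)) * exp (- (a/2) * (x - 1/a)))"
          by simp
        then show ?thesis using x False E by (simp flip: ennreal_mult add: ennreal_leI)
      qed
    qed simp
    have i1: "(\<integral>\<^sup>+x. ?f1 x \<partial>lborel) \<le> ennreal (1 / (\<gamma> + 1) * a powr (- \<gamma> - 1))"
    proof -
      have "(1/a) powr (\<gamma> + 1) = a powr (- (\<gamma> + 1))"
        unfolding powr_minus_divide using a by (simp add: powr_divide)
      then have eq: "(1/a) powr (\<gamma> + 1) / (\<gamma> + 1) = 1 / (\<gamma> + 1) * a powr (- \<gamma> - 1)" by simp
      show ?thesis using nn_integral_powr_head[OF g, of "1/a", unfolded eq] a by simp
    qed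
    have i2: "(\<integral>\<^sup>+x. ?f2 x \<partial>lborel) \<le> ennreal (2 * E * a powr (- \<gamma> - 1))"
    proof -
      have t: "nnint {1/a<..} (\<lambda>x. exp (- (a/2) * (x - 1/a))) \<le> ennreal (1 / (a/2))"
        by (rule nn_integral_exp_tail) (use a in simp)
      have "(\<integral>\<^sup>+x. ?f2 x \<partial>lborel)
        = ennreal (E * a powr (- \<gamma>)) * nnint {1/a<..} (\<lambda>x. exp (- (a/2) * (x - 1/a)))"
        by (rule nn_integral_cmult) measurable
      also have "\<dots> \<le> ennreal (E * a powr (- \<gamma>)) * ennreal (1 / (a/2))"
        by (rule mult_left_mono[OF t]) simp
      also have "\<dots> = ennreal (E * a powr (- \<gamma>) * (1 / (a/2)))" using a E by (intro ennreal_mult[symmetric]) auto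
      also have "E * a powr (- \<gamma>) * (1 / (a/2)) = 2 * E * a powr (- \<gamma> - 1)"
        using a by (simp add: powr_diff)
      finally show ?thesis .
    qed
    have "weighted_power p \<gamma> (\<lambda>x. V * exp (- a * x)) \<le> (\<integral>\<^sup>+x. ennreal (V powr p) * (?f1 x + ?f2 x) \<partial>lborel)"
      unfolding weighted_power_def by (intro nn_integral_mono pt)
    also have "\<dots> = ennreal (V powr p) * ((\<integral>\<^sup>+x. ?f1 x \<partial>lborel) + (\<integral>\<^sup>+x. ?f2 x \<partial>lborel))"
      by (simp add: nn_integral_add nn_integral_cmult)
    also have "\<dots> \<le> ennreal (V powr p) * (ennreal (1 / (\<gamma> + 1) * a powr (- \<gamma> - 1)) + ennreal (2 * E * a powr (- \<gamma> - 1)))"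
      by (intro add_mono mult_left_mono i1 i2) auto
    also have "\<dots> = ennreal (V powr p * (1 / (\<gamma> + 1) * a powr (- \<gamma> - 1) + 2 * E * a powr (- \<gamma> - 1)))"
      using g1 E by (simp flip: ennreal_mult ennreal_plus)
    also have "V powr p * (1 / (\<gamma> + 1) * a powr (- \<gamma> - 1) + 2 * E * a powr (- \<gamma> - 1)) = K * V powr p * a powr (- \<gamma> - 1)"
      by (simp add: K_def algebra_simps)
    finally show ?thesis .
  qed
  moreover have "0 < K" using E g1 by (simp add: K_def add_pos_pos)
  ultimately show ?thesis by blast
qed

text \<open>
  The additional term \<open>V * exp (- a * x)\<close> is a solution of the homogeneous equation.
\<close>

lemma exp_kernel_bounded:
  assumes g: "-1 < \<gamma>" and p: "1 < p"
  obtains C where "0 < C" "\<And>a V (h :: real \<Rightarrow> real) (v :: real \<Rightarrow> real).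
    0 < a \<Longrightarrow> 0 \<le> V \<Longrightarrow> h \<in> borel_measurable borel \<Longrightarrow> (\<And>y. 0 \<le> h y) \<Longrightarrow> (\<And>x. 0 \<le> v x) \<Longrightarrow>
    (\<And>x. 0 < x \<Longrightarrow> ennreal (v x) \<le> ennreal (V * exp (- a * x)) + (\<integral>\<^sup>+y. ennreal (exp_kernel a x y * h y) \<partial>lborel)) \<Longrightarrow>
    weighted_power p \<gamma> v \<le> ennreal (C * (V powr p * a powr (- \<gamma> - 1))) + ennreal (C * a powr (- p)) * weighted_power p \<gamma> h"
proof -
  obtain K where K: "0 < K" "\<And>a y. 0 < a \<Longrightarrow> (nnint {0<..} (\<lambda>x. exp_kernel a x y * x powr \<gamma>))
    \<le> ennreal (K / a * y powr \<gamma>) * indicator {0<..} y"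
    using exp_kernel_column[OF g] by blast
  obtain L where L: "0 < L" "\<And>a V. 0 < a \<Longrightarrow> 0 \<le> V \<Longrightarrow>
     weighted_power p \<gamma> (\<lambda>x. V * exp (- a * x)) \<le> ennreal (L * V powr p * a powr (- \<gamma> - 1))"
    using weighted_power_exp[OF g p] by blast
  define C where "C = max (2 powr p * L) (4 powr p * (exp 2 + 1) powr (p - 1) * K)"
  have C: "0 < C" using L(1) by (simp add: C_def less_max_iff_disj)
  have "weighted_power p \<gamma> v \<le> ennreal (C * (V powr p * a powr (- \<gamma> - 1))) + ennreal (C * a powr (- p)) * weighted_power p \<gamma> h"
    if a: "0 < a" and V: "0 \<le> V" and h: "h \<in> borel_measurable borel" "\<And>y. 0 \<le> h y" and v: "\<And>x. 0 \<le> v x"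
      and b: "\<And>x. 0 < x \<Longrightarrow> ennreal (v x) \<le> ennreal (V * exp (- a * x)) + (\<integral>\<^sup>+y. ennreal (exp_kernel a x y * h y) \<partial>lborel)"
    for a V h and v :: "real \<Rightarrow> real"
  proof -
    have "weighted_power p \<gamma> v \<le> ennreal (2 powr p) * weighted_power p \<gamma> (\<lambda>x. V * exp (- a * x))
      + ennreal (4 powr p * ((exp 2 + 1) / a) powr (p - 1) * (K / a)) * weighted_power p \<gamma> h"
      by (rule schur_test[OF p exp_kernel_measurable exp_kernel_nonneg h _ _ v exp_kernel_row[OF a] _ _ K(2)[OF a] b])
         (use a V K(1) in \<open>auto intro!: divide_pos_pos add_pos_pos\<close>)
    also have "\<dots> \<le> ennreal (2 powr p) * ennreal (L * V powr p * a powr (- \<gamma> - 1))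
      + ennreal (4 powr p * ((exp 2 + 1) / a) powr (p - 1) * (K / a)) * weighted_power p \<gamma> h"
      by (intro add_right_mono mult_left_mono L(2) a V) auto
    also have "\<dots> \<le> ennreal (C * (V powr p * a powr (- \<gamma> - 1))) + ennreal (C * a powr (- p)) * weighted_power p \<gamma> h"
    proof (intro add_mono mult_right_mono)
      have "2 powr p * L * (V powr p * a powr (- \<gamma> - 1)) \<le> C * (V powr p * a powr (- \<gamma> - 1))"
        by (intro mult_right_mono) (auto simp: C_def)
      then show "ennreal (2 powr p) * ennreal (L * V powr p * a powr (- \<gamma> - 1)) \<le> ennreal (C * (V powr p * a powr (- \<gamma> - 1)))"
        using L(1) by (simp flip: ennreal_mult add: ennreal_leI mult_ac)
      have "4 powr p * ((exp 2 + 1) / a) powr (p - 1) * (K / a) = 4 powr p * (exp 2 + 1) powr (p - 1) * K * a powr (- p)"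
        using a by (simp add: powr_divide powr_diff powr_minus field_simps add_pos_pos)
      also have "\<dots> \<le> C * a powr (- p)" by (intro mult_right_mono) (auto simp: C_def)
      finally show "ennreal (4 powr p * ((exp 2 + 1) / a) powr (p - 1) * (K / a)) \<le> ennreal (C * a powr (- p))"
        by (rule ennreal_leI)
    qed auto
    finally show ?thesis .
  qed
  note main = this
  show thesis by (rule that[OF C]) (rule main)
qed

section \<open>Hoelder bounds and first-order equations\<close>

locale weight =
  fixes p \<gamma> :: real
  assumes p: "1 < p" and g: "-1 < \<gamma>"
begin

lemma p0: "0 < p" and p1: "1 \<le> p"
  using p by auto

abbreviation wnorm :: "(real \<Rightarrow> 'a::real_normed_vector) \<Rightarrow> real" where
  "wnorm \<equiv> Lp_norm (weighted \<gamma>) p"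

abbreviation wLp :: "(real \<Rightarrow> 'a::real_normed_vector) set" where
  "wLp \<equiv> Lp (weighted \<gamma>) p"

abbreviation wpow :: "(real \<Rightarrow> 'a::real_normed_vector) \<Rightarrow> ennreal" where
  "wpow \<equiv> weighted_power p \<gamma>"

abbreviation chain :: "nat \<Rightarrow> (nat \<Rightarrow> real \<Rightarrow> 'a::real_normed_vector) \<Rightarrow> bool" where
  "chain k \<equiv> Sobolev_chain k p \<gamma>"

text \<open>
  Functions in the Sobolev space of order \<open>k\<close> have traces of order \<open>m < k - crit\<close>.
\<close>

abbreviation crit :: real where
  "crit \<equiv> (\<gamma> + 1) / p"

lemma wnorm_nonneg: "0 \<le> wnorm f"
  by (simp add: Lp_norm_def)

lemma weighted_power_eq_wnorm:
  assumes "f \<in> wLp"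
  shows "wpow f = ennreal (wnorm f powr p)"
proof -
  have fin: "wpow f < top" using assms by (simp add: Lp_weighted_iff)
  have "wnorm f powr p = enn2real (wpow f)"
    using p0 by (simp add: Lp_norm_weighted[OF assms] powr_powr)
  then show ?thesis using fin by simp
qed

text \<open>
  Measurability of the norm is available almost everywhere only; monotone integrals are therefore
  estimated with a Borel function in its place.
\<close>

lemma wLp_representative:
  assumes f: "f \<in> wLp"
  shows "\<exists>h :: real \<Rightarrow> real. h \<in> borel_measurable borel \<and> (\<forall>t. 0 \<le> h t) \<and>
    (AE t in lborel. 0 < t \<longrightarrow> norm (f t) = h t) \<and> wpow h = ennreal (wnorm f powr p)"
proof -
  have "strongly_measurable lborel (\<lambda>t. indicat_real {0<..} t *\<^sub>R f t)" using f by (simp add: Lp_weighted_iff)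
  from strongly_measurable_norm[OF this] obtain h :: "real \<Rightarrow> real" where h: "h \<in> borel_measurable borel" "\<And>t. 0 \<le> h t"
    "AE t in lborel. norm (indicat_real {0<..} t *\<^sub>R f t) = h t" by auto
  have ae: "AE t in lborel. 0 < t \<longrightarrow> norm (f t) = h t" using h(3) by eventually_elim auto
  have "wpow h = wpow f"
    unfolding weighted_power_def
  proof (rule nn_integral_cong_AE)
    show "AE t in lborel. ennreal (norm (h t) powr p * t powr \<gamma>) * indicator {0<..} t
      = ennreal (norm (f t) powr p * t powr \<gamma>) * indicator {0<..} t"
      using ae by eventually_elim (auto simp: h(2) split: split_indicator)
  qed
  then show ?thesis using h(1,2) ae weighted_power_eq_wnorm[OF f] by auto
qed

lemma nn_integral_norm_representative:
  assumes "AE t in lborel. 0 < t \<longrightarrow> norm (f t) = (h t :: real)" "A \<subseteq> {0<..}"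
  shows "nnint A (\<lambda>t. c t * norm (f t)) = nnint A (\<lambda>t. c t * h t)"
proof (rule nn_integral_cong_AE)
  show "AE t in lborel. ennreal (c t * norm (f t)) * indicator A t = ennreal (c t * h t) * indicator A t"
    using assms(1) by eventually_elim (use assms(2) in \<open>auto split: split_indicator\<close>)
qed

text \<open>Hoelder's inequality with the weights moved to the factor \<open>t powr \<beta>\<close>.\<close>

lemma powr_holder:
  fixes f :: "real \<Rightarrow> 'a::real_normed_vector"
  assumes f: "f \<in> wLp" and I[measurable]: "I \<in> sets borel" "I \<subseteq> {0<..}"
    and K: "nnint I (\<lambda>t. t powr (\<beta> - (\<gamma> - \<beta>) / (p - 1))) \<le> ennreal K" "0 < K"
  shows "nnint I (\<lambda>t. t powr \<beta> * norm (f t)) \<le> ennreal (2 * K powr (1 - 1/p) * wnorm f)"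
proof -
  obtain h where h[measurable]: "h \<in> borel_measurable borel" and h0: "\<And>t. 0 \<le> h t"
    and hf: "AE t in lborel. 0 < t \<longrightarrow> norm (f t) = h t" and hw: "wpow h = ennreal (wnorm f powr p)"
    using wLp_representative[OF f] by blast
  define \<theta> where "\<theta> = (\<gamma> - \<beta>) / (p - 1)"
  have "\<theta> * (p - 1) = \<gamma> - \<beta>" using p by (simp add: \<theta>_def)
  then have th: "\<beta> - \<theta> + \<theta> * p = \<gamma>" by (simp add: algebra_simps)
  let ?k = "\<lambda>t. t powr (\<beta> - \<theta>) * indicat_real I t"
  have "(\<integral>\<^sup>+t. ennreal (?k t * (\<bar>t\<bar> powr \<theta> * h t)) \<partial>lborel)
    \<le> ennreal (2 * K powr (1 - 1/p) * (wnorm f powr p) powr (1/p))"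
  proof (rule weighted_holder[OF p])
    have "(\<integral>\<^sup>+t. ennreal (?k t) \<partial>lborel) = nnint I (\<lambda>t. t powr (\<beta> - \<theta>))"
      by (intro nn_integral_cong) (auto split: split_indicator)
    then show "(\<integral>\<^sup>+t. ennreal (?k t) \<partial>lborel) \<le> ennreal K" using K by (simp add: \<theta>_def)
    show "(\<integral>\<^sup>+t. ennreal (?k t * (\<bar>t\<bar> powr \<theta> * h t) powr p) \<partial>lborel) \<le> ennreal (wnorm f powr p)"
      unfolding hw[symmetric] weighted_power_def
    proof (rule nn_integral_mono)
      fix t
      show "ennreal (?k t * (\<bar>t\<bar> powr \<theta> * h t) powr p) \<le> ennreal (norm (h t) powr p * t powr \<gamma>) * indicator {0<..} t"
      proof (cases "t \<in> I")
        case True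
        then have t: "0 < t" using I(2) by auto
        have "t powr (\<beta> - \<theta>) * (t powr \<theta> * h t) powr p = h t powr p * (t powr (\<beta> - \<theta>) * t powr (\<theta> * p))"
          using h0 by (simp add: powr_mult powr_powr)
        also have "t powr (\<beta> - \<theta>) * t powr (\<theta> * p) = t powr \<gamma>" by (simp flip: powr_add add: th)
        finally show ?thesis using True t h0[of t] by simp
      qed simp
    qed
  qed (use h0 K(2) in \<open>auto intro!: mult_nonneg_nonneg\<close>)
  moreover have "(\<integral>\<^sup>+t. ennreal (?k t * (\<bar>t\<bar> powr \<theta> * h t)) \<partial>lborel) = nnint I (\<lambda>t. t powr \<beta> * h t)"
  proof (rule nn_integral_cong)
    fix t
    have "t powr (\<beta> - \<theta>) * (\<bar>t\<bar> powr \<theta> * h t) = t powr \<beta> * h t" if "t \<in> I"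
    proof -
      have "\<bar>t\<bar> = t" using that I(2) by auto
      then show ?thesis by (simp flip: mult.assoc powr_add)
    qed
    note eq = this
    show "ennreal (?k t * (\<bar>t\<bar> powr \<theta> * h t)) = ennreal (t powr \<beta> * h t) * indicator I t"
      by (cases "t \<in> I") (simp_all add: eq)
  qed
  moreover have "(wnorm f powr p) powr (1/p) = wnorm f" using wnorm_nonneg[of f] p by (simp add: powr_powr)
  ultimately show ?thesis by (simp add: nn_integral_norm_representative[OF hf I(2)])
qed

text \<open>
  The power of \<open>d\<close> is forced by homogeneity under dilations, so the intervals near the origin and
  the tails are treated together.
\<close>

lemma powr_holder_scaling:
  fixes \<beta> :: real and I :: "real \<Rightarrow> real set"
  defines "\<sigma> \<equiv> \<beta> - (\<gamma> - \<beta>) / (p - 1)"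
  assumes I: "\<And>d. I d \<in> sets borel" "\<And>d. 0 < d \<Longrightarrow> I d \<subseteq> {0<..}" and L: "0 < L"
    and i: "\<And>d. 0 < d \<Longrightarrow> nnint (I d) (\<lambda>t. t powr \<sigma>) \<le> ennreal (L * d powr (\<sigma> + 1))"
  shows "\<exists>C>0. \<forall>f :: real \<Rightarrow> 'a::real_normed_vector. f \<in> wLp \<longrightarrow>
    (\<forall>d>0. nnint (I d) (\<lambda>t. t powr \<beta> * norm (f t)) \<le> ennreal (C * d powr (1 + \<beta> - crit) * wnorm f))"
proof -
  have "(\<sigma> + 1) * (1 - 1/p) = (\<sigma> + 1) * (p - 1) / p" using p by (simp add: field_simps)
  also have "(\<sigma> + 1) * (p - 1) = (1 + \<beta>) * p - 1 - \<gamma>" using p by (simp add: \<sigma>_def field_simps)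
  also have "((1 + \<beta>) * p - 1 - \<gamma>) / p = 1 + \<beta> - crit" using p by (simp add: field_simps)
  finally have e: "(\<sigma> + 1) * (1 - 1/p) = 1 + \<beta> - crit" .
  have "nnint (I d) (\<lambda>t. t powr \<beta> * norm (f t)) \<le> ennreal (2 * L powr (1 - 1/p) * d powr (1 + \<beta> - crit) * wnorm f)"
    if f: "f \<in> wLp" and d: "0 < d" for f :: "real \<Rightarrow> 'a" and d
  proof -
    have "nnint (I d) (\<lambda>t. t powr \<beta> * norm (f t)) \<le> ennreal (2 * (L * d powr (\<sigma> + 1)) powr (1 - 1/p) * wnorm f)"
      by (rule powr_holder[OF f I(1) I(2)[OF d]]) (use i[OF d] L d in \<open>auto simp: \<sigma>_def\<close>)
    then show ?thesis by (simp only: powr_mult powr_powr e mult.assoc)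
  qed
  moreover have "0 < 2 * L powr (1 - 1/p)" using L by simp
  ultimately show ?thesis by blast
qed

lemma powr_holder_head:
  assumes \<beta>: "\<gamma> < (1 + \<beta>) * p - 1"
  shows "\<exists>C>0. \<forall>f :: real \<Rightarrow> 'a::real_normed_vector. f \<in> wLp \<longrightarrow>
    (\<forall>d>0. nnint {0<..d} (\<lambda>t. t powr \<beta> * norm (f t)) \<le> ennreal (C * d powr (1 + \<beta> - crit) * wnorm f))"
proof (rule powr_holder_scaling)
  let ?\<sigma> = "\<beta> - (\<gamma> - \<beta>) / (p - 1)"
  have "(?\<sigma> + 1) * (p - 1) = (1 + \<beta>) * p - 1 - \<gamma>" using p by (simp add: field_simps)
  then have "0 < (?\<sigma> + 1) * (p - 1)" using \<beta> by linarith
  then have s: "0 < ?\<sigma> + 1" using p by (simp add: zero_less_mult_iff)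
  then show "0 < 1 / (?\<sigma> + 1)" by simp
  show "nnint {0<..d} (\<lambda>t. t powr ?\<sigma>) \<le> ennreal (1 / (?\<sigma> + 1) * d powr (?\<sigma> + 1))" if "0 < d" for d
    using nn_integral_powr_head[of ?\<sigma> d] s that by simp
qed auto

lemma powr_holder_tail:
  assumes \<beta>: "(1 + \<beta>) * p - 1 < \<gamma>"
  shows "\<exists>C>0. \<forall>f :: real \<Rightarrow> 'a::real_normed_vector. f \<in> wLp \<longrightarrow>
    (\<forall>d>0. nnint {d<..} (\<lambda>t. t powr \<beta> * norm (f t)) \<le> ennreal (C * d powr (1 + \<beta> - crit) * wnorm f))"
proof (rule powr_holder_scaling)
  let ?\<sigma> = "\<beta> - (\<gamma> - \<beta>) / (p - 1)"
  have "(?\<sigma> + 1) * (p - 1) = (1 + \<beta>) * p - 1 - \<gamma>" using p by (simp add: field_simps)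
  then have "(?\<sigma> + 1) * (p - 1) < 0" using \<beta> by linarith
  then have s: "?\<sigma> + 1 < 0" using p by (simp add: mult_less_0_iff)
  then show "0 < 1 / (- (?\<sigma> + 1))" by (intro divide_pos_pos) auto
  show "nnint {d<..} (\<lambda>t. t powr ?\<sigma>) \<le> ennreal (1 / (- (?\<sigma> + 1)) * d powr (?\<sigma> + 1))" if "0 < d" for d
    using nn_integral_powr_tail[of ?\<sigma> d] s that by (simp add: mult.commute)
qed auto

text \<open>The weight is absorbed by part of the exponential factor.\<close>

lemma exp_holder_tail:
  "\<exists>C>0. \<forall>f :: real \<Rightarrow> 'a::real_normed_vector. f \<in> wLp \<longrightarrow> (\<forall>a>0. \<forall>x>0.
    nnint {x<..} (\<lambda>t. exp (- a * (t - x)) * norm (f t))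
      \<le> ennreal (C * (1 + 1 / (a * x)) powr (\<bar>\<gamma>\<bar> / p) * a powr (1/p - 1) * x powr (- \<gamma> / p) * wnorm f))"
proof -
  obtain D where D: "1 \<le> D" "\<And>a x y. 0 < a \<Longrightarrow> 0 < x \<Longrightarrow> x \<le> y \<Longrightarrow>
    y powr (- \<gamma>) \<le> D * (1 + 1 / (a * x)) powr \<bar>- \<gamma>\<bar> * x powr (- \<gamma>) * exp (a * (y - x) / 2)"
    using powr_growth[of "- \<gamma>"] by blast
  define C where "C = 2 * D powr (1/p)"
  have "nnint {x<..} (\<lambda>t. exp (- a * (t - x)) * norm (f t))
      \<le> ennreal (C * (1 + 1 / (a * x)) powr (\<bar>\<gamma>\<bar> / p) * a powr (1/p - 1) * x powr (- \<gamma> / p) * wnorm f)"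
    if f: "f \<in> wLp" and a: "0 < a" and x: "0 < x" for f :: "real \<Rightarrow> 'a" and a x
  proof -
    obtain h where h[measurable]: "h \<in> borel_measurable borel" and h0: "\<And>t. 0 \<le> h t"
      and hf: "AE t in lborel. 0 < t \<longrightarrow> norm (f t) = h t" and hw: "wpow h = ennreal (wnorm f powr p)"
      using wLp_representative[OF f] by blast
    define M where "M = D * (1 + 1 / (a * x)) powr \<bar>\<gamma>\<bar> * x powr (- \<gamma>)"
    have M: "0 \<le> M" using D(1) by (simp add: M_def)
    let ?k = "\<lambda>t. exp (- a * (t - x)) * indicat_real {x<..} t"
    have "(\<integral>\<^sup>+t. ennreal (?k t * h t) \<partial>lborel) \<le> ennreal (2 * (1/a) powr (1 - 1/p) * (M * wnorm f powr p) powr (1/p))"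
    proof (rule weighted_holder[OF p])
      have "(\<integral>\<^sup>+t. ennreal (?k t) \<partial>lborel) = nnint {x<..} (\<lambda>t. exp (- a * (t - x)))"
        by (intro nn_integral_cong) (auto split: split_indicator)
      then show "(\<integral>\<^sup>+t. ennreal (?k t) \<partial>lborel) \<le> ennreal (1/a)" using nn_integral_exp_tail[OF a, of x] by simp
      have "(\<integral>\<^sup>+t. ennreal (?k t * h t powr p) \<partial>lborel) \<le> (\<integral>\<^sup>+t. ennreal M * (ennreal (norm (h t) powr p * t powr \<gamma>) * indicator {0<..} t) \<partial>lborel)"
      proof (rule nn_integral_mono)
        fix t
        show "ennreal (?k t * h t powr p) \<le> ennreal M * (ennreal (norm (h t) powr p * t powr \<gamma>) * indicator {0<..} t)"
        proof (cases "x < t")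
          case True
          then have t: "0 < t" using x by simp
          have "t powr (- \<gamma>) \<le> M * exp (a * (t - x) / 2)" using D(2)[OF a x, of t] True by (simp add: M_def)
          also have "\<dots> \<le> M * exp (a * (t - x))" using a True M by (intro mult_left_mono) (auto simp: field_simps)
          finally have "t powr (- \<gamma>) * (t powr \<gamma> * exp (- a * (t - x))) \<le> M * exp (a * (t - x)) * (t powr \<gamma> * exp (- a * (t - x)))"
            by (intro mult_right_mono) auto
          moreover have e1: "t powr (- \<gamma>) * (t powr \<gamma> * exp (- a * (t - x))) = exp (- a * (t - x))"
            using t by (simp add: powr_minus)
          moreover have e2: "M * exp (a * (t - x)) * (t powr \<gamma> * exp (- a * (t - x))) = M * t powr \<gamma>"
            by (simp add: exp_minus)
          ultimately have "exp (- a * (t - x)) \<le> M * t powr \<gamma>" by (simp only:)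
          then have "exp (- a * (t - x)) * h t powr p \<le> M * t powr \<gamma> * h t powr p"
            by (intro mult_right_mono) auto
          then show ?thesis using True t M h0[of t] by (simp flip: ennreal_mult add: ennreal_leI mult_ac)
        qed simp
      qed
      also have "\<dots> = ennreal M * wpow h" by (simp add: nn_integral_cmult weighted_power_def)
      also have "\<dots> \<le> ennreal M * ennreal (wnorm f powr p)" by (simp add: hw)
      finally show "(\<integral>\<^sup>+t. ennreal (?k t * h t powr p) \<partial>lborel) \<le> ennreal (M * wnorm f powr p)"
        using M by (simp flip: ennreal_mult)
    qed (use h0 M a in auto)
    moreover have "(\<integral>\<^sup>+t. ennreal (?k t * h t) \<partial>lborel) = nnint {x<..} (\<lambda>t. exp (- a * (t - x)) * norm (f t))"
    proof -
      have "{x<..} \<subseteq> {0<..}" using x by auto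
      then show ?thesis unfolding nn_integral_norm_representative[OF hf \<open>{x<..} \<subseteq> {0<..}\<close>]
        by (intro nn_integral_cong) (auto split: split_indicator)
    qed
    moreover have "2 * (1/a) powr (1 - 1/p) * (M * wnorm f powr p) powr (1/p)
        = C * (1 + 1 / (a * x)) powr (\<bar>\<gamma>\<bar> / p) * a powr (1/p - 1) * x powr (- \<gamma> / p) * wnorm f"
    proof -
      have "(M * wnorm f powr p) powr (1/p) = D powr (1/p) * (1 + 1 / (a * x)) powr (\<bar>\<gamma>\<bar> / p) * x powr (- \<gamma> / p) * wnorm f"
        using D(1) a x p wnorm_nonneg[of f] by (simp add: M_def powr_mult powr_powr)
      moreover have "(1/a) powr (1 - 1/p) = a powr (1/p - 1)"
        using a by (simp add: powr_divide powr_diff)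
      ultimately show ?thesis by (simp add: C_def mult_ac)
    qed
    ultimately show ?thesis by simp
  qed
  moreover have "0 < C" using D(1) by (simp add: C_def)
  ultimately show ?thesis by blast
qed

lemma wLpI_continuous:
  fixes v :: "real \<Rightarrow> 'a::real_normed_vector"
  assumes "continuous_on {0<..} v" "wpow v < \<infinity>"
  shows "v \<in> wLp"
  using strongly_measurable_continuous[OF assms(1)] assms(2) by (simp add: Lp_weighted_iff)

lemma wnorm_leI:
  assumes f: "f \<in> wLp" and le: "wpow f \<le> ennreal (B powr p)" and B: "0 \<le> B"
  shows "wnorm f \<le> B"
proof -
  have "wnorm f powr p \<le> B powr p"
    using le unfolding weighted_power_eq_wnorm[OF f] by (subst (asm) ennreal_le_iff) auto
  then show ?thesis
    using p0 B wnorm_nonneg[of f] by (meson not_le powr_less_mono2)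
qed

lemma powr_add_le:
  fixes x y :: real
  assumes "0 \<le> x" "0 \<le> y"
  shows "x powr p + y powr p \<le> (2 * (x + y)) powr p"
proof -
  have "x powr p + y powr p \<le> 2 * (x + y) powr p"
    using powr_mono2[of p x "x + y"] powr_mono2[of p y "x + y"] p assms by simp
  also have "2 \<le> (2::real) powr p" using powr_mono[of 1 p "2::real"] p by simp
  then have "2 * (x + y) powr p \<le> 2 powr p * (x + y) powr p" by (intro mult_right_mono) auto
  also have "\<dots> = (2 * (x + y)) powr p" using assms by (simp only: powr_mult)
  finally show ?thesis .
qed

text \<open>
  Minkowski's inequality with the constant 4, which follows from the pointwise estimate of
  \<open>(x + y) powr p\<close>.
\<close>

lemma wLp_triangle:
  fixes f g e :: "real \<Rightarrow> 'a::real_normed_vector"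
  assumes f: "f \<in> wLp" and g: "g \<in> wLp"
    and e: "strongly_measurable lborel (\<lambda>t. indicat_real {0<..} t *\<^sub>R e t)"
    and le: "\<And>t. 0 < t \<Longrightarrow> norm (e t) \<le> norm (f t) + norm (g t)"
  shows "e \<in> wLp" "wnorm e \<le> 4 * (wnorm f + wnorm g)"
proof -
  obtain h where h[measurable]: "h \<in> borel_measurable borel" and h0: "\<And>t. 0 \<le> h t"
    and hf: "AE t in lborel. 0 < t \<longrightarrow> norm (f t) = h t" and hw: "wpow h = ennreal (wnorm f powr p)"
    using wLp_representative[OF f] by blast
  obtain k where k[measurable]: "k \<in> borel_measurable borel" and k0: "\<And>t. 0 \<le> k t"
    and kg: "AE t in lborel. 0 < t \<longrightarrow> norm (g t) = k t" and kw: "wpow k = ennreal (wnorm g powr p)"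
    using wLp_representative[OF g] by blast
  have "wpow e \<le> (\<integral>\<^sup>+t. ennreal (2 powr p) * (ennreal (h t powr p * t powr \<gamma>) * indicator {0<..} t
      + ennreal (k t powr p * t powr \<gamma>) * indicator {0<..} t) \<partial>lborel)"
    unfolding weighted_power_def
  proof (rule nn_integral_mono_AE)
    show "AE t in lborel. ennreal (norm (e t) powr p * t powr \<gamma>) * indicator {0<..} t
      \<le> ennreal (2 powr p) * (ennreal (h t powr p * t powr \<gamma>) * indicator {0<..} t
      + ennreal (k t powr p * t powr \<gamma>) * indicator {0<..} t)"
      using hf kg
    proof eventually_elim
      fix t assume t: "0 < t \<longrightarrow> norm (f t) = h t" "0 < t \<longrightarrow> norm (g t) = k t"
      show "ennreal (norm (e t) powr p * t powr \<gamma>) * indicator {0<..} t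
        \<le> ennreal (2 powr p) * (ennreal (h t powr p * t powr \<gamma>) * indicator {0<..} t
        + ennreal (k t powr p * t powr \<gamma>) * indicator {0<..} t)"
      proof (cases "0 < t")
        case True
        have "norm (e t) \<le> 2 * max (h t) (k t)" using le[OF True] t True by (simp add: max_def)
        then have "norm (e t) powr p \<le> (2 * max (h t) (k t)) powr p" using p by (intro powr_mono2) auto
        also have "\<dots> = 2 powr p * max (h t) (k t) powr p" using h0[of t] by (simp add: powr_mult)
        also have "\<dots> \<le> 2 powr p * (h t powr p + k t powr p)" by (intro mult_left_mono) (auto simp: max_def)
        finally have "norm (e t) powr p * t powr \<gamma> \<le> 2 powr p * (h t powr p + k t powr p) * t powr \<gamma>"
          by (intro mult_right_mono) auto
        then have "ennreal (norm (e t) powr p * t powr \<gamma>)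
            \<le> ennreal (2 powr p * (h t powr p * t powr \<gamma> + k t powr p * t powr \<gamma>))"
          by (intro ennreal_leI) (simp add: algebra_simps)
        also have "\<dots> = ennreal (2 powr p) * (ennreal (h t powr p * t powr \<gamma>) + ennreal (k t powr p * t powr \<gamma>))"
          by (simp add: ennreal_mult' ennreal_plus)
        finally show ?thesis using True by simp
      qed simp
    qed
  qed
  also have "\<dots> = ennreal (2 powr p) * (wpow h + wpow k)"
    using h0 k0 by (simp add: nn_integral_cmult nn_integral_add weighted_power_def)
  also have "\<dots> = ennreal (2 powr p * (wnorm f powr p + wnorm g powr p))"
    unfolding hw kw by (simp add: ennreal_mult' ennreal_plus)
  also have "\<dots> \<le> ennreal ((4 * (wnorm f + wnorm g)) powr p)"
  proof (rule ennreal_leI)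
    have "2 powr p * (wnorm f powr p + wnorm g powr p)
       \<le> 2 powr p * (2 * (wnorm f + wnorm g)) powr p"
      by (intro mult_left_mono powr_add_le p wnorm_nonneg) auto
    also have "\<dots> = (2 * (2 * (wnorm f + wnorm g))) powr p"
      using wnorm_nonneg[of f] wnorm_nonneg[of g] by (intro powr_mult[symmetric])
    finally show "2 powr p * (wnorm f powr p + wnorm g powr p) \<le> (4 * (wnorm f + wnorm g)) powr p"
      by simp
  qed
  finally have le: "wpow e \<le> ennreal ((4 * (wnorm f + wnorm g)) powr p)" .
  then show el: "e \<in> wLp" using e by (auto simp: Lp_weighted_iff intro: le_less_trans)
  show "wnorm e \<le> 4 * (wnorm f + wnorm g)"
    using wnorm_nonneg[of f] wnorm_nonneg[of g] by (intro wnorm_leI[OF el le]) auto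
qed

lemma wLp_scaleC:
  fixes f :: "real \<Rightarrow> 'a::complex_banach"
  assumes f: "f \<in> wLp"
  shows "(\<lambda>t. c *\<^sub>C f t) \<in> wLp" "wnorm (\<lambda>t. c *\<^sub>C f t) \<le> cmod c * wnorm f"
proof -
  obtain h where h[measurable]: "h \<in> borel_measurable borel" and h0: "\<And>t. 0 \<le> h t"
    and hf: "AE t in lborel. 0 < t \<longrightarrow> norm (f t) = h t" and hw: "wpow h = ennreal (wnorm f powr p)"
    using wLp_representative[OF f] by blast
  have "strongly_measurable lborel (\<lambda>t. c *\<^sub>C indicat_real {0<..} t *\<^sub>R f t)"
    by (rule strongly_measurable_bounded_linear[OF scaleC.bounded_linear_right]) (use f in \<open>simp add: Lp_weighted_iff\<close>)
  then have m: "strongly_measurable lborel (\<lambda>t. indicat_real {0<..} t *\<^sub>R c *\<^sub>C f t)"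
    by (simp only: scaleC_scaleR_commute)
  have "wpow (\<lambda>t. c *\<^sub>C f t) = (\<integral>\<^sup>+t. ennreal (cmod c powr p) * (ennreal (norm (h t) powr p * t powr \<gamma>) * indicator {0<..} t) \<partial>lborel)"
    unfolding weighted_power_def
  proof (rule nn_integral_cong_AE)
    show "AE t in lborel. ennreal (norm (c *\<^sub>C f t) powr p * t powr \<gamma>) * indicator {0<..} t
      = ennreal (cmod c powr p) * (ennreal (norm (h t) powr p * t powr \<gamma>) * indicator {0<..} t)"
      using hf by eventually_elim
        (auto simp: norm_scaleC powr_mult h0 mult.assoc split: split_indicator simp flip: ennreal_mult)
  qed
  also have "\<dots> = ennreal (cmod c powr p) * wpow h"
    by (simp add: nn_integral_cmult weighted_power_def)
  also have "\<dots> = ennreal ((cmod c * wnorm f) powr p)"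
    unfolding hw using wnorm_nonneg[of f] by (simp add: powr_mult ennreal_mult')
  finally have eq: "wpow (\<lambda>t. c *\<^sub>C f t) = ennreal ((cmod c * wnorm f) powr p)" .
  then show el: "(\<lambda>t. c *\<^sub>C f t) \<in> wLp" using m by (simp add: Lp_weighted_iff)
  show "wnorm (\<lambda>t. c *\<^sub>C f t) \<le> cmod c * wnorm f"
    using wnorm_nonneg[of f] by (intro wnorm_leI[OF el]) (auto simp: eq)
qed

lemma wLp_measurable: "f \<in> wLp \<Longrightarrow> strongly_measurable lborel (\<lambda>t. indicat_real {0<..} t *\<^sub>R f t)"
  by (simp add: Lp_weighted_iff)

lemma wLp_combination:
  fixes f g :: "real \<Rightarrow> 'a::complex_banach"
  assumes f: "f \<in> wLp" and g: "g \<in> wLp"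
  shows "(\<lambda>t. c *\<^sub>C f t - d *\<^sub>C g t) \<in> wLp"
    "wnorm (\<lambda>t. c *\<^sub>C f t - d *\<^sub>C g t) \<le> 4 * (cmod c * wnorm f + cmod d * wnorm g)"
proof -
  note cf = wLp_scaleC[OF f, of c] and dg = wLp_scaleC[OF g, of d]
  have m: "strongly_measurable lborel (\<lambda>t. indicat_real {0<..} t *\<^sub>R (c *\<^sub>C f t - d *\<^sub>C g t))"
    using strongly_measurable_diff[OF wLp_measurable[OF cf(1)] wLp_measurable[OF dg(1)]]
    by (simp only: scaleR_diff_right)
  note tr = wLp_triangle[OF cf(1) dg(1) m norm_triangle_ineq4]
  show "(\<lambda>t. c *\<^sub>C f t - d *\<^sub>C g t) \<in> wLp" by (rule tr)
  show "wnorm (\<lambda>t. c *\<^sub>C f t - d *\<^sub>C g t) \<le> 4 * (cmod c * wnorm f + cmod d * wnorm g)"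
    by (rule order_trans[OF tr(2)]) (intro mult_left_mono add_mono cf dg, simp)
qed

text \<open>The weight has infinite mass at infinity.\<close>

lemma weighted_power_infinite:
  assumes \<kappa>: "0 < \<kappa>" "\<And>t. Z < t \<Longrightarrow> \<kappa> \<le> norm (D t)"
  shows "wpow D = \<infinity>"
proof (rule ccontr)
  assume "wpow D \<noteq> \<infinity>"
  then obtain M where M: "wpow D = ennreal M" "0 \<le> M"
    by (cases "wpow D" rule: ennreal_cases) auto
  have low: "\<kappa> powr p * 2 powr (- \<bar>\<gamma>\<bar>) * N powr (\<gamma> + 1) \<le> M" if N: "0 < N" "Z < N" for N
  proof -
    have w: "2 powr (- \<bar>\<gamma>\<bar>) * N powr \<gamma> \<le> t powr \<gamma>" if "N \<le> t" "t \<le> 2 * N" for t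
    proof (cases "0 \<le> \<gamma>")
      case True
      have "2 powr (- \<bar>\<gamma>\<bar>) * N powr \<gamma> \<le> 1 * N powr \<gamma>"
        by (intro mult_right_mono) (auto simp: powr_minus_divide ge_one_powr_ge_zero)
      also have "\<dots> \<le> t powr \<gamma>" using True that N by (auto intro: powr_mono2)
      finally show ?thesis .
    next
      case False
      have "(2 * N) powr \<gamma> \<le> t powr \<gamma>" using False that N by (intro powr_mono2') auto
      then show ?thesis using False N by (simp add: powr_mult)
    qed
    have "ennreal (\<kappa> powr p * (2 powr (- \<bar>\<gamma>\<bar>) * N powr \<gamma>)) * emeasure lborel {N<..2*N}
      = (\<integral>\<^sup>+t. ennreal (\<kappa> powr p * (2 powr (- \<bar>\<gamma>\<bar>) * N powr \<gamma>)) * indicator {N<..2*N} t \<partial>lborel)"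
      by (rule nn_integral_cmult_indicator[symmetric]) simp
    also have "\<dots> \<le> wpow D"
      unfolding weighted_power_def
    proof (rule nn_integral_mono)
      fix t
      show "ennreal (\<kappa> powr p * (2 powr (- \<bar>\<gamma>\<bar>) * N powr \<gamma>)) * indicator {N<..2*N} t
         \<le> ennreal (norm (D t) powr p * t powr \<gamma>) * indicator {0<..} t"
      proof (cases "t \<in> {N<..2*N}")
        case True
        then have "\<kappa> powr p * (2 powr (- \<bar>\<gamma>\<bar>) * N powr \<gamma>) \<le> norm (D t) powr p * t powr \<gamma>"
          using N p \<kappa> by (intro mult_mono powr_mono2 w) auto
        then show ?thesis using True N by (simp add: ennreal_leI)
      qed simp
    qed
    finally have "ennreal (\<kappa> powr p * (2 powr (- \<bar>\<gamma>\<bar>) * N powr \<gamma>)) * ennreal N \<le> ennreal M" using M N by simp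
    then have "\<kappa> powr p * (2 powr (- \<bar>\<gamma>\<bar>) * N powr \<gamma>) * N \<le> M"
      using M(2) N by (simp flip: ennreal_mult)
    then show ?thesis using N by (simp add: powr_add mult_ac)
  qed
  define c where "c = \<kappa> powr p * 2 powr (- \<bar>\<gamma>\<bar>)"
  have c: "0 < c" using \<kappa> by (simp add: c_def)
  define N where "N = max (max 1 (Z + 1)) (((M + 1) / c) powr (1 / (\<gamma> + 1)))"
  have "(M + 1) / c = (((M + 1) / c) powr (1 / (\<gamma> + 1))) powr (\<gamma> + 1)"
    using g c M(2) by (simp add: powr_powr)
  also have "\<dots> \<le> N powr (\<gamma> + 1)" using g by (intro powr_mono2) (auto simp: N_def)
  finally have "M + 1 \<le> c * N powr (\<gamma> + 1)" using c by (simp add: field_simps)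
  moreover have "c * N powr (\<gamma> + 1) \<le> M" unfolding c_def by (rule low) (auto simp: N_def)
  ultimately show False by simp
qed

lemma exp_has_vector_derivative:
  "((\<lambda>t. exp (\<mu> * complex_of_real t)) has_vector_derivative \<mu> * exp (\<mu> * complex_of_real t)) (at t)"
proof -
  have "((\<lambda>z. exp (\<mu> * z)) has_field_derivative \<mu> * exp (\<mu> * complex_of_real t)) (at (complex_of_real t))"
    by (auto intro!: derivative_eq_intros)
  from has_vector_derivative_real_field[OF this] show ?thesis by simp
qed

lemma indef_integral_exp:
  fixes v g :: "real \<Rightarrow> 'a::complex_banach"
  assumes "indef_integral v g"
  shows "indef_integral (\<lambda>t. exp (\<mu> * complex_of_real t) *\<^sub>C v t)
    (\<lambda>t. exp (\<mu> * complex_of_real t) *\<^sub>C (\<mu> *\<^sub>C v t + g t))"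
proof -
  have "indef_integral (\<lambda>t. exp (\<mu> * complex_of_real t) *\<^sub>C v t)
    (\<lambda>t. (\<mu> * exp (\<mu> * complex_of_real t)) *\<^sub>C v t + exp (\<mu> * complex_of_real t) *\<^sub>C g t)"
    by (rule indef_integral_mult[OF assms]) (auto intro!: exp_has_vector_derivative continuous_intros)
  then show ?thesis by (simp add: scaleC.add_right scaleC_scaleC mult.commute)
qed

lemma indef_integral_zero_const:
  assumes "indef_integral v (\<lambda>t. 0)" "0 < x" "0 < y"
  shows "v x = v y"
proof -
  have *: "v y = v x" if "0 < x" "x \<le> y" for x y
    using indef_integral_norm_le[OF assms(1) that] by simp
  show ?thesis using *[of x y] *[of y x] assms(2,3) by (cases "x \<le> y") auto
qed

text \<open>
  Variation of constants, forward from \<open>x\<close> and backward from \<open>z\<close>.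
\<close>

lemma first_order_bounds:
  fixes v W :: "real \<Rightarrow> 'a::complex_banach"
  assumes v: "indef_integral v (\<lambda>t. W t - s *\<^sub>C v t)" and x: "0 < x" "x \<le> z"
  shows "ennreal (norm (v z)) \<le> ennreal (exp (- Re s * (z - x)) * norm (v x))
      + nnint {x<..z} (\<lambda>t. exp (- Re s * (z - t)) * norm (W t))" (is ?A)
    "ennreal (norm (v x)) \<le> ennreal (exp (Re s * (z - x)) * norm (v z))
      + nnint {x<..z} (\<lambda>t. exp (Re s * (t - x)) * norm (W t))" (is ?B)
proof -
  let ?e = "\<lambda>t. exp (s * complex_of_real t)"
  have "indef_integral (\<lambda>t. ?e t *\<^sub>C v t) (\<lambda>t. ?e t *\<^sub>C W t)"
    using indef_integral_exp[OF v, of s] by simp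
  then have I: "has_set_integral {x<..z} (\<lambda>t. ?e t *\<^sub>C W t) (?e z *\<^sub>C v z - ?e x *\<^sub>C v x)"
    using x unfolding indef_integral_def by blast
  have J: "ennreal (norm (c *\<^sub>C (?e z *\<^sub>C v z - ?e x *\<^sub>C v x)))
     \<le> nnint {x<..z} (\<lambda>t. cmod c * exp (Re s * t) * norm (W t))" for c
    using has_set_integral_norm_le[OF has_set_integral_linear[OF scaleC.bounded_linear_right I, of c]]
    by (simp add: norm_scaleC mult.assoc)
  have sub: "ennreal (norm y) \<le> ennreal A + N" if "norm y \<le> A + norm i" "ennreal (norm i) \<le> N" "0 \<le> A"
    for y i :: 'a and A N
  proof -
    have "ennreal (norm y) \<le> ennreal (A + norm i)" by (rule ennreal_leI[OF that(1)])
    also have "\<dots> = ennreal A + ennreal (norm i)" using that(3) by (simp add: ennreal_plus)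
    also have "\<dots> \<le> ennreal A + N" by (intro add_left_mono that(2))
    finally show ?thesis .
  qed
  show ?A
  proof (rule sub)
    define i where "i = exp (- s * complex_of_real z) *\<^sub>C (?e z *\<^sub>C v z - ?e x *\<^sub>C v x)"
    have "i = v z - exp (s * complex_of_real (x - z)) *\<^sub>C v x"
      by (simp add: i_def scaleC.diff_right scaleC_scaleC algebra_simps flip: exp_add)
    then have "v z = exp (s * complex_of_real (x - z)) *\<^sub>C v x + i" by simp
    then have "norm (v z) \<le> norm (exp (s * complex_of_real (x - z)) *\<^sub>C v x) + norm i"
      by (metis norm_triangle_ineq)
    also have "norm (exp (s * complex_of_real (x - z)) *\<^sub>C v x) = exp (- Re s * (z - x)) * norm (v x)"
      by (simp add: norm_scaleC algebra_simps)
    finally show "norm (v z) \<le> exp (- Re s * (z - x)) * norm (v x) + norm i" .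
    have "cmod (exp (- s * complex_of_real z)) * exp (Re s * t) = exp (- Re s * (z - t))" for t
      by (simp add: algebra_simps flip: exp_add)
    then show "ennreal (norm i) \<le> nnint {x<..z} (\<lambda>t. exp (- Re s * (z - t)) * norm (W t))"
      using J[of "exp (- s * complex_of_real z)"] unfolding i_def by simp
  qed simp
  show ?B
  proof (rule sub)
    define i where "i = exp (- s * complex_of_real x) *\<^sub>C (?e z *\<^sub>C v z - ?e x *\<^sub>C v x)"
    have "i = exp (s * complex_of_real (z - x)) *\<^sub>C v z - v x"
      by (simp add: i_def scaleC.diff_right scaleC_scaleC algebra_simps flip: exp_add)
    then have "v x = exp (s * complex_of_real (z - x)) *\<^sub>C v z - i" by simp
    then have "norm (v x) \<le> norm (exp (s * complex_of_real (z - x)) *\<^sub>C v z) + norm i"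
      by (metis norm_triangle_ineq4)
    also have "norm (exp (s * complex_of_real (z - x)) *\<^sub>C v z) = exp (Re s * (z - x)) * norm (v z)"
      by (simp add: norm_scaleC)
    finally show "norm (v x) \<le> exp (Re s * (z - x)) * norm (v z) + norm i" .
    have "cmod (exp (- s * complex_of_real x)) * exp (Re s * t) = exp (Re s * (t - x))" for t
      by (simp add: algebra_simps flip: exp_add)
    then show "ennreal (norm i) \<le> nnint {x<..z} (\<lambda>t. exp (Re s * (t - x)) * norm (W t))"
      using J[of "exp (- s * complex_of_real x)"] unfolding i_def by simp
  qed simp
qed

text \<open>The bound satisfied by the decaying solution of \<open>W' = s *\<^sub>C W - f\<close>, where \<open>a = Re s\<close>.\<close>

definition forward_bound :: "real \<Rightarrow> (real \<Rightarrow> 'a::real_normed_vector) \<Rightarrow> (real \<Rightarrow> 'a) \<Rightarrow> bool" where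
  "forward_bound a f W \<longleftrightarrow> (\<forall>x>0. ennreal (norm (W x)) \<le>
    nnint {x<..} (\<lambda>t. exp (- a * (t - x)) * norm (f t)))"

lemma exp_tail_integrable:
  fixes f :: "real \<Rightarrow> 'a::complex_banach"
  assumes f: "f \<in> wLp" and s: "0 < Re s" and x: "0 < x"
  shows "set_integrable_on {x<..} (\<lambda>t. exp (- s * complex_of_real t) *\<^sub>C f t)"
  unfolding set_integrable_on_iff
proof
  have "strongly_measurable lborel (\<lambda>t::real. exp (- s * complex_of_real t))"
    by (intro strongly_measurable_borel sigma_finite_lborel) (auto intro!: borel_measurable_continuous_onI continuous_intros)
  from strongly_measurable_bounded_bilinear[OF bounded_bilinear_scaleC this
      strongly_measurable_indicator_subset[OF wLp_measurable[OF f], of "{x<..}"]]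
  show "strongly_measurable lborel (\<lambda>t. indicat_real {x<..} t *\<^sub>R exp (- s * complex_of_real t) *\<^sub>C f t)"
    using x by (simp add: scaleC_scaleR_commute subset_eq)
  obtain C where C: "nnint {x<..} (\<lambda>t. exp (- Re s * (t - x)) * norm (f t))
    \<le> ennreal (C * (1 + 1 / (Re s * x)) powr (\<bar>\<gamma>\<bar> / p) * Re s powr (1/p - 1) * x powr (- \<gamma> / p) * wnorm f)"
    using exp_holder_tail[where 'a='a] f s x by blast
  have "nnint {x<..} (\<lambda>t. norm (exp (- s * complex_of_real t) *\<^sub>C f t))
    = nnint {x<..} (\<lambda>t. exp (- Re s * t) * norm (f t))"
    by (simp add: norm_scaleC)
  also have "\<dots> \<le> nnint {x<..} (\<lambda>t. exp (- Re s * (t - x)) * norm (f t))"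
    using s x by (intro nn_integral_mono) (auto split: split_indicator intro!: ennreal_leI mult_right_mono)
  also note C
  finally show "nnint {x<..} (\<lambda>t. norm (exp (- s * complex_of_real t) *\<^sub>C f t)) < \<infinity>"
    by (auto intro: le_less_trans)
qed

text \<open>The decaying solution is \<open>W x = \<integral> exp (- s * (t - x)) *\<^sub>C f t\<close>, integrated over \<open>t > x\<close>.\<close>

lemma forward_solution_exists:
  fixes f :: "real \<Rightarrow> 'a::complex_banach"
  assumes f: "f \<in> wLp" and s: "0 < Re s"
  shows "\<exists>W. indef_integral W (\<lambda>t. s *\<^sub>C W t - f t) \<and> forward_bound (Re s) f W"
proof -
  let ?g = "\<lambda>t. exp (- s * complex_of_real t) *\<^sub>C f t"
  have "\<exists>I. has_set_integral {x<..} ?g I" if "0 < x" for x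
    using exp_tail_integrable[OF f s that] unfolding set_integrable_on_def .
  then obtain V where V: "\<And>x. 0 < x \<Longrightarrow> has_set_integral {x<..} ?g (V x)" by metis
  have "indef_integral (\<lambda>t. - V t) ?g"
    unfolding indef_integral_def
  proof (intro allI impI)
    fix x y :: real assume xy: "0 < x" "x \<le> y"
    have "set_integrable_on {x<..y} ?g"
      by (rule set_integrable_on_subset[OF exp_tail_integrable[OF f s xy(1)]]) auto
    then obtain I where I: "has_set_integral {x<..y} ?g I" unfolding set_integrable_on_def by blast
    have "{x<..y} \<union> {y<..} = {x<..}" "{x<..y} \<inter> {y<..} = {}" using xy by auto
    then have "has_set_integral {x<..} ?g (I + V y)"
      using has_set_integral_Un[OF I V[of y]] xy by simp
    then have "V x = I + V y" by (rule has_strong_integral_unique[OF V[OF xy(1)]])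
    then show "has_set_integral {x<..y} ?g (- V y - - V x)" using I by simp
  qed
  from indef_integral_linear[OF bounded_linear_minus[OF bounded_linear_ident] this]
  have Vi: "indef_integral V (\<lambda>t. - ?g t)" by simp
  define W where "W t = exp (s * complex_of_real t) *\<^sub>C V t" for t
  have "indef_integral W (\<lambda>t. exp (s * complex_of_real t) *\<^sub>C (s *\<^sub>C V t + - ?g t))"
    unfolding W_def by (rule indef_integral_exp[OF Vi])
  moreover have "exp (s * complex_of_real t) *\<^sub>C (s *\<^sub>C V t + - ?g t) = s *\<^sub>C W t - f t" for t
    by (simp add: W_def scaleC.diff_right scaleC_scaleC mult.commute flip: exp_add)
  moreover have "forward_bound (Re s) f W"
    unfolding forward_bound_def
  proof (intro allI impI)
    fix x :: real assume x: "0 < x"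
    have "has_set_integral {x<..} (\<lambda>t. exp (s * complex_of_real x) *\<^sub>C ?g t) (W x)"
      unfolding W_def by (rule has_set_integral_linear[OF scaleC.bounded_linear_right V[OF x]])
    from has_set_integral_norm_le[OF this]
    have "ennreal (norm (W x)) \<le> nnint {x<..} (\<lambda>t. norm (exp (s * complex_of_real x) *\<^sub>C ?g t))" .
    moreover have "norm (exp (s * complex_of_real x) *\<^sub>C ?g t) = exp (- Re s * (t - x)) * norm (f t)" for t
      by (simp add: norm_scaleC algebra_simps flip: exp_add mult.assoc)
    ultimately show "ennreal (norm (W x)) \<le> nnint {x<..} (\<lambda>t. exp (- Re s * (t - x)) * norm (f t))"
      by (simp only:)
  qed
  ultimately show ?thesis by (intro exI[of _ W]) (simp only: simp_thms)
qed

text \<open>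
  The two-sided bound for the second-order equation, in terms of one point value: solve forward
  for \<open>W = v' + s *\<^sub>C v\<close>, and then \<open>v' = W - s *\<^sub>C v\<close> in both directions from \<open>1 / a\<close>.
\<close>

lemma second_order_bound:
    obtains C where "0 < C" "\<And>s (f :: real \<Rightarrow> 'a::complex_banach) W v.
    0 < Re s \<Longrightarrow> f \<in> wLp \<Longrightarrow> continuous_on {0<..} W \<Longrightarrow> forward_bound (Re s) f W \<Longrightarrow>
    indef_integral v (\<lambda>t. W t - s *\<^sub>C v t) \<Longrightarrow>
    W \<in> wLp \<and> Re s * wnorm W \<le> C * wnorm f \<and>
    v \<in> wLp \<and> (Re s)\<^sup>2 * wnorm v \<le> C * (wnorm f + Re s powr (2 - crit) * norm (v (1 / Re s)))"
proof -
  obtain C where C: "0 < C" and bound: "\<And>a V h v. 0 < a \<Longrightarrow> 0 \<le> V \<Longrightarrow> h \<in> borel_measurable borel \<Longrightarrow>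
    (\<And>y. 0 \<le> h y) \<Longrightarrow> (\<And>x. 0 \<le> v x) \<Longrightarrow>
    (\<And>x. 0 < x \<Longrightarrow> ennreal (v x) \<le> ennreal (V * exp (- a * x)) + (\<integral>\<^sup>+y. ennreal (exp_kernel a x y * h y) \<partial>lborel)) \<Longrightarrow>
    wpow v \<le> ennreal (C * (V powr p * a powr (- \<gamma> - 1))) + ennreal (C * a powr (- p)) * wpow h"
    by (rule exp_kernel_bounded[OF g p]) blast
  define C1 where "C1 = C powr (1/p)"
  have C1: "0 < C1" "C1 powr p = C" using C p by (auto simp: C1_def powr_powr)
  define C2 where "C2 = C1 * (2 * (exp 1 + C1)) + C1"
  have "W \<in> wLp \<and> Re s * wnorm W \<le> C2 * wnorm f \<and>
    v \<in> wLp \<and> (Re s)\<^sup>2 * wnorm v \<le> C2 * (wnorm f + Re s powr (2 - crit) * norm (v (1 / Re s)))"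
    if s: "0 < Re s" and f: "f \<in> wLp" and Wc: "continuous_on {0<..} W" and fb: "forward_bound (Re s) f W"
      and v: "indef_integral v (\<lambda>t. W t - s *\<^sub>C v t)" for s and f W v :: "real \<Rightarrow> 'a"
  proof -
    define a where "a = Re s"
    have a: "0 < a" using s by (simp add: a_def)
    obtain h where h: "h \<in> borel_measurable borel" "\<And>t. 0 \<le> h t"
      and hf: "AE t in lborel. 0 < t \<longrightarrow> norm (f t) = h t" and hw: "wpow h = ennreal (wnorm f powr p)"
      using wLp_representative[OF f] by blast
    have "wpow (\<lambda>t. norm (W t)) \<le> ennreal (C * (0 powr p * a powr (- \<gamma> - 1))) + ennreal (C * a powr (- p)) * wpow h"
    proof (rule bound[OF a order_refl h])
      fix x :: real assume x: "0 < x"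
      have "ennreal (norm (W x)) \<le> nnint {x<..} (\<lambda>t. exp (- a * (t - x)) * norm (f t))"
        using fb x unfolding forward_bound_def a_def by blast
      also have "\<dots> = nnint {x<..} (\<lambda>t. exp (- a * (t - x)) * h t)"
        by (rule nn_integral_norm_representative[OF hf]) (use x in auto)
      also have "\<dots> \<le> (\<integral>\<^sup>+y. ennreal (exp_kernel a x y * h y) \<partial>lborel)"
      proof (rule nn_integral_mono)
        fix y
        show "ennreal (exp (- a * (y - x)) * h y) * indicator {x<..} y \<le> ennreal (exp_kernel a x y * h y)"
        proof (cases "x < y")
          case True
          have "1 * exp (- a * (y - x)) \<le> exp 2 * exp (- a * (y - x))" by (intro mult_right_mono) auto
          then have "exp (- a * (y - x)) \<le> exp_kernel a x y" using True x by (simp add: exp_kernel_def)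
          then show ?thesis using True h(2)[of y] by (simp add: ennreal_leI mult_right_mono)
        qed simp
      qed
      finally show "ennreal (norm (W x)) \<le> ennreal (0 * exp (- a * x)) + (\<integral>\<^sup>+y. ennreal (exp_kernel a x y * h y) \<partial>lborel)"
        by simp
    qed simp
    also have "\<dots> = ennreal ((C1 * wnorm f / a) powr p)"
      using C C1 a p0 wnorm_nonneg[of f] unfolding hw
      by (simp add: powr_mult powr_divide powr_minus_divide flip: ennreal_mult)
    finally have Wb: "wpow W \<le> ennreal ((C1 * wnorm f / a) powr p)"
      by (simp add: weighted_power_def)
    have Wl: "W \<in> wLp"
      by (rule wLpI_continuous[OF Wc]) (use Wb in \<open>auto intro: le_less_trans\<close>)
    have Wn: "wnorm W \<le> C1 * wnorm f / a"
      using C1 a wnorm_nonneg[of f] by (intro wnorm_leI[OF Wl Wb]) auto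
    define k where "k t = indicat_real {0<..} t * norm (W t)" for t
    have k: "k \<in> borel_measurable borel" "\<And>t. 0 \<le> k t"
    proof -
      have "(\<lambda>t. indicat_real {0<..} t *\<^sub>R norm (W t)) \<in> borel_measurable borel"
        by (rule borel_measurable_continuous_on_indicator) (auto intro: continuous_on_norm Wc)
      then show "k \<in> borel_measurable borel" by (simp add: k_def[abs_def])
    qed (simp add: k_def)
    have kw: "wpow k = ennreal (wnorm W powr p)"
      unfolding weighted_power_eq_wnorm[OF Wl, symmetric] weighted_power_def k_def
      by (intro nn_integral_cong) (auto split: split_indicator)
    define n where "n = norm (v (1/a))"
    have "wpow (\<lambda>t. norm (v t)) \<le> ennreal (C * ((exp 1 * n) powr p * a powr (- \<gamma> - 1))) + ennreal (C * a powr (- p)) * wpow k"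
    proof (rule bound[OF a _ k])
      fix x :: real assume x: "0 < x"
      show "ennreal (norm (v x)) \<le> ennreal (exp 1 * n * exp (- a * x)) + (\<integral>\<^sup>+y. ennreal (exp_kernel a x y * k y) \<partial>lborel)"
      proof (cases "x \<le> 1/a")
        case True
        have "ennreal (norm (v x)) \<le> ennreal (exp (a * (1/a - x)) * n)
          + nnint {x<..1/a} (\<lambda>t. exp (a * (t - x)) * norm (W t))"
          using first_order_bounds(2)[OF v x True] unfolding a_def n_def .
        also have "exp (a * (1/a - x)) * n = exp 1 * n * exp (- a * x)"
          using a by (simp add: algebra_simps flip: exp_add)
        also have "nnint {x<..1/a} (\<lambda>t. exp (a * (t - x)) * norm (W t))
          \<le> (\<integral>\<^sup>+y. ennreal (exp_kernel a x y * k y) \<partial>lborel)"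
        proof (rule nn_integral_mono)
          fix y
          show "ennreal (exp (a * (y - x)) * norm (W y)) * indicator {x<..1/a} y \<le> ennreal (exp_kernel a x y * k y)"
          proof (cases "y \<in> {x<..1/a}")
            case True
            then have "a * y \<le> 1" using a by (simp add: field_simps)
            then have "a * (y - x) \<le> 1 \<and> - a * (y - x) = - (a * (y - x))"
              using mult_pos_pos[OF a x] by (simp add: right_diff_distrib)
            then have "a * (y - x) \<le> 2 + - a * (y - x)" by linarith
            then have "exp (a * (y - x)) \<le> exp 2 * exp (- a * (y - x))" by (simp flip: exp_add)
            then have "exp (a * (y - x)) \<le> exp_kernel a x y" using True x by (simp add: exp_kernel_def)
            then show ?thesis using True x by (simp add: k_def ennreal_leI mult_right_mono)
          qed simp
        qed
        finally show ?thesis by (simp add: add_left_mono)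
      next
        case False
        have "ennreal (norm (v x)) \<le> ennreal (exp (- a * (x - 1/a)) * n)
          + nnint {1/a<..x} (\<lambda>t. exp (- a * (x - t)) * norm (W t))"
          using first_order_bounds(1)[OF v, of "1/a" x] a False unfolding a_def n_def by auto
        also have "exp (- a * (x - 1/a)) * n = exp 1 * n * exp (- a * x)"
          using a by (simp add: algebra_simps flip: exp_add)
        also have "nnint {1/a<..x} (\<lambda>t. exp (- a * (x - t)) * norm (W t))
          \<le> (\<integral>\<^sup>+y. ennreal (exp_kernel a x y * k y) \<partial>lborel)"
        proof (rule nn_integral_mono_AE)
          show "AE y in lborel. ennreal (exp (- a * (x - y)) * norm (W y)) * indicator {1/a<..x} y \<le> ennreal (exp_kernel a x y * k y)"
            using AE_lborel_singleton[of x]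
          proof eventually_elim
            fix y assume "y \<noteq> x"
            show "ennreal (exp (- a * (x - y)) * norm (W y)) * indicator {1/a<..x} y \<le> ennreal (exp_kernel a x y * k y)"
            proof (cases "y \<in> {1/a<..x}")
              case True
              have "0 < y" using True a by (auto intro: less_trans[of 0 "1/a"])
              then show ?thesis using True \<open>y \<noteq> x\<close> by (simp add: exp_kernel_def k_def)
            qed simp
          qed
        qed
        finally show ?thesis by (simp add: add_left_mono)
      qed
    qed (auto simp: n_def)
    also have "\<dots> = ennreal ((C1 * (exp 1 * n) * a powr (- crit)) powr p + (C1 * wnorm W / a) powr p)"
    proof -
      have "(a powr (- crit)) powr p = a powr (- \<gamma> - 1)" using p0 by (simp add: powr_powr)
      then have 1: "C * ((exp 1 * n) powr p * a powr (- \<gamma> - 1)) = (C1 * (exp 1 * n) * a powr (- crit)) powr p"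
        using C1 by (simp add: powr_mult n_def)
      have 2: "C * a powr (- p) * wnorm W powr p = (C1 * wnorm W / a) powr p"
        using C1 a wnorm_nonneg[of W] by (simp add: powr_mult powr_divide powr_minus_divide)
      show ?thesis unfolding kw 1 using 2 C by (simp flip: ennreal_mult ennreal_plus)
    qed
    also have "\<dots> \<le> ennreal ((2 * (C1 * (exp 1 * n) * a powr (- crit) + C1 * wnorm W / a)) powr p)"
      using p C1 a wnorm_nonneg[of W] by (intro ennreal_leI powr_add_le) (auto simp: n_def)
    finally have vb: "wpow v \<le> ennreal ((2 * (C1 * (exp 1 * n) * a powr (- crit) + C1 * wnorm W / a)) powr p)"
      by (simp add: weighted_power_def)
    have vl: "v \<in> wLp"
      by (rule wLpI_continuous[OF indef_integral_continuous_on[OF v]]) (use vb in \<open>auto intro: le_less_trans\<close>)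
    have "wnorm v \<le> 2 * (C1 * (exp 1 * n) * a powr (- crit) + C1 * wnorm W / a)"
      using C1 a wnorm_nonneg[of W] by (intro wnorm_leI[OF vl vb]) (auto simp: n_def)
    then have "a\<^sup>2 * wnorm v \<le> a\<^sup>2 * (2 * (C1 * (exp 1 * n) * a powr (- crit) + C1 * wnorm W / a))"
      by (intro mult_left_mono) auto
    also have "\<dots> = C1 * (2 * exp 1) * (a powr (2 - crit) * n) + C1 * 2 * (a * wnorm W)"
    proof -
      have "a powr (2 - crit) = a powr 2 * a powr (- crit)"
        by (simp only: powr_add[symmetric] minus_divide_left[symmetric] diff_conv_add_uminus)
      also have "a powr 2 = a\<^sup>2" using a by simp
      finally show ?thesis using a by (simp add: field_simps power2_eq_square)
    qed
    also have "\<dots> \<le> C1 * (2 * exp 1) * (a powr (2 - crit) * n) + C1 * 2 * (C1 * wnorm f)"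
      using Wn a C1 by (intro add_left_mono mult_left_mono) (auto simp: field_simps)
    also have "\<dots> \<le> C2 * (a powr (2 - crit) * n) + C2 * wnorm f"
    proof (intro add_mono)
      show "C1 * (2 * exp 1) * (a powr (2 - crit) * n) \<le> C2 * (a powr (2 - crit) * n)"
        using C1 by (intro mult_right_mono) (auto simp: C2_def n_def algebra_simps)
      have "C1 * 2 * C1 * wnorm f \<le> C2 * wnorm f"
        using C1 wnorm_nonneg[of f] by (intro mult_right_mono) (auto simp: C2_def algebra_simps)
      then show "C1 * 2 * (C1 * wnorm f) \<le> C2 * wnorm f" by (simp add: mult.assoc)
    qed
    finally have "a\<^sup>2 * wnorm v \<le> C2 * (wnorm f + a powr (2 - crit) * n)"
      by (simp add: algebra_simps)
    moreover have "a * wnorm W \<le> C2 * wnorm f"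
    proof -
      have "a * wnorm W \<le> C1 * wnorm f" using Wn a by (simp add: field_simps)
      also have "\<dots> \<le> C2 * wnorm f"
        using C1 wnorm_nonneg[of f] by (intro mult_right_mono) (auto simp: C2_def intro!: add_nonneg_nonneg)
      finally show ?thesis .
    qed
    ultimately show ?thesis using Wl vl by (simp add: a_def n_def)
  qed
  note main = this
  have "0 < C2" using C1 unfolding C2_def by (intro add_nonneg_pos mult_nonneg_nonneg) auto
  then show thesis by (rule that) (rule main)
qed

text \<open>
  Two solutions differ by a multiple of \<open>exp (s * t)\<close>, which has infinite norm.
\<close>

lemma forward_boundI_wLp:
  fixes f W :: "real \<Rightarrow> 'a::complex_banach"
  assumes f: "f \<in> wLp" and s: "0 < Re s"
    and W: "indef_integral W (\<lambda>t. s *\<^sub>C W t - f t)" and Wl: "W \<in> wLp"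
  shows "forward_bound (Re s) f W"
proof -
  obtain W' where W': "indef_integral W' (\<lambda>t. s *\<^sub>C W' t - f t)" and fb: "forward_bound (Re s) f W'"
    using forward_solution_exists[OF f s] by blast
  have W'c: "continuous_on {0<..} W'" by (rule indef_integral_continuous_on[OF W'])
  have "\<exists>v. indef_integral v (\<lambda>t. exp (s * complex_of_real t) *\<^sub>C W' t)"
  proof (rule indef_integral_exists)
    have "continuous_on {0<..} (\<lambda>t. exp (s * complex_of_real t) *\<^sub>C W' t)"
      by (intro scaleC.continuous_on continuous_intros W'c)
    then show "loc_integrable (\<lambda>t. exp (s * complex_of_real t) *\<^sub>C W' t)"
      unfolding loc_integrable_def using set_integrable_on_continuous by blast
  qed
  then obtain Y where Y: "indef_integral Y (\<lambda>t. exp (s * complex_of_real t) *\<^sub>C W' t)" by blast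
  define v where "v t = exp (- s * complex_of_real t) *\<^sub>C Y t" for t
  have "indef_integral v (\<lambda>t. exp (- s * complex_of_real t) *\<^sub>C (- s *\<^sub>C Y t + exp (s * complex_of_real t) *\<^sub>C W' t))"
    unfolding v_def by (rule indef_integral_exp[OF Y])
  then have v: "indef_integral v (\<lambda>t. W' t - s *\<^sub>C v t)"
    by (rule indef_integral_cong) (simp_all add: v_def scaleC.add_right scaleC.diff_right scaleC.minus_left scaleC.minus_right scaleC_scaleC mult.commute flip: exp_add)
  have W'l: "W' \<in> wLp"
    by (rule second_order_bound[where 'a='a]) (use s f W'c fb v in blast)
  define D where "D t = W t - W' t" for t
  have "D \<in> wLp"
    using wLp_combination(1)[of W W' 1 1] Wl W'l unfolding D_def[abs_def] by simp
  then have fin: "wpow D < \<infinity>" by (simp add: Lp_weighted_iff)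
  have "indef_integral D (\<lambda>t. (s *\<^sub>C W t - f t) - (s *\<^sub>C W' t - f t))"
    unfolding D_def by (rule indef_integral_diff[OF W W'])
  then have "indef_integral D (\<lambda>t. s *\<^sub>C D t)"
    by (rule indef_integral_cong) (simp_all add: D_def scaleC.diff_right)
  from indef_integral_exp[OF this, of "- s"]
  have D: "indef_integral (\<lambda>t. exp (- s * complex_of_real t) *\<^sub>C D t) (\<lambda>t. 0)"
    by (simp add: scaleC.minus_left scaleC.zero_right)
  have D0: "D x = 0" if x: "0 < x" for x
  proof (rule ccontr)
    assume nz: "D x \<noteq> 0"
    have "norm (D x) \<le> norm (D t)" if t: "x < t" for t
    proof -
      have "exp (- s * complex_of_real x) *\<^sub>C D x = exp (- s * complex_of_real t) *\<^sub>C D t"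
        using indef_integral_zero_const[OF D, of x t] x t by simp
      then have "norm (exp (- s * complex_of_real x) *\<^sub>C D x) = norm (exp (- s * complex_of_real t) *\<^sub>C D t)" by simp
      then have eq: "exp (- Re s * x) * norm (D x) = exp (- Re s * t) * norm (D t)" by (simp add: norm_scaleC)
      have "exp (- Re s * t) * norm (D x) \<le> exp (- Re s * x) * norm (D x)"
        using s t by (intro mult_right_mono) auto
      then show ?thesis unfolding eq by simp
    qed
    then have "wpow D = \<infinity>"
      using nz by (intro weighted_power_infinite[of "norm (D x)" x]) auto
    then show False using fin by simp
  qed
  show ?thesis
    using fb D0 unfolding forward_bound_def D_def by simp
qed

section \<open>Sources near the origin and boundary values\<close>

text \<open>
  Otherwise \<open>u\<close> would stay away from zero beyond \<open>y\<close>, which its finite norm forbids.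
\<close>

lemma norm_le_tail_integral:
  fixes u u' :: "real \<Rightarrow> 'a::banach"
  assumes u: "indef_integral u u'" and ul: "u \<in> wLp" and y: "0 < y"
    and T: "nnint {y<..} (\<lambda>t. norm (u' t)) \<le> ennreal T" "0 \<le> T"
  shows "norm (u y) \<le> T"
proof (rule ccontr)
  assume "\<not> norm (u y) \<le> T"
  then have \<kappa>: "0 < norm (u y) - T" by simp
  have "norm (u y) - T \<le> norm (u t)" if t: "y < t" for t
  proof -
    have "ennreal (norm (u t - u y)) \<le> nnint {y<..t} (\<lambda>r. norm (u' r))"
      by (rule indef_integral_norm_le[OF u y]) (use t in simp)
    also have "\<dots> \<le> nnint {y<..} (\<lambda>r. norm (u' r))"
      by (intro nn_integral_mono) (auto split: split_indicator)
    also note T(1)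
    finally have "norm (u t - u y) \<le> T" using T(2) by simp
    then show ?thesis using norm_triangle_ineq3[of "u t" "u y"] by linarith
  qed
  then have "wpow u = \<infinity>" by (intro weighted_power_infinite[OF \<kappa>])
  then show False using ul by (simp add: Lp_weighted_iff)
qed

lemma Sobolev_chain_shift:
  "chain (Suc k) F \<Longrightarrow> chain k (\<lambda>i. F (Suc i))"
  unfolding Sobolev_chain_def by auto

lemma Sobolev_chain_shift_add:
  "chain (i + k) F \<Longrightarrow> chain k (\<lambda>j. F (i + j))"
  unfolding Sobolev_chain_def by auto

lemma Sobolev_chain_mono:
  "chain k F \<Longrightarrow> m \<le> k \<Longrightarrow> chain m F"
  unfolding Sobolev_chain_def by auto

text \<open>
  Hardy's inequality in pointwise form: when the weight is so heavy that no trace exists,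
  a Sobolev function is the iterated tail integral of its last derivative.
\<close>

lemma Sobolev_pointwise:
  shows "real (Suc m) * p - 1 < \<gamma> \<Longrightarrow> \<exists>C>0. \<forall>F :: nat \<Rightarrow> real \<Rightarrow> 'a::complex_banach.
    chain (Suc m) F \<longrightarrow>
    (\<forall>y>0. norm (F 0 y) \<le> C * y powr (real (Suc m) - crit) * wnorm (F (Suc m)))"
proof (induction m)
  case 0
  obtain C where C: "0 < C" and tail: "\<And>(f :: real \<Rightarrow> 'a) d. f \<in> wLp \<Longrightarrow> 0 < d \<Longrightarrow>
    nnint {d<..} (\<lambda>t. t powr 0 * norm (f t)) \<le> ennreal (C * d powr (1 + 0 - crit) * wnorm f)"
    using powr_holder_tail[of 0, where 'a='a] 0 by auto
  have "norm (F 0 y) \<le> C * y powr (real (Suc 0) - crit) * wnorm (F (Suc 0))"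
    if F: "chain (Suc 0) F" and y: "0 < y" for F :: "nat \<Rightarrow> real \<Rightarrow> 'a" and y
  proof (rule norm_le_tail_integral[OF _ _ y])
    show "indef_integral (F 0) (F (Suc 0))" "F 0 \<in> wLp" using F by (auto simp: Sobolev_chain_def)
    have F1: "F (Suc 0) \<in> wLp" using F by (auto simp: Sobolev_chain_def)
    have "nnint {y<..} (\<lambda>t. norm (F (Suc 0) t)) = nnint {y<..} (\<lambda>t. t powr 0 * norm (F (Suc 0) t))"
      using y by (intro nn_integral_cong) (auto split: split_indicator)
    also have "\<dots> \<le> ennreal (C * y powr (1 + 0 - crit) * wnorm (F (Suc 0)))" by (rule tail[OF F1 y])
    finally show "nnint {y<..} (\<lambda>t. norm (F (Suc 0) t))
      \<le> ennreal (C * y powr (real (Suc 0) - crit) * wnorm (F (Suc 0)))" by simp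
  next
    show "0 \<le> C * y powr (real (Suc 0) - crit) * wnorm (F (Suc 0))"
      using C by (intro mult_nonneg_nonneg wnorm_nonneg) auto
  qed
  then show ?case using C by blast
next
  case (Suc m)
  define e where "e = real (Suc m) - crit"
  have "real (Suc (Suc m)) * p < \<gamma> + 1" using Suc.prems by linarith
  then have "real (Suc (Suc m)) < crit" using p0 by (simp add: pos_less_divide_eq)
  then have e: "e < -1" by (simp add: e_def)
  have "real (Suc m) * p - 1 < \<gamma>" using Suc.prems p by (simp add: algebra_simps)
  then obtain C where C: "0 < C" and IH: "\<And>F :: nat \<Rightarrow> real \<Rightarrow> 'a. chain (Suc m) F \<Longrightarrow>
    \<forall>y>0. norm (F 0 y) \<le> C * y powr e * wnorm (F (Suc m))"
    using Suc.IH unfolding e_def by blast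
  have "norm (F 0 y) \<le> C / (- (e + 1)) * y powr (real (Suc (Suc m)) - crit) * wnorm (F (Suc (Suc m)))"
    if F: "chain (Suc (Suc m)) F" and y: "0 < y" for F :: "nat \<Rightarrow> real \<Rightarrow> 'a" and y
  proof (rule norm_le_tail_integral[OF _ _ y])
    show "indef_integral (F 0) (F (Suc 0))" "F 0 \<in> wLp" using F by (auto simp: Sobolev_chain_def)
    let ?n = "wnorm (F (Suc (Suc m)))"
    have b: "norm (F (Suc 0) t) \<le> C * t powr e * ?n" if "0 < t" for t
      using IH[OF Sobolev_chain_shift[OF F]] that by simp
    have "nnint {y<..} (\<lambda>t. norm (F (Suc 0) t))
      \<le> (\<integral>\<^sup>+t. ennreal (C * ?n) * (ennreal (t powr e) * indicator {y<..} t) \<partial>lborel)"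
    proof (rule nn_integral_mono)
      fix t
      show "ennreal (norm (F (Suc 0) t)) * indicator {y<..} t \<le> ennreal (C * ?n) * (ennreal (t powr e) * indicator {y<..} t)"
        using b[of t] y C wnorm_nonneg[of "F (Suc (Suc m))"]
        by (auto split: split_indicator simp flip: ennreal_mult simp: mult_ac intro!: ennreal_leI)
    qed
    also have "\<dots> = ennreal (C * ?n) * nnint {y<..} (\<lambda>t. t powr e)"
      by (rule nn_integral_cmult) measurable
    also have "\<dots> \<le> ennreal (C * ?n) * ennreal (y powr (e + 1) / (- (e + 1)))"
      by (intro mult_left_mono nn_integral_powr_tail e y) auto
    also have "\<dots> = ennreal (C * ?n * (y powr (e + 1) / (- (e + 1))))"
      using C wnorm_nonneg[of "F (Suc (Suc m))"] e by (intro ennreal_mult[symmetric]) (auto intro: divide_nonneg_nonneg)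
    also have "C * ?n * (y powr (e + 1) / (- (e + 1))) = C / (- (e + 1)) * y powr (real (Suc (Suc m)) - crit) * ?n"
    proof -
      have "real (Suc (Suc m)) - crit = e + 1" by (simp add: e_def)
      then show ?thesis by (simp only: times_divide_eq_left times_divide_eq_right mult_ac)
    qed
    finally show "nnint {y<..} (\<lambda>t. norm (F (Suc 0) t))
      \<le> ennreal (C / (- (e + 1)) * y powr (real (Suc (Suc m)) - crit) * ?n)" .
  next
    have "0 \<le> C / (- (e + 1))" using C e by (intro divide_nonneg_nonneg) auto
    then show "0 \<le> C / (- (e + 1)) * y powr (real (Suc (Suc m)) - crit) * wnorm (F (Suc (Suc m)))"
      by (intro mult_nonneg_nonneg wnorm_nonneg) auto
  qed
  moreover have "0 < C / (- (e + 1))" using C e by (intro divide_pos_pos) auto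
  ultimately show ?case by blast
qed

text \<open>
  The parts of a source \<open>f\<close> before and after \<open>1 / a\<close> that determine the solution at \<open>1 / a\<close>.
\<close>

abbreviation near_source :: "nat \<Rightarrow> real \<Rightarrow> (real \<Rightarrow> 'a::real_normed_vector) \<Rightarrow> ennreal" where
  "near_source e d f \<equiv> nnint {0<..d} (\<lambda>t. t powr real e * norm (f t))"

abbreviation far_source :: "real \<Rightarrow> (real \<Rightarrow> 'a::real_normed_vector) \<Rightarrow> ennreal" where
  "far_source a f \<equiv> nnint {1/a<..} (\<lambda>t. exp (- a * (t - 1/a)) * norm (f t))"

lemma far_source_bound:
  shows "\<exists>C>0. \<forall>f :: real \<Rightarrow> 'a::complex_banach. f \<in> wLp \<longrightarrow>
    (\<forall>a>0. far_source a f \<le> ennreal (C * a powr (crit - 1) * wnorm f))"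
proof -
  obtain C where C: "0 < C" and tail: "\<And>(f :: real \<Rightarrow> 'a) a x. f \<in> wLp \<Longrightarrow> 0 < a \<Longrightarrow> 0 < x \<Longrightarrow>
    nnint {x<..} (\<lambda>t. exp (- a * (t - x)) * norm (f t))
      \<le> ennreal (C * (1 + 1 / (a * x)) powr (\<bar>\<gamma>\<bar> / p) * a powr (1/p - 1) * x powr (- \<gamma> / p) * wnorm f)"
    using exp_holder_tail[where 'a='a] by blast
  have "far_source a f \<le> ennreal (C * 2 powr (\<bar>\<gamma>\<bar> / p) * a powr (crit - 1) * wnorm f)"
    if f: "f \<in> wLp" and a: "0 < a" for f :: "real \<Rightarrow> 'a" and a
  proof -
    have "0 < 1 / a" using a by simp
    note tail[OF f a this]
    also have "C * (1 + 1 / (a * (1/a))) powr (\<bar>\<gamma>\<bar> / p) * a powr (1/p - 1) * (1/a) powr (- \<gamma> / p) * wnorm f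
        = C * 2 powr (\<bar>\<gamma>\<bar> / p) * a powr (crit - 1) * wnorm f"
    proof -
      have "(1/a) powr (- \<gamma> / p) = a powr (\<gamma> / p)"
        using a by (simp add: powr_divide powr_minus_divide)
      moreover have "a powr (1/p - 1) * a powr (\<gamma> / p) = a powr (crit - 1)"
      proof -
        have "1/p - 1 + \<gamma> / p = crit - 1" by (simp add: add_divide_distrib)
        then show ?thesis by (simp only: powr_add[symmetric])
      qed
      moreover have "1 + 1 / (a * (1/a)) = 2" using a by simp
      ultimately show ?thesis by (simp add: mult.assoc)
    qed
    finally show ?thesis .
  qed
  moreover have "0 < C * 2 powr (\<bar>\<gamma>\<bar> / p)" using C by simp
  ultimately show ?thesis by blast
qed

text \<open>
  For \<open>m = 0\<close> this is Hoelder's inequality. Otherwise the weight is too small near the origin for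
  that, and the pointwise bound of \<open>F 0\<close> is used; the second inequality on \<open>\<gamma>\<close> makes the resulting
  power of \<open>t\<close> integrable there.
\<close>

lemma source_bounds:
  assumes m: "real m * p - 1 < \<gamma>" "\<gamma> < (real m + 1 + real e) * p - 1"
  shows "\<exists>C>0. \<forall>F :: nat \<Rightarrow> real \<Rightarrow> 'a::complex_banach. chain m F \<longrightarrow>
    (\<forall>d>0. near_source e d (F 0) \<le> ennreal (C * d powr (real m + 1 + real e - crit) * wnorm (F m))) \<and>
    (\<forall>a>0. far_source a (F 0) \<le> ennreal (C * a powr (crit - real m - 1) * wnorm (F m)))"
proof (cases m)
  case 0
  obtain C1 where C1: "0 < C1" and head: "\<And>(f :: real \<Rightarrow> 'a) d. f \<in> wLp \<Longrightarrow> 0 < d \<Longrightarrow>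
    near_source e d f \<le> ennreal (C1 * d powr (1 + real e - crit) * wnorm f)"
    using powr_holder_head[of "real e", where 'a='a] m 0 by auto
  obtain C2 where C2: "0 < C2" and far: "\<And>(f :: real \<Rightarrow> 'a) a. f \<in> wLp \<Longrightarrow> 0 < a \<Longrightarrow>
    far_source a f \<le> ennreal (C2 * a powr (crit - 1) * wnorm f)"
    using far_source_bound[where 'a='a] by blast
  have mx: "ennreal (C1 * x * w) \<le> ennreal (max C1 C2 * x * w)" "ennreal (C2 * x * w) \<le> ennreal (max C1 C2 * x * w)"
    if "0 \<le> x" "0 \<le> w" for x w
    using that by (auto intro!: ennreal_leI mult_right_mono)
  have "near_source e d (F 0) \<le> ennreal (max C1 C2 * d powr (real m + 1 + real e - crit) * wnorm (F m))"
    if F: "chain m F" and d: "0 < d" for F :: "nat \<Rightarrow> real \<Rightarrow> 'a" and d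
  proof -
    have F0: "F 0 \<in> wLp" using F by (auto simp: Sobolev_chain_def)
    from head[OF F0 d] have "near_source e d (F 0) \<le> ennreal (C1 * d powr (1 + real e - crit) * wnorm (F 0))" .
    also have "\<dots> \<le> ennreal (max C1 C2 * d powr (1 + real e - crit) * wnorm (F 0))"
      by (rule mx) (auto simp: wnorm_nonneg)
    finally show ?thesis by (simp add: 0)
  qed
  moreover have "far_source a (F 0) \<le> ennreal (max C1 C2 * a powr (crit - real m - 1) * wnorm (F m))"
    if F: "chain m F" and a: "0 < a" for F :: "nat \<Rightarrow> real \<Rightarrow> 'a" and a
  proof -
    have F0: "F 0 \<in> wLp" using F by (auto simp: Sobolev_chain_def)
    from far[OF F0 a] have "far_source a (F 0) \<le> ennreal (max C1 C2 * a powr (crit - 1) * wnorm (F 0))"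
      by (rule order_trans) (rule mx, auto simp: wnorm_nonneg)
    then show ?thesis by (simp add: 0)
  qed
  moreover have "0 < max C1 C2" using C1 by simp
  ultimately show ?thesis by blast
next
  case (Suc m')
  define q where "q = real m - crit"
  have "real m < crit" using m(1) p0 by (simp add: pos_less_divide_eq)
  then have q: "q < 0" by (simp add: q_def)
  have "crit < real m + 1 + real e" using m(2) p0 by (simp add: pos_divide_less_eq)
  then have q2: "-1 < real e + q" by (simp add: q_def)
  obtain C where C: "0 < C" and pw: "\<And>(F :: nat \<Rightarrow> real \<Rightarrow> 'a) y. chain m F \<Longrightarrow> 0 < y \<Longrightarrow>
    norm (F 0 y) \<le> C * y powr q * wnorm (F m)"
    using Sobolev_pointwise[where 'a='a and m=m'] m Suc unfolding q_def by blast
  define C' where "C' = C * max 1 (1 / (real e + q + 1))"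
  have "C * 1 \<le> C'" "C * (1 / (real e + q + 1)) \<le> C'"
    unfolding C'_def using C by (intro mult_left_mono; simp)+
  then have C': "C \<le> C'" "C / (real e + q + 1) \<le> C'" by simp_all
  have "near_source e d (F 0) \<le> ennreal (C' * d powr (real m + 1 + real e - crit) * wnorm (F m))"
    if F: "chain m F" and d: "0 < d" for F :: "nat \<Rightarrow> real \<Rightarrow> 'a" and d
  proof -
    let ?n = "wnorm (F m)"
    have "near_source e d (F 0) \<le> (\<integral>\<^sup>+t. ennreal (C * ?n) * (ennreal (t powr (real e + q)) * indicator {0<..d} t) \<partial>lborel)"
    proof (rule nn_integral_mono)
      fix t
      show "ennreal (t powr real e * norm (F 0 t)) * indicator {0<..d} t
        \<le> ennreal (C * ?n) * (ennreal (t powr (real e + q)) * indicator {0<..d} t)"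
      proof (cases "t \<in> {0<..d}")
        case True
        have "t powr real e * norm (F 0 t) \<le> t powr real e * (C * t powr q * ?n)"
          using True by (intro mult_left_mono pw[OF F]) auto
        also have "\<dots> = C * ?n * t powr (real e + q)" by (simp add: powr_add)
        finally show ?thesis using True C wnorm_nonneg[of "F m"] by (simp flip: ennreal_mult add: ennreal_leI)
      qed simp
    qed
    also have "\<dots> = ennreal (C * ?n) * nnint {0<..d} (\<lambda>t. t powr (real e + q))"
      by (rule nn_integral_cmult) measurable
    also have "\<dots> \<le> ennreal (C * ?n) * ennreal (d powr (real e + q + 1) / (real e + q + 1))"
      by (intro mult_left_mono nn_integral_powr_head q2) (use d in auto)
    also have "\<dots> = ennreal (C * ?n * (d powr (real e + q + 1) / (real e + q + 1)))"
      using C q2 wnorm_nonneg[of "F m"] by (intro ennreal_mult[symmetric]) auto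
    also have "\<dots> \<le> ennreal (C' * d powr (real m + 1 + real e - crit) * ?n)"
    proof (rule ennreal_leI)
      have "C * ?n * (d powr (real e + q + 1) / (real e + q + 1)) = C / (real e + q + 1) * (d powr (real e + q + 1) * ?n)"
        by simp
      also have "\<dots> \<le> C' * (d powr (real e + q + 1) * ?n)"
        by (intro mult_right_mono mult_nonneg_nonneg C' wnorm_nonneg) auto
      finally have "C * ?n * (d powr (real e + q + 1) / (real e + q + 1)) \<le> C' * d powr (real e + q + 1) * ?n"
        by (simp only: mult.assoc)
      moreover have "real m + 1 + real e - crit = real e + q + 1" by (simp add: q_def)
      ultimately show "C * ?n * (d powr (real e + q + 1) / (real e + q + 1)) \<le> C' * d powr (real m + 1 + real e - crit) * ?n"
        by (simp only:)
    qed
    finally show ?thesis .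
  qed
  moreover have "far_source a (F 0) \<le> ennreal (C' * a powr (crit - real m - 1) * wnorm (F m))"
    if F: "chain m F" and a: "0 < a" for F :: "nat \<Rightarrow> real \<Rightarrow> 'a" and a
  proof -
    let ?n = "wnorm (F m)"
    have qa: "(1/a) powr q = a powr (- q)" using a by (simp add: powr_divide powr_minus_divide)
    have "far_source a (F 0) \<le> (\<integral>\<^sup>+t. ennreal (C * a powr (- q) * ?n) * (ennreal (exp (- a * (t - 1/a))) * indicator {1/a<..} t) \<partial>lborel)"
    proof (rule nn_integral_mono)
      fix t
      show "ennreal (exp (- a * (t - 1/a)) * norm (F 0 t)) * indicator {1/a<..} t
        \<le> ennreal (C * a powr (- q) * ?n) * (ennreal (exp (- a * (t - 1/a))) * indicator {1/a<..} t)"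
      proof (cases "1/a < t")
        case True
        have t: "0 < t" using True a by (auto intro: less_trans[of 0 "1/a"])
        have "t powr q \<le> (1/a) powr q" using True a q by (intro powr_mono2') auto
        then have "C * t powr q * ?n \<le> C * a powr (- q) * ?n"
          unfolding qa using C wnorm_nonneg by (intro mult_right_mono mult_left_mono) auto
        with pw[OF F t] have "norm (F 0 t) \<le> C * a powr (- q) * ?n" by (rule order_trans)
        then have "exp (- a * (t - 1/a)) * norm (F 0 t) \<le> exp (- a * (t - 1/a)) * (C * a powr (- q) * ?n)"
          by (rule mult_left_mono) simp
        then have "ennreal (exp (- a * (t - 1/a)) * norm (F 0 t)) \<le> ennreal (C * a powr (- q) * ?n * exp (- a * (t - 1/a)))"
          by (intro ennreal_leI) (simp only: mult.commute)
        also have "\<dots> = ennreal (C * a powr (- q) * ?n) * ennreal (exp (- a * (t - 1/a)))"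
          using C wnorm_nonneg[of "F m"] by (intro ennreal_mult) auto
        finally show ?thesis using True by simp
      qed simp
    qed
    also have "\<dots> = ennreal (C * a powr (- q) * ?n) * nnint {1/a<..} (\<lambda>t. exp (- a * (t - 1/a)))"
      by (rule nn_integral_cmult) measurable
    also have "\<dots> \<le> ennreal (C * a powr (- q) * ?n) * ennreal (1/a)"
      by (intro mult_left_mono nn_integral_exp_tail a) auto
    also have "\<dots> = ennreal (C * a powr (- q) * ?n * (1/a))"
      using C a wnorm_nonneg[of "F m"] by (intro ennreal_mult[symmetric]) auto
    also have "\<dots> \<le> ennreal (C' * a powr (crit - real m - 1) * ?n)"
    proof (rule ennreal_leI)
      have "a powr (crit - real m - 1) = a powr (- q) * (1/a)"
        using a by (simp add: q_def powr_diff)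
      then show "C * a powr (- q) * ?n * (1/a) \<le> C' * a powr (crit - real m - 1) * ?n"
        using mult_right_mono[OF C'(1), of "a powr (- q) * (1/a) * ?n"] a wnorm_nonneg[of "F m"]
        by (simp add: mult_ac)
    qed
    finally show ?thesis .
  qed
  moreover have "0 < C'" using C C'(1) by linarith
  ultimately show ?thesis by blast
qed

text \<open>
  By Fubini's theorem, the source at \<open>t\<close> contributes to \<open>W\<close> only on an interval of length at most
  \<open>min t (1 / a)\<close>.
\<close>

lemma forward_bound_integral:
  fixes f W :: "real \<Rightarrow> 'a::complex_banach"
  assumes a: "0 < a" and f: "f \<in> wLp" and fb: "forward_bound a f W"
  shows "nnint {0<..1/a} (\<lambda>y. norm (W y)) \<le> near_source 1 (1/a) f + ennreal (1/a) * far_source a f"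
proof -
  obtain h :: "real \<Rightarrow> real" where h[measurable]: "h \<in> borel_measurable borel" and h0: "\<And>t. 0 \<le> h t"
    and hf: "AE t in lborel. 0 < t \<longrightarrow> norm (f t) = h t"
    using wLp_representative[OF f] by blast
  have a1: "0 < 1/a" using a by simp
  let ?k = "\<lambda>y t. ennreal (exp (- a * (t - y)) * h t) * indicator {y<..} t * indicator {0<..1/a} y"
  have km: "(\<lambda>(y, t). ?k y t) \<in> borel_measurable (lborel \<Otimes>\<^sub>M lborel)"
  proof -
    have "(\<lambda>(y::real, t::real). ennreal (exp (- a * (t - y)) * h t) * (if y < t then 1 else 0) * (if 0 < y \<and> y \<le> 1/a then 1 else 0))
      \<in> borel_measurable (lborel \<Otimes>\<^sub>M lborel)" by measurable
    also have "(\<lambda>(y::real, t::real). ennreal (exp (- a * (t - y)) * h t) * (if y < t then 1 else 0) * (if 0 < y \<and> y \<le> 1/a then 1 else 0))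
      = (\<lambda>(y, t). ?k y t)" by (auto simp: fun_eq_iff split: split_indicator)
    finally show ?thesis .
  qed
  have "nnint {0<..1/a} (\<lambda>y. norm (W y)) \<le> (\<integral>\<^sup>+y. \<integral>\<^sup>+t. ?k y t \<partial>lborel \<partial>lborel)"
  proof (rule nn_integral_mono)
    fix y
    show "ennreal (norm (W y)) * indicator {0<..1/a} y \<le> (\<integral>\<^sup>+t. ?k y t \<partial>lborel)"
    proof (cases "y \<in> {0<..1/a}")
      case True
      then have "ennreal (norm (W y)) \<le> nnint {y<..} (\<lambda>t. exp (- a * (t - y)) * norm (f t))"
        using fb by (auto simp: forward_bound_def)
      also have "\<dots> = nnint {y<..} (\<lambda>t. exp (- a * (t - y)) * h t)"
        by (rule nn_integral_norm_representative[OF hf]) (use True in auto)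
      finally show ?thesis using True by simp
    qed simp
  qed
  also have "\<dots> = (\<integral>\<^sup>+t. \<integral>\<^sup>+y. ?k y t \<partial>lborel \<partial>lborel)"
    by (rule lborel_pair.Fubini'[OF km, symmetric])
  also have "\<dots> \<le> (\<integral>\<^sup>+t. ennreal (t powr real 1 * h t) * indicator {0<..1/a} t
      + ennreal (1/a) * (ennreal (exp (- a * (t - 1/a)) * h t) * indicator {1/a<..} t) \<partial>lborel)"
  proof (rule nn_integral_mono)
    fix t
    consider "t \<le> 0" | "0 < t" "t \<le> 1/a" | "1/a < t" by linarith
    then show "(\<integral>\<^sup>+y. ?k y t \<partial>lborel) \<le> ennreal (t powr real 1 * h t) * indicator {0<..1/a} t
      + ennreal (1/a) * (ennreal (exp (- a * (t - 1/a)) * h t) * indicator {1/a<..} t)"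
    proof cases
      case 1
      then have "?k y t = 0" for y by (auto split: split_indicator)
      then have "(\<integral>\<^sup>+y. ?k y t \<partial>lborel) = nn_integral lborel (\<lambda>y::real. 0)" by (intro nn_integral_cong)
      then show ?thesis by simp
    next
      case 2
      have "(\<integral>\<^sup>+y. ?k y t \<partial>lborel) \<le> (\<integral>\<^sup>+y. ennreal (h t) * indicator {0<..t} y \<partial>lborel)"
      proof (rule nn_integral_mono)
        fix y
        have "exp (- a * (t - y)) * h t \<le> 1 * h t" if "y < t"
          using that a h0 by (intro mult_right_mono) auto
        then show "?k y t \<le> ennreal (h t) * indicator {0<..t} y"
          by (auto split: split_indicator intro!: ennreal_leI)
      qed
      also have "\<dots> = ennreal (h t) * ennreal t" using 2 by (subst nn_integral_cmult_indicator) auto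
      finally show ?thesis using 2 h0[of t] by (simp add: mult.commute flip: ennreal_mult)
    next
      case 3
      have "(\<integral>\<^sup>+y. ?k y t \<partial>lborel) \<le> (\<integral>\<^sup>+y. ennreal (exp (- a * (t - 1/a)) * h t) * indicator {0<..1/a} y \<partial>lborel)"
      proof (rule nn_integral_mono)
        fix y
        have "exp (- a * (t - y)) * h t \<le> exp (- a * (t - 1/a)) * h t" if "y \<le> 1/a"
          using that a h0 by (intro mult_right_mono) auto
        then show "?k y t \<le> ennreal (exp (- a * (t - 1/a)) * h t) * indicator {0<..1/a} y"
          by (auto split: split_indicator intro!: ennreal_leI)
      qed
      also have "\<dots> = ennreal (exp (- a * (t - 1/a)) * h t) * ennreal (1/a)" using a by (subst nn_integral_cmult_indicator) auto
      finally show ?thesis using 3 by (simp add: mult.commute)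
    qed
  qed
  also have "\<dots> = nnint {0<..1/a} (\<lambda>t. t powr real 1 * h t)
      + ennreal (1/a) * nnint {1/a<..} (\<lambda>t. exp (- a * (t - 1/a)) * h t)"
    by (subst nn_integral_add, measurable, subst nn_integral_cmult, measurable)
  also have "nnint {0<..1/a} (\<lambda>t. t powr real 1 * h t) = near_source 1 (1/a) f"
    by (rule nn_integral_norm_representative[OF hf, symmetric]) auto
  also have "nnint {1/a<..} (\<lambda>t. exp (- a * (t - 1/a)) * h t) = far_source a f"
    by (rule nn_integral_norm_representative[OF hf, symmetric]) (use a1 in \<open>auto intro: less_trans\<close>)
  finally show ?thesis .
qed

lemma forward_bound_near:
  fixes f W :: "real \<Rightarrow> 'a::complex_banach"
  assumes a: "0 < a" and f: "f \<in> wLp" and fb: "forward_bound a f W" and x: "0 < x" "x \<le> 1/a"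
  shows "ennreal (norm (W x)) \<le> near_source 0 (1/a) f + far_source a f"
proof -
  obtain h :: "real \<Rightarrow> real" where h[measurable]: "h \<in> borel_measurable borel" and h0: "\<And>t. 0 \<le> h t"
    and hf: "AE t in lborel. 0 < t \<longrightarrow> norm (f t) = h t"
    using wLp_representative[OF f] by blast
  have a1: "0 < 1/a" using a by simp
  have "ennreal (norm (W x)) \<le> nnint {x<..} (\<lambda>t. exp (- a * (t - x)) * norm (f t))"
    using fb x by (auto simp: forward_bound_def)
  also have "\<dots> = nnint {x<..} (\<lambda>t. exp (- a * (t - x)) * h t)"
    by (rule nn_integral_norm_representative[OF hf]) (use x in auto)
  also have "\<dots> \<le> (\<integral>\<^sup>+t. ennreal (t powr real 0 * h t) * indicator {0<..1/a} t
      + ennreal (exp (- a * (t - 1/a)) * h t) * indicator {1/a<..} t \<partial>lborel)"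
  proof (rule nn_integral_mono)
    fix t
    have "exp (- a * (t - x)) * h t \<le> 1 * h t" if "x < t"
      using that a h0 by (intro mult_right_mono) auto
    moreover have "exp (- a * (t - x)) * h t \<le> exp (- a * (t - 1/a)) * h t"
      using x a h0 by (intro mult_right_mono) auto
    ultimately show "ennreal (exp (- a * (t - x)) * h t) * indicator {x<..} t \<le> ennreal (t powr real 0 * h t) * indicator {0<..1/a} t
      + ennreal (exp (- a * (t - 1/a)) * h t) * indicator {1/a<..} t"
      using x by (auto split: split_indicator intro!: ennreal_leI)
  qed
  also have "\<dots> = nnint {0<..1/a} (\<lambda>t. t powr real 0 * h t)
      + nnint {1/a<..} (\<lambda>t. exp (- a * (t - 1/a)) * h t)"
    by (subst nn_integral_add, measurable)
  also have "nnint {0<..1/a} (\<lambda>t. t powr real 0 * h t) = near_source 0 (1/a) f"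
    by (rule nn_integral_norm_representative[OF hf, symmetric]) auto
  also have "nnint {1/a<..} (\<lambda>t. exp (- a * (t - 1/a)) * h t) = far_source a f"
    by (rule nn_integral_norm_representative[OF hf, symmetric]) (use a1 in \<open>auto intro: less_trans\<close>)
  finally show ?thesis .
qed

lemma near_source_one_le:
  fixes f :: "real \<Rightarrow> 'a::complex_banach"
  assumes a: "0 < a" and f: "f \<in> wLp"
  shows "near_source 1 (1/a) f \<le> ennreal (1/a) * near_source 0 (1/a) f"
proof -
  obtain h :: "real \<Rightarrow> real" where h[measurable]: "h \<in> borel_measurable borel" and h0: "\<And>t. 0 \<le> h t"
    and hf: "AE t in lborel. 0 < t \<longrightarrow> norm (f t) = h t"
    using wLp_representative[OF f] by blast
  have "near_source 1 (1/a) f = nnint {0<..1/a} (\<lambda>t. t powr real 1 * h t)"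
    by (rule nn_integral_norm_representative[OF hf]) auto
  also have "\<dots> \<le> (\<integral>\<^sup>+t. ennreal (1/a) * (ennreal (t powr real 0 * h t) * indicator {0<..1/a} t) \<partial>lborel)"
  proof (rule nn_integral_mono)
    fix t
    show "ennreal (t powr real 1 * h t) * indicator {0<..1/a} t
      \<le> ennreal (1/a) * (ennreal (t powr real 0 * h t) * indicator {0<..1/a} t)"
    proof (cases "t \<in> {0<..1/a}")
      case True
      then have "t * h t \<le> 1/a * h t" using h0 by (intro mult_right_mono) auto
      then have "ennreal (t * h t) \<le> ennreal (1/a) * ennreal (h t)"
        using a h0[of t] by (subst ennreal_mult[symmetric]) (auto intro: ennreal_leI)
      then show ?thesis using True by simp
    qed simp
  qed
  also have "\<dots> = ennreal (1/a) * nnint {0<..1/a} (\<lambda>t. t powr real 0 * h t)"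
    by (rule nn_integral_cmult) measurable
  also have "nnint {0<..1/a} (\<lambda>t. t powr real 0 * h t) = near_source 0 (1/a) f"
    by (rule nn_integral_norm_representative[OF hf, symmetric]) auto
  finally show ?thesis .
qed

text \<open>The order of vanishing at the origin of the kernel of the solution operator.\<close>

definition bc_order :: "bc \<Rightarrow> nat" where
  "bc_order b = 1 - k_bc b"

lemma bc_order_simps [simp]: "bc_order Dir = 1" "bc_order Neu = 0"
  by (simp_all add: bc_order_def)

text \<open>
  The boundary condition fixes the free constant in \<open>v' = W - s *\<^sub>C v\<close>. For Dirichlet, \<open>v (1 / a)\<close> is
  bounded by the integral of \<open>W\<close> over \<open>(0, 1 / a)\<close>; for Neumann, \<open>s *\<^sub>C v\<close> is close to \<open>W\<close> near the
  origin, where \<open>W\<close> is bounded.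
\<close>

lemma boundary_value_bound:
  fixes f W v :: "real \<Rightarrow> 'a::complex_banach"
  assumes s: "0 < Re s" and f: "f \<in> wLp" and fb: "forward_bound (Re s) f W"
    and v: "indef_integral v (\<lambda>t. W t - s *\<^sub>C v t)"
    and bc: "((if b = Dir then v else (\<lambda>t. W t - s *\<^sub>C v t)) \<longlongrightarrow> 0) (at_right 0)"
    and S: "near_source (bc_order b) (1 / Re s) f \<le> ennreal S" "0 \<le> S"
    and J: "far_source (Re s) f \<le> ennreal J" "0 \<le> J"
  shows "Re s * norm (v (1 / Re s)) \<le> 2 * (Re s ^ bc_order b * S + J)" "norm (W (1 / Re s)) \<le> J"
proof -
  define a where "a = Re s"
  have a: "0 < a" and a1: "0 < 1/a" using s by (auto simp: a_def)
  show "norm (W (1 / Re s)) \<le> J"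
  proof -
    have "ennreal (norm (W (1/a))) \<le> far_source a f" using fb a1 by (auto simp: forward_bound_def a_def)
    also have "\<dots> \<le> ennreal J" using J(1) by (simp add: a_def)
    finally show ?thesis using J(2) by (simp add: a_def)
  qed
  define T where "T = (a ^ bc_order b * S + J) / a"
  have T0: "0 \<le> T" using a S(2) J(2) by (simp add: T_def)
  have WT: "nnint {0<..1/a} (\<lambda>y. norm (W y)) \<le> ennreal T"
  proof -
    have "near_source 1 (1/a) f \<le> ennreal (a ^ bc_order b * S / a)"
    proof (cases b)
      case Dir
      then show ?thesis using S a by (simp add: a_def)
    next
      case Neu
      have "near_source 1 (1/a) f \<le> ennreal (1/a) * near_source 0 (1/a) f" by (rule near_source_one_le[OF a f])
      also have "\<dots> \<le> ennreal (1/a) * ennreal S" using S(1) Neu by (intro mult_left_mono) (auto simp: a_def)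
      finally show ?thesis using a S(2) Neu by (simp flip: ennreal_mult)
    qed
    moreover have "ennreal (1/a) * far_source a f \<le> ennreal (J / a)"
      using mult_left_mono[OF J(1), of "ennreal (1/a)"] a J(2) by (simp add: a_def flip: ennreal_mult)
    ultimately have "near_source 1 (1/a) f + ennreal (1/a) * far_source a f \<le> ennreal (a ^ bc_order b * S / a) + ennreal (J / a)"
      by (rule add_mono)
    also have "\<dots> = ennreal T" using a S(2) J(2) by (simp add: T_def add_divide_distrib flip: ennreal_plus)
    finally show ?thesis
      using forward_bound_integral[OF a f fb[folded a_def]] by (rule order_trans[rotated])
  qed
  have near: "norm (v (1/a)) \<le> norm (v x) + T" if x: "0 < x" "x \<le> 1/a" for x
  proof -
    have "ennreal (norm (v (1/a))) \<le> ennreal (exp (- a * (1/a - x)) * norm (v x))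
      + nnint {x<..1/a} (\<lambda>t. exp (- a * (1/a - t)) * norm (W t))"
      using first_order_bounds(1)[OF v x] by (simp add: a_def)
    also have "\<dots> \<le> ennreal (norm (v x)) + ennreal T"
    proof (rule add_mono)
      have "exp (- a * (1/a - x)) * norm (v x) \<le> 1 * norm (v x)"
        using a x by (intro mult_right_mono) auto
      then show "ennreal (exp (- a * (1/a - x)) * norm (v x)) \<le> ennreal (norm (v x))" by (simp add: ennreal_leI)
      have "nnint {x<..1/a} (\<lambda>t. exp (- a * (1/a - t)) * norm (W t))
        \<le> nnint {0<..1/a} (\<lambda>y. norm (W y))"
      proof (rule nn_integral_mono)
        fix t
        have "exp (- a * (1/a - t)) * norm (W t) \<le> 1 * norm (W t)" if "t \<le> 1/a"
          using a that by (intro mult_right_mono) auto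
        then show "ennreal (exp (- a * (1/a - t)) * norm (W t)) * indicator {x<..1/a} t \<le> ennreal (norm (W t)) * indicator {0<..1/a} t"
          using x by (auto split: split_indicator intro!: ennreal_leI)
      qed
      then show "nnint {x<..1/a} (\<lambda>t. exp (- a * (1/a - t)) * norm (W t)) \<le> ennreal T"
        using WT by (rule order_trans)
    qed
    also have "\<dots> = ennreal (norm (v x) + T)" by (rule ennreal_plus[symmetric]) (use T0 in auto)
    finally show ?thesis by (subst (asm) ennreal_le_iff) (use T0 in auto)
  qed
  have ev: "eventually (\<lambda>x. 0 < x \<and> x \<le> 1/a) (at_right (0::real))"
    unfolding eventually_at_right_field using a1 by (intro exI[of _ "1/a"]) auto
  have aT: "a * T = a ^ bc_order b * S + J" using a by (simp add: T_def)
  have "a * norm (v (1/a)) \<le> 2 * (a ^ bc_order b * S + J)"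
  proof (cases b)
    case Dir
    have "((\<lambda>x. norm (v x) + T) \<longlongrightarrow> norm (0::'a) + T) (at_right 0)"
      using bc Dir by (intro tendsto_intros) auto
    then have "norm (v (1/a)) \<le> norm (0::'a) + T"
      by (rule tendsto_lowerbound) (use ev in \<open>auto elim!: eventually_mono intro: near\<close>)
    then have "a * norm (v (1/a)) \<le> a * T" using a by (simp add: mult_left_mono)
    also have "\<dots> \<le> 2 * (a ^ bc_order b * S + J)" unfolding aT using a S(2) J(2) by simp
    finally show ?thesis .
  next
    case Neu
    have as: "a \<le> cmod s" using complex_Re_le_cmod[of s] by (simp add: a_def)
    have "a * norm (v (1/a)) \<le> norm (W x - s *\<^sub>C v x) + (S + J) + a * T" if x: "0 < x" "x \<le> 1/a" for x
    proof -
      have "ennreal (norm (W x)) \<le> near_source 0 (1/a) f + far_source a f"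
        by (rule forward_bound_near[OF a f _ x]) (use fb in \<open>simp add: a_def\<close>)
      also have "\<dots> \<le> ennreal S + ennreal J" using S(1) J(1) Neu by (intro add_mono) (auto simp: a_def)
      also have "\<dots> = ennreal (S + J)" by (rule ennreal_plus[symmetric]) (use S(2) J(2) in auto)
      finally have W: "norm (W x) \<le> S + J" by (subst (asm) ennreal_le_iff) (use S(2) J(2) in auto)
      have "a * norm (v x) \<le> norm (s *\<^sub>C v x)" unfolding norm_scaleC using as by (intro mult_right_mono) auto
      also have "\<dots> \<le> norm (W x - s *\<^sub>C v x) + norm (W x)"
        using norm_triangle_ineq4[of "W x" "W x - s *\<^sub>C v x"] by simp
      finally have "a * norm (v x) \<le> norm (W x - s *\<^sub>C v x) + (S + J)" using W by simp
      moreover have "a * norm (v (1/a)) \<le> a * (norm (v x) + T)" using near[OF x] a by (intro mult_left_mono) auto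
      ultimately show ?thesis by (simp add: distrib_left)
    qed
    note le = this
    have "((\<lambda>x. norm (W x - s *\<^sub>C v x) + (S + J) + a * T) \<longlongrightarrow> norm (0::'a) + (S + J) + a * T) (at_right 0)"
      using bc Neu by (intro tendsto_intros) auto
    then have "a * norm (v (1/a)) \<le> norm (0::'a) + (S + J) + a * T"
      by (rule tendsto_lowerbound) (use ev in \<open>auto elim!: eventually_mono intro: le\<close>)
    then show ?thesis unfolding aT using Neu by simp
  qed
  then show "Re s * norm (v (1 / Re s)) \<le> 2 * (Re s ^ bc_order b * S + J)" by (simp add: a_def)
qed

section \<open>A priori estimates\<close>

text \<open>
  The chains \<open>F\<close> and \<open>U\<close> consist of the right-hand side and of the solution of \<open>s\<^sup>2 u - u'' = f\<close>,
  with their derivatives. The number \<open>c\<close> bounds the angle between \<open>s\<close> and the positive real axis,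
  and is what the constants in the estimates depend on.
\<close>

definition resolvent_data :: "bc \<Rightarrow> nat \<Rightarrow> real \<Rightarrow> complex \<Rightarrow>
    (nat \<Rightarrow> real \<Rightarrow> 'a::complex_banach) \<Rightarrow> (nat \<Rightarrow> real \<Rightarrow> 'a) \<Rightarrow> bool" where
  "resolvent_data b k c s F U \<longleftrightarrow>
    0 < Re s \<and> c * cmod s \<le> Re s \<and> chain k F \<and> chain (k + 2) U \<and>
    (\<forall>i\<le>k. \<forall>t. U (i + 2) t = s\<^sup>2 *\<^sub>C U i t - F i t) \<and>
    (U (k_bc b) \<longlongrightarrow> 0) (at_right 0) \<and>
    (\<forall>j. real (k_bc b + 2 * j) < real k - crit \<longrightarrow> (F (k_bc b + 2 * j) \<longlongrightarrow> 0) (at_right 0))"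

abbreviation chain_norm :: "nat \<Rightarrow> (nat \<Rightarrow> real \<Rightarrow> 'a::real_normed_vector) \<Rightarrow> real" where
  "chain_norm k F \<equiv> (\<Sum>i\<le>k. wnorm (F i))"

lemma wnorm_le_chain_norm: "i \<le> k \<Longrightarrow> wnorm (F i) \<le> chain_norm k F"
  by (rule member_le_sum) (auto simp: wnorm_nonneg)

lemma chain_norm_nonneg: "0 \<le> chain_norm k F"
  by (intro sum_nonneg wnorm_nonneg)

text \<open>
  The factorisation of \<open>s\<^sup>2 u - u'' = f\<close>, applied at each order of differentiation.
\<close>

lemma resolvent_data_first_order:
  fixes F U :: "nat \<Rightarrow> real \<Rightarrow> 'a::complex_banach"
  assumes d: "resolvent_data b k c s F U" and i: "i \<le> k"
  defines "W \<equiv> \<lambda>t. U (Suc i) t + s *\<^sub>C U i t"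
  shows "F i \<in> wLp" "continuous_on {0<..} W" "forward_bound (Re s) (F i) W"
    "indef_integral (U i) (\<lambda>t. W t - s *\<^sub>C U i t)"
proof -
  show Fi: "F i \<in> wLp" using d i by (auto simp: resolvent_data_def Sobolev_chain_def)
  have U: "indef_integral (U i) (U (Suc i))" "indef_integral (U (Suc i)) (U (Suc (Suc i)))"
    "U i \<in> wLp" "U (Suc i) \<in> wLp"
    using d i by (auto simp: resolvent_data_def Sobolev_chain_def)
  have U2: "U (Suc (Suc i)) t = s\<^sup>2 *\<^sub>C U i t - F i t" for t
    using d i by (auto simp: resolvent_data_def)
  have W: "indef_integral W (\<lambda>t. s *\<^sub>C W t - F i t)"
  proof -
    have "indef_integral W (\<lambda>t. U (Suc (Suc i)) t + s *\<^sub>C U (Suc i) t)"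
      unfolding W_def by (intro indef_integral_add indef_integral_scaleC U)
    then show ?thesis
      by (simp add: U2 W_def scaleC.add_right scaleC_scaleC power2_eq_square algebra_simps)
  qed
  show "continuous_on {0<..} W" by (rule indef_integral_continuous_on[OF W])
  have "(\<lambda>t. 1 *\<^sub>C U (Suc i) t - (- s) *\<^sub>C U i t) \<in> wLp" by (rule wLp_combination[OF U(4,3)])
  then have Wl: "W \<in> wLp" by (simp add: W_def scaleC_one scaleC.minus_left)
  show "forward_bound (Re s) (F i) W"
    by (rule forward_boundI_wLp[OF Fi _ W Wl]) (use d in \<open>simp add: resolvent_data_def\<close>)
  show "indef_integral (U i) (\<lambda>t. W t - s *\<^sub>C U i t)" using U(1) by (simp add: W_def)
qed

lemma value_bound_of_sources:
  fixes F U :: "nat \<Rightarrow> real \<Rightarrow> 'a::complex_banach"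
  assumes d: "resolvent_data b k c s F U"
    and S: "near_source (bc_order b) (1 / Re s) (F 0) \<le> ennreal S" "0 \<le> S"
    and J: "far_source (Re s) (F 0) \<le> ennreal J" "0 \<le> J"
  shows "Re s * norm (U 0 (1 / Re s)) \<le> 2 * (Re s ^ bc_order b * S + J)"
    "norm (U 1 (1 / Re s) + s *\<^sub>C U 0 (1 / Re s)) \<le> J"
proof -
  note fo = resolvent_data_first_order[OF d, of 0, simplified]
  have s: "0 < Re s" using d by (simp add: resolvent_data_def)
  have bc: "((if b = Dir then U 0 else (\<lambda>t. U (Suc 0) t + s *\<^sub>C U 0 t - s *\<^sub>C U 0 t)) \<longlongrightarrow> 0) (at_right 0)"
    using d by (cases b) (auto simp: resolvent_data_def)
  have "indef_integral (U 0) (\<lambda>t. U (Suc 0) t + s *\<^sub>C U 0 t - s *\<^sub>C U 0 t)" using fo(4) by simp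
  note bv = boundary_value_bound[OF s fo(1) fo(3) this bc S J]
  show "Re s * norm (U 0 (1 / Re s)) \<le> 2 * (Re s ^ bc_order b * S + J)" by (rule bv)
  show "norm (U 1 (1 / Re s) + s *\<^sub>C U 0 (1 / Re s)) \<le> J" using bv(2) by simp
qed

lemma powr_one_over: "0 < (a::real) \<Longrightarrow> (1 / a) powr x = a powr (- x)"
  by (simp add: powr_divide powr_minus_divide)

text \<open>The bounds of the near source and of the far source scale in the same way.\<close>

lemma value_bound:
  assumes m: "m \<le> k"
    and lev: "real m * p - 1 < \<gamma>" "\<gamma> < (real m + 1 + real (bc_order b)) * p - 1"
  shows "\<exists>C>0. \<forall>s (F :: nat \<Rightarrow> real \<Rightarrow> 'a::complex_banach) U. resolvent_data b k c s F U \<longrightarrow>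
    Re s * norm (U 0 (1 / Re s)) \<le> C * Re s powr (crit - real m - 1) * wnorm (F m) \<and>
    norm (U 1 (1 / Re s) + s *\<^sub>C U 0 (1 / Re s)) \<le> C * Re s powr (crit - real m - 1) * wnorm (F m)"
proof -
  obtain C where C: "0 < C" and src: "\<And>F :: nat \<Rightarrow> real \<Rightarrow> 'a. chain m F \<Longrightarrow>
    (\<forall>d>0. near_source (bc_order b) d (F 0) \<le> ennreal (C * d powr (real m + 1 + real (bc_order b) - crit) * wnorm (F m))) \<and>
    (\<forall>a>0. far_source a (F 0) \<le> ennreal (C * a powr (crit - real m - 1) * wnorm (F m)))"
    using source_bounds[OF lev, where 'a='a] by blast
  have "Re s * norm (U 0 (1 / Re s)) \<le> 4 * C * Re s powr (crit - real m - 1) * wnorm (F m) \<and>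
    norm (U 1 (1 / Re s) + s *\<^sub>C U 0 (1 / Re s)) \<le> 4 * C * Re s powr (crit - real m - 1) * wnorm (F m)"
    if d: "resolvent_data b k c s F U" for s and F U :: "nat \<Rightarrow> real \<Rightarrow> 'a"
  proof -
    define a where "a = Re s"
    have a: "0 < a" "0 < 1 / a" using d by (auto simp: a_def resolvent_data_def)
    have F: "chain m F" using d m by (auto simp: resolvent_data_def intro: Sobolev_chain_mono)
    let ?e = "real m + 1 + real (bc_order b) - crit"
    define S where "S = C * (1 / a) powr ?e * wnorm (F m)"
    define J where "J = C * a powr (crit - real m - 1) * wnorm (F m)"
    have nn: "0 \<le> S" "0 \<le> J" using C wnorm_nonneg[of "F m"] by (auto simp: S_def J_def)
    have SJ: "a ^ bc_order b * S = J"
    proof -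
      have "a ^ bc_order b * (1 / a) powr ?e = a powr real (bc_order b) * a powr (- ?e)"
        using a by (simp only: powr_one_over powr_realpow)
      also have "\<dots> = a powr (crit - real m - 1)"
      proof -
        have "real (bc_order b) + - ?e = crit - real m - 1" by simp
        then show ?thesis by (simp only: powr_add[symmetric])
      qed
      finally show ?thesis unfolding S_def J_def by (simp add: mult_ac)
    qed
    have "near_source (bc_order b) (1 / Re s) (F 0) \<le> ennreal S" "far_source (Re s) (F 0) \<le> ennreal J"
      using src[OF F] a by (auto simp: S_def J_def a_def)
    from value_bound_of_sources[OF d this(1) nn(1) this(2) nn(2)]
    have "a * norm (U 0 (1 / a)) \<le> 4 * J" "norm (U 1 (1 / a) + s *\<^sub>C U 0 (1 / a)) \<le> 4 * J"
      using SJ nn by (auto simp: a_def)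
    then show ?thesis by (simp add: a_def J_def mult.assoc)
  qed
  moreover have "0 < 4 * C" using C by simp
  ultimately show ?thesis by blast
qed

lemma level_exists_below:
  assumes "\<And>j::nat. 1 \<le> j \<Longrightarrow> \<gamma> \<noteq> real j * p - 1"
  shows "\<gamma> < real k * p - 1 \<Longrightarrow> \<exists>m<k. real m * p - 1 < \<gamma> \<and> \<gamma> < (real m + 1) * p - 1"
proof (induction k)
  case 0
  then show ?case using g by simp
next
  case (Suc k)
  show ?case
  proof (cases "\<gamma> < real k * p - 1")
    case True
    then show ?thesis using Suc.IH less_SucI by blast
  next
    case False
    have "\<gamma> \<noteq> real k * p - 1" using g assms[of k] by (cases "k = 0") auto
    then show ?thesis using False Suc.prems by (intro exI[of _ k]) (auto simp: algebra_simps)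
  qed
qed

text \<open>
  The excluded values of \<open>\<gamma>\<close> are the borderlines between the levels \<open>m\<close>. Beyond the last of them
  the level is \<open>k\<close>.
\<close>

lemma level_exists:
  assumes ne: "\<And>j::nat. 1 \<le> j \<Longrightarrow> \<gamma> \<noteq> real j * p - 1"
    and \<gamma>: "\<gamma> < (real k + 1 + real e) * p - 1"
  shows "\<exists>m\<le>k. real m * p - 1 < \<gamma> \<and> \<gamma> < (real m + 1 + real e) * p - 1"
proof (cases "\<gamma> < real k * p - 1")
  case True
  then obtain m where m: "m < k" "real m * p - 1 < \<gamma>" "\<gamma> < (real m + 1) * p - 1"
    using level_exists_below[OF ne] by blast
  have "0 \<le> real e * p" using p by simp
  then have "\<gamma> < (real m + 1 + real e) * p - 1" using m(3) by (simp add: algebra_simps)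
  then show ?thesis using m less_imp_le by blast
next
  case False
  have "\<gamma> \<noteq> real k * p - 1" using ne[of k] g by (cases "k = 0") auto
  then show ?thesis using False \<gamma> by auto
qed

definition other_bc :: "bc \<Rightarrow> bc" where
  "other_bc b = (if b = Dir then Neu else Dir)"

text \<open>
  Differentiating the equation swaps the two boundary conditions. From Dirichlet to Neumann this
  uses that \<open>F 0\<close> vanishes at the origin; the assumption on \<open>\<gamma>\<close> ensures that it has a trace.
\<close>

lemma resolvent_data_shift:
  fixes F U :: "nat \<Rightarrow> real \<Rightarrow> 'a::complex_banach"
  assumes d: "resolvent_data b (Suc k) c s F U" and \<gamma>: "\<gamma> < real (Suc k) * p - 1"
  shows "resolvent_data (other_bc b) k c s (\<lambda>i. F (Suc i)) (\<lambda>i. U (Suc i))"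
proof -
  have q: "0 < real (Suc k) - crit" using \<gamma> p by (simp add: field_simps)
  have F0: "(F (k_bc b + 2 * j) \<longlongrightarrow> 0) (at_right 0)" if "real (k_bc b + 2 * j) < real (Suc k) - crit" for j
    using d that by (simp add: resolvent_data_def)
  have U0: "(U (k_bc b) \<longlongrightarrow> 0) (at_right 0)" using d by (simp add: resolvent_data_def)
  have "(U (Suc (k_bc (other_bc b))) \<longlongrightarrow> 0) (at_right 0)"
  proof (cases b)
    case Dir
    have "((\<lambda>t. s\<^sup>2 *\<^sub>C U 0 t - F 0 t) \<longlongrightarrow> s\<^sup>2 *\<^sub>C 0 - 0) (at_right 0)"
      using U0 F0[of 0] q Dir by (intro tendsto_diff scaleC.tendsto tendsto_const) auto
    moreover have "U 2 = (\<lambda>t. s\<^sup>2 *\<^sub>C U 0 t - F 0 t)"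
      using d unfolding resolvent_data_def by (metis add_0 zero_le)
    ultimately show ?thesis using Dir by (simp add: other_bc_def numeral_2_eq_2 scaleC.zero_right)
  next
    case Neu
    then show ?thesis using U0 by (simp add: other_bc_def)
  qed
  moreover have "(F (Suc (k_bc (other_bc b) + 2 * j)) \<longlongrightarrow> 0) (at_right 0)"
    if "real (k_bc (other_bc b) + 2 * j) < real k - crit" for j
    using F0[of "if b = Dir then Suc j else j"] that by (cases b) (auto simp: other_bc_def)
  ultimately show ?thesis
    using d unfolding resolvent_data_def by (auto intro: Sobolev_chain_shift)
qed

lemma powr_le_one_of_ge:
  fixes a :: real
  assumes "1 \<le> a" "x \<le> 0"
  shows "a powr x \<le> 1"
  using powr_mono[of x 0 a] assms by simp

text \<open>
  Here all of \<open>F 0, \<dots>, F (k - 1)\<close> are bounded pointwise in terms of the norm of \<open>F k\<close>, so the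
  equation \<open>U (n + 2) = s\<^sup>2 U n - F n\<close> transports the bounds from \<open>U 0\<close> and \<open>U 1\<close> to all orders.
\<close>

lemma point_values_top_level:
  assumes c: "0 < c"
    and lev: "real k * p - 1 < \<gamma>" "\<gamma> < (real k + 1 + real (bc_order b)) * p - 1"
  shows "i \<le> k + 1 \<Longrightarrow> \<exists>C>0. \<forall>s (F :: nat \<Rightarrow> real \<Rightarrow> 'a::complex_banach) U. resolvent_data b k c s F U \<longrightarrow>
    norm (U i (1 / Re s)) \<le> C * Re s powr (crit - real k - 2 + real i) * wnorm (F k)"
proof (induction i rule: less_induct)
  case (less i)
  let ?q = "crit"
  obtain C where C: "0 < C" and vb: "\<And>s (F :: nat \<Rightarrow> real \<Rightarrow> 'a) U. resolvent_data b k c s F U \<Longrightarrow>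
    Re s * norm (U 0 (1 / Re s)) \<le> C * Re s powr (?q - real k - 1) * wnorm (F k) \<and>
    norm (U 1 (1 / Re s) + s *\<^sub>C U 0 (1 / Re s)) \<le> C * Re s powr (?q - real k - 1) * wnorm (F k)"
    using value_bound[OF order_refl lev, where 'a='a and c=c] by blast
  consider "i = 0" | "i = 1" | n where "i = n + 2" by (metis One_nat_def add_2_eq_Suc' not0_implies_Suc)
  then show ?case
  proof cases
    case 1
    have "norm (U 0 (1 / Re s)) \<le> C * Re s powr (?q - real k - 2) * wnorm (F k)"
      if d: "resolvent_data b k c s F U" for s and F U :: "nat \<Rightarrow> real \<Rightarrow> 'a"
    proof -
      have a: "0 < Re s" using d by (simp add: resolvent_data_def)
      have "?q - real k - 1 = 1 + (?q - real k - 2)" by simp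
      then have "Re s powr (?q - real k - 1) = Re s * Re s powr (?q - real k - 2)"
        using a by (simp only: powr_add) simp
      then have "Re s * norm (U 0 (1 / Re s)) \<le> Re s * (C * Re s powr (?q - real k - 2) * wnorm (F k))"
        using vb[OF d] by (simp add: mult_ac)
      then show ?thesis using a by simp
    qed
    then show ?thesis using C 1 by auto
  next
    case 2
    have "norm (U 1 (1 / Re s)) \<le> (C + C / c) * Re s powr (?q - real k - 1) * wnorm (F k)"
      if d: "resolvent_data b k c s F U" for s and F U :: "nat \<Rightarrow> real \<Rightarrow> 'a"
    proof -
      have cs: "cmod s \<le> Re s / c" using d c by (simp add: resolvent_data_def field_simps)
      let ?B = "Re s powr (?q - real k - 1) * wnorm (F k)"
      have "norm (U 1 (1 / Re s)) \<le> norm (U 1 (1 / Re s) + s *\<^sub>C U 0 (1 / Re s)) + norm (s *\<^sub>C U 0 (1 / Re s))"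
        using norm_triangle_ineq4[of "U 1 (1 / Re s) + s *\<^sub>C U 0 (1 / Re s)" "s *\<^sub>C U 0 (1 / Re s)"] by simp
      moreover have "norm (s *\<^sub>C U 0 (1 / Re s)) \<le> Re s / c * norm (U 0 (1 / Re s))"
        unfolding norm_scaleC by (intro mult_right_mono cs) auto
      moreover have "Re s / c * norm (U 0 (1 / Re s)) \<le> C * ?B / c"
        using vb[OF d] c by (simp add: divide_right_mono mult.assoc)
      ultimately show ?thesis using vb[OF d] by (simp add: algebra_simps)
    qed
    moreover have "0 < C + C / c" using C c by (simp add: add_pos_pos)
    ultimately show ?thesis using 2 by auto
  next
    case (3 n)
    have n: "n < k" using 3 less.prems by simp
    obtain C1 where C1: "0 < C1" and IH: "\<And>s (F :: nat \<Rightarrow> real \<Rightarrow> 'a) U. resolvent_data b k c s F U \<Longrightarrow>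
      norm (U n (1 / Re s)) \<le> C1 * Re s powr (?q - real k - 2 + real n) * wnorm (F k)"
      using less.IH[of n] 3 less.prems by auto
    obtain m where m: "k = n + Suc m" using n less_imp_add_positive[of n k] by (metis Suc_pred)
    have "real (Suc m) * p \<le> real k * p" using p m by (intro mult_right_mono) auto
    then have "real (Suc m) * p - 1 < \<gamma>" using lev(1) by linarith
    then obtain C2 where C2: "0 < C2" and pw: "\<And>(G :: nat \<Rightarrow> real \<Rightarrow> 'a) y. chain (Suc m) G \<Longrightarrow> 0 < y \<Longrightarrow>
      norm (G 0 y) \<le> C2 * y powr (real (Suc m) - ?q) * wnorm (G (Suc m))"
      using Sobolev_pointwise[where 'a='a and m=m] by blast
    have "norm (U (n + 2) (1 / Re s)) \<le> (C1 / c\<^sup>2 + C2) * Re s powr (?q - real k - 2 + real (n + 2)) * wnorm (F k)"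
      if d: "resolvent_data b k c s F U" for s and F U :: "nat \<Rightarrow> real \<Rightarrow> 'a"
    proof -
      define a where "a = Re s"
      have a: "0 < a" using d by (simp add: resolvent_data_def a_def)
      have cs: "cmod s \<le> a / c" using d c by (simp add: resolvent_data_def a_def field_simps)
      let ?e = "?q - real k - 2 + real (n + 2)" and ?w = "wnorm (F k)"
      have "?e = 2 + (?q - real k - 2 + real n)" by simp
      then have e: "a powr ?e = a\<^sup>2 * a powr (?q - real k - 2 + real n)"
        using a by (simp only: powr_add) simp
      have "chain (Suc m) (\<lambda>j. F (n + j))"
        using d m by (intro Sobolev_chain_shift_add) (simp add: resolvent_data_def)
      from pw[OF this, of "1 / a"] have "norm (F n (1 / a)) \<le> C2 * (1 / a) powr (real (Suc m) - ?q) * ?w"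
        using a m by simp
      also have "(1 / a) powr (real (Suc m) - ?q) = a powr (- (real (Suc m) - ?q))"
        using a by (simp only: powr_one_over)
      also have "- (real (Suc m) - ?q) = ?e" using m by simp
      finally have 1: "norm (F n (1 / a)) \<le> C2 * a powr ?e * ?w" .
      have "norm (s\<^sup>2 *\<^sub>C U n (1 / a)) \<le> (a / c)\<^sup>2 * (C1 * a powr (?q - real k - 2 + real n) * ?w)"
        unfolding norm_scaleC norm_power using IH[OF d] cs a c
        by (intro mult_mono power_mono) (auto simp: a_def)
      also have "\<dots> = C1 / c\<^sup>2 * a powr ?e * ?w" unfolding e by (simp add: power_divide)
      finally have 2: "norm (s\<^sup>2 *\<^sub>C U n (1 / a)) \<le> C1 / c\<^sup>2 * a powr ?e * ?w" .
      have "U (n + 2) (1 / a) = s\<^sup>2 *\<^sub>C U n (1 / a) - F n (1 / a)" using d n by (simp add: resolvent_data_def)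
      then have "norm (U (n + 2) (1 / a)) \<le> norm (s\<^sup>2 *\<^sub>C U n (1 / a)) + norm (F n (1 / a))"
        using norm_triangle_ineq4 by metis
      also have "\<dots> \<le> C1 / c\<^sup>2 * a powr ?e * ?w + C2 * a powr ?e * ?w" by (rule add_mono[OF 2 1])
      also have "\<dots> = (C1 / c\<^sup>2 + C2) * a powr ?e * ?w" by (simp only: distrib_right)
      finally show ?thesis by (simp only: a_def)
    qed
    moreover have "0 < C1 / c\<^sup>2 + C2" using C1 C2 c by (simp add: add_pos_pos)
    ultimately show ?thesis using 3 by blast
  qed
qed

lemma uniform_constant:
  fixes P :: "nat \<Rightarrow> real \<Rightarrow> bool"
  assumes ex: "\<And>i. i \<le> n \<Longrightarrow> \<exists>C>0. P i C" and mono: "\<And>i C D. P i C \<Longrightarrow> C \<le> D \<Longrightarrow> P i D"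
  shows "\<exists>C>0. \<forall>i\<le>n. P i C"
proof -
  obtain C where C: "\<And>i. i \<le> n \<Longrightarrow> 0 < C i \<and> P i (C i)" using ex by metis
  have le: "C i \<le> (\<Sum>j\<le>n. C j)" if "i \<le> n" for i
    by (rule member_le_sum) (use C that in \<open>auto intro: less_imp_le\<close>)
  have "0 < (\<Sum>j\<le>n. C j)" using C by (intro sum_pos) auto
  then show ?thesis using mono[OF _ le] C by blast
qed

text \<open>
  If \<open>\<gamma> < k p - 1\<close>, the differentiated equation is a resolvent problem of order \<open>k - 1\<close> with the
  other boundary condition, and covers all derivatives of positive order. Repeating this ends at
  an order to which \<open>point_values_top_level\<close> applies.
\<close>

lemma point_values_large:
  assumes c: "0 < c" and ne: "\<And>j::nat. 1 \<le> j \<Longrightarrow> \<gamma> \<noteq> real j * p - 1"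
  shows "\<gamma> < (real k + 1 + real (bc_order b)) * p - 1 \<Longrightarrow>
    \<exists>C>0. \<forall>s (F :: nat \<Rightarrow> real \<Rightarrow> 'a::complex_banach) U. resolvent_data b k c s F U \<longrightarrow> 1 \<le> Re s \<longrightarrow>
    (\<forall>i\<le>k. Re s powr (2 - crit) * norm (U i (1 / Re s)) \<le> C * chain_norm k F)"
proof (induction k arbitrary: b)
  have top: "\<exists>C>0. \<forall>s (F :: nat \<Rightarrow> real \<Rightarrow> 'a::complex_banach) U. resolvent_data b k c s F U \<longrightarrow> 1 \<le> Re s \<longrightarrow>
    (\<forall>i\<le>k. Re s powr (2 - crit) * norm (U i (1 / Re s)) \<le> C * chain_norm k F)"
    if lev: "real k * p - 1 < \<gamma>" "\<gamma> < (real k + 1 + real (bc_order b)) * p - 1" for k b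
  proof -
    let ?q = "crit"
    have "\<exists>C>0. \<forall>i\<le>k. \<forall>s (F :: nat \<Rightarrow> real \<Rightarrow> 'a::complex_banach) U. resolvent_data b k c s F U \<longrightarrow>
      norm (U i (1 / Re s)) \<le> C * Re s powr (?q - real k - 2 + real i) * wnorm (F k)"
    proof (rule uniform_constant)
      fix i C D
      assume A: "\<forall>s (F :: nat \<Rightarrow> real \<Rightarrow> 'a::complex_banach) U. resolvent_data b k c s F U \<longrightarrow>
        norm (U i (1 / Re s)) \<le> C * Re s powr (?q - real k - 2 + real i) * wnorm (F k)" and CD: "C \<le> D"
      have "C * Re s powr (?q - real k - 2 + real i) * wnorm (F k) \<le> D * Re s powr (?q - real k - 2 + real i) * wnorm (F k)"
        for s and F :: "nat \<Rightarrow> real \<Rightarrow> 'a" using CD by (intro mult_right_mono wnorm_nonneg) auto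
      then show "\<forall>s (F :: nat \<Rightarrow> real \<Rightarrow> 'a::complex_banach) U. resolvent_data b k c s F U \<longrightarrow>
        norm (U i (1 / Re s)) \<le> D * Re s powr (?q - real k - 2 + real i) * wnorm (F k)"
        using A order_trans by blast
    qed (rule point_values_top_level[OF c lev], simp)
    then obtain C where C: "0 < C" and pt: "\<And>i s (F :: nat \<Rightarrow> real \<Rightarrow> 'a) U. i \<le> k \<Longrightarrow> resolvent_data b k c s F U \<Longrightarrow>
      norm (U i (1 / Re s)) \<le> C * Re s powr (?q - real k - 2 + real i) * wnorm (F k)" by blast
    have "Re s powr (2 - ?q) * norm (U i (1 / Re s)) \<le> C * chain_norm k F"
      if d: "resolvent_data b k c s F U" and a: "1 \<le> Re s" and i: "i \<le> k" for s i and F U :: "nat \<Rightarrow> real \<Rightarrow> 'a"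
    proof -
      have "Re s powr (2 - ?q) * norm (U i (1 / Re s))
        \<le> Re s powr (2 - ?q) * (C * Re s powr (?q - real k - 2 + real i) * wnorm (F k))"
        by (intro mult_left_mono pt[OF i d]) auto
      also have "\<dots> = C * wnorm (F k) * Re s powr (real i - real k)"
      proof -
        have "Re s powr (2 - ?q) * Re s powr (?q - real k - 2 + real i) = Re s powr (real i - real k)"
          by (simp flip: powr_add)
        then show ?thesis by (simp add: mult_ac)
      qed
      also have "\<dots> \<le> C * wnorm (F k) * 1"
        using C i a wnorm_nonneg[of "F k"] by (intro mult_left_mono powr_le_one_of_ge) auto
      also have "\<dots> \<le> C * chain_norm k F"
        using C wnorm_le_chain_norm[of k k F] by simp
      finally show ?thesis .
    qed
    then show ?thesis using C by blast
  qed
  {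
    case 0
    then show ?case using g by (intro top) auto
  next
    case (Suc k)
    show ?case
    proof (cases "\<gamma> < real (Suc k) * p - 1")
      case False
      moreover have "\<gamma> \<noteq> real (Suc k) * p - 1" by (rule ne) simp
      ultimately show ?thesis using Suc.prems by (intro top) auto
    next
      case True
      let ?q = "crit"
      have "\<gamma> < (real k + 1 + real (bc_order (other_bc b))) * p - 1"
      proof -
        have "0 \<le> real (bc_order (other_bc b)) * p" using p by simp
        then show ?thesis using True by (simp add: algebra_simps)
      qed
      from Suc.IH[OF this] obtain C1 where C1: "0 < C1" and IH: "\<And>s (F :: nat \<Rightarrow> real \<Rightarrow> 'a) U i.
        resolvent_data (other_bc b) k c s F U \<Longrightarrow> 1 \<le> Re s \<Longrightarrow> i \<le> k \<Longrightarrow>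
        Re s powr (2 - ?q) * norm (U i (1 / Re s)) \<le> C1 * chain_norm k F" by blast
      obtain m where m: "m \<le> Suc k" "real m * p - 1 < \<gamma>" "\<gamma> < (real m + 1 + real (bc_order b)) * p - 1"
        using level_exists[OF ne Suc.prems] by blast
      obtain C2 where C2: "0 < C2" and vb: "\<And>s (F :: nat \<Rightarrow> real \<Rightarrow> 'a) U. resolvent_data b (Suc k) c s F U \<Longrightarrow>
        Re s * norm (U 0 (1 / Re s)) \<le> C2 * Re s powr (?q - real m - 1) * wnorm (F m)"
        using value_bound[OF m, where 'a='a and c=c] by blast
      have "Re s powr (2 - ?q) * norm (U i (1 / Re s)) \<le> (C1 + C2) * chain_norm (Suc k) F"
        if d: "resolvent_data b (Suc k) c s F U" and a: "1 \<le> Re s" and i: "i \<le> Suc k"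
        for s i and F U :: "nat \<Rightarrow> real \<Rightarrow> 'a"
      proof (cases i)
        case 0
        have "Re s powr (2 - ?q) * norm (U i (1 / Re s)) = Re s powr (1 - ?q) * (Re s * norm (U 0 (1 / Re s)))"
        proof -
          have "2 - ?q = 1 - ?q + 1" by simp
          then have "Re s powr (2 - ?q) = Re s powr (1 - ?q) * Re s" using a by (simp only: powr_add) simp
          then show ?thesis using 0 by simp
        qed
        also have "\<dots> \<le> Re s powr (1 - ?q) * (C2 * Re s powr (?q - real m - 1) * wnorm (F m))"
          by (intro mult_left_mono vb[OF d]) auto
        also have "\<dots> = C2 * wnorm (F m) * Re s powr (- real m)"
        proof -
          have "Re s powr (1 - ?q) * Re s powr (?q - real m - 1) = Re s powr (- real m)"
            by (simp flip: powr_add)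
          then show ?thesis by (simp add: mult_ac)
        qed
        also have "\<dots> \<le> C2 * wnorm (F m) * 1"
          using C2 a wnorm_nonneg[of "F m"] by (intro mult_left_mono powr_le_one_of_ge) auto
        also have "\<dots> \<le> C2 * chain_norm (Suc k) F"
          using C2 wnorm_le_chain_norm[OF m(1), of F] by (simp only: mult_1_right mult_left_mono less_imp_le)
        also have "\<dots> \<le> (C1 + C2) * chain_norm (Suc k) F"
          using C1 by (intro mult_right_mono chain_norm_nonneg) simp
        finally show ?thesis .
      next
        case (Suc n)
        have "Re s powr (2 - ?q) * norm (U i (1 / Re s)) \<le> C1 * chain_norm k (\<lambda>i. F (Suc i))"
          using IH[OF resolvent_data_shift[OF d True] a, of n] i Suc by simp
        also have "\<dots> \<le> C1 * chain_norm (Suc k) F"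
        proof (rule mult_left_mono)
          show "chain_norm k (\<lambda>i. F (Suc i)) \<le> chain_norm (Suc k) F"
            unfolding sum.atMost_Suc_shift using wnorm_nonneg[of "F 0"] by simp
        qed (use C1 in simp)
        also have "\<dots> \<le> (C1 + C2) * chain_norm (Suc k) F"
          using C2 by (intro mult_right_mono chain_norm_nonneg) simp
        finally show ?thesis .
      qed
      moreover have "0 < C1 + C2" using C1 C2 by simp
      ultimately show ?thesis by blast
    qed
  }
qed

lemma near_source_split:
  assumes e: "(1 + real e) * p - 1 < \<gamma>"
  shows "\<exists>C>0. \<forall>f :: real \<Rightarrow> 'a::complex_banach. f \<in> wLp \<longrightarrow>
    (\<forall>d. near_source e d f \<le> near_source e 1 f + ennreal (C * wnorm f))"
proof -
  obtain C where C: "0 < C" and tail: "\<And>(f :: real \<Rightarrow> 'a) d. f \<in> wLp \<Longrightarrow> 0 < d \<Longrightarrow>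
    nnint {d<..} (\<lambda>t. t powr real e * norm (f t)) \<le> ennreal (C * d powr (1 + real e - crit) * wnorm f)"
    using powr_holder_tail[OF e, where 'a='a] by blast
  have "near_source e d f \<le> near_source e 1 f + ennreal (C * wnorm f)"
    if f: "f \<in> wLp" for f :: "real \<Rightarrow> 'a" and d
  proof -
    obtain h :: "real \<Rightarrow> real" where h[measurable]: "h \<in> borel_measurable borel" and h0: "\<And>t. 0 \<le> h t"
      and hf: "AE t in lborel. 0 < t \<longrightarrow> norm (f t) = h t" and hw: "wpow h = ennreal (wnorm f powr p)"
      using wLp_representative[OF f] by blast
    have rep: "near_source e d f = nnint {0<..d} (\<lambda>t. t powr real e * h t)" for d
      by (rule nn_integral_norm_representative[OF hf]) auto
    have "near_source e d f \<le> (\<integral>\<^sup>+t. ennreal (t powr real e * h t) * indicator {0<..1} t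
        + ennreal (t powr real e * h t) * indicator {1<..} t \<partial>lborel)"
      unfolding rep by (intro nn_integral_mono) (auto split: split_indicator)
    also have "\<dots> = near_source e 1 f + nnint {1<..} (\<lambda>t. t powr real e * h t)"
      unfolding rep by (rule nn_integral_add) measurable
    also have "nnint {1<..} (\<lambda>t. t powr real e * h t) = nnint {1<..} (\<lambda>t. t powr real e * norm (f t))"
      by (rule nn_integral_norm_representative[OF hf, symmetric]) auto
    also have "\<dots> \<le> ennreal (C * 1 powr (1 + real e - crit) * wnorm f)" by (rule tail[OF f]) simp
    finally show ?thesis by (simp add: add_left_mono)
  qed
  then show ?thesis using C by blast
qed

text \<open>
  The exponent in the theorem is nontrivial exactly if the weight makes \<open>t powr (bc_order b)\<close>
  integrable against the source at infinity.
\<close>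

lemma two_minus_two_alpha:
  "2 - 2 * alpha_bc b p \<gamma> = min 0 (1 + real (bc_order b) - crit)"
proof -
  define h where "h = (\<gamma> + real (k_bc b) * p + 1) / (2 * p)"
  have "crit + real (k_bc b) = 2 * h" using p by (simp add: h_def field_simps)
  moreover have "real (bc_order b) = 1 - real (k_bc b)" by (cases b) auto
  ultimately have "1 + real (bc_order b) - crit = 2 - 2 * h" by linarith
  then show ?thesis unfolding alpha_bc_def h_def[symmetric] by (simp add: max_def min_def)
qed

text \<open>
  For small \<open>s\<close> the source between \<open>1\<close> and \<open>1 / a\<close> contributes to the boundary value. It is
  integrable against \<open>t powr e\<close> under a heavy weight, which costs the negative power of \<open>a\<close>.
\<close>

lemma point_value_small:
  assumes ne: "\<And>j::nat. 1 \<le> j \<Longrightarrow> \<gamma> \<noteq> real j * p - 1"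
    and \<gamma>: "\<gamma> < (real k + 1 + real (bc_order b)) * p - 1"
  shows "\<exists>C>0. \<forall>s (F :: nat \<Rightarrow> real \<Rightarrow> 'a::complex_banach) U. resolvent_data b k c s F U \<longrightarrow>
    Re s powr (2 - crit) * norm (U 0 (1 / Re s))
      \<le> C * (1 + Re s powr (2 - 2 * alpha_bc b p \<gamma>)) * chain_norm k F"
proof (cases "\<gamma> < (1 + real (bc_order b)) * p - 1")
  case True
  let ?q = "crit"
  obtain C where C: "0 < C" and vb: "\<And>s (F :: nat \<Rightarrow> real \<Rightarrow> 'a) U. resolvent_data b k c s F U \<Longrightarrow>
    Re s * norm (U 0 (1 / Re s)) \<le> C * Re s powr (?q - 1) * wnorm (F 0)"
    using value_bound[of 0 k b, where 'a='a and c=c] g True by auto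
  have "Re s powr (2 - ?q) * norm (U 0 (1 / Re s)) \<le> C * (1 + Re s powr (2 - 2 * alpha_bc b p \<gamma>)) * chain_norm k F"
    if d: "resolvent_data b k c s F U" for s and F U :: "nat \<Rightarrow> real \<Rightarrow> 'a"
  proof -
    have a: "0 < Re s" using d by (simp add: resolvent_data_def)
    have "2 - ?q = 1 - ?q + 1" by simp
    then have "Re s powr (2 - ?q) = Re s powr (1 - ?q) * Re s" using a by (simp only: powr_add) simp
    then have "Re s powr (2 - ?q) * norm (U 0 (1 / Re s)) = Re s powr (1 - ?q) * (Re s * norm (U 0 (1 / Re s)))"
      by simp
    also have "\<dots> \<le> Re s powr (1 - ?q) * (C * Re s powr (?q - 1) * wnorm (F 0))"
      by (intro mult_left_mono vb[OF d]) auto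
    also have "\<dots> = C * 1 * wnorm (F 0)"
    proof -
      have "Re s powr (1 - ?q) * Re s powr (?q - 1) = 1" using a by (simp flip: powr_add)
      then show ?thesis by (simp add: mult_ac)
    qed
    also have "\<dots> \<le> C * (1 + Re s powr (2 - 2 * alpha_bc b p \<gamma>)) * chain_norm k F"
      using C by (intro mult_mono wnorm_le_chain_norm) (auto simp: wnorm_nonneg)
    finally show ?thesis .
  qed
  then show ?thesis using C by blast
next
  case False
  let ?q = "crit" and ?e = "real (bc_order b)"
  have "\<gamma> \<noteq> real (Suc (bc_order b)) * p - 1" by (rule ne) simp
  then have gt: "(1 + ?e) * p - 1 < \<gamma>" using False by simp
  then have q: "1 + ?e - ?q < 0" using p by (simp add: field_simps)
  have al: "2 - 2 * alpha_bc b p \<gamma> = 1 + ?e - ?q" using two_minus_two_alpha[of b] q by simp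
  obtain m where m: "m \<le> k" "real m * p - 1 < \<gamma>" "\<gamma> < (real m + 1 + ?e) * p - 1"
    using level_exists[OF ne \<gamma>] by blast
  obtain C1 where C1: "0 < C1" and near: "\<And>F :: nat \<Rightarrow> real \<Rightarrow> 'a. chain m F \<Longrightarrow>
    near_source (bc_order b) 1 (F 0) \<le> ennreal (C1 * 1 powr (real m + 1 + ?e - ?q) * wnorm (F m))"
    using source_bounds[OF m(2,3), where 'a='a] zero_less_one by blast
  obtain C2 where C2: "0 < C2" and split: "\<And>(f :: real \<Rightarrow> 'a) d. f \<in> wLp \<Longrightarrow>
    near_source (bc_order b) d f \<le> near_source (bc_order b) 1 f + ennreal (C2 * wnorm f)"
    using near_source_split[OF gt, where 'a='a] by blast
  obtain C3 where C3: "0 < C3" and far: "\<And>(f :: real \<Rightarrow> 'a) a. f \<in> wLp \<Longrightarrow> 0 < a \<Longrightarrow>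
    far_source a f \<le> ennreal (C3 * a powr (?q - 1) * wnorm f)"
    using far_source_bound[where 'a='a] by blast
  define C where "C = 2 * (C1 + C2 + C3)"
  have "Re s powr (2 - ?q) * norm (U 0 (1 / Re s)) \<le> C * (1 + Re s powr (2 - 2 * alpha_bc b p \<gamma>)) * chain_norm k F"
    if d: "resolvent_data b k c s F U" for s and F U :: "nat \<Rightarrow> real \<Rightarrow> 'a"
  proof -
    define a where "a = Re s"
    have a: "0 < a" using d by (simp add: resolvent_data_def a_def)
    let ?N = "chain_norm k F"
    have N: "0 \<le> ?N" by (rule chain_norm_nonneg)
    have F: "chain m F" "F 0 \<in> wLp"
      using d m by (auto simp: resolvent_data_def Sobolev_chain_def)
    define S where "S = (C1 + C2) * ?N"
    define J where "J = C3 * a powr (?q - 1) * ?N"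
    have nn: "0 \<le> S" "0 \<le> J" using C1 C2 C3 N by (auto simp: S_def J_def)
    have S: "near_source (bc_order b) (1 / Re s) (F 0) \<le> ennreal S"
    proof -
      have "near_source (bc_order b) (1 / Re s) (F 0) \<le> near_source (bc_order b) 1 (F 0) + ennreal (C2 * wnorm (F 0))"
        by (rule split[OF F(2)])
      also have "\<dots> \<le> ennreal (C1 * wnorm (F m)) + ennreal (C2 * wnorm (F 0))"
        using near[OF F(1)] by (simp add: add_right_mono)
      also have "\<dots> = ennreal (C1 * wnorm (F m) + C2 * wnorm (F 0))"
        by (rule ennreal_plus[symmetric]) (use C1 C2 wnorm_nonneg[of "F m"] wnorm_nonneg[of "F 0"] in auto)
      also have "\<dots> \<le> ennreal S"
        unfolding S_def distrib_right using C1 C2 m(1)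
        by (intro ennreal_leI add_mono mult_left_mono wnorm_le_chain_norm) auto
      finally show ?thesis .
    qed
    have J: "far_source (Re s) (F 0) \<le> ennreal J"
    proof -
      have "far_source (Re s) (F 0) \<le> ennreal (C3 * a powr (?q - 1) * wnorm (F 0))"
        using far[OF F(2) a] by (simp add: a_def)
      also have "\<dots> \<le> ennreal J"
        unfolding J_def using C3 by (intro ennreal_leI mult_left_mono wnorm_le_chain_norm) auto
      finally show ?thesis .
    qed
    have vb: "a * norm (U 0 (1 / a)) \<le> 2 * (a ^ bc_order b * S + J)"
      using value_bound_of_sources(1)[OF d S nn(1) J nn(2)] by (simp add: a_def)
    have "2 - ?q = 1 - ?q + 1" by simp
    then have "a powr (2 - ?q) = a powr (1 - ?q) * a" using a by (simp only: powr_add) simp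
    then have "a powr (2 - ?q) * norm (U 0 (1 / a)) = a powr (1 - ?q) * (a * norm (U 0 (1 / a)))" by simp
    also have "\<dots> \<le> a powr (1 - ?q) * (2 * (a ^ bc_order b * S + J))" by (intro mult_left_mono vb) auto
    also have "\<dots> = 2 * (a powr (1 + ?e - ?q) * S + C3 * ?N)"
    proof -
      have "1 - ?q + ?e = 1 + ?e - ?q" by simp
      then have 1: "a powr (1 - ?q) * a ^ bc_order b = a powr (1 + ?e - ?q)"
        using a by (simp only: powr_add[symmetric] powr_realpow[symmetric])
      have "a powr (1 - ?q) * a powr (?q - 1) = 1" using a by (simp flip: powr_add)
      then have 2: "a powr (1 - ?q) * J = C3 * ?N" unfolding J_def by (simp add: mult_ac)
      have "a powr (1 - ?q) * (2 * (a ^ bc_order b * S + J)) = 2 * (a powr (1 - ?q) * a ^ bc_order b * S + a powr (1 - ?q) * J)"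
        by (simp add: algebra_simps)
      then show ?thesis unfolding 1 2 .
    qed
    also have "\<dots> \<le> 2 * (a powr (1 + ?e - ?q) * ((C1 + C2 + C3) * ?N) + (C1 + C2 + C3) * ?N)"
    proof -
      have "(C1 + C2) * ?N \<le> (C1 + C2 + C3) * ?N" "C3 * ?N \<le> (C1 + C2 + C3) * ?N"
        using C1 C2 C3 by (auto intro!: mult_right_mono N)
      then show ?thesis unfolding S_def by (intro mult_left_mono add_mono) auto
    qed
    also have "\<dots> = C * (1 + a powr (1 + ?e - ?q)) * ?N" unfolding C_def by (simp add: algebra_simps)
    finally show ?thesis by (simp only: al a_def)
  qed
  moreover have "0 < C" using C1 C2 C3 by (simp add: C_def)
  ultimately show ?thesis by blast
qed

text \<open>
  At each order of differentiation, the two-sided bound for \<open>U i\<close> and \<open>W = U (i + 1) + s U i\<close>, and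
  the equation for \<open>U (i + 2)\<close>.
\<close>

lemma energy_bound:
  assumes c: "0 < c"
  shows "\<exists>C>0. \<forall>s (F :: nat \<Rightarrow> real \<Rightarrow> 'a::complex_banach) U b k i j. resolvent_data b k c s F U \<longrightarrow> i \<le> k \<longrightarrow> j \<le> 2 \<longrightarrow>
    cmod s ^ (2 - j) * wnorm (U (i + j))
      \<le> C * (wnorm (F i) + Re s powr (2 - crit) * norm (U i (1 / Re s)))"
proof -
  obtain C where C: "0 < C" and so: "\<And>s (f :: real \<Rightarrow> 'a::complex_banach) W v.
    0 < Re s \<Longrightarrow> f \<in> wLp \<Longrightarrow> continuous_on {0<..} W \<Longrightarrow> forward_bound (Re s) f W \<Longrightarrow>
    indef_integral v (\<lambda>t. W t - s *\<^sub>C v t) \<Longrightarrow>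
    W \<in> wLp \<and> Re s * wnorm W \<le> C * wnorm f \<and>
    v \<in> wLp \<and> (Re s)\<^sup>2 * wnorm v \<le> C * (wnorm f + Re s powr (2 - crit) * norm (v (1 / Re s)))"
    by (rule second_order_bound) blast
  define K where "K = C / c\<^sup>2"
  have K: "0 < K" using C c by (simp add: K_def)
  define D where "D = K + 4 * (C / c + K) + 4 * (K + 1)"
  have "cmod s ^ (2 - j) * wnorm (U (i + j))
      \<le> D * (wnorm (F i) + Re s powr (2 - crit) * norm (U i (1 / Re s)))"
    if d: "resolvent_data b k c s F U" and i: "i \<le> k" and j: "j \<le> 2" for s b k i j and F U :: "nat \<Rightarrow> real \<Rightarrow> 'a"
  proof -
    define a r where "a = Re s" and "r = cmod s"
    have a: "0 < a" and r: "0 \<le> r" and cr: "c * r \<le> a" using d by (auto simp: resolvent_data_def a_def r_def)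
    have ra: "r \<le> a / c" using cr c by (simp add: field_simps)
    define W where "W t = U (Suc i) t + s *\<^sub>C U i t" for t
    note fo = resolvent_data_first_order[OF d i, folded W_def]
    define B where "B = wnorm (F i) + a powr (2 - crit) * norm (U i (1 / a))"
    have FB: "wnorm (F i) \<le> B" "0 \<le> B" using wnorm_nonneg[of "F i"] by (auto simp: B_def)
    have b: "W \<in> wLp" "a * wnorm W \<le> C * wnorm (F i)" "U i \<in> wLp" "a\<^sup>2 * wnorm (U i) \<le> C * B"
      using so[OF a[unfolded a_def] fo] by (auto simp: a_def B_def)
    have U0: "r\<^sup>2 * wnorm (U i) \<le> K * B"
    proof -
      have "r\<^sup>2 \<le> (a / c)\<^sup>2" using ra r by (intro power_mono) auto
      then have "r\<^sup>2 * wnorm (U i) \<le> (a / c)\<^sup>2 * wnorm (U i)" by (intro mult_right_mono wnorm_nonneg)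
      also have "\<dots> = a\<^sup>2 * wnorm (U i) / c\<^sup>2" by (simp add: power_divide)
      also have "\<dots> \<le> C * B / c\<^sup>2" using b(4) by (intro divide_right_mono) auto
      finally show ?thesis by (simp add: K_def)
    qed
    have U1: "r * wnorm (U (Suc i)) \<le> 4 * (C / c + K) * B"
    proof -
      have "U (Suc i) = (\<lambda>t. 1 *\<^sub>C W t - s *\<^sub>C U i t)" by (simp add: W_def scaleC_one fun_eq_iff)
      then have "wnorm (U (Suc i)) \<le> 4 * (wnorm W + r * wnorm (U i))"
        using wLp_combination(2)[OF b(1,3), of 1 s] by (simp add: r_def)
      then have "r * wnorm (U (Suc i)) \<le> r * (4 * (wnorm W + r * wnorm (U i)))"
        using r by (intro mult_left_mono) auto
      also have "\<dots> = 4 * (r * wnorm W + r\<^sup>2 * wnorm (U i))" by (simp add: algebra_simps power2_eq_square)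
      also have "r * wnorm W \<le> C / c * B"
      proof -
        have "r * wnorm W \<le> a / c * wnorm W" using ra by (intro mult_right_mono wnorm_nonneg)
        also have "\<dots> = a * wnorm W / c" by simp
        also have "\<dots> \<le> C * wnorm (F i) / c" using b(2) c by (intro divide_right_mono) auto
        also have "\<dots> \<le> C * B / c" using FB(1) C c by (intro divide_right_mono mult_left_mono) auto
        finally show ?thesis by simp
      qed
      finally show ?thesis using U0 by (simp add: algebra_simps)
    qed
    have U2: "wnorm (U (i + 2)) \<le> 4 * (K + 1) * B"
    proof -
      have "U (i + 2) = (\<lambda>t. s\<^sup>2 *\<^sub>C U i t - 1 *\<^sub>C F i t)"
        using d i by (simp add: resolvent_data_def scaleC_one fun_eq_iff)
      then have "wnorm (U (i + 2)) \<le> 4 * (r\<^sup>2 * wnorm (U i) + wnorm (F i))"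
        using wLp_combination(2)[OF b(3) fo(1), of "s\<^sup>2" 1] by (simp add: r_def norm_power)
      then show ?thesis using U0 FB(1) by (simp add: algebra_simps)
    qed
    have D: "K * B \<le> D * B" "4 * (C / c + K) * B \<le> D * B" "4 * (K + 1) * B \<le> D * B"
      unfolding D_def using K C c FB(2) by (auto intro!: mult_right_mono)
    have "r ^ (2 - j) * wnorm (U (i + j)) \<le> D * B"
    proof -
      consider "j = 0" | "j = 1" | "j = 2" using j by linarith
      then show ?thesis using U0 U1 U2 D by cases auto
    qed
    then show ?thesis by (simp add: r_def a_def B_def)
  qed
  moreover have "0 < D" using K C c unfolding D_def by (intro add_pos_pos mult_pos_pos) auto
  ultimately show ?thesis by blast
qed

lemma power_le_of_bounded:
  fixes r K :: real
  assumes "0 \<le> r" "r \<le> K" "1 \<le> K" "m \<le> n" "n \<le> 2"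
  shows "r ^ n \<le> K\<^sup>2 * r ^ m"
proof -
  have "r ^ n = r ^ (n - m) * r ^ m" using assms(4) by (simp flip: power_add)
  also have "r ^ (n - m) \<le> K ^ (n - m)" using assms by (intro power_mono) auto
  also have "\<dots> \<le> K\<^sup>2" using assms by (intro power_increasing) auto
  finally show ?thesis using assms(1) by (simp add: mult_right_mono)
qed

text \<open>
  As \<open>cmod s\<close> is bounded here, differentiating twice costs nothing: \<open>U (m + 2) = s\<^sup>2 U m - F m\<close>.
\<close>

lemma higher_bound_small:
  assumes c: "0 < c" and ne: "\<And>j::nat. 1 \<le> j \<Longrightarrow> \<gamma> \<noteq> real j * p - 1"
    and \<gamma>: "\<gamma> < (real k + 1 + real (bc_order b)) * p - 1"
  shows "n \<le> k + 2 \<Longrightarrow> \<exists>C>0. \<forall>s (F :: nat \<Rightarrow> real \<Rightarrow> 'a::complex_banach) U. resolvent_data b k c s F U \<longrightarrow> Re s \<le> 1 \<longrightarrow>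
    cmod s ^ (2 - n) * wnorm (U n) \<le> C * (1 + Re s powr (2 - 2 * alpha_bc b p \<gamma>)) * chain_norm k F"
proof (induction n rule: less_induct)
  case (less n)
  let ?\<delta> = "2 - 2 * alpha_bc b p \<gamma>"
  show ?case
  proof (cases "n \<le> 2")
    case True
    obtain C1 where C1: "0 < C1" and en: "\<And>s (F :: nat \<Rightarrow> real \<Rightarrow> 'a) U. resolvent_data b k c s F U \<Longrightarrow>
      cmod s ^ (2 - n) * wnorm (U (0 + n))
        \<le> C1 * (wnorm (F 0) + Re s powr (2 - crit) * norm (U 0 (1 / Re s)))"
      using energy_bound[OF c, where 'a='a] True zero_le by blast
    obtain C2 where C2: "0 < C2" and pv: "\<And>s (F :: nat \<Rightarrow> real \<Rightarrow> 'a) U. resolvent_data b k c s F U \<Longrightarrow>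
      Re s powr (2 - crit) * norm (U 0 (1 / Re s)) \<le> C2 * (1 + Re s powr ?\<delta>) * chain_norm k F"
      using point_value_small[OF ne \<gamma>, where 'a='a and c=c] by blast
    have "cmod s ^ (2 - n) * wnorm (U n) \<le> C1 * (1 + C2) * (1 + Re s powr ?\<delta>) * chain_norm k F"
      if d: "resolvent_data b k c s F U" for s and F U :: "nat \<Rightarrow> real \<Rightarrow> 'a"
    proof -
      let ?B = "(1 + Re s powr ?\<delta>) * chain_norm k F"
      have "wnorm (F 0) \<le> 1 * chain_norm k F" using wnorm_le_chain_norm[of 0 k F] by simp
      also have "\<dots> \<le> ?B" by (intro mult_right_mono chain_norm_nonneg) simp
      finally have "wnorm (F 0) + Re s powr (2 - crit) * norm (U 0 (1 / Re s)) \<le> (1 + C2) * ?B"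
        using pv[OF d] by (simp only: distrib_right mult_1_left mult.assoc add_mono)
      then have "C1 * (wnorm (F 0) + Re s powr (2 - crit) * norm (U 0 (1 / Re s))) \<le> C1 * ((1 + C2) * ?B)"
        using C1 by (intro mult_left_mono) auto
      with en[OF d] show ?thesis by (simp only: mult.assoc add_0)
    qed
    moreover have "0 < C1 * (1 + C2)" using C1 C2 by simp
    ultimately show ?thesis by blast
  next
    case False
    then obtain m where m: "n = m + 2" by (metis add.commute le_Suc_ex nat_le_linear)
    obtain C1 where C1: "0 < C1" and IH: "\<And>s (F :: nat \<Rightarrow> real \<Rightarrow> 'a) U. resolvent_data b k c s F U \<Longrightarrow> Re s \<le> 1 \<Longrightarrow>
      cmod s ^ (2 - m) * wnorm (U m) \<le> C1 * (1 + Re s powr ?\<delta>) * chain_norm k F"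
      using less.IH[of m] less.prems m by auto
    define K where "K = max 1 (1 / c)"
    have "cmod s ^ (2 - n) * wnorm (U n) \<le> 4 * (K\<^sup>2 * C1 + 1) * (1 + Re s powr ?\<delta>) * chain_norm k F"
      if d: "resolvent_data b k c s F U" and a: "Re s \<le> 1" for s and F U :: "nat \<Rightarrow> real \<Rightarrow> 'a"
    proof -
      let ?B = "(1 + Re s powr ?\<delta>) * chain_norm k F"
      have mk: "m \<le> k" using less.prems m by simp
      have "c * cmod s \<le> 1" using d a by (simp add: resolvent_data_def)
      then have r: "cmod s \<le> K" using c by (simp add: K_def le_max_iff_disj field_simps)
      have "wnorm (F m) \<le> 1 * chain_norm k F" using wnorm_le_chain_norm[OF mk, of F] by simp
      also have "\<dots> \<le> ?B" by (intro mult_right_mono chain_norm_nonneg) simp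
      finally have F: "wnorm (F m) \<le> ?B" .
      have "(cmod s)\<^sup>2 * wnorm (U m) \<le> K\<^sup>2 * cmod s ^ (2 - m) * wnorm (U m)"
        by (intro mult_right_mono power_le_of_bounded wnorm_nonneg r) (auto simp: K_def)
      also have "\<dots> = K\<^sup>2 * (cmod s ^ (2 - m) * wnorm (U m))" by simp
      also have "\<dots> \<le> K\<^sup>2 * (C1 * ?B)" using IH[OF d a] by (intro mult_left_mono) (auto simp: mult.assoc)
      finally have U: "(cmod s)\<^sup>2 * wnorm (U m) \<le> K\<^sup>2 * (C1 * ?B)" .
      have "U n = (\<lambda>t. s\<^sup>2 *\<^sub>C U m t - 1 *\<^sub>C F m t)"
        using d mk m by (simp add: resolvent_data_def scaleC_one fun_eq_iff)
      moreover have "U m \<in> wLp" "F m \<in> wLp" using d mk by (auto simp: resolvent_data_def Sobolev_chain_def)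
      ultimately have "wnorm (U n) \<le> 4 * ((cmod s)\<^sup>2 * wnorm (U m) + wnorm (F m))"
        using wLp_combination(2)[of "U m" "F m" "s\<^sup>2" 1] by (simp add: norm_power)
      also have "\<dots> \<le> 4 * (K\<^sup>2 * (C1 * ?B) + ?B)" by (intro mult_left_mono add_mono U F) simp
      also have "\<dots> = 4 * (K\<^sup>2 * C1 + 1) * (1 + Re s powr ?\<delta>) * chain_norm k F"
        by (simp only: distrib_right mult_1_left mult.assoc distrib_left)
      finally show ?thesis using False by simp
    qed
    moreover have "0 < 4 * (K\<^sup>2 * C1 + 1)" using C1 by (intro mult_pos_pos add_nonneg_pos) auto
    ultimately show ?thesis by blast
  qed
qed

lemma a_priori_bound:
  assumes c: "0 < c" and ne: "\<And>j::nat. 1 \<le> j \<Longrightarrow> \<gamma> \<noteq> real j * p - 1"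
    and \<gamma>: "\<gamma> < (real k + 1 + real (bc_order b)) * p - 1"
  shows "\<exists>C>0. \<forall>s (F :: nat \<Rightarrow> real \<Rightarrow> 'a::complex_banach) U i j. resolvent_data b k c s F U \<longrightarrow> i \<le> k \<longrightarrow> j \<le> 2 \<longrightarrow>
    cmod s ^ (2 - j) * wnorm (U (i + j)) \<le> C * (1 + cmod s powr (2 - 2 * alpha_bc b p \<gamma>)) * chain_norm k F"
proof -
  let ?\<delta> = "2 - 2 * alpha_bc b p \<gamma>"
  have \<delta>: "?\<delta> \<le> 0" using two_minus_two_alpha[of b] by simp
  obtain C1 where C1: "0 < C1" and en: "\<And>s (F :: nat \<Rightarrow> real \<Rightarrow> 'a) U i j. resolvent_data b k c s F U \<Longrightarrow> i \<le> k \<Longrightarrow> j \<le> 2 \<Longrightarrow>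
    cmod s ^ (2 - j) * wnorm (U (i + j))
      \<le> C1 * (wnorm (F i) + Re s powr (2 - crit) * norm (U i (1 / Re s)))"
    using energy_bound[OF c, where 'a='a] by blast
  obtain C2 where C2: "0 < C2" and pl: "\<And>s (F :: nat \<Rightarrow> real \<Rightarrow> 'a) U i. resolvent_data b k c s F U \<Longrightarrow> 1 \<le> Re s \<Longrightarrow> i \<le> k \<Longrightarrow>
    Re s powr (2 - crit) * norm (U i (1 / Re s)) \<le> C2 * chain_norm k F"
    using point_values_large[OF c ne \<gamma>, where 'a='a] by blast
  have "\<exists>C>0. \<forall>n\<le>k + 2. \<forall>s (F :: nat \<Rightarrow> real \<Rightarrow> 'a::complex_banach) U. resolvent_data b k c s F U \<longrightarrow> Re s \<le> 1 \<longrightarrow>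
    cmod s ^ (2 - n) * wnorm (U n) \<le> C * (1 + Re s powr ?\<delta>) * chain_norm k F"
  proof (rule uniform_constant)
    fix n C D
    assume A: "\<forall>s (F :: nat \<Rightarrow> real \<Rightarrow> 'a::complex_banach) U. resolvent_data b k c s F U \<longrightarrow> Re s \<le> 1 \<longrightarrow>
      cmod s ^ (2 - n) * wnorm (U n) \<le> C * (1 + Re s powr ?\<delta>) * chain_norm k F" and CD: "C \<le> D"
    have "C * (1 + Re s powr ?\<delta>) * chain_norm k F \<le> D * (1 + Re s powr ?\<delta>) * chain_norm k F"
      for s and F :: "nat \<Rightarrow> real \<Rightarrow> 'a" using CD by (intro mult_right_mono chain_norm_nonneg) (auto intro: add_nonneg_nonneg)
    then show "\<forall>s (F :: nat \<Rightarrow> real \<Rightarrow> 'a::complex_banach) U. resolvent_data b k c s F U \<longrightarrow> Re s \<le> 1 \<longrightarrow>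
      cmod s ^ (2 - n) * wnorm (U n) \<le> D * (1 + Re s powr ?\<delta>) * chain_norm k F"
      using A order_trans by blast
  qed (rule higher_bound_small[OF c ne \<gamma>])
  then obtain C3 where C3: "0 < C3" and hi: "\<And>s (F :: nat \<Rightarrow> real \<Rightarrow> 'a) U n. resolvent_data b k c s F U \<Longrightarrow> Re s \<le> 1 \<Longrightarrow> n \<le> k + 2 \<Longrightarrow>
    cmod s ^ (2 - n) * wnorm (U n) \<le> C3 * (1 + Re s powr ?\<delta>) * chain_norm k F" by blast
  define K where "K = max 1 (1 / c)"
  define E where "E = max 1 (c powr ?\<delta>)"
  define D where "D = C1 * (1 + C2) + K\<^sup>2 * C3 * E"
  have K: "1 \<le> K" and E: "1 \<le> E" "c powr ?\<delta> \<le> E" by (auto simp: K_def E_def)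
  have "cmod s ^ (2 - j) * wnorm (U (i + j)) \<le> D * (1 + cmod s powr ?\<delta>) * chain_norm k F"
    if d: "resolvent_data b k c s F U" and i: "i \<le> k" and j: "j \<le> 2" for s i j and F U :: "nat \<Rightarrow> real \<Rightarrow> 'a"
  proof -
    let ?N = "chain_norm k F"
    have N: "0 \<le> ?N" by (rule chain_norm_nonneg)
    have a: "0 < Re s" and cr: "c * cmod s \<le> Re s" using d by (auto simp: resolvent_data_def)
    have r: "0 < cmod s" using a by auto
    show ?thesis
    proof (cases "1 \<le> Re s")
      case True
      have "cmod s ^ (2 - j) * wnorm (U (i + j)) \<le> C1 * (?N + C2 * ?N)"
        using C1 by (intro order_trans[OF en[OF d i j]] mult_left_mono add_mono wnorm_le_chain_norm pl[OF d True i] i) simp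
      also have "\<dots> = C1 * (1 + C2) * 1 * ?N" by (simp add: algebra_simps)
      also have "\<dots> \<le> D * (1 + cmod s powr ?\<delta>) * ?N"
        using C1 C2 C3 E N by (intro mult_mono mult_nonneg_nonneg) (auto simp: D_def)
      finally show ?thesis .
    next
      case False
      then have a1: "Re s \<le> 1" by simp
      have "cmod s \<le> K" using cr a1 c by (simp add: K_def le_max_iff_disj field_simps)
      then have "cmod s ^ (2 - j) \<le> K\<^sup>2 * cmod s ^ (2 - (i + j))"
        using K by (intro power_le_of_bounded) auto
      then have "cmod s ^ (2 - j) * wnorm (U (i + j)) \<le> K\<^sup>2 * cmod s ^ (2 - (i + j)) * wnorm (U (i + j))"
        by (intro mult_right_mono wnorm_nonneg)
      also have "\<dots> = K\<^sup>2 * (cmod s ^ (2 - (i + j)) * wnorm (U (i + j)))" by simp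
      also have "\<dots> \<le> K\<^sup>2 * (C3 * (1 + Re s powr ?\<delta>) * ?N)"
        using i j by (intro mult_left_mono hi[OF d a1]) auto
      also have "\<dots> \<le> K\<^sup>2 * (C3 * (E * (1 + cmod s powr ?\<delta>)) * ?N)"
      proof -
        have "Re s powr ?\<delta> \<le> (c * cmod s) powr ?\<delta>"
          using \<delta> cr c r by (intro powr_mono2') auto
        also have "\<dots> = c powr ?\<delta> * cmod s powr ?\<delta>" by (rule powr_mult)
        also have "\<dots> \<le> E * cmod s powr ?\<delta>" by (intro mult_right_mono E) simp
        finally have "1 + Re s powr ?\<delta> \<le> E * (1 + cmod s powr ?\<delta>)" using E(1) by (simp add: distrib_left)
        then show ?thesis using C3 N by (intro mult_left_mono mult_right_mono) auto
      qed
      also have "\<dots> = K\<^sup>2 * C3 * E * (1 + cmod s powr ?\<delta>) * ?N" by (simp only: mult_ac)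
      also have "\<dots> \<le> D * (1 + cmod s powr ?\<delta>) * ?N"
        using C1 C2 N by (intro mult_right_mono) (auto simp: D_def)
      finally show ?thesis .
    qed
  qed
  moreover have "0 < D" using C1 C2 C3 K E by (auto simp: D_def intro!: add_pos_nonneg)
  ultimately show ?thesis by blast
qed

section \<open>Existence\<close>

text \<open>
  An indefinite integral of a function that is integrable up to the origin has a limit there.
\<close>

lemma indef_integral_from_zero:
  fixes g :: "real \<Rightarrow> 'a::complex_banach"
  assumes d: "0 < d" and near: "set_integrable_on {0<..d} g" and loc: "loc_integrable g"
  shows "\<exists>Y. indef_integral Y g \<and> (Y \<longlongrightarrow> 0) (at_right 0)"
proof -
  have "set_integrable_on {0<..x} g" if x: "0 < x" for x
  proof (cases "x \<le> d")
    case True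
    then show ?thesis by (intro set_integrable_on_subset[OF near]) auto
  next
    case False
    have "set_integrable_on {d<..x} g" using loc d False unfolding loc_integrable_def by simp
    then obtain I J where IJ: "has_set_integral {0<..d} g I" "has_set_integral {d<..x} g J"
      using near unfolding set_integrable_on_def by blast
    have "{0<..d} \<union> {d<..x} = {0<..x}" "{0<..d} \<inter> {d<..x} = {}" using d False by auto
    then show ?thesis using has_set_integral_Un[OF IJ] unfolding set_integrable_on_def by auto
  qed
  then obtain Y where Y: "\<And>x. 0 < x \<Longrightarrow> has_set_integral {0<..x} g (Y x)"
    unfolding set_integrable_on_def by metis
  have "indef_integral Y g"
    unfolding indef_integral_def
  proof (intro allI impI)
    fix x y :: real assume xy: "0 < x" "x \<le> y"
    obtain J where J: "has_set_integral {x<..y} g J"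
      using loc xy unfolding loc_integrable_def set_integrable_on_def by blast
    have "{0<..x} \<union> {x<..y} = {0<..y}" "{0<..x} \<inter> {x<..y} = {}" using xy by auto
    then have "has_set_integral {0<..y} g (Y x + J)" using has_set_integral_Un[OF Y[OF xy(1)] J] by simp
    moreover have "has_set_integral {0<..y} g (Y y)" using xy by (intro Y) simp
    ultimately have "Y x + J = Y y" by (rule has_strong_integral_unique)
    then have "Y y - Y x = J" by (metis add_diff_cancel_left')
    then show "has_set_integral {x<..y} g (Y y - Y x)" using J by simp
  qed
  moreover have "(Y \<longlongrightarrow> 0) (at_right 0)"
  proof (rule tendsto_at_right_sequentially[OF d])
    fix S :: "nat \<Rightarrow> real" assume S: "\<And>n. 0 < S n" "\<And>n. S n < d" "S \<longlonglongrightarrow> 0"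
    have "(\<lambda>n. \<integral>\<^sup>+t\<in>{0<..S n}. ennreal (norm (g t)) \<partial>lborel) \<longlonglongrightarrow> 0"
    proof (rule nn_integral_shrinking[OF near])
      show "{0<..S n} \<subseteq> {0<..d}" for n using S(2)[of n] by auto
      have "eventually (\<lambda>n. t \<notin> {0<..S n}) sequentially" for t
      proof (cases "0 < t")
        case True
        from order_tendstoD(2)[OF S(3) True] show ?thesis by eventually_elim auto
      qed simp
      then show "AE t in lborel. eventually (\<lambda>n. t \<notin> {0<..S n}) sequentially" by simp
    qed auto
    moreover have "ennreal (norm (Y (S n))) \<le> nnint {0<..S n} (\<lambda>t. norm (g t))" for n
      by (rule has_set_integral_norm_le[OF Y[OF S(1)]])
    ultimately show "(\<lambda>n. Y (S n)) \<longlonglongrightarrow> 0" by (rule tendsto_zero_ennreal_norm[rotated])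
  qed
  ultimately show ?thesis by blast
qed

lemma set_integrable_exp:
  fixes f :: "real \<Rightarrow> 'a::complex_banach"
  assumes f: "set_integrable_on {0<..d} f"
  shows "set_integrable_on {0<..d} (\<lambda>t. exp (s * complex_of_real t) *\<^sub>C f t)"
proof (rule set_integrable_on_bilinear[OF f _ _ _ bounded_bilinear_scaleC])
  show "(\<lambda>t. indicat_real {0<..d} t *\<^sub>R exp (s * complex_of_real t)) \<in> borel_measurable borel"
    by (rule borel_measurable_continuous_on_indicator) (auto intro!: continuous_intros)
  fix t assume t: "t \<in> {0<..d}"
  have "Re s * t \<le> \<bar>Re s\<bar> * t" using t by (intro mult_right_mono) auto
  also have "\<dots> \<le> \<bar>Re s\<bar> * d" using t by (intro mult_left_mono) auto
  finally show "norm (exp (s * complex_of_real t)) \<le> exp (\<bar>Re s\<bar> * d)" by simp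
qed auto

lemma exp_tendsto_one: "((\<lambda>t. exp (s * complex_of_real t)) \<longlongrightarrow> 1) (at_right 0)"
proof -
  have "((\<lambda>t. exp (s * complex_of_real t)) \<longlongrightarrow> exp (s * complex_of_real 0)) (at_right 0)"
    by (intro tendsto_intros)
  then show ?thesis by simp
qed

lemma exp_scaleC_tendsto:
  fixes v :: "real \<Rightarrow> 'a::complex_banach"
  assumes "(v \<longlongrightarrow> L) (at_right 0)"
  shows "((\<lambda>t. exp (s * complex_of_real t) *\<^sub>C v t) \<longlongrightarrow> L) (at_right 0)"
  using scaleC.tendsto[OF exp_tendsto_one assms, of s] by (simp add: scaleC_one)

text \<open>
  The derivatives of the solution with value \<open>v\<close> and derivative \<open>w\<close>, as the equation dictates
  them.
\<close>

fun resolvent_chain :: "complex \<Rightarrow> (nat \<Rightarrow> real \<Rightarrow> 'a::complex_banach) \<Rightarrow> (real \<Rightarrow> 'a) \<Rightarrow> (real \<Rightarrow> 'a) \<Rightarrow> nat \<Rightarrow> real \<Rightarrow> 'a" where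
  "resolvent_chain s F v w 0 = v"
| "resolvent_chain s F v w (Suc 0) = w"
| "resolvent_chain s F v w (Suc (Suc n)) = (\<lambda>t. s\<^sup>2 *\<^sub>C resolvent_chain s F v w n t - F n t)"

lemma near_source_integrable:
  fixes f :: "real \<Rightarrow> 'a::complex_banach"
  assumes "f \<in> wLp" "near_source 0 d f < \<infinity>"
  shows "set_integrable_on {0<..d} f"
  unfolding set_integrable_on_iff
proof
  show "strongly_measurable lborel (\<lambda>t. indicat_real {0<..d} t *\<^sub>R f t)"
    by (rule strongly_measurable_indicator_subset[OF wLp_measurable[OF assms(1)]]) auto
  have "nnint {0<..d} (\<lambda>t. norm (f t)) = near_source 0 d f"
    by (intro nn_integral_cong) (auto split: split_indicator)
  then show "nnint {0<..d} (\<lambda>t. norm (f t)) < \<infinity>" using assms(2) by simp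
qed

text \<open>
  The function \<open>W\<close> comes from infinity, and \<open>v' = W - s v\<close> is then integrated from the origin. The
  initial value of \<open>v\<close> is zero for Dirichlet. For Neumann it is \<open>1 / s\<close> times the limit of \<open>W\<close> at
  the origin, which exists because \<open>f\<close> is integrable there.
\<close>

lemma second_order_solution_exists:
  fixes f :: "real \<Rightarrow> 'a::complex_banach"
  assumes s: "0 < Re s" and f: "f \<in> wLp"
    and near: "\<And>d. 0 < d \<Longrightarrow> near_source (bc_order b) d f < \<infinity>" and far: "far_source (Re s) f < \<infinity>"
  shows "\<exists>W v. indef_integral W (\<lambda>t. s *\<^sub>C W t - f t) \<and> forward_bound (Re s) f W \<and>
    indef_integral v (\<lambda>t. W t - s *\<^sub>C v t) \<and>
    ((if b = Dir then v else (\<lambda>t. W t - s *\<^sub>C v t)) \<longlongrightarrow> 0) (at_right 0)"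
proof -
  define a where "a = Re s"
  have a: "0 < a" "0 < 1 / a" using s by (auto simp: a_def)
  obtain W where W: "indef_integral W (\<lambda>t. s *\<^sub>C W t - f t)" and fb: "forward_bound a f W"
    using forward_solution_exists[OF f s] unfolding a_def by blast
  have Wc: "continuous_on {0<..} W" by (rule indef_integral_continuous_on[OF W])
  have "near_source 1 (1/a) f < \<infinity>"
  proof (cases b)
    case Dir
    then show ?thesis using near[OF a(2)] by simp
  next
    case Neu
    have "ennreal (1/a) * near_source 0 (1/a) f < \<infinity>"
      using near[OF a(2)] Neu by (simp add: ennreal_mult_less_top)
    then show ?thesis using near_source_one_le[OF a(1) f] by (rule le_less_trans[rotated])
  qed
  then have "near_source 1 (1/a) f + ennreal (1/a) * far_source a f < \<infinity>"
    using far by (simp add: a_def ennreal_mult_less_top)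
  with forward_bound_integral[OF a(1) f fb]
  have Wfin: "nnint {0<..1/a} (\<lambda>y. norm (W y)) < \<infinity>" by (rule le_less_trans)
  have "set_integrable_on {0<..1/a} W"
    unfolding set_integrable_on_iff
    using Wfin strongly_measurable_indicator_subset[OF strongly_measurable_continuous[OF Wc], of "{0<..1/a}"]
    by (auto simp: subset_eq)
  then have "set_integrable_on {0<..1/a} (\<lambda>t. exp (s * complex_of_real t) *\<^sub>C W t)" by (rule set_integrable_exp)
  moreover have "loc_integrable (\<lambda>t. exp (s * complex_of_real t) *\<^sub>C W t)"
    unfolding loc_integrable_def
    by (intro allI impI set_integrable_on_continuous scaleC.continuous_on continuous_intros Wc)
  ultimately obtain Y where Y: "indef_integral Y (\<lambda>t. exp (s * complex_of_real t) *\<^sub>C W t)" "(Y \<longlongrightarrow> 0) (at_right 0)"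
    using indef_integral_from_zero[OF a(2)] by blast
  define v where "v c t = exp (- s * complex_of_real t) *\<^sub>C (Y t + c)" for c t
  have v: "indef_integral (v c) (\<lambda>t. W t - s *\<^sub>C v c t)" for c
  proof -
    have "indef_integral (v c) (\<lambda>t. exp (- s * complex_of_real t) *\<^sub>C ((- s) *\<^sub>C (Y t + c) + exp (s * complex_of_real t) *\<^sub>C W t))"
      unfolding v_def by (rule indef_integral_exp[OF indef_integral_shift[OF Y(1)]])
    moreover have "exp (- s * complex_of_real t) *\<^sub>C ((- s) *\<^sub>C (Y t + c) + exp (s * complex_of_real t) *\<^sub>C W t) = W t - s *\<^sub>C v c t" for t
      by (simp add: v_def scaleC.add_right scaleC.diff_right scaleC_scaleC scaleC.minus_left scaleC.minus_right scaleC_one mult.commute flip: exp_add)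
    ultimately show ?thesis by (simp only:)
  qed
  have vlim: "(v c \<longlongrightarrow> c) (at_right 0)" for c
    unfolding v_def using tendsto_add[OF Y(2) tendsto_const[of c]] by (intro exp_scaleC_tendsto) simp
  have "\<exists>c. ((if b = Dir then v c else (\<lambda>t. W t - s *\<^sub>C v c t)) \<longlongrightarrow> 0) (at_right 0)"
  proof (cases b)
    case Dir
    then show ?thesis using vlim[of 0] by auto
  next
    case Neu
    have fi: "set_integrable_on {0<..1} f"
      by (rule near_source_integrable[OF f]) (use near[of 1] Neu in simp)
    have Vi: "indef_integral (\<lambda>t. exp (- s * complex_of_real t) *\<^sub>C W t) (\<lambda>t. - (exp (- s * complex_of_real t) *\<^sub>C f t))"
    proof -
      have "indef_integral (\<lambda>t. exp (- s * complex_of_real t) *\<^sub>C W t)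
        (\<lambda>t. exp (- s * complex_of_real t) *\<^sub>C ((- s) *\<^sub>C W t + (s *\<^sub>C W t - f t)))"
        by (rule indef_integral_exp[OF W])
      then show ?thesis by (simp add: scaleC.minus_left scaleC.minus_right)
    qed
    have "set_integrable_on {0<..1} (\<lambda>t. exp (- s * complex_of_real t) *\<^sub>C (- f t))"
    proof (rule set_integrable_exp)
      show "set_integrable_on {0<..1} (\<lambda>t. - f t)"
        using set_integrable_on_diff[OF set_integrable_on_diff[OF fi fi] fi] by simp
    qed
    then have "set_integrable_on {0<..1} (\<lambda>t. - (exp (- s * complex_of_real t) *\<^sub>C f t))"
      by (simp add: scaleC.minus_right)
    then obtain Z where Z: "indef_integral Z (\<lambda>t. - (exp (- s * complex_of_real t) *\<^sub>C f t))" "(Z \<longlongrightarrow> 0) (at_right 0)"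
      using indef_integral_from_zero[OF zero_less_one _ indef_integral_imp_loc_integrable[OF Vi]] by blast
    define L where "L = exp (- s * complex_of_real 1) *\<^sub>C W 1 - Z 1"
    have VZ: "exp (- s * complex_of_real t) *\<^sub>C W t = Z t + L" if "0 < t" for t
    proof -
      have "indef_integral (\<lambda>t. exp (- s * complex_of_real t) *\<^sub>C W t - Z t) (\<lambda>t. 0)"
        using indef_integral_diff[OF Vi Z(1)] by simp
      from indef_integral_zero_const[OF this that, of 1] show ?thesis by (simp add: L_def algebra_simps)
    qed
    have "W t = exp (s * complex_of_real t) *\<^sub>C (Z t + L)" if "0 < t" for t
      unfolding VZ[OF that, symmetric] by (simp add: scaleC_scaleC scaleC_one flip: exp_add)
    then have ev: "eventually (\<lambda>t. exp (s * complex_of_real t) *\<^sub>C (Z t + L) = W t) (at_right 0)"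
      by (simp add: eventually_at_right_less eventually_mono[OF eventually_at_right_less])
    have "((\<lambda>t. exp (s * complex_of_real t) *\<^sub>C (Z t + L)) \<longlongrightarrow> L) (at_right 0)"
      using tendsto_add[OF Z(2) tendsto_const[of L]] by (intro exp_scaleC_tendsto) simp
    then have "(W \<longlongrightarrow> L) (at_right 0)" by (rule Lim_transform_eventually[OF _ ev])
    moreover have "s *\<^sub>C inverse s *\<^sub>C L = L"
    proof -
      have "s * inverse s = 1" using s by (intro right_inverse) auto
      then show ?thesis by (simp only: scaleC_scaleC scaleC_one)
    qed

    ultimately have "((\<lambda>t. W t - s *\<^sub>C v (inverse s *\<^sub>C L) t) \<longlongrightarrow> L - L) (at_right 0)"
      using scaleC.tendsto[OF tendsto_const[of s] vlim[of "inverse s *\<^sub>C L"]] by (intro tendsto_diff) auto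
    then show ?thesis using Neu by auto
  qed
  then show ?thesis using W fb v unfolding a_def by blast
qed

lemma resolvent_data_exists:
  fixes F :: "nat \<Rightarrow> real \<Rightarrow> 'a::complex_banach"
  assumes ne: "\<And>j::nat. 1 \<le> j \<Longrightarrow> \<gamma> \<noteq> real j * p - 1"
    and \<gamma>: "\<gamma> < (real k + 1 + real (bc_order b)) * p - 1"
    and s: "0 < Re s" "c * cmod s \<le> Re s" and F: "chain k F"
    and tr: "\<And>j. real (k_bc b + 2 * j) < real k - crit \<Longrightarrow> (F (k_bc b + 2 * j) \<longlongrightarrow> 0) (at_right 0)"
  shows "\<exists>U. resolvent_data b k c s F U"
proof -
  obtain m where m: "m \<le> k" "real m * p - 1 < \<gamma>" "\<gamma> < (real m + 1 + real (bc_order b)) * p - 1"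
    using level_exists[OF ne \<gamma>] by blast
  have Fm: "chain m F" by (rule Sobolev_chain_mono[OF F m(1)])
  have Fi: "F i \<in> wLp" if "i \<le> k" for i using F that by (auto simp: Sobolev_chain_def)
  note F0 = Fi[OF zero_le]
  obtain C where C: "\<And>G :: nat \<Rightarrow> real \<Rightarrow> 'a. chain m G \<Longrightarrow>
    (\<forall>d>0. near_source (bc_order b) d (G 0) \<le> ennreal (C * d powr (real m + 1 + real (bc_order b) - crit) * wnorm (G m))) \<and>
    (\<forall>a>0. far_source a (G 0) \<le> ennreal (C * a powr (crit - real m - 1) * wnorm (G m)))"
    using source_bounds[OF m(2,3), where 'a='a] by blast
  have fin: "near_source (bc_order b) d (F 0) < \<infinity>" "far_source d (F 0) < \<infinity>" if "0 < d" for d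
  proof -
    note le = C[OF Fm, THEN conjunct1, rule_format, OF that] C[OF Fm, THEN conjunct2, rule_format, OF that]
    show "near_source (bc_order b) d (F 0) < \<infinity>" by (rule le_less_trans[OF le(1)]) simp
    show "far_source d (F 0) < \<infinity>" by (rule le_less_trans[OF le(2)]) simp
  qed
  obtain W v where W: "indef_integral W (\<lambda>t. s *\<^sub>C W t - F 0 t)" "forward_bound (Re s) (F 0) W"
    and v: "indef_integral v (\<lambda>t. W t - s *\<^sub>C v t)"
    and bc: "((if b = Dir then v else (\<lambda>t. W t - s *\<^sub>C v t)) \<longlongrightarrow> 0) (at_right 0)"
    using second_order_solution_exists[OF s(1) F0 fin(1) fin(2)[OF s(1)]] by blast
  define w where "w t = W t - s *\<^sub>C v t" for t
  define U where "U = resolvent_chain s F v w"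
  have U: "U 0 = v" "U (Suc 0) = w" "U (Suc (Suc i)) = (\<lambda>t. s\<^sup>2 *\<^sub>C U i t - F i t)" for i
    by (simp_all add: U_def)
  have w: "indef_integral w (U (Suc (Suc 0)))"
  proof -
    have "indef_integral w (\<lambda>t. (s *\<^sub>C W t - F 0 t) - s *\<^sub>C (W t - s *\<^sub>C v t))"
      unfolding w_def[abs_def] by (intro indef_integral_diff W indef_integral_scaleC v)
    moreover have "(s *\<^sub>C W t - F 0 t) - s *\<^sub>C (W t - s *\<^sub>C v t) = U (Suc (Suc 0)) t" for t
      by (simp add: U scaleC.diff_right scaleC_scaleC power2_eq_square)
    ultimately show ?thesis by (simp only:)
  qed
  have "i < k + 2 \<Longrightarrow> indef_integral (U i) (U (Suc i))" for i
  proof (induction i rule: less_induct)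
    case (less i)
    consider "i = 0" | "i = Suc 0" | n where "i = Suc (Suc n)" by (metis not0_implies_Suc)
    then show ?case
    proof cases
      case 1
      then show ?thesis using v by (simp add: U w_def[abs_def])
    next
      case 2
      then show ?thesis using w by (simp add: U)
    next
      case (3 n)
      have "indef_integral (U n) (U (Suc n))" using less 3 by simp
      moreover have "indef_integral (F n) (F (Suc n))" using F less.prems 3 by (simp add: Sobolev_chain_def)
      ultimately show ?thesis unfolding 3 U(3) by (intro indef_integral_diff indef_integral_scaleC)
    qed
  qed
  moreover have "i \<le> k + 2 \<Longrightarrow> U i \<in> wLp" for i
  proof (induction i rule: less_induct)
    case (less i)
    have "W \<in> wLp \<and> v \<in> wLp"
      by (rule second_order_bound[where 'a='a])
        (use s(1) F0 W v indef_integral_continuous_on[OF W(1)] in blast)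
    then have "v \<in> wLp" "(\<lambda>t. 1 *\<^sub>C W t - s *\<^sub>C v t) \<in> wLp" using wLp_combination(1) by blast+
    then have vw: "v \<in> wLp" "w \<in> wLp" by (simp_all add: w_def[abs_def] scaleC_one)
    consider "i = 0" | "i = Suc 0" | n where "i = Suc (Suc n)" by (metis not0_implies_Suc)
    then show ?case
    proof cases
      case (3 n)
      have "(\<lambda>t. s\<^sup>2 *\<^sub>C U n t - 1 *\<^sub>C F n t) \<in> wLp"
        by (rule wLp_combination(1)) (use less 3 Fi in auto)
      then show ?thesis unfolding 3 U(3) by (simp add: scaleC_one)
    qed (use vw U in auto)
  qed
  ultimately have "chain (k + 2) U" by (simp add: Sobolev_chain_def)
  moreover have "(U (k_bc b) \<longlongrightarrow> 0) (at_right 0)" using bc by (cases b) (auto simp: U w_def[abs_def])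
  ultimately have "resolvent_data b k c s F U" using s F tr by (simp add: resolvent_data_def U)
  then show ?thesis by blast
qed

text \<open>The remaining boundary conditions of the solution are inherited from those of \<open>f\<close>.\<close>

lemma resolvent_data_traces:
  fixes F U :: "nat \<Rightarrow> real \<Rightarrow> 'a::complex_banach"
  assumes d: "resolvent_data b k c s F U" and q: "0 < crit"
  shows "real (k_bc b + 2 * j) < real (k + 2) - crit \<Longrightarrow> (U (k_bc b + 2 * j) \<longlongrightarrow> 0) (at_right 0)"
proof (induction j)
  case 0
  then show ?case using d by (simp add: resolvent_data_def)
next
  case (Suc j)
  let ?i = "k_bc b + 2 * j"
  have lt: "real ?i < real k - crit" using Suc.prems by simp
  then have "real ?i < real k" using q by linarith
  then have ik: "?i \<le> k" by linarith
  have "(F ?i \<longlongrightarrow> 0) (at_right 0)" using d lt by (simp only: resolvent_data_def)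
  moreover have "(U ?i \<longlongrightarrow> 0) (at_right 0)" using Suc by simp
  ultimately have "((\<lambda>t. s\<^sup>2 *\<^sub>C U ?i t - F ?i t) \<longlongrightarrow> s\<^sup>2 *\<^sub>C 0 - 0) (at_right 0)"
    by (intro tendsto_diff scaleC.tendsto tendsto_const)
  moreover have "U (?i + 2) = (\<lambda>t. s\<^sup>2 *\<^sub>C U ?i t - F ?i t)"
    using d ik by (simp add: resolvent_data_def fun_eq_iff)
  ultimately show ?case by (simp add: scaleC.zero_right)
qed

section \<open>Uniqueness\<close>

text \<open>
  The function \<open>W = D' + s D\<close> solves \<open>W' = s W\<close> in the weighted space, hence vanishes. Thus \<open>D\<close> is
  a multiple of \<open>exp (- s t)\<close>, and the boundary condition makes the multiple zero.
\<close>

lemma homogeneous_solution_zero: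
  fixes D D' :: "real \<Rightarrow> 'a::complex_banach"
  assumes s: "0 < Re s"
    and D: "indef_integral D D'" "indef_integral D' (\<lambda>t. s\<^sup>2 *\<^sub>C D t)" "D \<in> wLp" "D' \<in> wLp"
    and bc: "((if b = Dir then D else D') \<longlongrightarrow> 0) (at_right 0)" and t: "0 < t"
  shows "D t = 0"
proof -
  have s0: "s \<noteq> 0" using s by auto
  define W where "W t = D' t + s *\<^sub>C D t" for t
  have Wi: "indef_integral W (\<lambda>t. s *\<^sub>C W t - 0)"
  proof -
    have "indef_integral W (\<lambda>t. s\<^sup>2 *\<^sub>C D t + s *\<^sub>C D' t)"
      unfolding W_def[abs_def] by (intro indef_integral_add indef_integral_scaleC D)
    moreover have "s\<^sup>2 *\<^sub>C D t + s *\<^sub>C D' t = s *\<^sub>C W t - 0" for t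
      by (simp add: W_def scaleC.add_right scaleC_scaleC power2_eq_square)
    ultimately show ?thesis by (simp only:)
  qed
  have "(\<lambda>t. 1 *\<^sub>C D' t - (- s) *\<^sub>C D t) \<in> wLp" by (rule wLp_combination(1)[OF D(4,3)])
  then have Wl: "W \<in> wLp" by (simp add: W_def[abs_def] scaleC_one scaleC.minus_left)
  have zl: "(\<lambda>t. 0::'a) \<in> wLp"
    by (rule wLpI_continuous) (use p in \<open>auto simp: weighted_power_def\<close>)
  have "forward_bound (Re s) (\<lambda>t. 0) W" by (rule forward_boundI_wLp[OF zl s Wi Wl])
  then have W0: "W t = 0" if "0 < t" for t using that by (simp add: forward_bound_def)
  have D': "D' t = - (s *\<^sub>C D t)" if "0 < t" for t
    using W0[OF that] by (simp add: W_def eq_neg_iff_add_eq_0)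
  have "indef_integral (\<lambda>t. exp (s * complex_of_real t) *\<^sub>C D t) (\<lambda>t. exp (s * complex_of_real t) *\<^sub>C (s *\<^sub>C D t + D' t))"
    by (rule indef_integral_exp[OF D(1)])
  then have "indef_integral (\<lambda>t. exp (s * complex_of_real t) *\<^sub>C D t) (\<lambda>t. 0)"
    by (rule indef_integral_cong_AE) (simp add: D' scaleC.zero_right)
  from indef_integral_zero_const[OF this]
  have const: "exp (s * complex_of_real x) *\<^sub>C D x = exp (s * complex_of_real t) *\<^sub>C D t" if "0 < x" for x
    using that t by blast
  have ev: "eventually (\<lambda>x. 0 < x) (at_right (0::real))" by (rule eventually_at_right_less)
  have "(D \<longlongrightarrow> 0) (at_right 0)"
  proof (cases b)
    case Dir
    then show ?thesis using bc by simp
  next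
    case Neu
    then have "((\<lambda>x. (- inverse s) *\<^sub>C D' x) \<longlongrightarrow> (- inverse s) *\<^sub>C 0) (at_right 0)"
      using bc by (intro scaleC.tendsto tendsto_const) auto
    then have "((\<lambda>x. (- inverse s) *\<^sub>C D' x) \<longlongrightarrow> 0) (at_right 0)" by (simp add: scaleC.zero_right)
    then show ?thesis
    proof (rule Lim_transform_eventually)
      show "eventually (\<lambda>x. (- inverse s) *\<^sub>C D' x = D x) (at_right 0)"
        using ev s0 by (auto elim!: eventually_mono simp: D' scaleC.minus_left scaleC.minus_right scaleC_scaleC scaleC_one)
    qed
  qed
  then have "((\<lambda>x. exp (s * complex_of_real x) *\<^sub>C D x) \<longlongrightarrow> 0) (at_right 0)" by (rule exp_scaleC_tendsto)
  moreover have "((\<lambda>x. exp (s * complex_of_real x) *\<^sub>C D x) \<longlongrightarrow> exp (s * complex_of_real t) *\<^sub>C D t) (at_right 0)"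
    by (rule Lim_transform_eventually[OF tendsto_const]) (use ev in \<open>auto elim!: eventually_mono simp: const\<close>)
  ultimately have "exp (s * complex_of_real t) *\<^sub>C D t = 0"
    using tendsto_unique[OF trivial_limit_at_right_real] by blast
  then have "norm (exp (s * complex_of_real t) *\<^sub>C D t) = 0" by simp
  then show ?thesis by (simp add: norm_scaleC)
qed

section \<open>The resolvent problem\<close>

text \<open>
  The square root halves the angle: \<open>sqrt ((1 - cos \<omega>) / 2)\<close> is the cosine of \<open>(pi - \<omega>) / 2\<close>.
\<close>

lemma csqrt_sector:
  assumes \<omega>: "0 < \<omega>" "\<omega> < pi" and \<mu>: "\<mu> \<in> sector (pi - \<omega>)"
  shows "0 < Re (csqrt \<mu>)" "sqrt ((1 - cos \<omega>) / 2) * cmod (csqrt \<mu>) \<le> Re (csqrt \<mu>)"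
proof -
  have \<mu>0: "\<mu> \<noteq> 0" and arg: "\<bar>Arg \<mu>\<bar> < pi - \<omega>" using \<mu> by (auto simp: sector_def)
  have c: "0 < 1 - cos \<omega>" using cos_monotone_0_pi[of 0 \<omega>] \<omega> by simp
  have "cos (pi - \<omega>) \<le> cos \<bar>Arg \<mu>\<bar>" using arg \<omega> by (intro cos_monotone_0_pi_le) auto
  then have "- cos \<omega> \<le> cos (Arg \<mu>)" by (simp add: cos_diff)
  then have "cmod \<mu> * (- cos \<omega>) \<le> cmod \<mu> * cos (Arg \<mu>)" by (intro mult_left_mono) auto
  also have "cmod \<mu> * cos (Arg \<mu>) = Re \<mu>" using cos_Arg[OF \<mu>0] \<mu>0 by simp
  finally have re: "(1 - cos \<omega>) / 2 * cmod \<mu> \<le> (cmod \<mu> + Re \<mu>) / 2" by (simp add: algebra_simps)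
  have Re: "Re (csqrt \<mu>) = sqrt ((cmod \<mu> + Re \<mu>) / 2)" by simp
  have "sqrt ((1 - cos \<omega>) / 2 * cmod \<mu>) \<le> Re (csqrt \<mu>)" unfolding Re using re by (rule real_sqrt_le_mono)
  moreover have "cmod (csqrt \<mu>) = sqrt (cmod \<mu>)"
  proof -
    have "(cmod (csqrt \<mu>))\<^sup>2 = cmod \<mu>" by (simp flip: norm_power)
    then show ?thesis by (metis norm_ge_zero real_sqrt_unique)
  qed
  ultimately show le: "sqrt ((1 - cos \<omega>) / 2) * cmod (csqrt \<mu>) \<le> Re (csqrt \<mu>)"
    by (simp only: real_sqrt_mult)
  have "0 < sqrt ((1 - cos \<omega>) / 2) * cmod (csqrt \<mu>)" using c \<mu>0 by simp
  then show "0 < Re (csqrt \<mu>)" using le by linarith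
qed

lemma Sobolev_bc_chain:
  fixes f :: "real \<Rightarrow> 'a::complex_banach"
  assumes f: "f \<in> Sobolev_bc b k p \<gamma>"
  shows "\<exists>F. chain k F \<and> (AE t in lborel. 0 < t \<longrightarrow> f t = F 0 t) \<and> (\<forall>i\<le>k. weak_deriv i f (F i)) \<and>
    (\<forall>j. real (k_bc b + 2 * j) < real k - crit \<longrightarrow> (F (k_bc b + 2 * j) \<longlongrightarrow> 0) (at_right 0))"
proof -
  have q: "0 < crit" using g p by simp
  have "f \<in> Sobolev k p \<gamma>" using f by (simp add: Sobolev_bc_def)
  then obtain F where F: "chain k F" "AE t in lborel. 0 < t \<longrightarrow> f t = F 0 t" "\<And>i. i \<le> k \<Longrightarrow> weak_deriv i f (F i)"
    using Sobolev_chain_exists[of p f k \<gamma>] p by auto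
  have "(F (k_bc b + 2 * j) \<longlongrightarrow> 0) (at_right 0)" if j: "real (k_bc b + 2 * j) < real k - crit" for j
  proof -
    let ?i = "k_bc b + 2 * j"
    have "real ?i < real k" using j q by linarith
    then have ik: "?i < k" by linarith
    have "continuous_on {0<..} (F ?i)"
      using F(1) ik by (intro indef_integral_continuous_on[of _ "F (Suc ?i)"]) (simp add: Sobolev_chain_def)
    moreover have "has_trace (wderiv ?i f) 0" using f j by (simp add: Sobolev_bc_def)
    ultimately show ?thesis
      using has_trace_zero_iff[of "F ?i" "wderiv ?i f"] wderiv_eq_AE[OF F(3)] ik by simp
  qed
  then show ?thesis using F by blast
qed

lemma Sobolev_bcI_chain:
  fixes F :: "nat \<Rightarrow> real \<Rightarrow> 'a::complex_banach"
  assumes F: "chain k F"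
    and tr: "\<And>j. real (k_bc b + 2 * j) < real k - crit \<Longrightarrow> (F (k_bc b + 2 * j) \<longlongrightarrow> 0) (at_right 0)"
  shows "F 0 \<in> Sobolev_bc b k p \<gamma>"
proof -
  have q: "0 < crit" using g p by simp
  have "has_trace (wderiv (k_bc b + 2 * j) (F 0)) 0" if j: "real (k_bc b + 2 * j) < real k - crit" for j
  proof -
    let ?i = "k_bc b + 2 * j"
    have "real ?i < real k" using j q by linarith
    then have ik: "?i < k" by linarith
    have "continuous_on {0<..} (F ?i)"
      using F ik by (intro indef_integral_continuous_on[of _ "F (Suc ?i)"]) (simp add: Sobolev_chain_def)
    moreover have "weak_deriv ?i (F 0) (F ?i)" using Sobolev_chain_weak_deriv[OF p1 F, of 0 ?i] ik by simp
    ultimately show ?thesis using has_trace_zero_iff wderiv_eq_AE tr[OF j] by blast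
  qed
  then show ?thesis using Sobolev_chain_imp_Sobolev[OF p1 F] by (simp add: Sobolev_bc_def)
qed

lemma Sobolev_norm_wderiv_chain:
  fixes U :: "nat \<Rightarrow> real \<Rightarrow> 'a::complex_banach"
  assumes U: "chain (k + m) U" and j: "j \<le> m"
  shows "Sobolev_norm k p \<gamma> (wderiv j (U 0)) = (\<Sum>i\<le>k. wnorm (U (i + j)))"
proof (rule Sobolev_norm_eq)
  fix i assume i: "i \<le> k"
  have "weak_deriv j (U 0) (U j)" using Sobolev_chain_weak_deriv[OF p1 U, of 0 j] j by simp
  from wderiv_eq_AE[OF this] have ae: "AE t in lborel. 0 < t \<longrightarrow> U j t = wderiv j (U 0) t" by eventually_elim simp
  have "j + i \<le> k + m" using i j by simp
  then have "weak_deriv i (U j) (U (j + i))" by (rule Sobolev_chain_weak_deriv[OF p1 U])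
  then have wd: "weak_deriv i (U j) (U (i + j))" by (simp only: add.commute)
  show "weak_deriv i (wderiv j (U 0)) (U (i + j))" by (rule weak_deriv_cong_AE[OF wd ae]) simp
qed

end

theorem theorem3p7:
  fixes p \<gamma> \<omega> :: real and k :: nat and b :: bc
  assumes "1 < p"
    and "-1 < \<gamma>" and "\<gamma> < (real k + 2 - real (k_bc b)) * p - 1"
    and "\<gamma> \<notin> {real j * p - 1 | j::nat. 1 \<le> j}"
    and "0 < \<omega>" and "\<omega> < pi"
    and "UMD TYPE('a::complex_banach)"
  shows "\<exists>C>0. \<forall>f \<in> (Sobolev_bc b k p \<gamma> :: (real \<Rightarrow> 'a) set). \<forall>\<mu> \<in> sector (pi - \<omega>).
    (\<exists>u \<in> Sobolev_bc b (k + 2) p \<gamma>.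
      solves_resolvent \<mu> f u \<and>
      (\<forall>v \<in> Sobolev_bc b (k + 2) p \<gamma>.
         solves_resolvent \<mu> f v \<longrightarrow> (AE x in halfline. v x = u x)) \<and>
      (\<Sum>j\<le>2. cmod \<mu> powr (1 - real j / 2) * Sobolev_norm k p \<gamma> (wderiv j u))
        \<le> C * (1 + cmod \<mu> powr (1 - alpha_bc b p \<gamma>)) * Sobolev_norm k p \<gamma> f)"
proof -
  interpret weight p \<gamma> using assms(1,2) by unfold_locales
  have ne: "\<gamma> \<noteq> real j * p - 1" if "1 \<le> j" for j :: nat using assms(4) that by blast
  have "real (bc_order b) = 1 - real (k_bc b)" by (cases b) auto
  then have "real k + 1 + real (bc_order b) = real k + 2 - real (k_bc b)" by simp
  then have \<gamma>: "\<gamma> < (real k + 1 + real (bc_order b)) * p - 1" using assms(3) by (simp only:)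
  have q: "0 < crit" using g p by simp
  have "\<gamma> + 1 < (real k + 2 - real (k_bc b)) * p" using assms(3) by linarith
  then have bcq: "real (k_bc b) < real (k + 2) - crit" using p0 by (simp add: field_simps)
  \<comment> \<open>the lower bound of \<open>Re s / cmod s\<close> for \<open>s = csqrt \<mu>\<close>, with \<open>\<mu>\<close> in the sector\<close>
  define c where "c = sqrt ((1 - cos \<omega>) / 2)"
  have c: "0 < c" using cos_monotone_0_pi[of 0 \<omega>] assms(5,6) by (simp add: c_def)
  obtain C where C: "0 < C" and ap: "\<And>s (F :: nat \<Rightarrow> real \<Rightarrow> 'a) U i j. resolvent_data b k c s F U \<Longrightarrow> i \<le> k \<Longrightarrow> j \<le> 2 \<Longrightarrow>
    cmod s ^ (2 - j) * wnorm (U (i + j)) \<le> C * (1 + cmod s powr (2 - 2 * alpha_bc b p \<gamma>)) * chain_norm k F"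
    using a_priori_bound[OF c ne \<gamma>, where 'a='a] by blast
  have "\<exists>u \<in> Sobolev_bc b (k + 2) p \<gamma>.
      solves_resolvent \<mu> f u \<and>
      (\<forall>v \<in> Sobolev_bc b (k + 2) p \<gamma>.
         solves_resolvent \<mu> f v \<longrightarrow> (AE x in halfline. v x = u x)) \<and>
      (\<Sum>j\<le>2. cmod \<mu> powr (1 - real j / 2) * Sobolev_norm k p \<gamma> (wderiv j u))
        \<le> 3 * (real k + 1) * C * (1 + cmod \<mu> powr (1 - alpha_bc b p \<gamma>)) * Sobolev_norm k p \<gamma> f"
    if f: "f \<in> Sobolev_bc b k p \<gamma>" and \<mu>: "\<mu> \<in> sector (pi - \<omega>)" for f :: "real \<Rightarrow> 'a" and \<mu>
  proof -
    define s where "s = csqrt \<mu>"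
    have s: "0 < Re s" "c * cmod s \<le> Re s" using csqrt_sector[OF assms(5,6) \<mu>] by (auto simp: s_def c_def)
    have s2: "s\<^sup>2 = \<mu>" by (simp add: s_def)
    obtain F where F: "chain k F" and fF: "AE t in lborel. 0 < t \<longrightarrow> f t = F 0 t"
      and fw: "\<And>i. i \<le> k \<Longrightarrow> weak_deriv i f (F i)"
      and Ft: "\<And>j. real (k_bc b + 2 * j) < real k - crit \<Longrightarrow> (F (k_bc b + 2 * j) \<longlongrightarrow> 0) (at_right 0)"
      using Sobolev_bc_chain[OF f] by blast
    obtain U where d: "resolvent_data b k c s F U"
      using resolvent_data_exists[OF ne \<gamma> s F Ft] by blast
    have U: "chain (k + 2) U" using d by (simp add: resolvent_data_def)
    have U2: "U 2 t = \<mu> *\<^sub>C U 0 t - F 0 t" for t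
      using d unfolding resolvent_data_def s2 by (metis add_0 zero_le)
    have "U 0 \<in> Sobolev_bc b (k + 2) p \<gamma>"
      by (rule Sobolev_bcI_chain[OF U resolvent_data_traces[OF d q]])
    moreover have "solves_resolvent \<mu> f (U 0)"
    proof -
      have "weak_deriv 2 (U 0) (U 2)" using Sobolev_chain_weak_deriv[OF p1 U, of 0 2] by (simp only: add_0 le_add2)
      from wderiv_eq_AE[OF this] fF have "AE t in lborel. 0 < t \<longrightarrow> \<mu> *\<^sub>C U 0 t - wderiv 2 (U 0) t = f t"
        by eventually_elim (simp add: U2)
      then show ?thesis by (simp add: solves_resolvent_def laplacian_def AE_halfline)
    qed
    moreover have "AE x in halfline. v x = U 0 x" if v: "v \<in> Sobolev_bc b (k + 2) p \<gamma>" and sv: "solves_resolvent \<mu> f v" for v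
    proof -
      obtain V where V: "chain (k + 2) V" and vV: "AE t in lborel. 0 < t \<longrightarrow> v t = V 0 t"
        and vw: "\<And>i. i \<le> k + 2 \<Longrightarrow> weak_deriv i v (V i)"
        and Vt: "\<And>j. real (k_bc b + 2 * j) < real (k + 2) - crit \<Longrightarrow> (V (k_bc b + 2 * j) \<longlongrightarrow> 0) (at_right 0)"
        using Sobolev_bc_chain[OF v] by blast
      have "AE t in lborel. 0 < t \<longrightarrow> \<mu> *\<^sub>C v t - wderiv 2 v t = f t"
        using sv by (simp add: solves_resolvent_def laplacian_def AE_halfline)
      moreover have "AE t in lborel. 0 < t \<longrightarrow> wderiv 2 v t = V 2 t" by (rule wderiv_eq_AE[OF vw]) simp
      ultimately have V2: "AE t in lborel. 0 < t \<longrightarrow> V 2 t - U 2 t = s\<^sup>2 *\<^sub>C (V 0 t - U 0 t)"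
        using vV fF
      proof eventually_elim
        fix t assume A: "0 < t \<longrightarrow> \<mu> *\<^sub>C v t - wderiv 2 v t = f t" "0 < t \<longrightarrow> wderiv 2 v t = V 2 t"
          "0 < t \<longrightarrow> v t = V 0 t" "0 < t \<longrightarrow> f t = F 0 t"
        show "0 < t \<longrightarrow> V 2 t - U 2 t = s\<^sup>2 *\<^sub>C (V 0 t - U 0 t)"
        proof
          assume "0 < t"
          then have "V 2 t = \<mu> *\<^sub>C V 0 t - F 0 t" using A by (auto simp: algebra_simps)
          then show "V 2 t - U 2 t = s\<^sup>2 *\<^sub>C (V 0 t - U 0 t)" by (simp add: U2 s2 scaleC.diff_right)
        qed
      qed
      define D D' where "D t = V 0 t - U 0 t" and "D' t = V 1 t - U 1 t" for t
      have VU: "indef_integral (V i) (V (Suc i))" "indef_integral (U i) (U (Suc i))" if "i < 2" for i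
        using V U that by (auto simp: Sobolev_chain_def)
      have "indef_integral D D'"
        unfolding D_def[abs_def] D'_def[abs_def] using VU[of 0] by (intro indef_integral_diff) auto
      moreover have "indef_integral D' (\<lambda>t. s\<^sup>2 *\<^sub>C D t)"
      proof (rule indef_integral_cong_AE)
        show "indef_integral D' (\<lambda>t. V 2 t - U 2 t)"
          unfolding D'_def[abs_def] using VU[of 1] by (intro indef_integral_diff) (auto simp: numeral_2_eq_2)
        show "AE t in lborel. 0 < t \<longrightarrow> V 2 t - U 2 t = s\<^sup>2 *\<^sub>C D t" using V2 by (simp add: D_def)
      qed
      moreover have "D \<in> wLp" "D' \<in> wLp"
      proof -
        have "(\<lambda>t. 1 *\<^sub>C V i t - 1 *\<^sub>C U i t) \<in> wLp" if "i < 2" for i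
          by (rule wLp_combination(1)) (use V U that in \<open>auto simp: Sobolev_chain_def\<close>)
        from this[of 0] this[of 1] show "D \<in> wLp" "D' \<in> wLp"
          by (simp_all add: D_def[abs_def] D'_def[abs_def] scaleC_one)
      qed
      moreover have "((if b = Dir then D else D') \<longlongrightarrow> 0) (at_right 0)"
      proof -
        have "((\<lambda>t. V (k_bc b) t - U (k_bc b) t) \<longlongrightarrow> 0 - 0) (at_right 0)"
          using Vt[of 0] bcq d by (intro tendsto_diff) (auto simp: resolvent_data_def)
        then show ?thesis by (cases b) (auto simp: D_def[abs_def] D'_def[abs_def])
      qed
      ultimately have "D t = 0" if "0 < t" for t using homogeneous_solution_zero[OF s(1)] that by blast
      then have VU0: "V 0 t = U 0 t" if "0 < t" for t using that by (simp add: D_def)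
      from vV have "AE t in lborel. 0 < t \<longrightarrow> v t = U 0 t" by eventually_elim (simp add: VU0)
      then show ?thesis by (simp add: AE_halfline)
    qed
    moreover have "(\<Sum>j\<le>2. cmod \<mu> powr (1 - real j / 2) * Sobolev_norm k p \<gamma> (wderiv j (U 0)))
        \<le> 3 * (real k + 1) * C * (1 + cmod \<mu> powr (1 - alpha_bc b p \<gamma>)) * Sobolev_norm k p \<gamma> f"
    proof -
      have fN: "Sobolev_norm k p \<gamma> f = chain_norm k F" by (rule Sobolev_norm_eq[OF fw])
      have r: "0 < cmod s" using s(1) by auto
      have \<mu>r: "cmod \<mu> = cmod s powr 2" using r by (simp flip: s2 add: norm_power)
      have e1: "cmod \<mu> powr (1 - real j / 2) = cmod s ^ (2 - j)" if "j \<le> 2" for j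
      proof -
        have "2 * (1 - real j / 2) = real (2 - j)" using that by (simp add: of_nat_diff)
        then show ?thesis unfolding \<mu>r powr_powr using r by (simp only: powr_realpow)
      qed
      have e2: "cmod \<mu> powr (1 - alpha_bc b p \<gamma>) = cmod s powr (2 - 2 * alpha_bc b p \<gamma>)"
        unfolding \<mu>r powr_powr by (simp only: right_diff_distrib mult_1_right)
      let ?R = "C * (1 + cmod s powr (2 - 2 * alpha_bc b p \<gamma>)) * chain_norm k F"
      have "(\<Sum>j\<le>2. cmod \<mu> powr (1 - real j / 2) * Sobolev_norm k p \<gamma> (wderiv j (U 0)))
        = (\<Sum>j\<le>2. \<Sum>i\<le>k. cmod s ^ (2 - j) * wnorm (U (i + j)))"
        by (intro sum.cong refl) (simp add: e1 Sobolev_norm_wderiv_chain[OF U] sum_distrib_left)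
      also have "\<dots> \<le> (\<Sum>j\<le>(2::nat). \<Sum>i\<le>k. ?R)" by (intro sum_mono ap[OF d]) auto
      also have "\<dots> = 3 * (real k + 1) * ?R" by simp
      finally show ?thesis by (simp only: fN e2 mult.assoc)
    qed
    ultimately show ?thesis by blast
  qed
  moreover have "0 < 3 * (real k + 1) * C" using C by simp
  ultimately show ?thesis by blast
qed

end
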